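(* Let $\nu>-1$, $\delta>0$ and $1<p\le\infty$. Suppose the real parameters $b,B$ satisfy (1) $b>-\frac{2(\nu+1)}{p}$ ($\ge$ if $p=\infty$); (2) $B<2(\nu+1)(1-\frac1p)$ ($\le$ if $p=1$); (3) $b>2(\nu+1)(\frac12-\frac1p)-\delta-\frac12$ ($\ge$ if $p=\infty$); (4) $B\le 2(\nu+1)(\frac12-\frac1p)+\delta+\frac12$; (5) $B\le b$; and in at least one of each of the following pairs the inequality is strict: (2) and (5); (3) and (5); and (4) and (5) except for $p=\infty$. Then there is $C$ independent of $f$ such that $$\|x^b\mathcal{B}^\delta f\|_{L^p((0,1),d\mu_\nu)}\le C\|x^Bf\|_{L^p((0,1),d\mu_\nu)}.$$
   Context: Let $J_\nu$ be the Bessel function of order $\nu>-1$, $0<s_1<s_2<\dots$ its successive positive zeros, $d\mu_\nu(x)=x^{2\nu+1}dx$ on $(0,1)$, $\psi_j(x)=\frac{\sqrt2}{|J_{\nu+1}(s_j)|}x^{-\nu}J_\nu(s_jx)$, $a_j(f)=\int_0^1 f\psi_j\,d\mu_\nu$. For $\delta>0$, $R>0$, $\mathcal{B}_R^\delta(f,x)=\sum_{j\ge1}(1-s_j^2/R^2)_+^\delta a_j(f)\psi_j(x)$ with $(1-s^2)_+=\max\{1-s^2,0\}$, and $\mathcal{B}^\delta f(x)=\sup_{R>0}|\mathcal{B}_R^\delta(f,x)|$. *)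

theory Defs
  imports "HOL-Analysis.Analysis" "HOL-Probability.Essential_Supremum"
begin

definition besselJ :: "real \<Rightarrow> real \<Rightarrow> real" where
  "besselJ nu x = (\<Sum>m. (-1) ^ m / (fact m * Gamma (real m + nu + 1)) * (x / 2) powr (2 * real m + nu))"

text \<open>The j-th positive zero (j \<ge> 1) of besselJ nu: the positive zero s having exactly j-1 zeros in (0,s).\<close>
definition besselzero :: "real \<Rightarrow> nat \<Rightarrow> real" where
  "besselzero nu j = (THE s. 0 < s \<and> besselJ nu s = 0 \<and>
      card {t. 0 < t \<and> t < s \<and> besselJ nu t = 0} = j - 1)"

definition mu_nu :: "real \<Rightarrow> real measure" where
  "mu_nu nu = density (restrict_space lborel {0<..<1}) (\<lambda>x. ennreal (x powr (2 * nu + 1)))"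

definition psi :: "real \<Rightarrow> nat \<Rightarrow> real \<Rightarrow> real" where
  "psi nu j x = sqrt 2 / \<bar>besselJ (nu + 1) (besselzero nu j)\<bar> * x powr (- nu) * besselJ nu (besselzero nu j * x)"

definition coeff_a :: "real \<Rightarrow> nat \<Rightarrow> (real \<Rightarrow> real) \<Rightarrow> real" where
  "coeff_a nu j f = (\<integral>x. f x * psi nu j x \<partial>mu_nu nu)"

definition BR_mean :: "real \<Rightarrow> real \<Rightarrow> real \<Rightarrow> (real \<Rightarrow> real) \<Rightarrow> real \<Rightarrow> real" where
  "BR_mean nu delta R f x = (\<Sum>j. (max (1 - (besselzero nu (Suc j))\<^sup>2 / R\<^sup>2) 0) powr delta
       * coeff_a nu (Suc j) f * psi nu (Suc j) x)"

definition BR_max :: "real \<Rightarrow> real \<Rightarrow> (real \<Rightarrow> real) \<Rightarrow> real \<Rightarrow> ennreal" where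
  "BR_max nu delta f x = (SUP R\<in>{0<..}. ennreal \<bar>BR_mean nu delta R f x\<bar>)"

definition Lp_norm :: "'a measure \<Rightarrow> ennreal \<Rightarrow> ('a \<Rightarrow> ennreal) \<Rightarrow> ennreal" where
  "Lp_norm M p g = (if p = \<infinity> then esssup M g
     else (let I = (\<integral>\<^sup>+ x. ennreal ((enn2real (g x)) powr (enn2real p)) * indicator {x. g x < \<infinity>} x
                         + (\<infinity> * indicator {x. g x = \<infinity>} x) \<partial>M)
           in if I = \<infinity> then \<infinity> else ennreal ((enn2real I) powr (1 / enn2real p))))"

definition recip :: "ennreal \<Rightarrow> real" where
  "recip p = enn2real (1 / p)"

end

theory Submission
  imports Defs "HOL-Complex_Analysis.Complex_Analysis"
begin

text \<open>
  Put \<open>\<phi>(z) = z\<^sup>-\<^sup>\<nu> J\<^sub>\<nu>(z)\<close> and \<open>a = \<nu> + 1/2\<close>. The means are integral operators with kernel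
  \<open>\<Sum> (1 - s\<^sup>2/R\<^sup>2)\<^sup>\<delta> \<psi>(x) \<psi>(y)\<close>, summed over the zeros \<open>s < R\<close>. By residues such a sum is a contour integral of
  \<open>\<phi>(zx) V\<^sub>z(y) / \<phi>(z)\<close>, where \<open>V\<^sub>z\<close> solves the same radial equation with \<open>V\<^sub>z(1) = 0\<close>. Energy estimates
  for the equation give two-sided bounds for \<open>\<phi>\<close> off the real axis, and the kernel is
  \<open>O(R\<^sup>2\<^sup>a\<^sup>+\<^sup>1 (1+Rx)\<^sup>-\<^sup>a (1+Ry)\<^sup>-\<^sup>a (1+R|x-y|)\<^sup>-\<^sup>1\<^sup>-\<^sup>\<delta>)\<close>. For \<open>y\<close> comparable to \<open>x\<close> this is dominated by the
  Hardy-Littlewood maximal function; for \<open>y \<le> x/2\<close> and \<open>y \<ge> 2x\<close> it is dominated by Hardy kernels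
  homogeneous of degree 0 with respect to \<open>dy/y\<close>, to which Schur's test applies. At an endpoint the
  strict inequality \<open>B < b\<close> leaves a spare power of \<open>x\<close>.
\<close>

text \<open>Three obstacles shape the proof. The zeros of \<open>bphi nu\<close> are real, so the
  vertical sides of the contour must cross the real axis at a point X where \<open>bphi nu\<close>
  has its full size; the energy supplies one in every interval of a fixed length L. The multiplier
  (1 - z^2/R^2)^delta has branch points at R and -R, so X is kept in [R - 1 - L, R - 1]: there the
  multiplier has size R^(-delta) near the axis, and the boundedly many zeros in [X, R) can be
  estimated one by one. Along a side, the decay exp (- |Im z| |x - y|) integrates to one factor 1 /
  |x - y|, and the growth of the multiplier supplies the other delta powers. Finally, nu > -1 admits
  a in (-1/2, 0), where the weights change their monotonicity and only 2 a + 1 > 0 survives; this is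
  why several estimates split on the sign of a. For critical exponents the homogeneous Hardy
  majorant has no decay left, and the dependence on R, which it discards, has to be used
  instead.\<close>

abbreviation nn_lborel :: "('a::euclidean_space \<Rightarrow> ennreal) \<Rightarrow> ennreal" (binder "NN " 10) where
  "nn_lborel f \<equiv> nn_integral lborel f"

section \<open>The normalised Bessel function\<close>

text \<open>Coefficients of \<open>x powr (- nu) * besselJ nu x\<close> as a power series in x^2.
  Splitting off the power leaves an even entire function, so that complex arguments raise no
  question of branches.\<close>

definition bessel_coeff :: "real \<Rightarrow> nat \<Rightarrow> real" where
  "bessel_coeff nu m = (-1) ^ m / (fact m * Gamma (real m + nu + 1)) / (2 powr nu * 4 ^ m)"

text \<open>One series serves real and complex arguments: the zeros and the means live over the
  reals, the contour over the complex numbers, and \<open>bphi_of_real\<close> passes between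
  them.\<close>

definition bessel_gen :: "real \<Rightarrow> 'a::{real_normed_field,banach} \<Rightarrow> 'a" where
  "bessel_gen nu s = (\<Sum>m. of_real (bessel_coeff nu m) * s ^ m)"

definition bphi :: "real \<Rightarrow> 'a::{real_normed_field,banach} \<Rightarrow> 'a" where
  "bphi nu z = bessel_gen nu (z\<^sup>2)"

lemma bessel_coeff_Suc:
  assumes "nu > -1"
  shows "bessel_coeff nu (Suc m) = - bessel_coeff nu m / (4 * (real m + 1) * (real m + nu + 1))"
proof -
  have 1: "real m + nu + 1 > 0" using assms by linarith
  have "real m + nu + 1 \<notin> \<int>\<^sub>\<le>\<^sub>0" using 1 by (auto elim!: nonpos_Ints_cases)
  hence "Gamma (real (Suc m) + nu + 1) = (real m + nu + 1) * Gamma (real m + nu + 1)"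
    using Gamma_plus1[of "real m + nu + 1"] by (simp add: algebra_simps)
  thus ?thesis unfolding bessel_coeff_def by (simp add: field_simps)
qed

lemma summable_bessel_coeff:
  fixes s :: "'a::{real_normed_field,banach}"
  assumes "nu > -1"
  shows "summable (\<lambda>m. of_real (bessel_coeff nu m) * s ^ m)"
proof -
  obtain N :: nat where N: "norm s \<le> real N" using real_arch_simple by blast
  have "norm (of_real (bessel_coeff nu (Suc m)) * s ^ Suc m)
      \<le> 1/2 * norm (of_real (bessel_coeff nu m) * s ^ m)" if m: "m \<ge> N + 1" for m
  proof -
    have p: "real m + nu + 1 \<ge> 1" using assms m by linarith
    have "norm (bessel_coeff nu (Suc m)) = \<bar>bessel_coeff nu m\<bar> / (4 * (real m + 1) * (real m + nu + 1))"
      using p by (simp add: bessel_coeff_Suc[OF assms] abs_mult)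
    also have "... \<le> \<bar>bessel_coeff nu m\<bar> / (2 * (real m + 1))"
      
    proof (rule divide_left_mono)
      have "2 * (real m + 1) \<le> 4 * (real m + 1) * 1" by simp
      also have "... \<le> 4 * (real m + 1) * (real m + nu + 1)" by (rule mult_left_mono[OF p]) simp
      finally show "2 * (real m + 1) \<le> 4 * (real m + 1) * (real m + nu + 1)" .
    qed (use p in auto)
    finally have 1: "norm (bessel_coeff nu (Suc m)) \<le> \<bar>bessel_coeff nu m\<bar> / (2 * (real m + 1))" .
    have "norm (of_real (bessel_coeff nu (Suc m)) * s ^ Suc m) = norm (bessel_coeff nu (Suc m)) * norm s * norm s ^ m"
      by (simp add: norm_mult norm_power)
    also have "... \<le> \<bar>bessel_coeff nu m\<bar> / (2 * (real m + 1)) * (real m + 1) * norm s ^ m"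
      using 1 N m by (intro mult_right_mono mult_mono) auto
    also have "... = 1/2 * norm (of_real (bessel_coeff nu m) * s ^ m)"
      by (simp add: norm_mult norm_power field_simps)
    finally show ?thesis .
  qed
  thus ?thesis by (intro summable_ratio_test[of "1/2" "N+1"]) auto
qed

lemma bessel_gen_sums:
  assumes "nu > -1"
  shows "(\<lambda>m. of_real (bessel_coeff nu m) * s ^ m) sums bessel_gen nu (s::'a::{real_normed_field,banach})"
  unfolding bessel_gen_def using summable_sums[OF summable_bessel_coeff[OF assms]] .

lemma Gamma_shift: assumes "nu > -1" shows "Gamma (real m + nu + 2) = (real m + nu + 1) * Gamma (real m + nu + 1)"
proof -
  have 1: "real m + nu + 1 > 0" using assms by linarith
  have "real m + nu + 1 \<notin> \<int>\<^sub>\<le>\<^sub>0" using 1 by (auto elim!: nonpos_Ints_cases)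
  thus ?thesis using Gamma_plus1[of "real m + nu + 1"] by (simp add: algebra_simps)
qed

lemma bessel_coeff_order_Suc:
  assumes "nu > -1"
  shows "bessel_coeff (nu+1) m = bessel_coeff nu m / (2 * (real m + nu + 1))"
proof -
  have e: "real m + (nu + 1) + 1 = real m + nu + 2" by simp
  have p1: "2 powr (nu + 1) = 2 powr nu * (2::real)" by (simp add: powr_add)
  have "p / (q * (A * g)) / (r * 2 * t) = p / (q * g) / (r * t) / (2 * A)" for p q A g r t :: real
    by simp
  thus ?thesis
    unfolding bessel_coeff_def e Gamma_shift[OF assms, of m] p1 .
qed

lemma bessel_coeff_diffs:
  assumes "nu > -1"
  shows "real (Suc m) * bessel_coeff nu (Suc m) = -1/2 * bessel_coeff (nu+1) m"
proof -
  have "M * (- c / (4 * M * A)) = -1/2 * (c / (2 * A))" if "M \<noteq> 0" for M A c :: real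
    using that by simp
  from this[of "real m + 1" "bessel_coeff nu m" "real m + nu + 1"] show ?thesis
    unfolding bessel_coeff_Suc[OF assms] bessel_coeff_order_Suc[OF assms] of_nat_Suc
    by (simp only: add.commute[of 1 "real m"])
qed

text \<open>In the variable s = z^2 this is the classical rule that the derivative of z^(-nu) J_nu
  is - z^(-nu) J_(nu+1): by \<open>bessel_coeff_diffs\<close>, differentiating the series termwise
  raises the order by one.\<close>

lemma bessel_gen_deriv:
  assumes "nu > -1"
  shows "(bessel_gen nu has_field_derivative (-1/2 * bessel_gen (nu+1) s)) (at (s::'a::{real_normed_field,banach}))"
proof -
  have "((\<lambda>x. \<Sum>n. of_real (bessel_coeff nu n) * x ^ n) has_field_derivative
          (\<Sum>n. diffs (\<lambda>n. of_real (bessel_coeff nu n)) n * s ^ n)) (at s)"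
    by (rule termdiffs_strong_converges_everywhere) (rule summable_bessel_coeff[OF assms])
  also have "(\<lambda>x::'a. \<Sum>n. of_real (bessel_coeff nu n) * x ^ n) = bessel_gen nu"
    by (simp add: bessel_gen_def fun_eq_iff)
  also have "(\<Sum>n. diffs (\<lambda>n. of_real (bessel_coeff nu n)) n * s ^ n)
      = (\<Sum>n. (-1/2) * (of_real (bessel_coeff (nu+1) n) * s ^ n))"
  proof (rule suminf_cong)
    fix n
    have "diffs (\<lambda>n. of_real (bessel_coeff nu n)) n = (of_real (real (Suc n) * bessel_coeff nu (Suc n)) :: 'a)"
      unfolding diffs_def by simp
    hence "diffs (\<lambda>n. of_real (bessel_coeff nu n)) n = (-1/2) * (of_real (bessel_coeff (nu+1) n) :: 'a)"
      unfolding bessel_coeff_diffs[OF assms] by simp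
    thus "diffs (\<lambda>n. of_real (bessel_coeff nu n)) n * s ^ n = (-1/2) * (of_real (bessel_coeff (nu+1) n) * s ^ n)"
      by simp
  qed
  also have "... = -1/2 * bessel_gen (nu+1) s"
    unfolding bessel_gen_def by (rule suminf_mult) (rule summable_bessel_coeff, use assms in simp)
  finally show ?thesis .
qed

text \<open>The three-term recurrence of Bessel functions, by comparison of coefficients. It takes
  the place of the second-order equation: differentiating \<open>bphi\<close> twice leads to order
  nu+2, which this brings back to nu and nu+1.\<close>

lemma bessel_gen_rec:
  assumes "nu > -1"
  shows "bessel_gen nu s = of_real (2*nu+2) * bessel_gen (nu+1) s - s * bessel_gen (nu+2) (s::'a::{real_normed_field,banach})"
proof -
  have n1: "nu+1 > -1" "nu+2 > -1" using assms by auto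
  have a: "(\<lambda>m. of_real (2*nu+2) * (of_real (bessel_coeff (nu+1) m) * s ^ m)) sums (of_real (2*nu+2) * bessel_gen (nu+1) s)"
    by (intro sums_mult bessel_gen_sums n1)
  have "(\<lambda>m. s * (of_real (bessel_coeff (nu+2) m) * s ^ m)) sums (s * bessel_gen (nu+2) s)"
    by (intro sums_mult bessel_gen_sums n1)
  \<comment> \<open>The factor s shifts the index; the summand 0 at m = 0 lets both series be
    subtracted term by term.\<close>
  hence b: "(\<lambda>m. if m = 0 then 0 else of_real (bessel_coeff (nu+2) (m-1)) * s ^ m) sums (s * bessel_gen (nu+2) s)"
    using sums_Suc_iff[of "\<lambda>m. if m = 0 then 0 else of_real (bessel_coeff (nu+2) (m-1)) * s ^ m" "s * bessel_gen (nu+2) s"]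
    by (simp add: algebra_simps)
  have c: "of_real (2*nu+2) * (of_real (bessel_coeff (nu+1) m) * s ^ m) - (if m = 0 then 0 else of_real (bessel_coeff (nu+2) (m-1)) * s ^ m)
     = of_real (bessel_coeff nu m) * s ^ m" for m
  proof -
    have 1: "real m + nu + 1 > 0" using assms by linarith
    have "(2*nu+2) * bessel_coeff (nu+1) m - (if m = 0 then 0 else bessel_coeff (nu+2) (m-1)) = bessel_coeff nu m"
    proof (cases m)
      case 0
      have "(2*nu+2) * (bessel_coeff nu 0 / (2 * (nu + 1))) = bessel_coeff nu 0" using assms by (simp add: field_simps)
      thus ?thesis using 0 bessel_coeff_order_Suc[OF assms, of 0] by simp
    next
      case (Suc k)
      define A where "A = real k + nu + 1"
      have A: "A > 0" "A + 1 > 0" using assms by (auto simp: A_def)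
      have e1: "bessel_coeff (nu+1) m = bessel_coeff nu m / (2 * (A + 1))"
        unfolding bessel_coeff_order_Suc[OF assms] by (simp add: A_def Suc add_ac)
      have "bessel_coeff (nu+2) k = bessel_coeff (nu+1) k / (2 * (A+1))"
        using bessel_coeff_order_Suc[OF n1(1), of k] by (simp add: A_def add_ac)
      hence e2: "bessel_coeff (nu+2) k = bessel_coeff nu k / (2 * A) / (2 * (A+1))"
        unfolding bessel_coeff_order_Suc[OF assms] by (simp add: A_def)
      have "bessel_coeff nu m = - bessel_coeff nu k / (4 * (real k + 1) * A)"
        using bessel_coeff_Suc[OF assms, of k] by (simp add: Suc A_def)
      moreover define D where "D = 4 * (real k + 1) * A"
      moreover have "D \<noteq> 0" using A by (simp add: D_def)
      ultimately have e3: "bessel_coeff nu k = - (4 * (real k + 1) * A) * bessel_coeff nu m"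
        by simp
      have "(2*nu+2) * (bessel_coeff nu m / (2 * (A + 1))) - (- (4 * (real k + 1) * A) * bessel_coeff nu m) / (2 * A) / (2 * (A+1))
          = bessel_coeff nu m * ((nu + 1 + (real k + 1)) / (A + 1))"
        using A by (simp add: divide_simps) (simp add: algebra_simps)
      also have "... = bessel_coeff nu m" 
      proof -
        have "nu + 1 + (real k + 1) = A + 1" by (simp add: A_def)
        hence "(nu + 1 + (real k + 1)) / (A + 1) = 1" using A(2) by (metis divide_self less_irrefl)
        thus ?thesis by (metis mult.right_neutral)
      qed
      finally have F: "(2*nu+2) * (bessel_coeff nu m / (2 * (A + 1))) - (- (4 * (real k + 1) * A) * bessel_coeff nu m) / (2 * A) / (2 * (A+1)) = bessel_coeff nu m" .
      have r: "(if m = 0 then 0 else bessel_coeff (nu+2) (m-1)) = bessel_coeff (nu+2) k" using Suc by simp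
      show ?thesis unfolding r e1 e2 e3 by (rule F)
    qed
    hence "of_real ((2*nu+2) * bessel_coeff (nu+1) m - (if m = 0 then 0 else bessel_coeff (nu+2) (m-1))) * s^m
      = of_real (bessel_coeff nu m) * s^m" by simp
    thus ?thesis unfolding of_real_diff of_real_mult left_diff_distrib mult.assoc by (cases "m = 0") simp_all
  qed
  have "(\<lambda>m. of_real (bessel_coeff nu m) * s ^ m) sums (of_real (2*nu+2) * bessel_gen (nu+1) s - s * bessel_gen (nu+2) s)"
    using sums_diff[OF a b] by (simp only: c)
  thus ?thesis using sums_unique2[OF bessel_gen_sums[OF assms, of s]] by blast
qed

lemma bphi_deriv:
  assumes "nu > -1"
  shows "(bphi nu has_field_derivative (- z * bphi (nu+1) z)) (at (z::'a::{real_normed_field,banach}))"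
proof -
  have "((\<lambda>z. bessel_gen nu (z\<^sup>2)) has_field_derivative (-1/2 * bessel_gen (nu+1) (z\<^sup>2)) * (2 * z)) (at z)"
    by (rule DERIV_chain2[OF bessel_gen_deriv[OF assms]]) (auto intro!: derivative_eq_intros)
  thus ?thesis unfolding bphi_def by (simp add: field_simps)
qed

lemma bphi_rec:
  assumes "nu > -1"
  shows "z\<^sup>2 * bphi (nu+2) z = of_real (2*nu+2) * bphi (nu+1) z - bphi nu (z::'a::{real_normed_field,banach})"
  using bessel_gen_rec[OF assms, of "z\<^sup>2"] by (simp add: bphi_def algebra_simps)

lemma bphi_of_real: assumes "nu > -1" shows "bphi nu (of_real x) = of_real (bphi nu (x::real))"
proof -
  have "(\<lambda>m. of_real (of_real (bessel_coeff nu m) * (x\<^sup>2) ^ m)) sums (of_real (bessel_gen nu (x\<^sup>2)) :: 'a::{real_normed_field,banach})"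
    using bessel_gen_sums[OF assms, of "x\<^sup>2"] by (rule sums_of_real)
  thus ?thesis using bessel_gen_sums[OF assms, of "(of_real x :: 'a)\<^sup>2"]
    by (simp add: bphi_def) (metis sums_unique2)
qed

lemma bphi_cnj: assumes "nu > -1" shows "bphi nu (cnj z) = cnj (bphi nu z)"
proof -
  have "(\<lambda>m. cnj (of_real (bessel_coeff nu m) * (z\<^sup>2) ^ m)) sums cnj (bessel_gen nu (z\<^sup>2))"
    using bessel_gen_sums[OF assms, of "z\<^sup>2"] by (subst sums_cnj)
  thus ?thesis using bessel_gen_sums[OF assms, of "(cnj z)\<^sup>2"]
    by (simp add: bphi_def) (metis sums_unique2)
qed

lemma bphi_minus [simp]: "bphi nu (- z) = bphi nu z"
  by (simp add: bphi_def)

lemma bphi_0: assumes "nu > -1" shows "bphi nu (0::real) > 0"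
proof -
  have "bphi nu (0::real) = bessel_coeff nu 0" unfolding bphi_def bessel_gen_def by (simp)
  thus ?thesis using assms by (simp add: bessel_coeff_def Gamma_real_pos)
qed

text \<open>For z^2 = - t^2 the alternating signs cancel and every term of the series is
  nonnegative, so the value is at least the constant term.\<close>

lemma bphi_imaginary: assumes "nu > -1" shows "bphi nu (\<i> * of_real t) \<noteq> 0"
proof -
  have s: "(\<lambda>m. of_real (bessel_coeff nu m) * (- (t\<^sup>2)) ^ m) sums bessel_gen nu (- (t\<^sup>2))"
    by (rule bessel_gen_sums[OF assms])
  have pos: "of_real (bessel_coeff nu m) * (- (t\<^sup>2)) ^ m \<ge> 0" for m
  proof -
    have "real m + nu + 1 > 0" using assms by linarith
    hence "Gamma (real m + nu + 1) > 0" by (rule Gamma_real_pos)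
    moreover have "of_real (bessel_coeff nu m) * (- (t\<^sup>2)) ^ m = ((-1)^m * (-1)^m) * (t\<^sup>2)^m / (fact m * Gamma (real m + nu + 1)) / (2 powr nu * 4 ^ m)"
      by (subst power_minus) (simp add: bessel_coeff_def)
    moreover have "(-1)^m * (-1)^m = (1::real)" by (simp add: power_mult_distrib[symmetric])
    ultimately show ?thesis by simp
  qed
  have "bessel_gen nu (- (t\<^sup>2)) \<ge> (\<Sum>m<1. of_real (bessel_coeff nu m) * (- (t\<^sup>2)) ^ m)"
    unfolding bessel_gen_def using s pos by (intro sum_le_suminf) (auto simp: sums_iff)
  also have "(\<Sum>m<1. of_real (bessel_coeff nu m) * (- (t\<^sup>2)) ^ m) = bphi nu 0"
    by (simp add: bphi_def bessel_gen_def)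
  finally have p: "bessel_gen nu (- (t\<^sup>2)) > 0" using bphi_0[OF assms] by linarith
  have "(\<lambda>m. of_real (of_real (bessel_coeff nu m) * (- (t\<^sup>2)) ^ m)) sums (of_real (bessel_gen nu (- (t\<^sup>2))) :: complex)"
    using s by (rule sums_of_real)
  hence "bessel_gen nu (of_real (- (t\<^sup>2)) :: complex) = of_real (bessel_gen nu (- (t\<^sup>2)))"
    using bessel_gen_sums[OF assms, of "of_real (- (t\<^sup>2)) :: complex"] by simp (metis sums_unique2)
  moreover have "(\<i> * of_real t)\<^sup>2 = (of_real (- (t\<^sup>2)) :: complex)" by (simp add: power_mult_distrib)
  ultimately show ?thesis using p unfolding bphi_def by simp
qed

lemma besselJ_bphi:
  assumes "nu > -1" "x > 0"
  shows "besselJ nu x = x powr nu * bphi nu x"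
proof -
  have "(-1) ^ m / (fact m * Gamma (real m + nu + 1)) * (x / 2) powr (2 * real m + nu)
     = x powr nu * (of_real (bessel_coeff nu m) * (x\<^sup>2) ^ m)" for m
  proof -
    have "(x/2) powr (2 * real m + nu) = (x/2) powr (real (2 * m)) * (x/2) powr nu"
      by (simp add: powr_add)
    also have "(x/2) powr (real (2 * m)) = (x/2)^(2*m)" using assms by (subst powr_realpow) auto
    also have "... = (x\<^sup>2)^m / 4^m" by (simp add: power_mult power_divide)
    finally have e: "(x / 2) powr (2 * real m + nu) = (x\<^sup>2)^m / 4^m * (x powr nu / 2 powr nu)"
      using assms by (simp add: powr_divide)
    show ?thesis unfolding e bessel_coeff_def by (simp add: divide_inverse mult_ac)
  qed
  hence "besselJ nu x = (\<Sum>m. x powr nu * (of_real (bessel_coeff nu m) * (x\<^sup>2) ^ m))"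
    unfolding besselJ_def by simp
  also have "... = x powr nu * bphi nu x"
    unfolding bphi_def bessel_gen_def by (rule suminf_mult) (rule summable_bessel_coeff[OF assms(1)])
  finally show ?thesis .
qed

lemma bphi_zero_iff:
  assumes "nu > -1" "x > 0"
  shows "besselJ nu x = 0 \<longleftrightarrow> bphi nu x = 0"
  using besselJ_bphi[OF assms] assms by simp

section \<open>Energy estimates\<close>

lemma has_real_derivative_norm_sq:
  fixes f :: "real \<Rightarrow> complex"
  assumes "(f has_vector_derivative f') (at s)"
  shows "((\<lambda>s. (norm (f s))\<^sup>2) has_real_derivative 2 * (f s \<bullet> f')) (at s)"
proof -
  have "((\<lambda>s. f s \<bullet> f s) has_derivative (\<lambda>h. f s \<bullet> (h *\<^sub>R f') + (h *\<^sub>R f') \<bullet> f s)) (at s)"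
    using assms unfolding has_vector_derivative_def by (intro has_derivative_inner)
  moreover have "(\<lambda>h. f s \<bullet> (h *\<^sub>R f') + (h *\<^sub>R f') \<bullet> f s) = (*) (2 * (f s \<bullet> f'))"
    by (auto simp: inner_commute algebra_simps)
  ultimately show ?thesis by (simp add: has_field_derivative_def power2_norm_eq_inner)
qed

definition ode_energy :: "complex \<Rightarrow> complex \<Rightarrow> complex \<Rightarrow> real" where
  "ode_energy k u u' = (norm u')\<^sup>2 + (norm k)\<^sup>2 * (norm u)\<^sup>2"

text \<open>The weight |k|^2 in the energy makes the cross terms of the derivative combine into k^2
  + |k|^2 = 2 Re(k) k. Only Re k and the perturbation r then cause growth, and 2 |u'| |k u| is at
  most the energy.\<close>

lemma ode_energy_deriv:
  fixes f f' :: "real \<Rightarrow> complex" and k r :: complex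
  assumes f: "(f has_vector_derivative f' s) (at s)"
    and f': "(f' has_vector_derivative (k\<^sup>2 + r) * f s) (at s)"
    and r: "norm r \<le> norm k * d" and k: "k \<noteq> 0"
  shows "\<exists>e. ((\<lambda>s. ode_energy k (f s) (f' s)) has_real_derivative e) (at s) \<and>
           \<bar>e\<bar> \<le> (2 * \<bar>Re k\<bar> + d) * ode_energy k (f s) (f' s)"
proof -
  define e where "e = 2 * (f' s \<bullet> ((k\<^sup>2 + r) * f s)) + (norm k)\<^sup>2 * (2 * (f s \<bullet> f' s))"
  have 1: "((\<lambda>s. ode_energy k (f s) (f' s)) has_real_derivative e) (at s)"
    unfolding ode_energy_def e_def
    by (intro DERIV_add DERIV_cmult has_real_derivative_norm_sq f f')
  have kk: "k\<^sup>2 + of_real ((norm k)\<^sup>2) = 2 * of_real (Re k) * k"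
    by (simp add: complex_eq_iff cmod_power2) (simp add: power2_eq_square algebra_simps)
  have "(norm k)\<^sup>2 * (f s \<bullet> f' s) = f' s \<bullet> (of_real ((norm k)\<^sup>2) * f s)"
    unfolding scaleR_conv_of_real[symmetric] by (simp add: inner_commute)
  hence "e = 2 * (f' s \<bullet> ((k\<^sup>2 + of_real ((norm k)\<^sup>2) + r) * f s))"
    unfolding e_def by (simp add: algebra_simps)
  hence "\<bar>e\<bar> \<le> 2 * (norm (f' s) * norm ((k\<^sup>2 + of_real ((norm k)\<^sup>2) + r) * f s))"
    using Cauchy_Schwarz_ineq2[of "f' s" "(k\<^sup>2 + of_real ((norm k)\<^sup>2) + r) * f s"] by simp
  also have "norm ((k\<^sup>2 + of_real ((norm k)\<^sup>2) + r) * f s) \<le> (2 * \<bar>Re k\<bar> * norm k + norm k * d) * norm (f s)"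
    unfolding norm_mult kk using r
    by (intro mult_right_mono order_trans[OF norm_triangle_ineq] add_mono) (auto simp: norm_mult)
  also have "2 * (norm (f' s) * ((2 * \<bar>Re k\<bar> * norm k + norm k * d) * norm (f s)))
      = (2 * \<bar>Re k\<bar> + d) * (2 * norm (f' s) * (norm k * norm (f s)))" by (simp add: algebra_simps)
  also have "... \<le> (2 * \<bar>Re k\<bar> + d) * ode_energy k (f s) (f' s)"
  proof -
    have "0 \<le> norm k * d" using r norm_ge_zero order_trans by blast
    hence "d \<ge> 0" using k by (simp add: zero_le_mult_iff)
    moreover have "2 * norm (f' s) * (norm k * norm (f s)) \<le> ode_energy k (f s) (f' s)"
      unfolding ode_energy_def using sum_squares_bound[of "norm (f' s)" "norm k * norm (f s)"]
      by (simp add: power_mult_distrib)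
    ultimately show ?thesis by (intro mult_left_mono) auto
  qed
  finally show ?thesis using 1 by (auto simp: mult_left_mono)
qed

text \<open>A Gronwall estimate without integral equations: the energy of \<open>u'' = (k\<^sup>2 + r) u\<close> changes at
  relative rate at most \<open>2\<bar>Re k\<bar> + \<bar>r\<bar>/\<bar>k\<bar>\<close>, in either direction.\<close>
lemma ode_energy_bounds:
  fixes f f' r :: "real \<Rightarrow> complex" and k :: complex and D D' :: "real \<Rightarrow> real"
  assumes ab: "a \<le> b" and k: "k \<noteq> 0"
    and f: "\<And>s. s \<in> {a<..<b} \<Longrightarrow> (f has_vector_derivative f' s) (at s)"
    and f': "\<And>s. s \<in> {a<..<b} \<Longrightarrow> (f' has_vector_derivative (k\<^sup>2 + r s) * f s) (at s)"
    and D: "\<And>s. s \<in> {a<..<b} \<Longrightarrow> (D has_real_derivative D' s) (at s)"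
    and r: "\<And>s. s \<in> {a<..<b} \<Longrightarrow> norm (r s) \<le> norm k * D' s"
    and cont: "continuous_on {a..b} f" "continuous_on {a..b} f'" "continuous_on {a..b} D"
  shows "ode_energy k (f b) (f' b) \<le> ode_energy k (f a) (f' a) * exp (2 * \<bar>Re k\<bar> * (b - a) + (D b - D a))"
    and "ode_energy k (f a) (f' a) \<le> ode_energy k (f b) (f' b) * exp (2 * \<bar>Re k\<bar> * (b - a) + (D b - D a))"
proof -
  define N where "N s = ode_energy k (f s) (f' s)" for s
  \<comment> \<open>L is the accumulated growth rate: \<open>N s * exp (- L s)\<close> decreases and
    \<open>N s * exp (L s)\<close> increases, which are the two directions of the estimate.\<close>
  define L where "L s = 2 * \<bar>Re k\<bar> * s + D s" for s
  have contN: "continuous_on {a..b} N" unfolding N_def ode_energy_def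
    by (intro continuous_intros cont)
  have contL: "continuous_on {a..b} L" unfolding L_def by (intro continuous_intros cont)
  have N: "\<exists>e. (N has_real_derivative e) (at s) \<and> \<bar>e\<bar> \<le> (2 * \<bar>Re k\<bar> + D' s) * N s"
    if "s \<in> {a<..<b}" for s
    unfolding N_def by (rule ode_energy_deriv[OF f[OF that] f'[OF that] r[OF that] k])
  have L: "(L has_real_derivative (2 * \<bar>Re k\<bar> + D' s)) (at s)" if "s \<in> {a<..<b}" for s
    unfolding L_def using D[OF that] by (auto intro!: derivative_eq_intros)
  have 1: "N b * exp (- L b) \<le> N a * exp (- L a)"
  proof (rule DERIV_nonpos_imp_decreasing_open[OF ab])
    fix s assume s: "a < s" "s < b"
    then obtain e where e: "(N has_real_derivative e) (at s)" "\<bar>e\<bar> \<le> (2 * \<bar>Re k\<bar> + D' s) * N s"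
      using N[of s] by auto
    have "((\<lambda>s. N s * exp (- L s)) has_real_derivative (e - (2 * \<bar>Re k\<bar> + D' s) * N s) * exp (- L s)) (at s)"
      using e(1) L[of s] s by (auto intro!: derivative_eq_intros simp: algebra_simps)
    moreover have "(e - (2 * \<bar>Re k\<bar> + D' s) * N s) * exp (- L s) \<le> 0"
      using e(2) by (intro mult_nonpos_nonneg) auto
    ultimately show "\<exists>y. ((\<lambda>s. N s * exp (- L s)) has_real_derivative y) (at s) \<and> y \<le> 0" by blast
  qed (intro continuous_intros contN contL)
  have 2: "N a * exp (L a) \<le> N b * exp (L b)"
  proof (rule DERIV_nonneg_imp_increasing_open[OF ab])
    fix s assume s: "a < s" "s < b"
    then obtain e where e: "(N has_real_derivative e) (at s)" "\<bar>e\<bar> \<le> (2 * \<bar>Re k\<bar> + D' s) * N s"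
      using N[of s] by auto
    have "((\<lambda>s. N s * exp (L s)) has_real_derivative (e + (2 * \<bar>Re k\<bar> + D' s) * N s) * exp (L s)) (at s)"
      using e(1) L[of s] s by (auto intro!: derivative_eq_intros simp: algebra_simps)
    moreover have "(e + (2 * \<bar>Re k\<bar> + D' s) * N s) * exp (L s) \<ge> 0"
      using e(2) by (intro mult_nonneg_nonneg) auto
    ultimately show "\<exists>y. ((\<lambda>s. N s * exp (L s)) has_real_derivative y) (at s) \<and> y \<ge> 0" by blast
  qed (intro continuous_intros contN contL)
  have e: "2 * \<bar>Re k\<bar> * (b - a) + (D b - D a) = L b - L a" by (simp add: L_def algebra_simps)
  show "ode_energy k (f b) (f' b) \<le> ode_energy k (f a) (f' a) * exp (2 * \<bar>Re k\<bar> * (b - a) + (D b - D a))"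
    unfolding e using 1 by (simp add: N_def exp_diff exp_minus field_simps)
  show "ode_energy k (f a) (f' a) \<le> ode_energy k (f b) (f' b) * exp (2 * \<bar>Re k\<bar> * (b - a) + (D b - D a))"
    unfolding e using 2 by (simp add: N_def exp_diff exp_minus field_simps)
qed

section \<open>Bessel's equation in Liouville normal form\<close>

text \<open>This is sqrt z J_nu(z). The power removes the first-order term of Bessel's equation and
  leaves w'' = ((nu^2 - 1/4) / z^2 - 1) w, a perturbation of w'' = - w that is integrable at
  infinity.\<close>

definition bw :: "real \<Rightarrow> complex \<Rightarrow> complex" where
  "bw nu z = z powr of_real (nu + 1/2) * bphi nu z"

definition bw' :: "real \<Rightarrow> complex \<Rightarrow> complex" where
  "bw' nu z = z powr of_real (nu + 1/2) * (of_real (nu + 1/2) / z * bphi nu z - z * bphi (nu+1) z)"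

lemma bw_deriv:
  assumes "nu > -1" "z \<notin> \<real>\<^sub>\<le>\<^sub>0"
  shows "(bw nu has_field_derivative bw' nu z) (at z)"
proof -
  have z: "z \<noteq> 0" using assms(2) by auto
  have p: "z powr (c - 1) = z powr c / z" for c using z by (simp add: powr_diff)
  have "((\<lambda>z. z powr of_real (nu + 1/2) * bphi nu z) has_field_derivative
      (of_real (nu + 1/2) * z powr (of_real (nu + 1/2) - 1)) * bphi nu z + (- z * bphi (nu+1) z) * z powr of_real (nu + 1/2)) (at z)"
    by (intro DERIV_mult has_field_derivative_powr bphi_deriv assms)
  moreover have "(of_real (nu + 1/2) * z powr (of_real (nu + 1/2) - 1)) * bphi nu z + (- z * bphi (nu+1) z) * z powr of_real (nu + 1/2)
     = bw' nu z"
    unfolding bw'_def p by (simp add: algebra_simps)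
  ultimately show ?thesis unfolding bw_def[abs_def] by simp
qed

lemma bw'_deriv:
  assumes "nu > -1" "z \<notin> \<real>\<^sub>\<le>\<^sub>0"
  shows "(bw' nu has_field_derivative (of_real (nu\<^sup>2 - 1/4) / z\<^sup>2 - 1) * bw nu z) (at z)"
proof -
  have z: "z \<noteq> 0" using assms(2) by auto
  have p: "z powr (c - 1) = z powr c / z" for c using z by (simp add: powr_diff)
  have n1: "nu + 1 > -1" using assms(1) by simp
  \<comment> \<open>The recurrence removes order nu+2, so that the derivative of
    \<open>bphi (nu+1)\<close> closes up on the orders nu and nu+1.\<close>
  have b2: "- z * bphi (nu + 2) z = (bphi nu z - of_real (2*nu+2) * bphi (nu+1) z) / z"
    using bphi_rec[OF assms(1), of z] z by (simp add: field_simps power2_eq_square)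
  have d1: "(bphi (nu+1) has_field_derivative (bphi nu z - of_real (2*nu+2) * bphi (nu+1) z) / z) (at z)"
    using bphi_deriv[OF n1, of z] unfolding b2[symmetric] by (simp add: add.assoc)
  define A where "A = (of_real (nu + 1/2) :: complex)"
  define P0 where "P0 = bphi nu z"
  define P1 where "P1 = bphi (nu+1) z"
  have nu: "of_real nu = A - 1/2" by (simp add: A_def)
  have "((\<lambda>z. z powr A * (A / z * bphi nu z - z * bphi (nu+1) z)) has_field_derivative
      (A * z powr (A - 1)) * (A / z * P0 - z * P1) + 
      (((- A / z\<^sup>2) * P0 + (- z * P1) * (A / z)) - (1 * P1 + (P0 - of_real (2*nu+2) * P1) / z * z)) * z powr A) (at z)"
    unfolding P0_def P1_def using z
    by (intro DERIV_mult DERIV_diff has_field_derivative_powr bphi_deriv assms d1 DERIV_ident)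
       (auto intro!: derivative_eq_intros simp: power2_eq_square)
  moreover have "(A * z powr (A - 1)) * (A / z * P0 - z * P1) + 
      (((- A / z\<^sup>2) * P0 + (- z * P1) * (A / z)) - (1 * P1 + (P0 - of_real (2*nu+2) * P1) / z * z)) * z powr A
     = (of_real (nu\<^sup>2 - 1/4) / z\<^sup>2 - 1) * (z powr A * P0)"
    unfolding p using z by (simp add: nu field_simps power2_eq_square)
  ultimately show ?thesis unfolding bw'_def[abs_def] bw_def A_def P0_def by simp
qed


definition bE :: "real \<Rightarrow> complex \<Rightarrow> real" where
  "bE nu z = (norm (bw' nu z))\<^sup>2 + (norm (bw nu z))\<^sup>2"

lemma bw_line_deriv:
  assumes "nu > -1" "p + of_real s * e \<notin> \<real>\<^sub>\<le>\<^sub>0"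
  shows "((\<lambda>s. bw nu (p + of_real s * e)) has_vector_derivative e * bw' nu (p + of_real s * e)) (at s)"
    and "((\<lambda>s. bw' nu (p + of_real s * e)) has_vector_derivative
           e * ((of_real (nu\<^sup>2 - 1/4) / (p + of_real s * e)\<^sup>2 - 1) * bw nu (p + of_real s * e))) (at s)"
proof -
  have l: "((\<lambda>s. p + of_real s * e) has_vector_derivative e) (at s)"
    by (auto intro!: derivative_eq_intros)
  show "((\<lambda>s. bw nu (p + of_real s * e)) has_vector_derivative e * bw' nu (p + of_real s * e)) (at s)"
    using field_vector_diff_chain_at[OF l bw_deriv[OF assms]] by (simp add: o_def)
  show "((\<lambda>s. bw' nu (p + of_real s * e)) has_vector_derivative
           e * ((of_real (nu\<^sup>2 - 1/4) / (p + of_real s * e)\<^sup>2 - 1) * bw nu (p + of_real s * e))) (at s)"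
    using field_vector_diff_chain_at[OF l bw'_deriv[OF assms]] by (simp add: o_def)
qed

text \<open>Along the line p + s e the equation becomes u'' = (k^2 + r) u with k = i e, so the
  exponential rate is |Re k| = |Im e|. The function D is left free; its derivative has to dominate
  |e| |nu^2 - 1/4| / |p + s e|^2.\<close>

lemma bE_line_bounds:
  fixes D D' :: "real \<Rightarrow> real"
  assumes nu: "nu > -1" and e: "e \<noteq> 0" and ab: "a \<le> b"
    and dom: "\<And>s. s \<in> {a..b} \<Longrightarrow> p + of_real s * e \<notin> \<real>\<^sub>\<le>\<^sub>0"
    and D: "\<And>s. s \<in> {a..b} \<Longrightarrow> (D has_real_derivative D' s) (at s)"
    and r: "\<And>s. s \<in> {a<..<b} \<Longrightarrow> norm e * \<bar>nu\<^sup>2 - 1/4\<bar> \<le> D' s * (norm (p + of_real s * e))\<^sup>2"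
  shows "bE nu (p + of_real b * e) \<le> bE nu (p + of_real a * e) * exp (2 * \<bar>Im e\<bar> * (b - a) + (D b - D a))"
    and "bE nu (p + of_real a * e) \<le> bE nu (p + of_real b * e) * exp (2 * \<bar>Im e\<bar> * (b - a) + (D b - D a))"
proof -
  define f where "f s = bw nu (p + of_real s * e)" for s
  define f' where "f' s = e * bw' nu (p + of_real s * e)" for s
  define r where "r s = e\<^sup>2 * (of_real (nu\<^sup>2 - 1/4) / (p + of_real s * e)\<^sup>2)" for s
  define k where "k = \<i> * e"
  have k: "k \<noteq> 0" "norm k = norm e" "Re k = - Im e" "k\<^sup>2 = - (e\<^sup>2)"
    using e by (auto simp: k_def norm_mult power_mult_distrib)
  have fd: "(f has_vector_derivative f' s) (at s)" if "s \<in> {a..b}" for s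
    unfolding f_def f'_def by (rule bw_line_deriv[OF nu dom[OF that]])
  have "((\<lambda>s. e * bw' nu (p + of_real s * e)) has_vector_derivative
           e * (e * ((of_real (nu\<^sup>2 - 1/4) / (p + of_real s * e)\<^sup>2 - 1) * bw nu (p + of_real s * e)))) (at s)"
    if "s \<in> {a..b}" for s
    by (intro has_vector_derivative_mult_right bw_line_deriv(2)[OF nu dom[OF that]])
  hence fd': "(f' has_vector_derivative (k\<^sup>2 + r s) * f s) (at s)" if "s \<in> {a..b}" for s
    using that unfolding f'_def[abs_def] r_def k(4) f_def by (simp add: algebra_simps power2_eq_square)
  have rb: "norm (r s) \<le> norm k * D' s" if s: "s \<in> {a<..<b}" for s
  proof -
    have "p + of_real s * e \<noteq> 0" using dom[of s] s by auto
    hence n: "(norm (p + of_real s * e))\<^sup>2 > 0" by simp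
    have "norm (r s) = norm e * (norm e * \<bar>nu\<^sup>2 - 1/4\<bar> / (norm (p + of_real s * e))\<^sup>2)"
      unfolding r_def norm_mult norm_divide norm_power norm_of_real by (simp add: power2_eq_square)
    also have "norm e * \<bar>nu\<^sup>2 - 1/4\<bar> / (norm (p + of_real s * e))\<^sup>2 \<le> D' s"
      using r[OF s] n by (simp add: divide_le_eq)
    finally show ?thesis by (simp add: k mult_left_mono)
  qed
  have cont: "continuous_on {a..b} f" "continuous_on {a..b} f'" "continuous_on {a..b} D"
    using fd fd' D by (meson continuous_at_imp_continuous_on has_vector_derivative_continuous DERIV_isCont)+
  have oe: "ode_energy k (f s) (f' s) = (norm e)\<^sup>2 * bE nu (p + of_real s * e)" for s
    unfolding ode_energy_def bE_def f_def f'_def k(2) norm_mult by (simp add: algebra_simps power_mult_distrib)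
  have ne: "(norm e)\<^sup>2 > 0" using e by simp
  have "ode_energy k (f b) (f' b) \<le> ode_energy k (f a) (f' a) * exp (2 * \<bar>Re k\<bar> * (b - a) + (D b - D a))"
    "ode_energy k (f a) (f' a) \<le> ode_energy k (f b) (f' b) * exp (2 * \<bar>Re k\<bar> * (b - a) + (D b - D a))"
    by (rule ode_energy_bounds[where D'=D' and r=r]; use ab k fd fd' D rb cont in auto)+
  thus "bE nu (p + of_real b * e) \<le> bE nu (p + of_real a * e) * exp (2 * \<bar>Im e\<bar> * (b - a) + (D b - D a))"
    "bE nu (p + of_real a * e) \<le> bE nu (p + of_real b * e) * exp (2 * \<bar>Im e\<bar> * (b - a) + (D b - D a))"
    unfolding oe k(3) using ne by (simp_all add: mult.assoc)
qed

lemma bw_continuous: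
  assumes "nu > -1" "S \<inter> \<real>\<^sub>\<le>\<^sub>0 = {}"
  shows "continuous_on S (bw nu)" "continuous_on S (bw' nu)" "continuous_on S (bE nu)"
proof -
  show 1: "continuous_on S (bw nu)" "continuous_on S (bw' nu)"
    using bw_deriv[OF assms(1)] bw'_deriv[OF assms(1)] assms(2)
    by (meson continuous_at_imp_continuous_on DERIV_isCont disjoint_iff)+
  show "continuous_on S (bE nu)" unfolding bE_def by (intro continuous_intros 1)
qed

lemma bE_nonneg [simp]: "bE nu z \<ge> 0" by (simp add: bE_def)

text \<open>Start on the unit half circle, where compactness bounds the energy, and move outwards
  along the ray through z. The potential, being integrable from 1 on, contributes at most |nu^2 -
  1/4| to the exponent, and the direction of the ray at most 2 |Im z|.\<close>

lemma bE_upper: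
  assumes nu: "nu > -1"
  shows "\<exists>C>0. \<forall>z. Re z \<ge> 0 \<longrightarrow> norm z \<ge> 1 \<longrightarrow> bE nu z \<le> C * exp (2 * \<bar>Im z\<bar>)"
proof -
  define S where "S = sphere (0::complex) 1 \<inter> {z. Re z \<ge> 0}"
  have "compact S" unfolding S_def by (intro compact_Int_closed closed_halfspace_Re_ge) auto
  moreover have dS: "S \<inter> \<real>\<^sub>\<le>\<^sub>0 = {}"
  proof -
    have False if "z \<in> S" "z \<in> \<real>\<^sub>\<le>\<^sub>0" for z
    proof -
      from that(2) obtain t where t: "z = of_real t" "t \<le> 0" by (auto elim!: nonpos_Reals_cases)
      with that(1) show False by (auto simp: S_def)
    qed
    thus ?thesis by auto
  qed
  ultimately have "bounded (bE nu ` S)"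
    by (intro compact_imp_bounded compact_continuous_image bw_continuous[OF nu])
  then obtain C0 where C0: "C0 > 0" "\<And>z. z \<in> S \<Longrightarrow> norm (bE nu z) \<le> C0"
    unfolding bounded_pos by auto
  define m where "m = \<bar>nu\<^sup>2 - 1/4\<bar>"
  have "bE nu z \<le> C0 * exp m * exp (2 * \<bar>Im z\<bar>)" if z: "Re z \<ge> 0" "norm z \<ge> 1" for z
  proof -
    define e where "e = z / of_real (norm z)"
    have nz: "norm z > 0" using z by linarith
    have ne: "norm e = 1" unfolding e_def using nz by (simp add: norm_divide)
    have eS: "e \<in> S" using z ne nz by (auto simp: S_def e_def)
    have zz: "z = 0 + of_real (norm z) * e" "e = 0 + of_real 1 * e" using nz by (auto simp: e_def)
    have "bE nu (0 + of_real (norm z) * e) \<le> bE nu (0 + of_real 1 * e) *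
        exp (2 * \<bar>Im e\<bar> * (norm z - 1) + (- m / norm z - (- m / 1)))"
    proof (rule bE_line_bounds(1)[OF nu, where D = "\<lambda>s. - m / s" and D' = "\<lambda>s. m / s\<^sup>2"])
      show "e \<noteq> 0" using ne by auto
      fix s assume s: "s \<in> {1..norm z}"
      show "0 + of_real s * e \<notin> \<real>\<^sub>\<le>\<^sub>0"
      proof
        assume "0 + of_real s * e \<in> \<real>\<^sub>\<le>\<^sub>0"
        then obtain t where t: "of_real s * e = of_real t" "t \<le> 0" by (auto elim!: nonpos_Reals_cases)
        hence "e = of_real (t / s)" "t / s \<le> 0" using s by (auto simp: field_simps divide_nonpos_pos)
        hence "e \<in> \<real>\<^sub>\<le>\<^sub>0" by (metis nonpos_Reals_of_real_iff)
        thus False using eS dS by auto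
      qed
      show "((\<lambda>s. - m / s) has_real_derivative m / s\<^sup>2) (at s)"
        using s by (auto intro!: derivative_eq_intros simp: power2_eq_square)
    next
      fix s assume "s \<in> {1<..<norm z}"
      thus "norm e * \<bar>nu\<^sup>2 - 1/4\<bar> \<le> m / s\<^sup>2 * (norm (0 + of_real s * e))\<^sup>2"
        by (simp add: norm_mult ne m_def power_mult_distrib)
    qed (use z in auto)
    hence "bE nu z \<le> bE nu e * exp (2 * \<bar>Im e\<bar> * (norm z - 1) + (- m / norm z - (- m / 1)))"
      using zz by simp
    also have "... \<le> C0 * exp (m + 2 * \<bar>Im z\<bar>)"
    proof (intro mult_mono)
      show "bE nu e \<le> C0" using C0(2)[OF eS] by simp
      have "Im z = norm z * Im e" using zz(1) by (metis Im_complex_of_real Re_complex_of_real add_0 mult_zero_left add.right_neutral times_complex.simps(2))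
      hence "\<bar>Im z\<bar> = \<bar>Im e\<bar> * norm z" by (simp add: abs_mult)
      moreover have "m / norm z \<ge> 0" by (simp add: m_def)
      ultimately have "2 * \<bar>Im e\<bar> * (norm z - 1) + (- m / norm z - (- m / 1)) \<le> m + 2 * \<bar>Im z\<bar>"
        by (simp add: algebra_simps)
      thus "exp (2 * \<bar>Im e\<bar> * (norm z - 1) + (- m / norm z - (- m / 1))) \<le> exp (m + 2 * \<bar>Im z\<bar>)" by simp
    qed (use C0 in auto)
    finally show ?thesis by (simp add: exp_add mult.assoc)
  qed
  thus ?thesis using C0(1) by (intro exI[of _ "C0 * exp m"]) auto
qed

lemma bw_real:
  assumes "nu > -1" "x > 0"
  shows "bw nu (of_real x) = of_real (x powr (nu + 1/2) * bphi nu x)" (is ?A)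
    and "bw' nu (of_real x) \<in> \<real>"
proof -
  show ?A using assms by (simp add: bw_def bphi_of_real powr_of_real del: of_real_add)
  have "bphi (nu + 1) (of_real x) = (of_real (bphi (nu+1) x) :: complex)" using assms by (intro bphi_of_real) auto
  thus "bw' nu (of_real x) \<in> \<real>" unfolding bw'_def using assms
    by (simp add: bphi_of_real powr_of_real del: of_real_add)
qed

text \<open>The energy changes at a bounded relative rate on any compact part of the positive axis,
  so it cannot vanish anywhere once it is positive at a point near 0, where \<open>bphi nu\<close>
  is positive.\<close>

lemma bE_pos:
  assumes nu: "nu > -1" and x: "x > 0"
  shows "bE nu (of_real x) > 0"
proof -
  have "isCont (bphi nu) (0::real)" using bphi_deriv[OF nu] DERIV_isCont by blast
  hence "eventually (\<lambda>y::real. bphi nu y > 0) (at 0)"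
    using bphi_0[OF nu] by (simp add: isCont_def order_tendstoD)
  then obtain d where d: "d > 0" "\<And>y::real. y \<noteq> 0 \<Longrightarrow> dist y 0 < d \<Longrightarrow> bphi nu y > 0"
    unfolding eventually_at by auto
  define y where "y = min d x / 2"
  have y: "0 < y" "y < x" "y < d" using d(1) x by (auto simp: y_def)
  have yp: "bphi nu y > 0" using d(2)[of y] y by simp
  define m where "m = \<bar>nu\<^sup>2 - 1/4\<bar>"
  have "bw nu (of_real y) \<noteq> 0" using y yp by (simp add: bw_real[OF nu])
  hence p: "bE nu (of_real y) > 0" unfolding bE_def by (simp add: add_nonneg_pos)
  have "bE nu (0 + of_real y * 1) \<le> bE nu (0 + of_real x * 1) * exp (2 * \<bar>Im 1\<bar> * (x - y) + (- m / x - (- m / y)))"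
    using y by (intro bE_line_bounds(2)[OF nu, where D = "\<lambda>s. - m / s" and D' = "\<lambda>s. m / s\<^sup>2"])
      (auto intro!: derivative_eq_intros simp: m_def power2_eq_square)
  with p show ?thesis by (smt (verit) bE_nonneg exp_gt_zero mult.right_neutral mult_eq_0_iff add_0)
qed

text \<open>On the real axis there is no exponential rate, and the potential has total mass m / x0
  to the right of x0; the energy therefore loses at most a fixed factor.\<close>

lemma bE_lower:
  assumes nu: "nu > -1" and x0: "x0 > 0"
  shows "\<exists>c>0. \<forall>x\<ge>x0. bE nu (of_real x) \<ge> c"
proof -
  define m where "m = \<bar>nu\<^sup>2 - 1/4\<bar>"
  have "bE nu (of_real x) \<ge> bE nu (of_real x0) * exp (- (m / x0))" if x: "x \<ge> x0" for x
  proof -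
    have "bE nu (0 + of_real x0 * 1) \<le> bE nu (0 + of_real x * 1) * exp (2 * \<bar>Im 1\<bar> * (x - x0) + (- m / x - (- m / x0)))"
      using x x0 by (intro bE_line_bounds(2)[OF nu, where D = "\<lambda>s. - m / s" and D' = "\<lambda>s. m / s\<^sup>2"])
        (auto intro!: derivative_eq_intros simp: m_def power2_eq_square)
    also have "... \<le> bE nu (of_real x) * exp (m / x0)"
      using x x0 by (auto intro!: mult_left_mono simp: m_def)
    finally show ?thesis by (simp add: exp_minus field_simps)
  qed
  thus ?thesis using bE_pos[OF nu x0] by (intro exI[of _ "bE nu (of_real x0) * exp (- (m / x0))"]) auto
qed

lemma not_nonpos_Reals_Re: "Re z > 0 \<Longrightarrow> z \<notin> \<real>\<^sub>\<le>\<^sub>0"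
  by (auto elim!: nonpos_Reals_cases)

lemma not_nonpos_Reals_Im: "Im z \<noteq> 0 \<Longrightarrow> z \<notin> \<real>\<^sub>\<le>\<^sub>0"
  by (auto elim!: nonpos_Reals_cases)

lemma bE_norm_le:
  assumes "bE nu z \<le> C * exp (2 * t)" "C \<ge> 0"
  shows "norm (bw nu z) \<le> sqrt C * exp t"
proof -
  have "(norm (bw nu z))\<^sup>2 \<le> (sqrt C * exp t)\<^sup>2"
  proof -
    have "(norm (bw nu z))\<^sup>2 \<le> C * exp (2 * t)" using assms(1) unfolding bE_def
      by (rule order_trans[rotated]) simp
    also have "... = (sqrt C * exp t)\<^sup>2" using assms(2) by (simp add: power_mult_distrib exp_double)
    finally show ?thesis .
  qed
  thus ?thesis by (rule power2_le_imp_le) (use assms in simp)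
qed

lemma bw_upper:
  assumes nu: "nu > -1"
  shows "\<exists>C>0. \<forall>z. Re z \<ge> 0 \<longrightarrow> norm z \<ge> 1 \<longrightarrow> norm (bw nu z) \<le> C * exp \<bar>Im z\<bar>"
proof -
  obtain C where C: "C > 0" "\<And>z. Re z \<ge> 0 \<Longrightarrow> norm z \<ge> 1 \<Longrightarrow> bE nu z \<le> C * exp (2 * \<bar>Im z\<bar>)"
    using bE_upper[OF nu] by blast
  thus ?thesis by (intro exI[of _ "sqrt C"]) (auto intro!: bE_norm_le)
qed

text \<open>Along a vertical line the potential is integrable with total mass \<open>O(1/x)\<close>, so \<open>w\<close> is, up to that
  relative error, the solution of the free equation with the same data at the real point \<open>x\<close>.\<close>
lemma bw_vertical:
  assumes nu: "nu > -1"
  shows "\<exists>C>0. \<forall>x\<ge>1. \<forall>t\<ge>0.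
     norm (bw nu (Complex x t) - (bw nu (of_real x) * of_real (cosh t) + \<i> * bw' nu (of_real x) * of_real (sinh t))) \<le> C / x * exp t \<and>
     norm (bw' nu (Complex x t) - (bw' nu (of_real x) * of_real (cosh t) - \<i> * bw nu (of_real x) * of_real (sinh t))) \<le> C / x * exp t"
proof -
  obtain C where C: "C > 0" "\<And>z. Re z \<ge> 0 \<Longrightarrow> norm z \<ge> 1 \<Longrightarrow> norm (bw nu z) \<le> C * exp \<bar>Im z\<bar>"
    using bw_upper[OF nu] by blast
  define m where "m = \<bar>nu\<^sup>2 - 1/4\<bar>"
  have m: "m \<ge> 0" by (simp add: m_def)
  define K where "K = C * m * 2 + 1"
  have K: "K > 0" using C m by (simp add: K_def add_nonneg_pos)
  have main: "norm (bw nu (Complex x t) - (bw nu (of_real x) * of_real (cosh t) + \<i> * bw' nu (of_real x) * of_real (sinh t))) \<le> K / x * exp t \<and>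
     norm (bw' nu (Complex x t) - (bw' nu (of_real x) * of_real (cosh t) - \<i> * bw nu (of_real x) * of_real (sinh t))) \<le> K / x * exp t"
    if x: "x \<ge> 1" and t: "t > 0" for x t
  proof -
    define f where "f s = bw nu (of_real x + of_real s * \<i>)" for s
    define g where "g s = \<i> * bw' nu (of_real x + of_real s * \<i>)" for s
    define q where "q s = (of_real (nu\<^sup>2 - 1/4) / (of_real x + of_real s * \<i>)\<^sup>2 :: complex)" for s
    have dom: "of_real x + of_real s * \<i> \<notin> \<real>\<^sub>\<le>\<^sub>0" for s using x by (intro not_nonpos_Reals_Re) simp
    have df: "(f has_vector_derivative g s) (at s)" for s
      unfolding f_def g_def by (rule bw_line_deriv[OF nu dom])
    have "(g has_vector_derivative \<i> * (\<i> * ((of_real (nu\<^sup>2 - 1/4) / (of_real x + of_real s * \<i>)\<^sup>2 - 1) * bw nu (of_real x + of_real s * \<i>)))) (at s)" for s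
      unfolding g_def by (intro has_vector_derivative_mult_right bw_line_deriv(2)[OF nu dom])
    moreover have "\<i> * (\<i> * ((of_real (nu\<^sup>2 - 1/4) / (of_real x + of_real s * \<i>)\<^sup>2 - 1) * bw nu (of_real x + of_real s * \<i>))) = f s - q s * f s" for s
    proof -
      have "\<i> * (\<i> * ((Q - 1) * W)) = W - Q * W" for Q W :: complex by (simp add: algebra_simps)
      thus ?thesis unfolding f_def q_def .
    qed
    ultimately have dg: "(g has_vector_derivative f s - q s * f s) (at s)" for s by simp
    have nrm: "norm (of_real x + of_real s * \<i>) ^ 2 = x\<^sup>2 + s\<^sup>2" for s by (simp add: cmod_power2)
    have qf: "norm (q s * f s) \<le> C * m / (x\<^sup>2 + s\<^sup>2) * exp s" if "s > 0" for s
    proof -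
      have "1 \<le> x\<^sup>2" using x by (simp add: one_le_power)
      hence "1 \<le> (norm (of_real x + of_real s * \<i>))\<^sup>2" unfolding nrm using zero_le_power2[of s] by linarith
      hence "1\<^sup>2 \<le> (norm (of_real x + of_real s * \<i>))\<^sup>2" by simp
      hence "1 \<le> norm (of_real x + of_real s * \<i>)" by (rule power2_le_imp_le) auto
      hence "norm (f s) \<le> C * exp s" unfolding f_def using C(2)[of "of_real x + of_real s * \<i>"] x that by simp
      moreover have "norm (q s) = m / (x\<^sup>2 + s\<^sup>2)" unfolding q_def norm_divide norm_power nrm norm_of_real m_def by simp
      ultimately have "norm (q s * f s) \<le> m / (x\<^sup>2 + s\<^sup>2) * (C * exp s)"
        unfolding norm_mult by (intro mult_mono) (use m in auto)
      thus ?thesis by (simp add: mult_ac)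
    qed
    \<comment> \<open>Up to the factor m this is the mass of the potential on the vertical line
      below height s. It never exceeds 2 / x, which is the source of the relative error 1 /
      x.\<close>
    have at: "((\<lambda>s. arctan (s / x) / x) has_real_derivative 1 / (x\<^sup>2 + s\<^sup>2)) (at s)" for s
    proof -
      have "((\<lambda>s. arctan (s / x) / x) has_real_derivative (inverse (1 + (s/x)\<^sup>2) * (1 / x)) / x) (at s)"
        using x by (intro DERIV_cdivide DERIV_chain2[OF DERIV_arctan]) (auto intro!: derivative_eq_intros)
      moreover have "(inverse (1 + (s/x)\<^sup>2) * (1 / x)) / x = 1 / (x\<^sup>2 + s\<^sup>2)"
      proof -
        have "(1 + (s/x)\<^sup>2) * x * x = x\<^sup>2 + s\<^sup>2" using x by (simp add: field_simps power2_eq_square)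
        thus ?thesis by (simp add: field_simps)
      qed
      ultimately show ?thesis by simp
    qed
    have at2: "arctan (t / x) / x \<le> 2 / x" using x pi_less_4 arctan_ubound[of "t/x"] by (intro divide_right_mono) auto
    have at0: "arctan (s / x) \<ge> 0" if "s \<ge> 0" for s using x that by simp
    \<comment> \<open>For f'' = f both P and Q are constant. Here their derivatives contain only the
      potential term, so each is controlled by integrating q f.\<close>
    define P where "P s = exp (-s) *\<^sub>R (g s + f s)" for s
    define Q where "Q s = exp s *\<^sub>R (g s - f s)" for s
    have dP: "(P has_vector_derivative exp (-s) *\<^sub>R (- (q s * f s))) (at s)" for s
    proof -
      have e: "((\<lambda>s. exp (-s)) has_vector_derivative - exp (- s)) (at s)"
        unfolding has_real_derivative_iff_has_vector_derivative[symmetric] by (auto intro!: derivative_eq_intros)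
      have "(P has_vector_derivative (exp (-s) *\<^sub>R ((f s - q s * f s) + g s) + (- exp (-s)) *\<^sub>R (g s + f s))) (at s)"
        unfolding P_def by (intro has_vector_derivative_scaleR has_vector_derivative_add df dg) (auto intro!: derivative_eq_intros)
      moreover have "(exp (-s) *\<^sub>R ((f s - q s * f s) + g s) + (- exp (-s)) *\<^sub>R (g s + f s)) = exp (-s) *\<^sub>R (- (q s * f s))"
        by (simp add: algebra_simps)
      ultimately show ?thesis by simp
    qed
    have dQ: "(Q has_vector_derivative exp s *\<^sub>R (- (q s * f s))) (at s)" for s
    proof -
      have "(Q has_vector_derivative (exp s *\<^sub>R ((f s - q s * f s) - g s) + exp s *\<^sub>R (g s - f s))) (at s)"
        unfolding Q_def by (intro has_vector_derivative_scaleR has_vector_derivative_diff df dg) (auto intro!: derivative_eq_intros)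
      moreover have "(exp s *\<^sub>R ((f s - q s * f s) - g s) + exp s *\<^sub>R (g s - f s)) = exp s *\<^sub>R (- (q s * f s))"
        by (simp add: algebra_simps)
      ultimately show ?thesis by simp
    qed
    have cont: "continuous_on {0..t} P" "continuous_on {0..t} Q"
      using dP dQ by (meson continuous_at_imp_continuous_on has_vector_derivative_continuous)+
    have "norm (P t - P 0) \<le> C * m * (arctan (t / x) / x) - C * m * (arctan (0 / x) / x)"
    proof (rule differentiable_bound_general[OF t cont(1) _ dP])
      show "((\<lambda>s. C * m * (arctan (s / x) / x)) has_vector_derivative C * m * (1 / (x\<^sup>2 + s\<^sup>2))) (at s)" for s
        unfolding has_real_derivative_iff_has_vector_derivative[symmetric] by (intro DERIV_cmult at)
      thus "continuous_on {0..t} (\<lambda>s. C * m * (arctan (s / x) / x))"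
        by (meson continuous_at_imp_continuous_on has_vector_derivative_continuous)
      fix s assume s: "0 < s" "s < t"
      have "norm (exp (- s) *\<^sub>R - (q s * f s)) = exp (-s) * norm (q s * f s)" by simp
      also have "... \<le> exp (-s) * (C * m / (x\<^sup>2 + s\<^sup>2) * exp s)" by (intro mult_left_mono qf s) auto
      also have "... = C * m * (1 / (x\<^sup>2 + s\<^sup>2))" by (simp add: exp_minus)
      finally show "norm (exp (- s) *\<^sub>R - (q s * f s)) \<le> C * m * (1 / (x\<^sup>2 + s\<^sup>2))" .
    qed
    also have "... \<le> C * m * (2 / x)" using mult_left_mono[OF at2, of "C * m"] C m by simp
    also have "... \<le> K / x" using x by (simp add: K_def field_simps)
    finally have bP: "norm (P t - P 0) \<le> K / x" .
    \<comment> \<open>The derivative of Q carries exp (2 s). The majorant exp (2 s) times the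
      arctangent has the required term in its derivative, plus a nonnegative one.\<close>
    have "norm (Q t - Q 0) \<le> exp (2 * t) * (C * m * (arctan (t / x) / x)) - exp (2*0) * (C * m * (arctan (0 / x) / x))"
    proof (rule differentiable_bound_general[OF t cont(2) _ dQ])
      show "((\<lambda>s. exp (2 * s) * (C * m * (arctan (s / x) / x))) has_vector_derivative
         2 * exp (2 * s) * (C * m * (arctan (s / x) / x)) + C * m * (1 / (x\<^sup>2 + s\<^sup>2)) * exp (2 * s)) (at s)" for s
        unfolding has_real_derivative_iff_has_vector_derivative[symmetric] 
        by (intro DERIV_mult DERIV_cmult at) (auto intro!: derivative_eq_intros)
      thus "continuous_on {0..t} (\<lambda>s. exp (2 * s) * (C * m * (arctan (s / x) / x)))"
        by (meson continuous_at_imp_continuous_on has_vector_derivative_continuous)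
      fix s assume s: "0 < s" "s < t"
      have "norm (exp s *\<^sub>R - (q s * f s)) = exp s * norm (q s * f s)" by simp
      also have "... \<le> exp s * (C * m / (x\<^sup>2 + s\<^sup>2) * exp s)" by (intro mult_left_mono qf s) auto
      also have "... = C * m * (1 / (x\<^sup>2 + s\<^sup>2)) * exp (2 * s)" by (simp add: exp_double power2_eq_square)
      also have "... \<le> 2 * exp (2 * s) * (C * m * (arctan (s / x) / x)) + C * m * (1 / (x\<^sup>2 + s\<^sup>2)) * exp (2 * s)"
        using at0[of s] s C m x by simp
      finally show "norm (exp s *\<^sub>R - (q s * f s)) \<le> 2 * exp (2 * s) * (C * m * (arctan (s / x) / x)) + C * m * (1 / (x\<^sup>2 + s\<^sup>2)) * exp (2 * s)" .
    qed
    also have "... \<le> exp (2 * t) * (C * m * (2 / x))" using mult_left_mono[OF at2, of "exp (2 * t) * (C * m)"] C m by (simp add: mult_ac)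
    also have "... \<le> exp (2 * t) * (K / x)" using x by (intro mult_left_mono) (auto simp: K_def field_simps)
    finally have bQ: "norm (Q t - Q 0) \<le> exp (2 * t) * (K / x)" .
    define A where "A = exp t *\<^sub>R (P t - P 0)"
    define B where "B = exp (-t) *\<^sub>R (Q t - Q 0)"
    have nA: "norm A \<le> exp t * (K / x)" using mult_left_mono[OF bP, of "exp t"] by (simp add: A_def)
    have "norm B \<le> exp (-t) * (exp (2 * t) * (K / x))" unfolding B_def using mult_left_mono[OF bQ, of "exp (-t)"] by simp
    also have "... = (exp (-t) * exp (2 * t)) * (K / x)" by (rule mult.assoc[symmetric])
    also have "exp (-t) * exp (2 * t) = exp t" by (simp flip: exp_add)
    finally have nB: "norm B \<le> exp t * (K / x)" .
    have PQ: "A = g t + f t - exp t *\<^sub>R (g 0 + f 0)" "B = g t - f t - exp (-t) *\<^sub>R (g 0 - f 0)"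
      by (auto simp: A_def B_def P_def Q_def scaleR_diff_right exp_minus)
    have ft: "f t - (of_real (cosh t) * f 0 + of_real (sinh t) * g 0) = (1/2) *\<^sub>R (A - B)"
      unfolding PQ by (simp add: cosh_def sinh_def scaleR_conv_of_real field_simps)
    have gt: "g t - (of_real (cosh t) * g 0 + of_real (sinh t) * f 0) = (1/2) *\<^sub>R (A + B)"
      unfolding PQ by (simp add: cosh_def sinh_def scaleR_conv_of_real field_simps)
    have avg: "c / 2 \<le> Z" if "a \<le> Z" "b \<le> Z" "c \<le> a + b" for a b c Z :: real using that by linarith
    have "norm ((1/2) *\<^sub>R (A - B)) \<le> exp t * (K / x)" proof -
      have "norm ((1/2) *\<^sub>R (A - B)) = norm (A - B) / 2" by simp
      also have "norm (A - B) / 2 \<le> exp t * (K / x)" by (rule avg[OF nA nB norm_triangle_ineq4])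
      finally show ?thesis .
    qed
    hence 1: "norm (f t - (of_real (cosh t) * f 0 + of_real (sinh t) * g 0)) \<le> K / x * exp t" unfolding ft by (simp add: mult_ac)
    have "norm ((1/2) *\<^sub>R (A + B)) \<le> exp t * (K / x)" proof -
      have "norm ((1/2) *\<^sub>R (A + B)) = norm (A + B) / 2" by simp
      also have "norm (A + B) / 2 \<le> exp t * (K / x)" by (rule avg[OF nA nB norm_triangle_ineq])
      finally show ?thesis .
    qed
    hence 2: "norm (g t - (of_real (cosh t) * g 0 + of_real (sinh t) * f 0)) \<le> K / x * exp t" unfolding gt by (simp add: mult_ac)
    have z: "Complex x t = of_real x + of_real t * \<i>" by (simp add: complex_eq_iff)
    have "bw' nu (Complex x t) - (bw' nu (of_real x) * of_real (cosh t) - \<i> * bw nu (of_real x) * of_real (sinh t))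
       = (- \<i>) * (g t - (of_real (cosh t) * g 0 + of_real (sinh t) * f 0))"
      unfolding z f_def g_def by (simp add: algebra_simps)
    hence "norm (bw' nu (Complex x t) - (bw' nu (of_real x) * of_real (cosh t) - \<i> * bw nu (of_real x) * of_real (sinh t)))
       = norm (g t - (of_real (cosh t) * g 0 + of_real (sinh t) * f 0))" by (simp add: norm_mult)
    moreover have "bw nu (Complex x t) - (bw nu (of_real x) * of_real (cosh t) + \<i> * bw' nu (of_real x) * of_real (sinh t))
      = f t - (of_real (cosh t) * f 0 + of_real (sinh t) * g 0)"
      unfolding z f_def g_def by (simp add: algebra_simps)
    ultimately show ?thesis using 1 2 by simp
  qed
  have "norm (bw nu (Complex x t) - (bw nu (of_real x) * of_real (cosh t) + \<i> * bw' nu (of_real x) * of_real (sinh t))) \<le> K / x * exp t \<and>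
     norm (bw' nu (Complex x t) - (bw' nu (of_real x) * of_real (cosh t) - \<i> * bw nu (of_real x) * of_real (sinh t))) \<le> K / x * exp t"
    if x: "x \<ge> 1" and t: "t \<ge> 0" for x t
  proof (cases "t = 0")
    case True
    have "Complex x 0 = of_real x" by (simp add: complex_eq_iff)
    thus ?thesis using True K x by simp
  qed (use main[OF x] t in auto)
  thus ?thesis using K by blast
qed

section \<open>Lower bounds for w off the real axis\<close>

lemma norm_real_combination:
  assumes "u \<in> \<real>" "v \<in> \<real>"
  shows "(norm (u + \<i> * v))\<^sup>2 = (norm u)\<^sup>2 + (norm v)\<^sup>2"
  using assms by (auto elim!: Reals_cases simp: cmod_power2)

text \<open>At a real point w and w' are real, so the two terms of w cosh t + i w' sinh t are
  orthogonal and cannot cancel. If w carries half of the energy at x, the first term alone has size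
  exp t, and for large x the error C / x of \<open>bw_vertical\<close> is harmless.\<close>

lemma bw_lower_good:
  assumes nu: "nu > -1"
  shows "\<exists>c>0. \<exists>X\<ge>1. \<forall>x\<ge>X. (norm (bw nu (of_real x)))\<^sup>2 \<ge> bE nu (of_real x) / 2 \<longrightarrow>
           (\<forall>t\<ge>0. norm (bw nu (Complex x t)) \<ge> c * exp t)"
proof -
  obtain C where C: "C > 0" "\<And>x t. x \<ge> 1 \<Longrightarrow> t \<ge> 0 \<Longrightarrow>
     norm (bw nu (Complex x t) - (bw nu (of_real x) * of_real (cosh t) + \<i> * bw' nu (of_real x) * of_real (sinh t))) \<le> C / x * exp t"
    using bw_vertical[OF nu] by blast
  obtain c0 where c0: "c0 > 0" "\<And>x. x \<ge> 1 \<Longrightarrow> bE nu (of_real x) \<ge> c0"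
    using bE_lower[OF nu, of 1] by auto
  \<comment> \<open>The main term is at least sqrt (c0 / 2) exp t / 2 = 2 c exp t; X is chosen so
    that the error takes away at most half of it.\<close>
  define c where "c = sqrt (c0 / 2) / 4"
  have c: "c > 0" using c0 by (simp add: c_def)
  define X where "X = max 1 (C / c)"
  have "norm (bw nu (Complex x t)) \<ge> c * exp t" if x: "x \<ge> X" and t: "t \<ge> 0"
    and g: "(norm (bw nu (of_real x)))\<^sup>2 \<ge> bE nu (of_real x) / 2" for x t
  proof -
    have x1: "x \<ge> 1" "C / x \<le> c" using x c C(1) by (auto simp: X_def field_simps)
    define u where "u = bw nu (of_real x) * of_real (cosh t)"
    define v where "v = bw' nu (of_real x) * of_real (sinh t)"
    have re: "bw nu (of_real x) \<in> \<real>" "bw' nu (of_real x) \<in> \<real>" using bw_real[OF nu, of x] x1 by auto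
    have "u \<in> \<real>" "v \<in> \<real>" unfolding u_def v_def using re by (auto intro: Reals_mult)
    hence "(norm u)\<^sup>2 \<le> (norm (u + \<i> * v))\<^sup>2" by (subst norm_real_combination) auto
    hence 1: "norm u \<le> norm (u + \<i> * v)" by (rule power2_le_imp_le) auto
    have "norm (bw nu (of_real x)) \<ge> sqrt (c0 / 2)"
      using g c0(2)[OF x1(1)] by (intro real_le_lsqrt) (auto simp: field_simps)
    moreover have "cosh t \<ge> exp t / 2" by (simp add: cosh_field_def)
    ultimately have "sqrt (c0 / 2) * (exp t / 2) \<le> norm (bw nu (of_real x)) * cosh t"
      using c0 by (intro mult_mono) auto
    also have "... = norm u" by (simp add: u_def norm_mult)
    finally have 2: "2 * c * exp t \<le> norm u" by (simp add: c_def)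
    have "norm (bw nu (Complex x t) - (u + \<i> * v)) \<le> C / x * exp t"
      using C(2)[OF x1(1) t] by (simp add: u_def v_def mult.assoc)
    also have "... \<le> c * exp t" using x1 by (intro mult_right_mono) auto
    finally have 3: "norm (bw nu (Complex x t) - (u + \<i> * v)) \<le> c * exp t" .
    have "norm (u + \<i> * v) \<le> norm (bw nu (Complex x t)) + norm (bw nu (Complex x t) - (u + \<i> * v))"
      by (metis norm_minus_commute norm_triangle_sub)
    thus ?thesis using 1 2 3 by linarith
  qed
  thus ?thesis using c by (intro exI[of _ c] conjI exI[of _ X]) (auto simp: X_def)
qed

text \<open>Far above the axis it no longer matters how the energy is split between w and w' at the
  foot of the vertical line: the growing component dominates in any case. Lines close to the
  imaginary axis start near the singularity at 0, where \<open>bw_vertical\<close> says nothing;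
  they are reached horizontally, at a height where the potential is small.\<close>

lemma bw_lower_high:
  assumes nu: "nu > -1"
  shows "\<exists>c>0. \<exists>T\<ge>1. \<forall>z. Re z \<ge> 0 \<longrightarrow> Im z \<ge> T \<longrightarrow> norm (bw nu z) \<ge> c * exp (Im z)"
proof -
  obtain C where C: "C > 0" "\<And>x t. x \<ge> 1 \<Longrightarrow> t \<ge> 0 \<Longrightarrow>
     norm (bw nu (Complex x t) - (bw nu (of_real x) * of_real (cosh t) + \<i> * bw' nu (of_real x) * of_real (sinh t))) \<le> C / x * exp t \<and>
     norm (bw' nu (Complex x t) - (bw' nu (of_real x) * of_real (cosh t) - \<i> * bw nu (of_real x) * of_real (sinh t))) \<le> C / x * exp t"
    using bw_vertical[OF nu] by blast
  obtain K where K: "K > 0" "\<And>z. Re z \<ge> 0 \<Longrightarrow> norm z \<ge> 1 \<Longrightarrow> norm (bw nu z) \<le> K * exp \<bar>Im z\<bar>"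
    using bw_upper[OF nu] by blast
  obtain c0 where c0: "c0 > 0" "\<And>x. x \<ge> 1 \<Longrightarrow> bE nu (of_real x) \<ge> c0"
    using bE_lower[OF nu, of 1] by auto
  define m where "m = \<bar>nu\<^sup>2 - 1/4\<bar>"
  have m: "m \<ge> 0" by (simp add: m_def)
  \<comment> \<open>One sixteenth leaves room: of the amplitude S >= 16 c at most S / 4 is lost to
    the decaying component and at most 6 c to the errors.\<close>
  define c where "c = sqrt c0 / 16"
  have c: "c > 0" using c0 by (simp add: c_def)
  define X where "X = max 1 (C / c)"
  have X: "X \<ge> 1" by (simp add: X_def)
  have small: "C / x \<le> c" if "x \<ge> X" for x using that c C(1) by (auto simp: X_def field_simps)
  have Er: "sqrt c0 \<le> norm (bw' nu (of_real x) - \<i> * bw nu (of_real x))"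
    "norm (bw' nu (of_real x) + \<i> * bw nu (of_real x)) = norm (bw' nu (of_real x) - \<i> * bw nu (of_real x))"
    "norm (bw' nu (of_real x) + \<i> * bw nu (of_real x)) = sqrt (bE nu (of_real x))"
    if x: "x \<ge> 1" for x
  proof -
    have re: "bw nu (of_real x) \<in> \<real>" "bw' nu (of_real x) \<in> \<real>" using bw_real[OF nu, of x] x by auto
    have 1: "(norm (bw' nu (of_real x) - \<i> * bw nu (of_real x)))\<^sup>2 = bE nu (of_real x)"
      using norm_real_combination[of "bw' nu (of_real x)" "- bw nu (of_real x)"] re by (simp add: bE_def)
    have 2: "(norm (bw' nu (of_real x) + \<i> * bw nu (of_real x)))\<^sup>2 = bE nu (of_real x)"
      using norm_real_combination[of "bw' nu (of_real x)" "bw nu (of_real x)"] re by (simp add: bE_def)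
    show "sqrt c0 \<le> norm (bw' nu (of_real x) - \<i> * bw nu (of_real x))"
      using 1 c0(2)[OF x] by (intro real_le_lsqrt) (auto)
    show "norm (bw' nu (of_real x) + \<i> * bw nu (of_real x)) = norm (bw' nu (of_real x) - \<i> * bw nu (of_real x))"
      using 1 2 by (metis norm_ge_zero power2_eq_imp_eq)
    show "norm (bw' nu (of_real x) + \<i> * bw nu (of_real x)) = sqrt (bE nu (of_real x))"
      using 2 by (metis norm_ge_zero real_sqrt_unique)
  qed
  \<comment> \<open>On the line \<open>Re z = x\<close> the component \<open>w' - iw\<close> carries the growth, while \<open>w' + iw\<close> is only an error term.\<close>
  have split: "norm (bw' nu (Complex x t) - \<i> * bw nu (Complex x t)) \<ge> exp t * (sqrt (bE nu (of_real x)) - 2 * c)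
      \<and> norm (bw' nu (Complex x t) + \<i> * bw nu (Complex x t)) \<le> exp (-t) * sqrt (bE nu (of_real x)) + 2 * c * exp t"
    if x: "x \<ge> X" and t: "t \<ge> 0" for x t
  proof -
    have x1: "x \<ge> 1" using x X by linarith
    define w where "w = bw nu (of_real x)"
    define w' where "w' = bw' nu (of_real x)"
    define A where "A = bw nu (Complex x t) - (w * of_real (cosh t) + \<i> * w' * of_real (sinh t))"
    define B where "B = bw' nu (Complex x t) - (w' * of_real (cosh t) - \<i> * w * of_real (sinh t))"
    have "norm A \<le> C / x * exp t" "norm B \<le> C / x * exp t" using C(2)[OF x1 t] by (auto simp: A_def B_def w_def w'_def)
    moreover have "C / x * exp t \<le> c * exp t" using small[OF x] by (intro mult_right_mono) auto
    ultimately have AB: "norm A \<le> c * exp t" "norm B \<le> c * exp t" by auto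
    have e1: "bw' nu (Complex x t) - \<i> * bw nu (Complex x t) = of_real (exp t) * (w' - \<i> * w) + (B - \<i> * A)"
      by (simp add: A_def B_def cosh_def sinh_def scaleR_conv_of_real field_simps)
    have e2: "bw' nu (Complex x t) + \<i> * bw nu (Complex x t) = of_real (exp (-t)) * (w' + \<i> * w) + (B + \<i> * A)"
      by (simp add: A_def B_def cosh_def sinh_def scaleR_conv_of_real field_simps)
    have nI: "norm (\<i> * A) = norm A" by (simp add: norm_mult)
    have n: "norm (B - \<i> * A) \<le> 2 * c * exp t" "norm (B + \<i> * A) \<le> 2 * c * exp t"
      using AB norm_triangle_ineq4[of B "\<i> * A"] norm_triangle_ineq[of B "\<i> * A"] nI by linarith+
    have s: "norm (w' - \<i> * w) = sqrt (bE nu (of_real x))" "norm (w' + \<i> * w) = sqrt (bE nu (of_real x))"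
      using Er[OF x1] by (auto simp: w_def w'_def)
    have "norm (of_real (exp t) * (w' - \<i> * w)) \<le> norm (of_real (exp t) * (w' - \<i> * w) + (B - \<i> * A)) + norm (B - \<i> * A)"
      by (metis add_diff_cancel_right' norm_triangle_ineq4)
    hence "exp t * sqrt (bE nu (of_real x)) \<le> norm (bw' nu (Complex x t) - \<i> * bw nu (Complex x t)) + 2 * c * exp t"
      using n e1 s by (simp add: norm_mult)
    moreover have "norm (bw' nu (Complex x t) + \<i> * bw nu (Complex x t)) \<le> exp (-t) * sqrt (bE nu (of_real x)) + 2 * c * exp t"
    proof -
      have "norm (of_real (exp (-t)) * (w' + \<i> * w)) = exp (-t) * sqrt (bE nu (of_real x))" using s by (simp add: norm_mult)
      thus ?thesis unfolding e2 using norm_triangle_ineq[of "of_real (exp (-t)) * (w' + \<i> * w)" "B + \<i> * A"] n(2) by linarith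
    qed
    ultimately show ?thesis by (auto simp: algebra_simps)
  qed
  \<comment> \<open>Hence \<open>2\<bar>w\<bar> \<ge> \<bar>w' - iw\<bar> - \<bar>w' + iw\<bar>\<close> is large; moving left from \<open>Re z = X\<close> costs only \<open>O(1/T\<^sup>2)\<close>.\<close>
  define T where "T = max 2 (X * m * K / c)"
  have T: "T \<ge> 2" "X * m * K \<le> c * T"
  proof -
    have "X * m * K / c \<le> T" by (simp add: T_def)
    thus "X * m * K \<le> c * T" using c by (simp add: field_simps)
  qed (simp add: T_def)
  have e4: "exp (-t) \<le> exp t / 4" if "t \<ge> 2" for t :: real
  proof -
    have "4 \<le> (1 + 1) * (1 + (1::real))" by simp
    also have "... \<le> exp 1 * exp 1" by (intro mult_mono exp_ge_add_one_self) auto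
    also have "... = exp (2::real)" by (simp flip: exp_add)
    also have "... \<le> exp (t + t)" using that by simp
    also have "... = exp t * exp t" by (rule exp_add)
    finally show ?thesis by (simp add: exp_minus field_simps)
  qed
  have far: "norm (bw nu z) \<ge> c * exp (Im z)" if z: "Re z \<ge> X" "Im z \<ge> T" for z
  proof -
    define x t where "x = Re z" "t = Im z"
    have zz: "z = Complex x t" by (simp add: x_t_def)
    have x: "x \<ge> X" "x \<ge> 1" "t \<ge> 2" using z T X by (auto simp: x_t_def)
    define S where "S = sqrt (bE nu (of_real x))"
    have S: "S \<ge> 16 * c" using c0(2)[OF x(2)] by (simp add: S_def c_def)
    have "2 * norm (bw nu z) = norm ((bw' nu z - \<i> * bw nu z) - (bw' nu z + \<i> * bw nu z))"
      by (simp add: norm_mult)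
    also have "... \<ge> norm (bw' nu z - \<i> * bw nu z) - norm (bw' nu z + \<i> * bw nu z)"
      by (rule norm_triangle_ineq2)
    finally have "2 * norm (bw nu z) \<ge> exp t * (S - 2 * c) - (exp (-t) * S + 2 * c * exp t)"
      using split[OF x(1), of t] x(3) unfolding S_def zz by linarith
    moreover have "exp (-t) * S \<le> exp t / 4 * S" using e4[OF x(3)] S c by (intro mult_right_mono) auto
    moreover have "exp t * (16 * c) \<le> exp t * S" using S by simp
    moreover have "exp t * c > 0" using c by simp
    moreover have "exp t * (S - 2 * c) - (exp (-t) * S + 2 * c * exp t) = exp t * S - exp (-t) * S - 4 * (exp t * c)"
      "exp t * (16 * c) = 16 * (exp t * c)" "exp t / 4 * S = (exp t * S) / 4" by (auto simp: algebra_simps)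
    ultimately have "2 * norm (bw nu z) \<ge> 2 * (exp t * c)" by linarith
    thus ?thesis by (simp add: x_t_def mult_ac)
  qed
  have near: "norm (bw nu z) \<ge> c * exp (Im z)" if z: "Re z \<ge> 0" "Re z < X" "Im z \<ge> T" for z
  proof -
    define t where "t = Im z"
    have t: "t \<ge> 2" "t \<ge> T" using z T by (auto simp: t_def)
    define p where "p = \<i> * of_real t"
    have zz: "z = p + of_real (Re z)" "Complex X t = p + of_real X" by (auto simp: p_def t_def complex_eq_iff)
    have dom: "p + of_real s * 1 \<notin> \<real>\<^sub>\<le>\<^sub>0" for s using t by (intro not_nonpos_Reals_Im) (simp add: p_def)
    define q where "q s = (of_real (nu\<^sup>2 - 1/4) / (p + of_real s)\<^sup>2 :: complex)" for s
    define f where "f s = bw nu (p + of_real s)" for s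
    define g where "g s = bw' nu (p + of_real s)" for s
    have df: "(f has_vector_derivative g s) (at s)" for s
      using bw_line_deriv(1)[OF nu dom] by (simp add: f_def[abs_def] g_def)
    have dg: "(g has_vector_derivative q s * f s - f s) (at s)" for s
      using bw_line_deriv(2)[OF nu dom] by (simp add: f_def g_def[abs_def] q_def algebra_simps)
    \<comment> \<open>At height t >= T the potential is at most m / T and |w| <= K exp t. As T
      satisfies X m K <= c T, the integral over [0, X] is at most c exp t.\<close>
    have bnd: "norm (q s * f s) \<le> c * exp t / X" if s: "s \<ge> 0" for s
    proof -
      have n2: "(norm (p + of_real s))\<^sup>2 = s\<^sup>2 + t\<^sup>2" by (simp add: p_def cmod_power2)
      hence n3: "t\<^sup>2 \<le> (norm (p + of_real s))\<^sup>2" by simp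
      hence n4: "t \<le> norm (p + of_real s)" by (rule power2_le_imp_le) simp
      have "norm (f s) \<le> K * exp \<bar>Im (p + of_real s)\<bar>" unfolding f_def using s n4 t
        by (intro K(2)) (auto simp: p_def)
      also have "\<bar>Im (p + of_real s)\<bar> = t" using t by (simp add: p_def)
      finally have f: "norm (f s) \<le> K * exp t" .
      have "norm (q s) = m / (norm (p + of_real s))\<^sup>2" unfolding q_def norm_divide norm_power norm_of_real m_def by simp
      also have "... \<le> m / t\<^sup>2" using n3 m t by (intro divide_left_mono) (auto intro!: mult_pos_pos)
      also have "... \<le> m / T" 
      proof -
        have "T * 1 \<le> t * t" using t T by (intro mult_mono) auto
        thus ?thesis using m T by (intro divide_left_mono) (auto simp: power2_eq_square intro!: mult_pos_pos)
      qed
      finally have "norm (q s) \<le> m / T" .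
      hence "norm (q s * f s) \<le> m / T * (K * exp t)" unfolding norm_mult using f m T by (intro mult_mono) auto
      also have "... = (X * m * K / T) * exp t / X" using X by simp
      also have "... \<le> c * exp t / X" using T X c by (intro divide_right_mono mult_right_mono) (auto simp: field_simps)
      finally show ?thesis .
    qed
    \<comment> \<open>For horizontal motion the free modes are exp (i s) and exp (- i s). Hence w' +
      \<sigma> w, with \<sigma> = i or - i, changes its modulus only through the potential.\<close>
    have dev: "norm (g x + \<sigma> * f x) \<le> norm (g X + \<sigma> * f X) + c * exp t \<and> norm (g X + \<sigma> * f X) \<le> norm (g x + \<sigma> * f x) + c * exp t"
      if \<sigma>: "\<sigma>\<^sup>2 = - 1" "norm \<sigma> = 1" "Re \<sigma> = 0" and x: "0 \<le> x" "x < X" for \<sigma> x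
    proof -
      define h where "h s = exp (- \<sigma> * of_real s) * (g s + \<sigma> * f s)" for s
      have dh: "(h has_vector_derivative exp (- \<sigma> * of_real s) * (q s * f s)) (at s)" for s
      proof -
        have "((\<lambda>s. exp (- \<sigma> * of_real s)) has_vector_derivative - \<sigma> * exp (- \<sigma> * of_real s)) (at s)"
          by (rule has_vector_derivative_eq_rhs[OF field_vector_diff_chain_at[of "\<lambda>s. - \<sigma> * of_real s" "- \<sigma>" _ exp "exp (- \<sigma> * of_real s)", unfolded o_def]])
             (auto intro!: derivative_eq_intros)
        hence "(h has_vector_derivative exp (- \<sigma> * of_real s) * ((q s * f s - f s) + \<sigma> * g s) + (- \<sigma> * exp (- \<sigma> * of_real s)) * (g s + \<sigma> * f s)) (at s)"
          unfolding h_def by (intro has_vector_derivative_mult has_vector_derivative_add has_vector_derivative_mult_right df dg)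
        moreover have "exp (- \<sigma> * of_real s) * ((q s * f s - f s) + \<sigma> * g s) + (- \<sigma> * exp (- \<sigma> * of_real s)) * (g s + \<sigma> * f s)
           = exp (- \<sigma> * of_real s) * (q s * f s - f s - \<sigma>\<^sup>2 * f s)" by (simp add: algebra_simps power2_eq_square)
        ultimately show ?thesis using \<sigma> by simp
      qed
      have "norm (h X - h x) \<le> c * exp t / X * X - c * exp t / X * x"
      proof (rule differentiable_bound_general[OF x(2) _ _ dh])
        show "continuous_on {x..X} h" using dh by (meson continuous_at_imp_continuous_on has_vector_derivative_continuous)
        show "((\<lambda>s. c * exp t / X * s) has_vector_derivative c * exp t / X) (at s)" for s
          unfolding has_real_derivative_iff_has_vector_derivative[symmetric] by (auto intro!: derivative_eq_intros)
        fix s assume "x < s" "s < X"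
        thus "norm (exp (- \<sigma> * of_real s) * (q s * f s)) \<le> c * exp t / X"
          using bnd[of s] x \<sigma> by (simp add: norm_mult)
      qed (intro continuous_intros)
      also have "... \<le> c * exp t" using X c x by (simp)
      finally have d: "norm (h X - h x) \<le> c * exp t" .
      have "norm (h s) = norm (g s + \<sigma> * f s)" for s using \<sigma> by (simp add: h_def norm_mult)
      thus ?thesis using d norm_triangle_ineq2[of "h X" "h x"] norm_triangle_ineq3[of "h X" "h x"] by auto
    qed
    define x where "x = Re z"
    have x: "0 \<le> x" "x < X" using z by (auto simp: x_def)
    define S where "S = sqrt (bE nu (of_real X))"
    have S: "S \<ge> 16 * c" using c0(2)[OF X] by (simp add: S_def c_def)
    have gX: "g X = bw' nu (Complex X t)" "f X = bw nu (Complex X t)" using zz by (auto simp: f_def g_def)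
    have "norm (g x + (- \<i>) * f x) \<ge> exp t * (S - 2 * c) - c * exp t"
      using dev[of "- \<i>" x] x split[of X t] t by (auto simp: gX S_def)
    moreover have "norm (g x + \<i> * f x) \<le> exp (-t) * S + 2 * c * exp t + c * exp t"
      using dev[of "\<i>" x] x split[of X t] t by (auto simp: gX S_def)
    moreover have "2 * norm (f x) \<ge> norm (g x + (- \<i>) * f x) - norm (g x + \<i> * f x)"
      using norm_triangle_ineq2[of "g x + (- \<i>) * f x" "g x + \<i> * f x"] by (simp add: norm_mult)
    moreover have "exp (-t) * S \<le> exp t / 4 * S" using e4[OF t(1)] S c by (intro mult_right_mono) auto
    moreover have "exp t * (16 * c) \<le> exp t * S" using S by simp
    moreover have "exp t * c > 0" using c by simp
    moreover have "exp t * (S - 2 * c) - c * exp t = exp t * S - 3 * (exp t * c)"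
      "exp (-t) * S + 2 * c * exp t + c * exp t = exp (-t) * S + 3 * (exp t * c)"
      "exp t * (16 * c) = 16 * (exp t * c)" "exp t / 4 * S = (exp t * S) / 4" by (auto simp: algebra_simps)
    ultimately have "2 * norm (f x) \<ge> 2 * (exp t * c)" by linarith
    moreover have "f x = bw nu z" using zz by (simp add: f_def x_def)
    ultimately show ?thesis by (simp add: t_def mult_ac)
  qed
  have "norm (bw nu z) \<ge> c * exp (Im z)" if "Re z \<ge> 0" "Im z \<ge> T" for z
    using far[of z] near[of z] that by (cases "Re z \<ge> X") auto
  thus ?thesis using c T by (intro exI[of _ c] conjI exI[of _ T]) auto
qed

lemma norm_bw: "norm (bw nu z) = norm z powr (nu + 1/2) * norm (bphi nu z)"
  unfolding bw_def norm_mult by (subst norm_powr_real_powr') auto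

lemma bphi_continuous_on:
  assumes "nu > -1" shows "continuous_on S (bphi nu :: 'a::{real_normed_field,banach} \<Rightarrow> 'a)"
  using bphi_deriv[OF assms] DERIV_isCont by (blast intro: continuous_at_imp_continuous_on)

lemma powr_add_one_le:
  fixes r a :: real
  assumes "r \<ge> 1"
  shows "r powr a \<le> 2 powr \<bar>a\<bar> * (1 + r) powr a"
proof (cases "a \<ge> 0")
  case True
  have "1 * r powr a \<le> 2 powr \<bar>a\<bar> * (1 + r) powr a"
    using assms True by (intro mult_mono powr_mono2 ge_one_powr_ge_zero) auto
  thus ?thesis by simp
next
  case False
  have "(2 * r) powr a \<le> (1 + r) powr a" using assms False by (intro powr_mono2') auto
  hence "2 powr (-a) * (2 powr a * r powr a) \<le> 2 powr (-a) * (1 + r) powr a"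
    using assms by (intro mult_left_mono) (auto simp: powr_mult)
  moreover have "2 powr (-a) * (2 powr a * r powr a) = r powr a"
    by (simp add: powr_minus)
  ultimately show ?thesis using False by simp
qed

text \<open>For |z| >= 1 in the right half plane this is \<open>bw_upper\<close> with the power
  divided out, for |z| <= 1 it is compactness, and evenness gives the left half plane. Writing 1 +
  |z| for |z| lets one formula cover the origin, whatever the sign of nu + 1/2.\<close>

lemma bphi_upper:
  assumes nu: "nu > -1"
  shows "\<exists>C>0. \<forall>z. norm (bphi nu z) \<le> C * (1 + norm z) powr (- (nu + 1/2)) * exp \<bar>Im z\<bar>"
proof -
  define a where "a = nu + 1/2"
  obtain C where C: "C > 0" "\<And>z. Re z \<ge> 0 \<Longrightarrow> norm z \<ge> 1 \<Longrightarrow> norm (bw nu z) \<le> C * exp \<bar>Im z\<bar>"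
    using bw_upper[OF nu] by blast
  have "bounded (bphi nu ` cball (0::complex) 1)"
    by (intro compact_imp_bounded compact_continuous_image bphi_continuous_on nu) auto
  then obtain C1 where C1: "C1 > 0" "\<And>z. norm z \<le> 1 \<Longrightarrow> norm (bphi nu (z::complex)) \<le> C1"
    unfolding bounded_pos by auto
  define K where "K = max C C1 * 2 powr \<bar>a\<bar>"
  have K: "K > 0" using C by (simp add: K_def)
  have main: "norm (bphi nu z) \<le> K * (1 + norm z) powr (- a) * exp \<bar>Im z\<bar>" if z: "Re z \<ge> 0" for z
  proof (cases "norm z \<ge> 1")
    case True
    have "norm z powr a * norm (bphi nu z) \<le> C * exp \<bar>Im z\<bar>" using C(2)[OF z True] norm_bw[of nu z] by (simp add: a_def)
    hence "norm z powr (-a) * (norm z powr a * norm (bphi nu z)) \<le> norm z powr (-a) * (C * exp \<bar>Im z\<bar>)"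
      by (rule mult_left_mono) simp
    moreover have "norm z powr (-a) * (norm z powr a * norm (bphi nu z)) = norm (bphi nu z)"
    proof -
      have "norm z powr (-a) * norm z powr a = 1" unfolding powr_add[symmetric] using True by auto
      thus ?thesis by (simp only: mult.assoc[symmetric])
    qed
    ultimately have "norm (bphi nu z) \<le> norm z powr (-a) * (C * exp \<bar>Im z\<bar>)" by simp
    also have "... \<le> (2 powr \<bar>-a\<bar> * (1 + norm z) powr (-a)) * (max C C1 * exp \<bar>Im z\<bar>)"
      using C by (intro mult_mono powr_add_one_le True) auto
    finally show ?thesis by (simp add: K_def mult_ac)
  next
    case False
    have "norm (bphi nu z) \<le> C1" using C1(2)[of z] False by simp
    also have "... \<le> max C C1 * (2 powr \<bar>a\<bar> * (1 + norm z) powr (- a)) * exp \<bar>Im z\<bar>"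
    proof -
      have "1 \<le> 2 powr \<bar>a\<bar> * (1 + norm z) powr (- a)"
      proof (cases "a \<ge> 0")
        case True
        have "2 powr (-a) \<le> (1 + norm z) powr (-a)" using True False by (intro powr_mono2') (auto intro: add_pos_nonneg)
        hence "2 powr a * 2 powr (-a) \<le> 2 powr a * (1 + norm z) powr (-a)" by (intro mult_left_mono) auto
        thus ?thesis using True by (simp add: powr_minus)
      next
        case F: False
        have "1 * 1 \<le> 2 powr \<bar>a\<bar> * (1 + norm z) powr (- a)" using F by (intro mult_mono ge_one_powr_ge_zero) auto
        thus ?thesis by simp
      qed
      hence "C1 * 1 * 1 \<le> max C C1 * (2 powr \<bar>a\<bar> * (1 + norm z) powr (- a)) * exp \<bar>Im z\<bar>"
        using C1 by (intro mult_mono) auto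
      thus ?thesis by simp
    qed
    finally show ?thesis by (simp add: K_def mult_ac)
  qed
  have "norm (bphi nu z) \<le> K * (1 + norm z) powr (- a) * exp \<bar>Im z\<bar>" for z
    using main[of z] main[of "-z"] by (cases "Re z \<ge> 0") auto
  thus ?thesis using K unfolding a_def by blast
qed

section \<open>Zeros\<close>

definition wr :: "real \<Rightarrow> real \<Rightarrow> real" where "wr nu x = Re (bw nu (of_real x))"
definition wr' :: "real \<Rightarrow> real \<Rightarrow> real" where "wr' nu x = Re (bw' nu (of_real x))"

lemma wr_facts:
  assumes nu: "nu > -1" and x: "x > 0"
  shows "wr nu x = x powr (nu + 1/2) * bphi nu x"
    and "bw nu (of_real x) = of_real (wr nu x)"
    and "(wr nu has_real_derivative wr' nu x) (at x)"
    and "(wr' nu has_real_derivative ((nu\<^sup>2 - 1/4) / x\<^sup>2 - 1) * wr nu x) (at x)"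
    and "bE nu (of_real x) = (wr nu x)\<^sup>2 + (wr' nu x)\<^sup>2"
    and "wr nu x = 0 \<longleftrightarrow> bphi nu x = 0"
    and "wr' nu x = x powr (nu + 1/2) * ((nu + 1/2) / x * bphi nu x - x * bphi (nu+1) x)"
proof -
  show 1: "wr nu x = x powr (nu + 1/2) * bphi nu x" by (simp add: wr_def bw_real[OF assms] del: of_real_mult)
  show 2: "bw nu (of_real x) = of_real (wr nu x)" by (simp add: wr_def bw_real[OF assms] del: of_real_mult)
  have n1: "nu + 1 > -1" using nu by simp
  have e: "bw' nu (of_real x) = of_real (x powr (nu + 1/2) * ((nu + 1/2) / x * bphi nu x - x * bphi (nu+1) x))"
    unfolding bw'_def using x by (simp add: bphi_of_real[OF nu] bphi_of_real[OF n1] powr_of_real del: of_real_add)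
  show "wr' nu x = x powr (nu + 1/2) * ((nu + 1/2) / x * bphi nu x - x * bphi (nu+1) x)"
    unfolding wr'_def e by simp
  have 3: "bw' nu (of_real x) = of_real (wr' nu x)" unfolding wr'_def e by simp
  have dom: "0 + of_real x * 1 \<notin> \<real>\<^sub>\<le>\<^sub>0" using x by simp
  have "((\<lambda>s. Re (bw nu (of_real s))) has_vector_derivative Re (bw' nu (of_real x))) (at x)"
    using bounded_linear.has_vector_derivative[OF bounded_linear_Re, OF bw_line_deriv(1)[OF nu dom]] by simp
  thus "(wr nu has_real_derivative wr' nu x) (at x)"
    by (simp add: wr_def[abs_def] wr'_def has_real_derivative_iff_has_vector_derivative)
  have "((\<lambda>s. Re (bw' nu (of_real s))) has_vector_derivative
       Re ((of_real (nu\<^sup>2 - 1/4) / (of_real x)\<^sup>2 - 1) * bw nu (of_real x))) (at x)"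
    using bounded_linear.has_vector_derivative[OF bounded_linear_Re, OF bw_line_deriv(2)[OF nu dom]] by simp
  moreover have "(of_real (nu\<^sup>2 - 1/4) / (of_real x)\<^sup>2 - 1) * bw nu (of_real x) = of_real (((nu\<^sup>2 - 1/4) / x\<^sup>2 - 1) * wr nu x)"
    unfolding 2 by simp
  ultimately show "(wr' nu has_real_derivative ((nu\<^sup>2 - 1/4) / x\<^sup>2 - 1) * wr nu x) (at x)"
    by (simp only: wr'_def[abs_def] has_real_derivative_iff_has_vector_derivative Re_complex_of_real)
  show "bE nu (of_real x) = (wr nu x)\<^sup>2 + (wr' nu x)\<^sup>2" unfolding bE_def 2 3 by simp
  show "wr nu x = 0 \<longleftrightarrow> bphi nu x = 0" unfolding 1 using x by simp
qed

lemma wr_bounds: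
  assumes nu: "nu > -1" and x0: "x0 > 0"
  shows "\<exists>c C. 0 < c \<and> c \<le> C \<and> (\<forall>x\<ge>x0. c \<le> (wr nu x)\<^sup>2 + (wr' nu x)\<^sup>2 \<and> (wr nu x)\<^sup>2 + (wr' nu x)\<^sup>2 \<le> C)"
proof -
  obtain c where c: "c > 0" "\<And>x. x \<ge> x0 \<Longrightarrow> bE nu (of_real x) \<ge> c" using bE_lower[OF nu x0] by blast
  obtain C where C: "C > 0" "\<And>z. Re z \<ge> 0 \<Longrightarrow> norm z \<ge> 1 \<Longrightarrow> bE nu z \<le> C * exp (2 * \<bar>Im z\<bar>)"
    using bE_upper[OF nu] by blast
  have cS: "compact (of_real ` {x0..1} :: complex set)" by (intro compact_continuous_image continuous_intros) auto
  have dS: "of_real ` {x0..1} \<inter> \<real>\<^sub>\<le>\<^sub>0 = ({} :: complex set)" using x0 by auto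
  have "bounded (bE nu ` (of_real ` {x0..1} :: complex set))"
    by (rule compact_imp_bounded[OF compact_continuous_image[OF bw_continuous(3)[OF nu dS] cS]])
  then obtain C1 where "\<forall>y\<in>bE nu ` (of_real ` {x0..1} :: complex set). norm y \<le> C1"
    unfolding bounded_iff by blast
  hence C1: "norm (bE nu (of_real x)) \<le> C1" if "x \<in> {x0..1}" for x using that by blast
  have "bE nu (of_real x) \<le> max C C1" if "x \<ge> x0" for x
    using C1[of x] C(2)[of "of_real x"] that x0 by (cases "x \<le> 1") auto
  moreover have "c \<le> max C C1" using c(2)[of x0] calculation[of x0] by simp
  moreover have "bE nu (of_real x) = (wr nu x)\<^sup>2 + (wr' nu x)\<^sup>2" if "x \<ge> x0" for x
    using wr_facts(5)[OF nu, of x] that x0 by simp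
  ultimately show ?thesis using c by (intro exI[of _ c] exI[of _ "max C C1"]) auto
qed

text \<open>If w held less than half of the energy on a whole interval of length L, then |w'| would
  exceed sqrt (c/2) throughout it, and by the mean value theorem w would change by more than 2 sqrt
  C, although |w| <= sqrt C.\<close>

lemma good_points:
  assumes nu: "nu > -1"
  shows "\<exists>L>0. \<forall>x\<ge>1. \<exists>y\<in>{x..x+L}. (wr nu y)\<^sup>2 \<ge> bE nu (of_real y) / 2"
proof -
  obtain c C where cC: "0 < c" "c \<le> C"
    "\<And>x. x \<ge> 1 \<Longrightarrow> c \<le> (wr nu x)\<^sup>2 + (wr' nu x)\<^sup>2" "\<And>x. x \<ge> 1 \<Longrightarrow> (wr nu x)\<^sup>2 + (wr' nu x)\<^sup>2 \<le> C"
    using wr_bounds[OF nu, of 1] by auto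
  define L where "L = 2 * sqrt C / sqrt (c/2) + 1"
  have L: "L > 0" "L * sqrt (c/2) > 2 * sqrt C" using cC by (auto simp: L_def field_simps add_nonneg_pos)
  have "\<exists>y\<in>{x..x+L}. (wr nu y)\<^sup>2 \<ge> bE nu (of_real y) / 2" if x: "x \<ge> 1" for x
  proof (rule ccontr)
    assume "\<not> ?thesis"
    hence bad: "(wr nu y)\<^sup>2 < bE nu (of_real y) / 2" if "y \<in> {x..x+L}" for y using that by (force simp: not_le)
    have big: "(wr' nu y)\<^sup>2 > c / 2" if "y \<in> {x..x+L}" for y
    proof -
      have "bE nu (of_real y) = (wr nu y)\<^sup>2 + (wr' nu y)\<^sup>2" using wr_facts(5)[OF nu, of y] that x by auto
      thus ?thesis using bad[OF that] cC(3)[of y] that x by auto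
    qed
    have "\<exists>z. x < z \<and> z < x + L \<and> wr nu (x+L) - wr nu x = (x + L - x) * wr' nu z"
      using L x by (intro MVT2 wr_facts[OF nu]) auto
    then obtain z where z: "x < z" "z < x + L" "wr nu (x+L) - wr nu x = L * wr' nu z" by auto
    have wb: "\<bar>wr nu y\<bar> \<le> sqrt C" if "y \<ge> 1" for y
    proof -
      have "(wr nu y)\<^sup>2 \<le> C" using cC(4)[OF that] zero_le_power2[of "wr' nu y"] by linarith
      thus ?thesis using real_le_rsqrt real_sqrt_abs real_sqrt_le_mono by metis
    qed
    have "sqrt (c/2) < \<bar>wr' nu z\<bar>" using big[of z] z(1,2) by (metis atLeastAtMost_iff less_imp_le real_sqrt_abs real_sqrt_less_mono)
    hence "L * sqrt (c/2) < L * \<bar>wr' nu z\<bar>" using L by simp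
    also have "... = \<bar>wr nu (x+L) - wr nu x\<bar>" using z(3) L by (simp add: abs_mult)
    also have "... \<le> 2 * sqrt C" using wb[of x] wb[of "x+L"] x L by linarith
    finally show False using L(2) by simp
  qed
  thus ?thesis using L(1) by blast
qed

text \<open>A Sturm-type argument. If w had constant sign beyond Y, then u = |w| would satisfy u''
  <= - u / 2 there. A positive concave function on a half line is nondecreasing, so u'' would stay
  below a negative constant and u' would become negative. That there are infinitely many zeros is
  what makes \<open>besselzero\<close> meaningful for every index.\<close>

lemma wr_zeros_unbounded:
  assumes nu: "nu > -1"
  shows "\<exists>t>X. bphi nu (t::real) = 0"
proof (rule ccontr)
  assume "\<not> ?thesis"
  hence nz: "bphi nu t \<noteq> 0" if "t > X" for t using that by auto
  define m where "m = \<bar>nu\<^sup>2 - 1/4\<bar>"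
  \<comment> \<open>For t >= Y the potential is at most 1/2: this uses both t >= 2 m and t >= 1, and
    leaves u'' <= - u / 2.\<close>
  define Y where "Y = max 1 (max (X + 1) (2 * m))"
  have Y: "Y \<ge> 1" "Y > X" "Y \<ge> 2 * m" by (auto simp: Y_def)
  have "\<exists>\<sigma>. (\<sigma> = 1 \<or> \<sigma> = -1) \<and> (\<forall>t\<ge>Y. \<sigma> * wr nu t > 0)"
  proof -
    have nzw: "wr nu t \<noteq> 0" if "t \<ge> Y" for t using nz[of t] wr_facts(6)[OF nu, of t] that Y by auto
    have cont: "continuous_on {Y..} (wr nu)"
      by (intro continuous_at_imp_continuous_on ballI DERIV_isCont[OF wr_facts(3)[OF nu]]) (use Y in auto)
    have "wr nu t * wr nu Y > 0" if t: "t \<ge> Y" for t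
    proof (rule ccontr)
      assume "\<not> ?thesis"
      hence n: "wr nu t * wr nu Y < 0" using nzw[OF t] nzw[of Y] by (simp add: not_less le_less)
      have c: "continuous_on {Y..t} (wr nu)" using cont by (rule continuous_on_subset) auto
      have "\<exists>s. Y \<le> s \<and> s \<le> t \<and> wr nu s = 0"
        using n IVT'[of "wr nu" Y 0 t] IVT2'[of "wr nu" t 0 Y] t c by (auto simp: mult_less_0_iff)
      thus False using nzw by auto
    qed
    thus ?thesis using nzw[of Y] by (cases "wr nu Y > 0") (force simp: zero_less_mult_iff)+
  qed
  then obtain \<sigma> where \<sigma>: "\<sigma> = 1 \<or> \<sigma> = -1" "\<And>t. t \<ge> Y \<Longrightarrow> \<sigma> * wr nu t > 0" by blast
  define u where "u t = \<sigma> * wr nu t" for t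
  define v where "v t = \<sigma> * wr' nu t" for t
  have upos: "u t > 0" if "t \<ge> Y" for t using \<sigma>(2)[OF that] by (simp add: u_def)
  have du: "(u has_real_derivative v t) (at t)" if "t \<ge> Y" for t
    unfolding u_def[abs_def] v_def using wr_facts(3)[OF nu, of t] that Y by (intro DERIV_cmult) auto
  have dv: "\<exists>d. (v has_real_derivative d) (at t) \<and> d \<le> - u t / 2" if "t \<ge> Y" for t
  proof (intro exI conjI)
    show "(v has_real_derivative \<sigma> * (((nu\<^sup>2 - 1/4) / t\<^sup>2 - 1) * wr nu t)) (at t)"
      unfolding v_def[abs_def] using wr_facts(4)[OF nu, of t] that Y by (intro DERIV_cmult) auto
    have "(nu\<^sup>2 - 1/4) * 2 \<le> m * 2" unfolding m_def by (intro mult_right_mono abs_ge_self) simp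
    also have "m * 2 \<le> t * 1" using that Y by simp
    also have "... \<le> t * t" using that Y by (intro mult_left_mono) auto
    finally have "(nu\<^sup>2 - 1/4) * 2 \<le> t\<^sup>2" by (simp add: power2_eq_square)
    hence "(nu\<^sup>2 - 1/4) / t\<^sup>2 \<le> 1/2" using that Y by (simp add: field_simps)
    hence "(nu\<^sup>2 - 1/4) / t\<^sup>2 - 1 \<le> - 1/2" by linarith
    hence "((nu\<^sup>2 - 1/4) / t\<^sup>2 - 1) * u t \<le> (- 1/2) * u t" by (rule mult_right_mono) (use upos[OF that] in simp)
    thus "\<sigma> * (((nu\<^sup>2 - 1/4) / t\<^sup>2 - 1) * wr nu t) \<le> - u t / 2" by (simp add: u_def mult_ac)
  qed
  have vmono: "v t \<le> v s" if "Y \<le> s" "s \<le> t" for s t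
  proof (rule DERIV_nonpos_imp_nonincreasing[OF that(2)])
    fix x assume "s \<le> x" "x \<le> t"
    thus "\<exists>y. (v has_real_derivative y) (at x) \<and> y \<le> 0" using dv[of x] upos[of x] that by fastforce
  qed
  have vpos: "v s \<ge> 0" if s: "s \<ge> Y" for s
  proof (rule ccontr)
    assume n: "\<not> v s \<ge> 0"
    \<comment> \<open>The point where the tangent to u at s meets the axis; by concavity u is not
      positive there.\<close>
    define t where "t = s + u s / (- v s)"
    have ts: "t > s" using n upos[OF s] by (simp add: t_def divide_pos_neg)
    have "\<exists>z. s < z \<and> z < t \<and> u t - u s = (t - s) * v z" using ts s by (intro MVT2 du) auto
    then obtain z where z: "s < z" "u t - u s = (t - s) * v z" by auto
    have "(t - s) * v z \<le> (t - s) * v s" using ts vmono[OF s, of z] z by (intro mult_left_mono) auto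
    also have "... = - u s" using n by (simp add: t_def)
    finally have "u t \<le> 0" using z by linarith
    thus False using upos[of t] ts s by simp
  qed
  have umono: "u Y \<le> u t" if "t \<ge> Y" for t
    by (rule DERIV_nonneg_imp_nondecreasing[OF that]) (use du vpos in blast)
  define k where "k = u Y / 2"
  have k: "k > 0" using upos[of Y] by (simp add: k_def)
  \<comment> \<open>Chosen so that a decrease of v at rate k from Y on has brought it down to
    -1.\<close>
  define t where "t = Y + (v Y + 1) / k"
  have tY: "t > Y" using k vpos[of Y] by (simp add: t_def)
  have "v t + k * t \<le> v Y + k * Y"
  proof (rule DERIV_nonpos_imp_nonincreasing[of Y t "\<lambda>x. v x + k * x"])
    fix x assume x: "Y \<le> x" "x \<le> t"
    obtain d where d: "(v has_real_derivative d) (at x)" "d \<le> - u x / 2" using dv[OF x(1)] by blast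
    have "d + k \<le> 0" using d(2) umono[OF x(1)] by (simp add: k_def)
    moreover have "((\<lambda>x. v x + k * x) has_real_derivative d + k) (at x)" using d(1) by (auto intro!: derivative_eq_intros)
    ultimately show "\<exists>y. ((\<lambda>x. v x + k * x) has_real_derivative y) (at x) \<and> y \<le> 0" by blast
  qed (use tY in simp)
  moreover have "k * t = k * Y + (v Y + 1)" using k unfolding t_def distrib_left by simp
  ultimately have "v t \<le> -1" by linarith
  thus False using vpos[of t] tY by simp
qed

lemma zeros_away_from_0:
  assumes nu: "nu > -1"
  shows "\<exists>a0>0. \<forall>t. 0 < t \<longrightarrow> t < a0 \<longrightarrow> bphi nu (t::real) \<noteq> 0"
proof -
  have "isCont (bphi nu) (0::real)" using bphi_deriv[OF nu] DERIV_isCont by blast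
  hence "eventually (\<lambda>y::real. bphi nu y > 0) (at 0)"
    using bphi_0[OF nu] by (simp add: isCont_def order_tendstoD)
  then obtain d where d: "d > 0" "\<And>y::real. y \<noteq> 0 \<Longrightarrow> dist y 0 < d \<Longrightarrow> bphi nu y > 0"
    unfolding eventually_at by auto
  have "bphi nu t \<noteq> 0" if "0 < t" "t < d" for t :: real using d(2)[of t] that by simp
  thus ?thesis using d(1) by blast
qed

definition bzeros :: "real \<Rightarrow> real set" where "bzeros nu = {t. t > 0 \<and> bphi nu t = 0}"

text \<open>At a zero s the whole energy sits in w', which equals - s^(nu + 1/2) s
  \<open>bphi (nu+1) s\<close> there; this bounds the normalising factor from below. For the
  separation, w' vanishes somewhere between two zeros while |w'| >= sqrt c at the left one, and
  |w''| <= M, so that point is at least sqrt c / M away.\<close>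

lemma zeros_facts:
  assumes nu: "nu > -1"
  shows "\<exists>a0>0. \<exists>g>0. \<exists>c>0. (\<forall>s\<in>bzeros nu. a0 \<le> s \<and> c \<le> s powr (nu + 1/2) * \<bar>s * bphi (nu+1) s\<bar>) \<and>
     (\<forall>s\<in>bzeros nu. \<forall>t\<in>bzeros nu. s < t \<longrightarrow> t - s \<ge> g)"
proof -
  obtain a0 where a0: "a0 > 0" "\<And>t. 0 < t \<Longrightarrow> t < a0 \<Longrightarrow> bphi nu (t::real) \<noteq> 0"
    using zeros_away_from_0[OF nu] by blast
  obtain c C where cC: "0 < c" "c \<le> C"
    "\<And>x. x \<ge> a0 \<Longrightarrow> c \<le> (wr nu x)\<^sup>2 + (wr' nu x)\<^sup>2" "\<And>x. x \<ge> a0 \<Longrightarrow> (wr nu x)\<^sup>2 + (wr' nu x)\<^sup>2 \<le> C"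
    using wr_bounds[OF nu a0(1)] by auto
  have za: "a0 \<le> s" "s > 0" "wr nu s = 0" if "s \<in> bzeros nu" for s
    using that a0(2)[of s] wr_facts(6)[OF nu, of s] by (auto simp: bzeros_def not_less[symmetric])
  have w': "sqrt c \<le> \<bar>wr' nu s\<bar>" if "s \<in> bzeros nu" for s
    using cC(3)[OF za(1)[OF that]] za(3)[OF that] by (metis add_0 power_zero_numeral real_sqrt_abs real_sqrt_le_mono)
  have d: "sqrt c \<le> s powr (nu + 1/2) * \<bar>s * bphi (nu+1) s\<bar>" if "s \<in> bzeros nu" for s
  proof -
    have "wr' nu s = s powr (nu + 1/2) * (- (s * bphi (nu+1) s))"
      using wr_facts(7)[OF nu za(2)[OF that]] that by (simp add: bzeros_def)
    thus ?thesis using w'[OF that] by (simp add: abs_mult)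
  qed
  define m where "m = \<bar>nu\<^sup>2 - 1/4\<bar>"
  define M where "M = (m / a0\<^sup>2 + 1) * sqrt C"
  have M: "M > 0" using a0 cC by (auto simp: M_def m_def intro!: mult_pos_pos add_nonneg_pos)
  have sep: "t - s \<ge> sqrt c / M" if s: "s \<in> bzeros nu" and t: "t \<in> bzeros nu" and st: "s < t" for s t
  proof -
    have "\<exists>z. s < z \<and> z < t \<and> wr nu t - wr nu s = (t - s) * wr' nu z"
      using st za(2)[OF s] by (intro MVT2 wr_facts[OF nu]) auto
    then obtain z where z: "s < z" "z < t" "wr' nu z = 0" using za(3)[OF s] za(3)[OF t] st by auto
    have "\<exists>y. s < y \<and> y < z \<and> wr' nu z - wr' nu s = (z - s) * (((nu\<^sup>2 - 1/4) / y\<^sup>2 - 1) * wr nu y)"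
      using z(1) za(2)[OF s] by (intro MVT2 wr_facts[OF nu]) auto
    then obtain y where y: "s < y" "y < z" "wr' nu z - wr' nu s = (z - s) * (((nu\<^sup>2 - 1/4) / y\<^sup>2 - 1) * wr nu y)" by blast
    have ya: "y \<ge> a0" using y za(1)[OF s] by simp
    have "(wr nu y)\<^sup>2 \<le> C" using cC(4)[OF ya] zero_le_power2[of "wr' nu y"] by linarith
    hence 1: "\<bar>wr nu y\<bar> \<le> sqrt C" using real_le_rsqrt real_sqrt_abs real_sqrt_le_mono by metis
    have "\<bar>(nu\<^sup>2 - 1/4) / y\<^sup>2 - 1\<bar> \<le> \<bar>(nu\<^sup>2 - 1/4) / y\<^sup>2\<bar> + 1" by linarith
    also have "\<bar>(nu\<^sup>2 - 1/4) / y\<^sup>2\<bar> = m / y\<^sup>2" by (simp add: m_def)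
    also have "m / y\<^sup>2 \<le> m / a0\<^sup>2" using ya a0(1) by (intro divide_left_mono power_mono mult_pos_pos) (auto simp: m_def)
    finally have 2: "\<bar>(nu\<^sup>2 - 1/4) / y\<^sup>2 - 1\<bar> \<le> m / a0\<^sup>2 + 1" by simp
    have "sqrt c \<le> \<bar>wr' nu z - wr' nu s\<bar>" using w'[OF s] z(3) by simp
    also have "... = (z - s) * (\<bar>(nu\<^sup>2 - 1/4) / y\<^sup>2 - 1\<bar> * \<bar>wr nu y\<bar>)" unfolding y(3) using z by (simp add: abs_mult)
    also have "... \<le> (z - s) * M" unfolding M_def using 1 2 z by (intro mult_left_mono mult_mono) auto
    also have "... \<le> (t - s) * M" using z M by (intro mult_right_mono) auto
    finally show ?thesis using M by (simp add: field_simps)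
  qed
  show ?thesis using a0(1) M cC(1) za(1) d sep
    by (intro exI[of _ a0] conjI exI[of _ "sqrt c / M"] exI[of _ "sqrt c"]) auto
qed

text \<open>The points are counted by cells of length g: the floor of (t - u) / g is injective on
  S.\<close>

lemma card_separated_le:
  fixes S :: "real set"
  assumes g: "g > 0" and S: "S \<subseteq> {u..v}" and uv: "u \<le> v"
    and sep: "\<And>s t. s \<in> S \<Longrightarrow> t \<in> S \<Longrightarrow> s < t \<Longrightarrow> t - s \<ge> g"
  shows "finite S" "real (card S) \<le> (v - u) / g + 1"
proof -
  define F where "F t = nat \<lfloor>(t - u) / g\<rfloor>" for t
  have inj: "inj_on F S"
  proof (rule linorder_inj_onI')
    fix s t assume st: "s \<in> S" "t \<in> S" "s < t"
    have "1 \<le> (t - s) / g" using sep[OF st] g by simp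
    hence "(s - u) / g + 1 \<le> (t - u) / g" by (simp add: diff_divide_distrib)
    hence "\<lfloor>(s - u) / g\<rfloor> + 1 \<le> \<lfloor>(t - u) / g\<rfloor>" by linarith
    moreover have "0 \<le> (s - u) / g" using st S g by auto
    ultimately show "F s \<noteq> F t" unfolding F_def by linarith
  qed
  define N where "N = nat \<lfloor>(v - u) / g\<rfloor>"
  have sub: "F ` S \<subseteq> {..N}"
  proof safe
    fix t assume "t \<in> S"
    hence "(t - u) / g \<le> (v - u) / g" using S g by (intro divide_right_mono) auto
    thus "F t \<le> N" unfolding F_def N_def by (intro nat_mono floor_mono)
  qed
  show "finite S" using inj sub by (meson finite_atMost finite_imageD finite_subset)
  have "card S = card (F ` S)" using card_image[OF inj] by simp
  also have "... \<le> N + 1" using card_mono[OF _ sub] by simp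
  finally have "real (card S) \<le> real N + 1" by linarith
  also have "real N \<le> (v - u) / g" unfolding N_def using uv g by (simp add: of_nat_nat)
  finally show "real (card S) \<le> (v - u) / g + 1" by simp
qed

section \<open>The radial equation and the reality of the zeros\<close>

text \<open>The radial equation as a first-order system: for U(x) =
  \<open>bphi nu (z * of_real x)\<close> the flux x^(2 nu + 1) U' is - z^2 times the second
  function, and its derivative is - z^2 x^(2 nu + 1) U. In this form no second derivative
  occurs.\<close>

lemma bphi_ray_deriv:
  fixes z :: complex
  assumes nu: "nu > -1" and x: "x > 0"
  shows "((\<lambda>x. bphi nu (z * of_real x)) has_vector_derivative - (z\<^sup>2 * of_real x * bphi (nu+1) (z * of_real x))) (at x)"
    and "((\<lambda>x. of_real (x powr (2*nu+2)) * bphi (nu+1) (z * of_real x)) has_vector_derivative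
            of_real (x powr (2*nu+1)) * bphi nu (z * of_real x)) (at (x::real))"
proof -
  have n1: "nu + 1 > -1" using nu by simp
  have l: "((\<lambda>x. z * of_real x) has_vector_derivative z) (at x)" by (auto intro!: derivative_eq_intros)
  show "((\<lambda>x. bphi nu (z * of_real x)) has_vector_derivative - (z\<^sup>2 * of_real x * bphi (nu+1) (z * of_real x))) (at x)"
    using field_vector_diff_chain_at[OF l bphi_deriv[OF nu]] by (simp add: o_def power2_eq_square mult_ac)
  have d1: "((\<lambda>x. bphi (nu+1) (z * of_real x)) has_vector_derivative - (z\<^sup>2 * of_real x * bphi (nu+2) (z * of_real x))) (at x)"
    using field_vector_diff_chain_at[OF l bphi_deriv[OF n1]] by (simp add: o_def power2_eq_square mult_ac add.assoc)
  have d2: "((\<lambda>x. of_real (x powr (2*nu+2)) :: complex) has_vector_derivative of_real ((2*nu+2) * x powr (2*nu+1))) (at x)"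
  proof -
    have "((\<lambda>x. x powr (2*nu+2)) has_real_derivative (2*nu+2) * x powr (2*nu+2-1)) (at x)"
      by (rule has_real_derivative_powr[OF x])
    thus ?thesis by (intro has_vector_derivative_of_real) (simp add: has_real_derivative_iff_has_vector_derivative add.commute)
  qed
  have "of_real (x powr (2*nu+2)) * - (z\<^sup>2 * of_real x * bphi (nu+2) (z * of_real x)) + of_real ((2*nu+2) * x powr (2*nu+1)) * bphi (nu+1) (z * of_real x)
    = of_real (x powr (2*nu+1)) * bphi nu (z * of_real x)"
  proof -
    have e: "x powr (2*nu+2) = x * x powr (2*nu+1)"
    proof -
      have "x powr (1 + (2*nu+1)) = x powr 1 * x powr (2*nu+1)" by (rule powr_add)
      thus ?thesis using x by (simp add: add_ac)
    qed
    define Z where "Z = z * of_real x"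
    have r: "bphi nu Z = of_real (2*nu+2) * bphi (nu+1) Z - Z\<^sup>2 * bphi (nu+2) Z" using bphi_rec[OF nu, of Z] by simp
    have Z2: "Z\<^sup>2 = z\<^sup>2 * of_real x * of_real x" by (simp add: Z_def power2_eq_square)
    show ?thesis unfolding Z_def[symmetric] r Z2 e by (simp add: algebra_simps)
  qed
  thus "((\<lambda>x. of_real (x powr (2*nu+2)) * bphi (nu+1) (z * of_real x)) has_vector_derivative
            of_real (x powr (2*nu+1)) * bphi nu (z * of_real x)) (at (x::real))"
    using has_vector_derivative_mult[OF d2 d1] by simp
qed

text \<open>Self-adjointness: \<open>Im (x\<^sup>2\<^sup>\<nu>\<^sup>+\<^sup>1 U' cnj U)\<close> is monotone in \<open>x\<close> with rate \<open>- Im (z\<^sup>2) x\<^sup>2\<^sup>\<nu>\<^sup>+\<^sup>1 \<bar>U\<bar>\<^sup>2\<close> and vanishes at both ends.\<close>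
lemma bphi_zero_real:
  assumes nu: "nu > -1" and z: "bphi nu z = 0"
  shows "Im z = 0"
proof (rule ccontr)
  assume "Im z \<noteq> 0"
  \<comment> \<open>On the imaginary axis z^2 is real and the monotonicity argument is void, so this
    case rests on the positivity of the series.\<close>
  have "Re z \<noteq> 0"
  proof
    assume "Re z = 0"
    hence "z = \<i> * of_real (Im z)" by (simp add: complex_eq_iff)
    thus False using bphi_imaginary[OF nu, of "Im z"] z by simp
  qed
  with \<open>Im z \<noteq> 0\<close> have im: "Im (z\<^sup>2) \<noteq> 0" by (simp add: Im_power2)
  define U where "U x = bphi nu (z * of_real x)" for x :: real
  define Q where "Q x = of_real (x powr (2*nu+2)) * bphi (nu+1) (z * of_real x)" for x :: real
  define h where "h x = Im (- (z\<^sup>2) * Q x * cnj (U x))" for x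
  have n1: "nu + 1 > -1" using nu by simp
  have dh: "(h has_real_derivative - Im (z\<^sup>2) * x powr (2*nu+1) * (norm (U x))\<^sup>2) (at x)" if x: "x > 0" for x
  proof -
    have dU: "(U has_vector_derivative - (z\<^sup>2 * of_real x * bphi (nu+1) (z * of_real x))) (at x)"
      unfolding U_def[abs_def] by (rule bphi_ray_deriv(1)[OF nu x])
    have dQ: "(Q has_vector_derivative of_real (x powr (2*nu+1)) * U x) (at x)"
      unfolding Q_def[abs_def] U_def by (rule bphi_ray_deriv(2)[OF nu x])
    have "((\<lambda>x. - (z\<^sup>2) * Q x * cnj (U x)) has_vector_derivative
       - (z\<^sup>2) * Q x * cnj (- (z\<^sup>2 * of_real x * bphi (nu+1) (z * of_real x))) + - (z\<^sup>2) * (of_real (x powr (2*nu+1)) * U x) * cnj (U x)) (at x)"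
      by (intro has_vector_derivative_mult has_vector_derivative_mult_right has_vector_derivative_cnj dU dQ)
    hence dh0: "(h has_vector_derivative Im (- (z\<^sup>2) * Q x * cnj (- (z\<^sup>2 * of_real x * bphi (nu+1) (z * of_real x))) + - (z\<^sup>2) * (of_real (x powr (2*nu+1)) * U x) * cnj (U x))) (at x)"
      unfolding h_def by (rule bounded_linear.has_vector_derivative[OF bounded_linear_Im])
    have e1: "- (z\<^sup>2) * Q x * cnj (- (z\<^sup>2 * of_real x * bphi (nu+1) (z * of_real x)))
        = of_real (x powr (2*nu+2) * x * (norm (z\<^sup>2 * bphi (nu+1) (z * of_real x)))\<^sup>2)"
    proof -
      have "of_real ((norm (z\<^sup>2 * bphi (nu+1) (z * of_real x)))\<^sup>2) = (z\<^sup>2 * bphi (nu+1) (z * of_real x)) * cnj (z\<^sup>2 * bphi (nu+1) (z * of_real x))"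
        by (rule complex_norm_square)
      thus ?thesis unfolding Q_def of_real_mult by simp
    qed
    have e2: "- (z\<^sup>2) * (of_real (x powr (2*nu+1)) * U x) * cnj (U x) = - (z\<^sup>2) * of_real (x powr (2*nu+1) * (norm (U x))\<^sup>2)"
      unfolding of_real_mult complex_norm_square[of "U x"] by simp
    have "Im (of_real A + - (z\<^sup>2) * of_real (B * D)) = - Im (z\<^sup>2) * B * D" for A B D :: real by simp
    with dh0 show ?thesis unfolding has_real_derivative_iff_has_vector_derivative e1 e2 by (simp only:)
  qed
  have contU: "continuous_on {0..1} U"
    unfolding U_def by (intro continuous_on_compose2[OF bphi_continuous_on[OF nu, of UNIV]] continuous_intros) auto
  \<comment> \<open>Continuity down to 0 uses 2 nu + 2 > 0; this is what makes the boundary term at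
    0 vanish as a limit and not merely by the value of \<open>powr\<close> at 0.\<close>
  have conth: "continuous_on {0..1} h" unfolding h_def Q_def
    by (intro continuous_intros contU continuous_on_compose2[OF bphi_continuous_on[OF n1, of UNIV]]
          continuous_on_powr') (use nu in auto)
  have h0: "h 0 = 0" by (simp add: h_def Q_def)
  have h1: "h 1 = 0" using z by (simp add: h_def U_def)
  \<comment> \<open>the sign makes the monotone function increasing\<close>
  define \<sigma> where "\<sigma> = - sgn (Im (z\<^sup>2))"
  have \<sigma>: "\<sigma> * - Im (z\<^sup>2) = \<bar>Im (z\<^sup>2)\<bar>" by (simp add: \<sigma>_def sgn_if)
  have dg: "((\<lambda>x. \<sigma> * h x) has_real_derivative \<bar>Im (z\<^sup>2)\<bar> * x powr (2*nu+1) * (norm (U x))\<^sup>2) (at x)" if "x > 0" for x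
  proof -
    have "((\<lambda>x. \<sigma> * h x) has_real_derivative \<sigma> * (- Im (z\<^sup>2) * x powr (2*nu+1) * (norm (U x))\<^sup>2)) (at x)"
      by (intro DERIV_cmult dh that)
    thus ?thesis by (simp only: mult.assoc[symmetric] \<sigma>)
  qed
  have mono: "\<sigma> * h s \<le> \<sigma> * h t" if "0 \<le> s" "s \<le> t" "t \<le> 1" for s t
  proof (rule DERIV_nonneg_imp_increasing_open[OF that(2)])
    show "\<exists>y. ((\<lambda>x. \<sigma> * h x) has_real_derivative y) (at x) \<and> y \<ge> 0" if "s < x" "x < t" for x
      by (intro exI[of _ "\<bar>Im (z\<^sup>2)\<bar> * x powr (2*nu+1) * (norm (U x))\<^sup>2"] conjI dg) (use that \<open>0 \<le> s\<close> in auto)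
    show "continuous_on {s..t} (\<lambda>x. \<sigma> * h x)"
      using that by (intro continuous_intros continuous_on_subset[OF conth]) auto
  qed
  have const: "\<sigma> * h s = 0" if "0 \<le> s" "s \<le> 1" for s
    using mono[of 0 s] mono[of s 1] that h0 h1 by simp
  have U0: "U s = 0" if s: "0 < s" "s < 1" for s
  proof -
    have "((\<lambda>x. \<sigma> * h x) has_real_derivative 0) (at s)"
    proof (rule has_field_derivative_transform_within[where f="\<lambda>_. 0" and d="min s (1-s)"])
      fix y assume "dist y s < min s (1 - s)"
      thus "0 = \<sigma> * h y" using const[of y] by (auto simp: dist_real_def abs_if split: if_splits)
    qed (use s in auto)
    hence "\<bar>Im (z\<^sup>2)\<bar> * s powr (2*nu+1) * (norm (U s))\<^sup>2 = 0" using dg[OF s(1)] DERIV_unique by blast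
    thus ?thesis using im s by simp
  qed
  have "(U \<longlongrightarrow> U 0) (at 0 within {0..1})" using contU by (simp add: continuous_on_def)
  hence "(U \<longlongrightarrow> U 0) (at 0 within {0<..<1})" by (rule tendsto_within_subset) auto
  moreover have "(U \<longlongrightarrow> 0) (at 0 within {0<..<1})"
    using U0 by (intro tendsto_eventually) (auto simp: eventually_at_filter)
  moreover have "at 0 within {0<..<1} \<noteq> (bot :: real filter)"
    by (simp add: at_within_eq_bot_iff islimpt_greaterThanLessThan1)
  ultimately have "U 0 = 0" using tendsto_unique by blast
  moreover have "U 0 = of_real (bphi nu 0)" using bphi_of_real[OF nu, of 0, where 'a=complex] by (simp add: U_def)
  ultimately show False using bphi_0[OF nu] by simp
qed

section \<open>Enumeration of the zeros and sums over them\<close>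

lemma bzeros_besselJ: "nu > -1 \<Longrightarrow> bzeros nu = {t. 0 < t \<and> besselJ nu t = 0}"
  by (auto simp: bzeros_def bphi_zero_iff)

lemma finite_bzeros_less:
  assumes nu: "nu > -1"
  shows "finite {t\<in>bzeros nu. t < R}"
proof -
  obtain g where g: "g > 0" "\<And>s t. s \<in> bzeros nu \<Longrightarrow> t \<in> bzeros nu \<Longrightarrow> s < t \<Longrightarrow> t - s \<ge> g"
    using zeros_facts[OF nu] by blast
  show ?thesis
    by (rule card_separated_le(1)[OF g(1), where u = 0 and v = "max R 0"]) (auto simp: g bzeros_def)
qed

text \<open>The rank of a zero, that is, the number of zeros below it, is injective, and its range
  is infinite and closed under predecessors, hence all of the natural numbers.
  \<open>besselzero nu (Suc j)\<close> is the zero of rank j, which also justifies the definite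
  description in its definition.\<close>

lemma besselzero_bij:
  assumes nu: "nu > -1"
  shows "bij_betw (\<lambda>j. besselzero nu (Suc j)) UNIV (bzeros nu)"
proof -
  define rk where "rk s = card {t\<in>bzeros nu. t < s}" for s
  have fin: "finite {t\<in>bzeros nu. t < s}" for s by (rule finite_bzeros_less[OF nu])
  have mono: "rk s < rk t" if "s \<in> bzeros nu" "s < t" for s t
    unfolding rk_def by (rule psubset_card_mono[OF fin]) (use that in auto)
  have inj: "inj_on rk (bzeros nu)"
    by (rule linorder_inj_onI') (use mono in fastforce)
  have inf: "infinite (bzeros nu)"
  proof
    assume f: "finite (bzeros nu)"
    obtain t where t: "t > Max (insert 0 (bzeros nu))" "bphi nu t = 0" using wr_zeros_unbounded[OF nu] by blast
    hence "t > 0" using f by (simp add: Max_less_iff)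
    hence "t \<in> bzeros nu" using t by (simp add: bzeros_def)
    thus False using t(1) f Max_ge[of "insert 0 (bzeros nu)" t] by auto
  qed
  have down: "n \<in> rk ` bzeros nu" if "Suc n \<in> rk ` bzeros nu" for n
  proof -
    from that obtain s where s': "Suc n = rk s" "s \<in> bzeros nu" by (rule imageE)
    hence s: "s \<in> bzeros nu" "rk s = Suc n" by auto
    define A where "A = {t\<in>bzeros nu. t < s}"
    have A: "finite A" "card A = Suc n" using fin s by (auto simp: A_def rk_def)
    hence ne: "A \<noteq> {}" by auto
    define m where "m = Max A"
    have m: "m \<in> A" using A ne by (simp add: m_def)
    have "{t\<in>bzeros nu. t < m} = A - {m}"
    proof (intro set_eqI iffI)
      fix t assume "t \<in> {t\<in>bzeros nu. t < m}"
      thus "t \<in> A - {m}" using m by (auto simp: A_def)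
    next
      fix t assume t: "t \<in> A - {m}"
      hence "t \<le> m" using A by (simp add: m_def)
      thus "t \<in> {t\<in>bzeros nu. t < m}" using t by (auto simp: A_def)
    qed
    hence "rk m = n" using A m by (simp add: rk_def)
    thus ?thesis using m by (auto simp: A_def)
  qed
  have "n \<in> rk ` bzeros nu" for n
  proof -
    have "infinite (rk ` bzeros nu)" using inf inj finite_imageD by blast
    then obtain k where k: "k \<ge> n" "k \<in> rk ` bzeros nu" by (meson finite_nat_set_iff_bounded_le linear)
    have "k - i \<in> rk ` bzeros nu" for i
    proof (induction i)
      case (Suc i) thus ?case using down[of "k - Suc i"] by (cases "i < k") (auto simp: Suc_diff_Suc)
    qed (use k in simp)
    from this[of "k - n"] show ?thesis using k by simp
  qed
  hence bij: "bij_betw rk (bzeros nu) UNIV" using inj by (auto simp: bij_betw_def)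
  have "besselzero nu (Suc j) = inv_into (bzeros nu) rk j" for j
  proof -
    have "besselzero nu (Suc j) = (THE s. s \<in> bzeros nu \<and> rk s = j)"
      unfolding besselzero_def rk_def bzeros_besselJ[OF nu] by (intro arg_cong[where f=The] ext) (auto intro: arg_cong[where f=card])
    also have "... = inv_into (bzeros nu) rk j"
    proof (rule the_equality)
      show "inv_into (bzeros nu) rk j \<in> bzeros nu \<and> rk (inv_into (bzeros nu) rk j) = j"
        using bij by (metis UNIV_I bij_betw_def f_inv_into_f inv_into_into)
      show "s = inv_into (bzeros nu) rk j" if "s \<in> bzeros nu \<and> rk s = j" for s
        using that inj by auto
    qed
    finally show ?thesis .
  qed
  thus ?thesis using bij_betw_inv_into[OF bij] by simp
qed

lemma powr_increment_le:
  fixes \<beta> :: real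
  assumes "0 < \<beta>" "\<beta> \<le> 1" "0 < h" "h \<le> s"
  shows "\<beta> * h * s powr (\<beta> - 1) \<le> s powr \<beta> - (s - h) powr \<beta>"
proof -
  have "s - h < s" using assms by simp
  moreover have "continuous_on {s-h..s} (\<lambda>x. x powr \<beta>)" using assms by (intro continuous_on_powr' continuous_intros) auto
  moreover have "(\<lambda>x. x powr \<beta>) differentiable (at x)" if "s - h < x" "x < s" for x
    using has_real_derivative_powr[of x \<beta>] that assms real_differentiable_def by force
  ultimately obtain l z where z: "s - h < z" "z < s" "((\<lambda>x. x powr \<beta>) has_real_derivative l) (at z)"
    "s powr \<beta> - (s - h) powr \<beta> = (s - (s - h)) * l" using MVT[of "s-h" s "\<lambda>x. x powr \<beta>"] by blast
  have zp: "z > 0" using z assms by simp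
  have "l = \<beta> * z powr (\<beta> - 1)" using DERIV_unique[OF z(3) has_real_derivative_powr[OF zp]] .
  hence e: "s powr \<beta> - (s - h) powr \<beta> = h * (\<beta> * z powr (\<beta> - 1))" using z by simp
  have "s powr (\<beta> - 1) \<le> z powr (\<beta> - 1)" using zp z assms by (intro powr_mono2') auto
  hence "h * (\<beta> * s powr (\<beta> - 1)) \<le> h * (\<beta> * z powr (\<beta> - 1))" using assms by (intro mult_left_mono) auto
  thus ?thesis unfolding e by (simp add: mult_ac)
qed

text \<open>A comparison with the integral of s^(\<beta> - 1): the term at s is paid for by the
  increment of s^\<beta> over [s - h, s], and these intervals do not overlap. The lower bound h on S
  keeps them inside the positive half line.\<close>

lemma sum_powr_separated:
  fixes S :: "real set"
  assumes "finite S" and \<beta>: "0 < \<beta>" "\<beta> \<le> 1" and h: "0 < h"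
    and "S \<subseteq> {h..R}" "R \<ge> 0" and "\<And>s t. s \<in> S \<Longrightarrow> t \<in> S \<Longrightarrow> s < t \<Longrightarrow> t - s \<ge> h"
  shows "(\<Sum>s\<in>S. s powr (\<beta> - 1)) \<le> R powr \<beta> / (\<beta> * h)"
  using assms(1,5-)
proof (induction S arbitrary: R rule: finite_linorder_max_induct)
  case empty thus ?case using \<beta> h by simp
next
  case (insert b A)
  have b: "h \<le> b" "b \<le> R" using insert.prems by auto
  have "(\<Sum>s\<in>A. s powr (\<beta> - 1)) \<le> (b - h) powr \<beta> / (\<beta> * h)"
  proof (rule insert.IH)
    show "A \<subseteq> {h..b - h}"
    proof
      fix s assume s: "s \<in> A"
      hence "b - s \<ge> h" using insert.hyps insert.prems(3)[of s b] by auto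
      thus "s \<in> {h..b-h}" using s insert.prems(1) by auto
    qed
    show "0 \<le> b - h" using b by simp
    show "\<And>s t. s \<in> A \<Longrightarrow> t \<in> A \<Longrightarrow> s < t \<Longrightarrow> h \<le> t - s" using insert.prems(3) by auto
  qed
  moreover have "b powr (\<beta> - 1) \<le> (b powr \<beta> - (b - h) powr \<beta>) / (\<beta> * h)"
    using powr_increment_le[OF \<beta> h b(1)] \<beta> h by (simp add: field_simps)
  ultimately have "(\<Sum>s\<in>insert b A. s powr (\<beta> - 1)) \<le> (b - h) powr \<beta> / (\<beta> * h) + (b powr \<beta> - (b - h) powr \<beta>) / (\<beta> * h)"
    using insert.hyps by (subst sum.insert) auto
  also have "... = b powr \<beta> / (\<beta> * h)" by (simp add: diff_divide_distrib)
  also have "... \<le> R powr \<beta> / (\<beta> * h)" using b h \<beta> by (intro divide_right_mono powr_mono2) auto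
  finally show ?case .
qed

text \<open>For a >= 0 each factor s^a (1 + s u)^(-a) is a power of s / (1 + s u) and increases with
  s, so the sum is at most the number of zeros times the value at R. For a < 0 only (1 + s u)^(-a)
  increases; s^(2 a) is then summed by \<open>sum_powr_separated\<close>, which needs 2 a + 1 >
  0.\<close>

lemma zero_sum_bound:
  assumes nu: "nu > -1"
  defines "a \<equiv> nu + 1/2"
  shows "\<exists>C>0. \<forall>R>0. \<forall>x\<ge>0. \<forall>y\<ge>0.
    (\<Sum>s\<in>{s\<in>bzeros nu. s < R}. s powr (2*a) * (1 + s * x) powr (-a) * (1 + s * y) powr (-a))
       \<le> C * R powr (2*a+1) * (1 + R * x) powr (-a) * (1 + R * y) powr (-a)"
proof -
  obtain a0 g where ag: "a0 > 0" "g > 0" "\<And>s. s \<in> bzeros nu \<Longrightarrow> a0 \<le> s"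
    "\<And>s t. s \<in> bzeros nu \<Longrightarrow> t \<in> bzeros nu \<Longrightarrow> s < t \<Longrightarrow> t - s \<ge> g"
    using zeros_facts[OF nu] by blast
  have b1: "2*a+1 > 0" using nu by (simp add: a_def)
  define h where "h = min g a0"
  have h: "h > 0" "h \<le> g" "h \<le> a0" using ag by (auto simp: h_def)
  define C where "C = (if a \<ge> 0 then 1/g + 1/a0 else 1 / ((2*a+1) * h))"
  have C: "C > 0" using ag h b1 by (auto simp: C_def add_pos_pos)
  have "(\<Sum>s\<in>{s\<in>bzeros nu. s < R}. s powr (2*a) * (1 + s * x) powr (-a) * (1 + s * y) powr (-a))
       \<le> C * R powr (2*a+1) * (1 + R * x) powr (-a) * (1 + R * y) powr (-a)"
    if R: "R > 0" and x: "x \<ge> 0" and y: "y \<ge> 0" for R x y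
  proof (cases "a \<ge> 0")
    case True
    define S where "S = {s\<in>bzeros nu. s < R}"
    have mon: "s powr a * (1 + s * u) powr (-a) \<le> R powr a * (1 + R * u) powr (-a)" if "s \<in> S" "u \<ge> 0" for s u
    proof -
      have s: "0 < s" "s < R" using that ag(1,3) by (auto simp: S_def intro: less_le_trans)
      have p: "1 + s * u > 0" "1 + R * u > 0" using s R that(2) by (auto intro: add_pos_nonneg)
      have "s / (1 + s * u) \<le> R / (1 + R * u)" using p s by (simp add: field_simps)
      hence "(s / (1 + s * u)) powr a \<le> (R / (1 + R * u)) powr a" using True s p by (intro powr_mono2) auto
      thus ?thesis using s p R by (simp add: powr_divide powr_minus_divide)
    qed
    have t: "s powr (2*a) * (1 + s * x) powr (-a) * (1 + s * y) powr (-a) \<le> R powr (2*a) * (1 + R * x) powr (-a) * (1 + R * y) powr (-a)"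
      if "s \<in> S" for s
    proof -
      have "(s powr a * (1 + s * x) powr (-a)) * (s powr a * (1 + s * y) powr (-a))
        \<le> (R powr a * (1 + R * x) powr (-a)) * (R powr a * (1 + R * y) powr (-a))"
        by (rule mult_mono[OF mon[OF that x] mon[OF that y]]) auto
      moreover have "r powr (2*a) = r powr a * r powr a" for r :: real by (simp flip: powr_add)
      ultimately show ?thesis by (simp add: mult_ac)
    qed
    have card: "real (card S) \<le> (1/g + 1/a0) * R"
    \<comment> \<open>Below the first zero the sum is empty; only above it can the additive 1 of the
      counting estimate be absorbed into R / a0.\<close>
    proof (cases "R > a0")
      case True
      have "real (card S) \<le> (R - 0) / g + 1"
        by (rule card_separated_le(2)) (use ag R in \<open>auto simp: S_def bzeros_def\<close>)
      also have "... \<le> R / g + R / a0"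
      proof -
        have "1 \<le> R / a0" using True ag(1) by simp
        thus ?thesis by simp
      qed
      finally show ?thesis by (simp add: algebra_simps)
    next
      case False
      hence "S = {}" using ag(3) by (force simp: S_def)
      thus ?thesis using ag R by simp
    qed
    have "(\<Sum>s\<in>S. s powr (2*a) * (1 + s * x) powr (-a) * (1 + s * y) powr (-a))
       \<le> real (card S) * (R powr (2*a) * (1 + R * x) powr (-a) * (1 + R * y) powr (-a))"
      using t by (rule sum_bounded_above)
    also have "... \<le> ((1/g + 1/a0) * R) * (R powr (2*a) * (1 + R * x) powr (-a) * (1 + R * y) powr (-a))"
      using card by (intro mult_right_mono) auto
    also have "... = C * R powr (2*a+1) * (1 + R * x) powr (-a) * (1 + R * y) powr (-a)"
      using True R by (simp add: C_def powr_add mult_ac)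
    finally show ?thesis unfolding S_def .
  next
    case False
    define S where "S = {s\<in>bzeros nu. s < R}"
    have s: "h \<le> s" "s < R" "s > 0" if "s \<in> S" for s using that ag(1,3) h by (force simp: S_def)+
    have t: "s powr (2*a) * (1 + s * x) powr (-a) * (1 + s * y) powr (-a) \<le> s powr ((2*a+1) - 1) * ((1 + R * x) powr (-a) * (1 + R * y) powr (-a))"
      if "s \<in> S" for s
    proof -
      have "(1 + s * u) powr (-a) \<le> (1 + R * u) powr (-a)" if "u \<ge> 0" for u
        using s[OF \<open>s \<in> S\<close>] that False by (intro powr_mono2 add_left_mono mult_right_mono) (auto intro: add_nonneg_nonneg)
      hence "(1 + s * x) powr (-a) * (1 + s * y) powr (-a) \<le> (1 + R * x) powr (-a) * (1 + R * y) powr (-a)"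
        using x y by (intro mult_mono) auto
      thus ?thesis by (simp add: mult.assoc mult_left_mono)
    qed
    have "(\<Sum>s\<in>S. s powr (2*a) * (1 + s * x) powr (-a) * (1 + s * y) powr (-a))
       \<le> (\<Sum>s\<in>S. s powr ((2*a+1) - 1) * ((1 + R * x) powr (-a) * (1 + R * y) powr (-a)))"
      by (intro sum_mono t)
    also have "... = (\<Sum>s\<in>S. s powr ((2*a+1) - 1)) * ((1 + R * x) powr (-a) * (1 + R * y) powr (-a))"
      by (simp add: sum_distrib_right)
    also have "... \<le> (R powr (2*a+1) / ((2*a+1) * h)) * ((1 + R * x) powr (-a) * (1 + R * y) powr (-a))"
    proof (intro mult_right_mono sum_powr_separated)
      show "finite S" unfolding S_def by (rule finite_bzeros_less[OF nu])
      show "S \<subseteq> {h..R}" using s by (fastforce intro: less_imp_le)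
      show "\<And>s t. s \<in> S \<Longrightarrow> t \<in> S \<Longrightarrow> s < t \<Longrightarrow> h \<le> t - s" using ag(4) h(2) unfolding S_def by force
    qed (use b1 False h R in auto)
    also have "... = C * R powr (2*a+1) * (1 + R * x) powr (-a) * (1 + R * y) powr (-a)"
      using False by (simp add: C_def mult_ac)
    finally show ?thesis unfolding S_def .
  qed
  thus ?thesis using C by blast
qed

section \<open>The solution vanishing at the boundary\<close>

lemma has_vector_derivative_series:
  fixes f f' :: "nat \<Rightarrow> real \<Rightarrow> 'b::banach"
  assumes S: "convex S" and x: "x \<in> S"
    and f: "\<And>n x. x \<in> S \<Longrightarrow> (f n has_vector_derivative f' n x) (at x within S)"
    and M: "\<And>n x. x \<in> S \<Longrightarrow> norm (f' n x) \<le> M n" "summable M"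
    and s: "\<And>x. x \<in> S \<Longrightarrow> summable (\<lambda>n. f n x)"
  shows "((\<lambda>x. \<Sum>n. f n x) has_vector_derivative (\<Sum>n. f' n x)) (at x within S)"
proof -
  have u: "uniform_limit S (\<lambda>n x. \<Sum>i<n. f' i x) (\<lambda>x. \<Sum>i. f' i x) sequentially"
    by (rule Weierstrass_m_test[OF M])
  have "\<exists>g. \<forall>x\<in>S. (\<lambda>n. f n x) sums (g x) \<and> (g has_derivative (\<lambda>h. h *\<^sub>R (\<Sum>i. f' i x))) (at x within S)"
  proof (rule has_derivative_series[where f=f and f'="\<lambda>n x h. h *\<^sub>R f' n x" and g'="\<lambda>x h. h *\<^sub>R (\<Sum>i. f' i x)", OF S _ _ x summable_sums[OF s[OF x]]])
    show "(f n has_derivative (\<lambda>h. h *\<^sub>R f' n y)) (at y within S)" if "y \<in> S" for n y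
      using f[OF that] by (simp add: has_vector_derivative_def)
    fix e :: real assume e: "e > 0"
    have "\<forall>\<^sub>F n in sequentially. \<forall>x\<in>S. dist (\<Sum>i<n. f' i x) (\<Sum>i. f' i x) < e"
      using u e by (simp add: uniform_limit_iff)
    thus "\<forall>\<^sub>F n in sequentially. \<forall>x\<in>S. \<forall>h. norm ((\<Sum>i<n. h *\<^sub>R f' i x) - h *\<^sub>R (\<Sum>i. f' i x)) \<le> e * norm h"
    proof (rule eventually_mono, intro ballI allI)
      fix n y h assume "\<forall>x\<in>S. dist (\<Sum>i<n. f' i x) (\<Sum>i. f' i x) < e" and y: "y \<in> S"
      hence "norm ((\<Sum>i<n. f' i y) - (\<Sum>i. f' i y)) \<le> e" by (auto simp: dist_norm intro: less_imp_le)
      hence "\<bar>h\<bar> * norm ((\<Sum>i<n. f' i y) - (\<Sum>i. f' i y)) \<le> \<bar>h\<bar> * e" by (rule mult_left_mono) simp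
      thus "norm ((\<Sum>i<n. h *\<^sub>R f' i y) - h *\<^sub>R (\<Sum>i. f' i y)) \<le> e * norm h"
        by (simp add: scaleR_sum_right[symmetric] scaleR_diff_right[symmetric] mult.commute)
    qed
  qed
  then obtain g where g: "\<And>x. x \<in> S \<Longrightarrow> (\<lambda>n. f n x) sums (g x)"
    "\<And>x. x \<in> S \<Longrightarrow> (g has_derivative (\<lambda>h. h *\<^sub>R (\<Sum>i. f' i x))) (at x within S)" by blast
  have "(g has_vector_derivative (\<Sum>i. f' i x)) (at x within S)" using g(2)[OF x] by (simp add: has_vector_derivative_def)
  thus ?thesis
    by (rule has_vector_derivative_transform[OF x, rotated]) (use g(1) in \<open>simp add: sums_iff\<close>)
qed

text \<open>Coefficients, as power series in \<open>z\<^sup>2\<close>, of the solution \<open>V\<close> of the radial equation with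
  \<open>V(1) = 0\<close>, \<open>V'(1) = 1\<close>, and of \<open>Q = y\<^sup>2\<^sup>\<nu>\<^sup>+\<^sup>1 V'\<close>.\<close>
primrec bQc :: "real \<Rightarrow> nat \<Rightarrow> real \<Rightarrow> real" where
  "bQc nu 0 = (\<lambda>_. 1)"
| "bQc nu (Suc n) = (\<lambda>s. integral {s..1} (\<lambda>r. r powr (2*nu+1) *
      (- integral {r..1} (\<lambda>t. t powr (-(2*nu+1)) * bQc nu n t))))"

definition bVc :: "real \<Rightarrow> nat \<Rightarrow> real \<Rightarrow> real" where
  "bVc nu n y = - integral {y..1} (\<lambda>t. t powr (-(2*nu+1)) * bQc nu n t)"

lemma bQc_Suc: "bQc nu (Suc n) s = integral {s..1} (\<lambda>r. r powr (2*nu+1) * bVc nu n r)"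
  by (simp add: bVc_def)

lemma powr_cont_pos: "y0 > 0 \<Longrightarrow> continuous_on {y0..1} (\<lambda>t. t powr (c::real))"
  by (intro continuous_intros) auto

lemma bVc_deriv_aux:
  assumes "y0 > 0" "y \<in> {y0..1}" "continuous_on {y0..1} (bQc nu n)"
  shows "(bVc nu n has_real_derivative y powr (-(2*nu+1)) * bQc nu n y) (at y within {y0..1})"
proof -
  have "continuous_on {y0..1} (\<lambda>t. t powr (-(2*nu+1)) * bQc nu n t)"
    by (intro continuous_on_mult powr_cont_pos assms)
  from DERIV_minus[OF integral_has_real_derivative'[OF this assms(2)]]
  show ?thesis by (simp add: bVc_def[abs_def])
qed

lemma bQc_continuous:
  assumes "y0 > 0" shows "continuous_on {y0..1} (bQc nu n)" 
proof (induction n)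
  case (Suc n)
  have "continuous_on {y0..1} (bVc nu n)"
    by (rule DERIV_continuous_on) (rule bVc_deriv_aux[OF assms _ Suc])
  hence "continuous_on {y0..1} (\<lambda>r. r powr (2*nu+1) * bVc nu n r)"
    by (intro continuous_on_mult powr_cont_pos assms)
  from integral_has_real_derivative'[OF this] show ?case
    unfolding bQc_Suc[abs_def] by (rule DERIV_continuous_on)
qed simp

lemma bVc_deriv:
  assumes "y0 > 0" "y \<in> {y0..1}"
  shows "(bVc nu n has_real_derivative y powr (-(2*nu+1)) * bQc nu n y) (at y within {y0..1})"
  by (rule bVc_deriv_aux[OF assms bQc_continuous[OF assms(1)]])

lemma bVc_continuous: "y0 > 0 \<Longrightarrow> continuous_on {y0..1} (bVc nu n)"
  by (rule DERIV_continuous_on) (rule bVc_deriv)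

lemma bQc_deriv:
  assumes "y0 > 0" "y \<in> {y0..1}"
  shows "(bQc nu (Suc n) has_real_derivative - (y powr (2*nu+1) * bVc nu n y)) (at y within {y0..1})"
proof -
  have "continuous_on {y0..1} (\<lambda>r. r powr (2*nu+1) * bVc nu n r)"
    by (intro continuous_on_mult powr_cont_pos bVc_continuous assms)
  from integral_has_real_derivative'[OF this assms(2)] show ?thesis unfolding bQc_Suc[abs_def] .
qed

text \<open>One step of a Picard iteration: integrating from 1 inwards adds one power of 1 - y and
  one factor to the factorial.\<close>

lemma integral_factorial_bound:
  fixes g :: "real \<Rightarrow> real"
  assumes "y \<le> 1" "continuous_on {y..1} g" "\<And>t. t \<in> {y..1} \<Longrightarrow> \<bar>g t\<bar> \<le> M * (1 - t) ^ k / fact k"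
  shows "\<bar>integral {y..1} g\<bar> \<le> M * (1 - y) ^ Suc k / fact (Suc k)"
proof -
  define F where "F t = - (M * (1 - t) ^ Suc k / fact (Suc k))" for t :: real
  have f: "fact (Suc k) = (1 + real k) * fact k" by simp
  have "(F has_real_derivative M * (1 - t) ^ k / fact k) (at t within {y..1})" for t
  proof -
    have "(F has_real_derivative - (M * (real (Suc k) * ((0 - 1) * (1 - t) ^ (Suc k - Suc 0))) / fact (Suc k))) (at t within {y..1})"
      unfolding F_def by (intro DERIV_minus DERIV_cdivide DERIV_cmult DERIV_power DERIV_diff DERIV_const DERIV_ident)
    moreover have "- (M * (real (Suc k) * ((0 - 1) * (1 - t) ^ (Suc k - Suc 0))) / fact (Suc k)) = M * (1 - t) ^ k / fact k"
      by (simp add: f del: fact_Suc)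
    ultimately show ?thesis by simp
  qed
  hence "((\<lambda>t. M * (1 - t) ^ k / fact k) has_integral (F 1 - F y)) {y..1}"
    using assms(1) by (intro fundamental_theorem_of_calculus) (auto simp: has_real_derivative_iff_has_vector_derivative)
  hence i: "(\<lambda>t. M * (1 - t) ^ k / fact k) integrable_on {y..1}" "integral {y..1} (\<lambda>t. M * (1 - t) ^ k / fact k) = F 1 - F y"
    by (auto simp: has_integral_iff)
  have "norm (integral {y..1} g) \<le> integral {y..1} (\<lambda>t. M * (1 - t) ^ k / fact k)"
    by (rule integral_norm_bound_integral[OF integrable_continuous_real[OF assms(2)] i(1)]) (use assms(3) in auto)
  thus ?thesis unfolding i(2) by (simp add: F_def)
qed

lemma bQc_bVc_bound:
  assumes y0: "0 < y0" "y0 \<le> 1"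
  shows "\<exists>K\<ge>1. \<forall>n. \<forall>y\<in>{y0..1}. \<bar>bQc nu n y\<bar> \<le> K ^ (2*n) * (1 - y) ^ (2*n) / fact (2*n) \<and>
     \<bar>bVc nu n y\<bar> \<le> K ^ (2*n+1) * (1 - y) ^ (2*n+1) / fact (2*n+1) \<and> y powr (2*nu+1) \<le> K \<and> y powr (-(2*nu+1)) \<le> K"
proof -
  have b: "\<exists>K. \<forall>y\<in>{y0..1}. y powr c \<le> K" for c :: real
  proof -
    have "bounded ((\<lambda>t. t powr c) ` {y0..1})"
      by (intro compact_imp_bounded compact_continuous_image[OF powr_cont_pos] y0) auto
    then obtain K where "\<forall>y\<in>(\<lambda>t. t powr c) ` {y0..1}. norm y \<le> K" unfolding bounded_iff by blast
    thus ?thesis by auto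
  qed
  obtain K1 where K1: "\<forall>y\<in>{y0..1}. y powr (2*nu+1) \<le> K1" using b by blast
  obtain K2 where K2: "\<forall>y\<in>{y0..1}. y powr (-(2*nu+1)) \<le> K2" using b by blast
  define K where "K = max 1 (max K1 K2)"
  have K: "K \<ge> 1" by (simp add: K_def)
  have Kp: "y powr (2*nu+1) \<le> K" "y powr (-(2*nu+1)) \<le> K" if "y \<in> {y0..1}" for y
    using K1 K2 that unfolding K_def by (meson max.coboundedI2 max.coboundedI1)+
  have VfromQ: "\<bar>bVc nu n y\<bar> \<le> K ^ (2*n+1) * (1 - y) ^ (2*n+1) / fact (2*n+1)"
    if Q: "\<And>y. y \<in> {y0..1} \<Longrightarrow> \<bar>bQc nu n y\<bar> \<le> K ^ (2*n) * (1 - y) ^ (2*n) / fact (2*n)" and y: "y \<in> {y0..1}" for n y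
  proof -
    have yp: "y > 0" using y y0 by simp
    have "\<bar>integral {y..1} (\<lambda>t. t powr (-(2*nu+1)) * bQc nu n t)\<bar> \<le> K ^ (2*n+1) * (1 - y) ^ Suc (2*n) / fact (Suc (2*n))"
    proof (rule integral_factorial_bound)
      show "continuous_on {y..1} (\<lambda>t. t powr (-(2*nu+1)) * bQc nu n t)"
        by (intro continuous_on_mult powr_cont_pos bQc_continuous yp)
      fix t assume t: "t \<in> {y..1}"
      hence t0: "t \<in> {y0..1}" using y by auto
      have "\<bar>t powr (-(2*nu+1)) * bQc nu n t\<bar> = t powr (-(2*nu+1)) * \<bar>bQc nu n t\<bar>" by (simp add: abs_mult)
      also have "... \<le> K * (K ^ (2*n) * (1 - t) ^ (2*n) / fact (2*n))"
        using K by (intro mult_mono Kp(2)[OF t0] Q[OF t0]) auto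
      finally show "\<bar>t powr (-(2*nu+1)) * bQc nu n t\<bar> \<le> K ^ (2*n+1) * (1 - t) ^ (2*n) / fact (2*n)" by simp
    qed (use y in auto)
    thus ?thesis by (simp add: bVc_def)
  qed
  have Q: "\<forall>y\<in>{y0..1}. \<bar>bQc nu n y\<bar> \<le> K ^ (2*n) * (1 - y) ^ (2*n) / fact (2*n)" for n
  proof (induction n)
    case (Suc n)
    show ?case
    proof
      fix y assume y: "y \<in> {y0..1}"
      hence yp: "y > 0" using y0 by simp
      have "\<bar>integral {y..1} (\<lambda>r. r powr (2*nu+1) * bVc nu n r)\<bar> \<le> K ^ (2*n+2) * (1 - y) ^ Suc (2*n+1) / fact (Suc (2*n+1))"
      proof (rule integral_factorial_bound)
        show "continuous_on {y..1} (\<lambda>r. r powr (2*nu+1) * bVc nu n r)"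
          by (intro continuous_on_mult powr_cont_pos bVc_continuous yp)
        fix t assume t: "t \<in> {y..1}"
        hence t0: "t \<in> {y0..1}" using y by auto
        have "\<bar>t powr (2*nu+1) * bVc nu n t\<bar> = t powr (2*nu+1) * \<bar>bVc nu n t\<bar>" by (simp add: abs_mult)
        also have "... \<le> K * (K ^ (2*n+1) * (1 - t) ^ (2*n+1) / fact (2*n+1))"
          using K Suc by (intro mult_mono Kp(1)[OF t0] VfromQ[OF _ t0]) auto
        finally show "\<bar>t powr (2*nu+1) * bVc nu n t\<bar> \<le> K ^ (2*n+2) * (1 - t) ^ (2*n+1) / fact (2*n+1)" by simp
      qed (use y in auto)
      moreover have "2 * Suc n = Suc (2*n+1)" "2*n+2 = Suc (2*n+1)" by auto
      ultimately show "\<bar>bQc nu (Suc n) y\<bar> \<le> K ^ (2*Suc n) * (1 - y) ^ (2*Suc n) / fact (2*Suc n)"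
        unfolding bQc_Suc by metis
    qed
  qed simp
  show ?thesis using K Q VfromQ Kp by (intro exI[of _ K]) blast
qed

text \<open>A coarser form with a single factorial, uniform on [y0, 1]. It is all that convergence
  for every z and termwise differentiation in y require.\<close>

lemma bQc_bVc_exp_bound:
  assumes y0: "0 < y0" "y0 \<le> 1"
  shows "\<exists>K\<ge>1. \<forall>n. \<forall>y\<in>{y0..1}. \<bar>bQc nu n y\<bar> \<le> K * K ^ n / fact n \<and>
     \<bar>bVc nu n y\<bar> \<le> K * K ^ n / fact n \<and> y powr (2*nu+1) \<le> K \<and> y powr (-(2*nu+1)) \<le> K"
proof -
  obtain K where K: "K \<ge> 1" "\<And>n y. y \<in> {y0..1} \<Longrightarrow> \<bar>bQc nu n y\<bar> \<le> K ^ (2*n) * (1 - y) ^ (2*n) / fact (2*n)"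
     "\<And>n y. y \<in> {y0..1} \<Longrightarrow> \<bar>bVc nu n y\<bar> \<le> K ^ (2*n+1) * (1 - y) ^ (2*n+1) / fact (2*n+1)"
     "\<And>y. y \<in> {y0..1} \<Longrightarrow> y powr (2*nu+1) \<le> K \<and> y powr (-(2*nu+1)) \<le> K"
    using bQc_bVc_bound[OF y0, of nu] by blast
  have f: "K ^ j * (1 - y) ^ j / fact j \<le> K\<^sup>2 * (K\<^sup>2) ^ n / fact n" if j: "n \<le> j" "j \<le> 2 * n + 2" and y: "y \<in> {y0..1}" for n j y
  proof -
    have "K ^ j * (1 - y) ^ j / fact j \<le> K ^ (2*n+2) * 1 / fact n"
    proof (rule frac_le)
      show "K ^ j * (1 - y) ^ j \<le> K ^ (2*n+2) * 1"
        using K(1) y y0 j by (intro mult_mono power_increasing power_le_one) auto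
      show "fact n \<le> (fact j :: real)" using j by (simp add: fact_mono)
    qed (use K in auto)
    also have "K ^ (2*n+2) = K\<^sup>2 * (K\<^sup>2) ^ n" unfolding power_add power_mult by (rule mult.commute)
    finally show ?thesis by simp
  qed
  have KK: "K \<le> K\<^sup>2" using K(1) by (simp add: power2_eq_square mult_le_cancel_left1)
  show ?thesis
  proof (intro exI[of _ "K\<^sup>2"] conjI allI ballI)
    show "1 \<le> K\<^sup>2" using K(1) by (simp add: one_le_power)
    fix n y assume y: "y \<in> {y0..1}"
    show "\<bar>bQc nu n y\<bar> \<le> K\<^sup>2 * (K\<^sup>2) ^ n / fact n" using K(2)[OF y, of n] f[of n "2*n" y] y by linarith
    show "\<bar>bVc nu n y\<bar> \<le> K\<^sup>2 * (K\<^sup>2) ^ n / fact n" using K(3)[OF y, of n] f[of n "2*n+1" y] y by linarith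
    show "y powr (2*nu+1) \<le> K\<^sup>2" "y powr (-(2*nu+1)) \<le> K\<^sup>2" using K(4)[OF y] KK by auto
  qed
qed

text \<open>Iterating from the endpoint 1 yields this solution directly as an entire function of
  z^2. An expression through a second Bessel function would depend on whether nu is an
  integer.\<close>

definition bV :: "real \<Rightarrow> complex \<Rightarrow> real \<Rightarrow> complex" where
  "bV nu z y = (\<Sum>n. of_real (bVc nu n y) * (z\<^sup>2) ^ n)"

definition bQ :: "real \<Rightarrow> complex \<Rightarrow> real \<Rightarrow> complex" where
  "bQ nu z y = (\<Sum>n. of_real (bQc nu n y) * (z\<^sup>2) ^ n)"

lemma summable_exp_type:
  fixes w :: complex and c :: "nat \<Rightarrow> real"
  assumes "\<And>n. \<bar>c n\<bar> \<le> K * K ^ n / fact n" "K \<ge> 1"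
  shows "summable (\<lambda>n. of_real (c n) * w ^ n)" 
proof (rule summable_comparison_test'[where N=0])
  have "summable (\<lambda>n. inverse (fact n) * (K * norm w) ^ n)" by (rule summable_exp)
  thus "summable (\<lambda>n. K * (inverse (fact n) * (K * norm w) ^ n))" by (rule summable_mult)
  fix n
  have "norm (of_real (c n) * w ^ n) = \<bar>c n\<bar> * norm w ^ n" by (simp add: norm_mult norm_power)
  also have "... \<le> (K * K ^ n / fact n) * norm w ^ n" by (intro mult_right_mono assms) auto
  finally show "norm (of_real (c n) * w ^ n) \<le> K * (inverse (fact n) * (K * norm w) ^ n)"
    by (simp add: power_mult_distrib divide_inverse mult_ac)
qed

text \<open>The system is needed up to the endpoint 1, where the data are prescribed, hence the
  one-sided derivatives; \<open>bV_bQ_deriv\<close> specialises to interior points.\<close>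

lemma bV_bQ_deriv_within:
  assumes y0: "0 < y0" and y: "y \<in> {y0..1}"
  shows "(bV nu z has_vector_derivative of_real (y powr (-(2*nu+1))) * bQ nu z y) (at y within {y0..1})"
    and "(bQ nu z has_vector_derivative - (z\<^sup>2 * of_real (y powr (2*nu+1)) * bV nu z y)) (at y within {y0..1})"
proof -
  have y01: "y0 \<le> 1" using y by auto
  obtain K where K: "K \<ge> 1" "\<And>n y. y \<in> {y0..1} \<Longrightarrow> \<bar>bQc nu n y\<bar> \<le> K * K ^ n / fact n"
     "\<And>n y. y \<in> {y0..1} \<Longrightarrow> \<bar>bVc nu n y\<bar> \<le> K * K ^ n / fact n"
     "\<And>y. y \<in> {y0..1} \<Longrightarrow> y powr (2*nu+1) \<le> K \<and> y powr (-(2*nu+1)) \<le> K"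
    using bQc_bVc_exp_bound[OF y0 y01, of nu] by blast
  define M where "M n = K * (K * (inverse (fact n) * (K * norm (z\<^sup>2)) ^ n))" for n
  have sM: "summable M" unfolding M_def by (intro summable_mult summable_exp)
  have bnd: "norm (of_real (p * c) * (z\<^sup>2) ^ n) \<le> M n" if "0 \<le> p" "p \<le> K" "\<bar>c\<bar> \<le> K * K ^ n / fact n" for p c n
  proof -
    have "norm (of_real (p * c) * (z\<^sup>2) ^ n) = p * \<bar>c\<bar> * norm (z\<^sup>2) ^ n" using that by (simp add: norm_mult norm_power)
    also have "... \<le> K * (K * K ^ n / fact n) * norm (z\<^sup>2) ^ n" using that K by (intro mult_right_mono mult_mono) auto
    finally show ?thesis unfolding M_def by (simp add: power_mult_distrib divide_inverse mult_ac)
  qed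
  have sV: "summable (\<lambda>n. of_real (bVc nu n x) * (z\<^sup>2) ^ n)" and sQ: "summable (\<lambda>n. of_real (bQc nu n x) * (z\<^sup>2) ^ n)"
    if "x \<in> {y0..1}" for x by (rule summable_exp_type[OF _ K(1)], rule K(2,3)[OF that])+
  have "((\<lambda>y. \<Sum>n. of_real (bVc nu n y) * (z\<^sup>2) ^ n) has_vector_derivative
      (\<Sum>n. of_real (y powr (-(2*nu+1)) * bQc nu n y) * (z\<^sup>2) ^ n)) (at y within {y0..1})"
  proof (rule has_vector_derivative_series[OF _ y _ _ sM])
    fix n x assume x: "x \<in> {y0..1}"
    show "((\<lambda>y. of_real (bVc nu n y) * (z\<^sup>2) ^ n) has_vector_derivative of_real (x powr (-(2*nu+1)) * bQc nu n x) * (z\<^sup>2) ^ n) (at x within {y0..1})"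
      by (intro has_vector_derivative_mult_left has_vector_derivative_of_real bVc_deriv[OF y0 x])
    show "norm (of_real (x powr (-(2*nu+1)) * bQc nu n x) * (z\<^sup>2) ^ n) \<le> M n"
      by (rule bnd) (use K x in auto)
  qed (use sV in auto)
  moreover have "(\<Sum>n. of_real (y powr (-(2*nu+1)) * bQc nu n y) * (z\<^sup>2) ^ n) = of_real (y powr (-(2*nu+1))) * bQ nu z y"
    unfolding bQ_def suminf_mult[OF sQ[OF y], symmetric] by (simp add: mult.assoc)
  ultimately show "(bV nu z has_vector_derivative of_real (y powr (-(2*nu+1))) * bQ nu z y) (at y within {y0..1})"
    by (simp add: bV_def[abs_def])
  \<comment> \<open>The derivative of the n-th coefficient of Q involves coefficient n - 1 of V, and
    coefficient 0 of Q is constant; this shift of the index produces the factor z^2.\<close>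
  define c where "c n x = (case n of 0 \<Rightarrow> 0 | Suc k \<Rightarrow> - (x powr (2*nu+1) * bVc nu k x))" for n x
  define N where "N n = (case n of 0 \<Rightarrow> 0 | Suc k \<Rightarrow> norm (z\<^sup>2) * M k)" for n
  have sN: "summable N" unfolding summable_Suc_iff[of N, symmetric] by (simp add: N_def summable_mult sM)
  have "((\<lambda>y. \<Sum>n. of_real (bQc nu n y) * (z\<^sup>2) ^ n) has_vector_derivative
      (\<Sum>n. of_real (c n y) * (z\<^sup>2) ^ n)) (at y within {y0..1})"
  proof (rule has_vector_derivative_series[OF _ y _ _ sN])
    fix n x assume x: "x \<in> {y0..1}"
    have "(bQc nu n has_real_derivative c n x) (at x within {y0..1})"
      using bQc_deriv[OF y0 x]
      by (cases n) (auto simp: c_def simp del: bQc.simps(2))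
    thus "((\<lambda>y. of_real (bQc nu n y) * (z\<^sup>2) ^ n) has_vector_derivative of_real (c n x) * (z\<^sup>2) ^ n) (at x within {y0..1})"
      by (intro has_vector_derivative_mult_left has_vector_derivative_of_real)
    show "norm (of_real (c n x) * (z\<^sup>2) ^ n) \<le> N n"
    proof (cases n)
      case (Suc k)
      have "norm (of_real (c n x) * (z\<^sup>2) ^ n) = norm (z\<^sup>2) * norm (of_real (x powr (2*nu+1) * bVc nu k x) * (z\<^sup>2) ^ k)"
        unfolding Suc c_def by (simp add: norm_mult norm_power)
      also have "... \<le> norm (z\<^sup>2) * M k" by (intro mult_left_mono bnd) (use K x in auto)
      finally show ?thesis by (simp add: Suc N_def)
    qed (simp add: c_def N_def)
  qed (use sQ in auto)
  moreover have "(\<Sum>n. of_real (c n y) * (z\<^sup>2) ^ n) = - (z\<^sup>2 * of_real (y powr (2*nu+1)) * bV nu z y)"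
  proof -
    have "(\<lambda>n. (- (z\<^sup>2) * of_real (y powr (2*nu+1))) * (of_real (bVc nu n y) * (z\<^sup>2) ^ n)) sums (- (z\<^sup>2) * of_real (y powr (2*nu+1)) * bV nu z y)"
      unfolding bV_def by (intro sums_mult summable_sums sV y)
    hence "(\<lambda>n. of_real (c (Suc n) y) * (z\<^sup>2) ^ Suc n) sums (- (z\<^sup>2) * of_real (y powr (2*nu+1)) * bV nu z y)"
      by (simp add: c_def mult_ac)
    hence "(\<lambda>n. of_real (c n y) * (z\<^sup>2) ^ n) sums (- (z\<^sup>2) * of_real (y powr (2*nu+1)) * bV nu z y + of_real (c 0 y) * (z\<^sup>2) ^ 0)"
      by (subst (asm) sums_Suc_iff)
    thus ?thesis by (simp add: sums_iff c_def)
  qed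
  ultimately show "(bQ nu z has_vector_derivative - (z\<^sup>2 * of_real (y powr (2*nu+1)) * bV nu z y)) (at y within {y0..1})"
    by (simp add: bQ_def[abs_def])
qed

lemma bV_at_1: "bV nu z 1 = 0" "bQ nu z 1 = 1"
proof -
  have "bVc nu n 1 = 0" for n by (simp add: bVc_def)
  thus "bV nu z 1 = 0" by (simp add: bV_def)
  have "bQc nu n 1 = (if n = 0 then 1 else 0)" for n by (cases n) auto
  hence "(\<lambda>n. of_real (bQc nu n 1) * (z\<^sup>2) ^ n) = (\<lambda>n. if n = 0 then 1 else 0)" by (auto simp: fun_eq_iff)
  moreover have "(\<lambda>n::nat. if n = 0 then 1 else 0) sums (1::complex)" using sums_single[of 0 "\<lambda>_. 1::complex"] by simp
  ultimately show "bQ nu z 1 = 1" by (simp add: bQ_def sums_iff)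
qed

lemma bV_minus: "bV nu (- z) y = bV nu z y" by (simp add: bV_def)

lemma bV_holomorphic:
  assumes "0 < y" "y \<le> 1"
  shows "(\<lambda>z. bV nu z y) holomorphic_on S"
proof -
  obtain K where K: "K \<ge> 1" "\<And>n. \<bar>bVc nu n y\<bar> \<le> K * K ^ n / fact n"
    using bQc_bVc_exp_bound[OF assms, of nu] assms by fastforce
  define G where "G w = (\<Sum>n. of_real (bVc nu n y) * w ^ n)" for w :: complex
  have "(G has_field_derivative (\<Sum>n. diffs (\<lambda>n. of_real (bVc nu n y)) n * w ^ n)) (at w)" for w
    unfolding G_def[abs_def] by (rule termdiffs_strong_converges_everywhere) (rule summable_exp_type[OF K(2,1)])
  hence "G holomorphic_on UNIV" by (auto simp: holomorphic_on_open)
  moreover have "(\<lambda>z. z\<^sup>2) holomorphic_on S" by (intro holomorphic_intros)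
  ultimately have "(G \<circ> (\<lambda>z. z\<^sup>2)) holomorphic_on S"
    by (metis holomorphic_on_compose holomorphic_on_subset subset_UNIV)
  thus ?thesis by (simp add: o_def G_def bV_def)
qed

section \<open>Size of the boundary solution and its values at the zeros\<close>

text \<open>The same Liouville transform on the interval: y^(nu + 1/2) V satisfies u'' = (- z^2 +
  (nu^2 - 1/4) / y^2) u, and the energy is run from 1 inwards to y. V and Q are arbitrary because
  the lemma serves twice: for the size of \<open>bV\<close>, and, with zero data at 1, as a
  uniqueness theorem.\<close>

lemma radial_energy:
  fixes V Q :: "real \<Rightarrow> complex"
  assumes y: "0 < y" "y \<le> 1" and z: "z \<noteq> 0"
    and V: "\<And>s. s \<in> {y<..<1} \<Longrightarrow> (V has_vector_derivative of_real (s powr (-(2*nu+1))) * Q s) (at s)"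
    and Q: "\<And>s. s \<in> {y<..<1} \<Longrightarrow> (Q has_vector_derivative - (z\<^sup>2 * of_real (s powr (2*nu+1)) * V s)) (at s)"
    and cont: "continuous_on {y..1} V" "continuous_on {y..1} Q"
  shows "norm z * norm (of_real (y powr (nu+1/2)) * V y) \<le>
      sqrt ((norm (of_real (nu+1/2) * V 1 + Q 1))\<^sup>2 + (norm z * norm (V 1))\<^sup>2) * exp (\<bar>Im z\<bar> * (1 - y) + \<bar>nu\<^sup>2 - 1/4\<bar> / (norm z * y))"
proof -
  define a where "a = nu + 1/2"
  have a2: "2*nu+1 = 2*a" by (simp add: a_def)
  define m where "m = \<bar>nu\<^sup>2 - 1/4\<bar>"
  have aa: "a * (a - 1) = nu\<^sup>2 - 1/4" by (simp add: a_def power2_eq_square field_simps)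
  define f where "f s = of_real (s powr a) * V s" for s
  define f' where "f' s = of_real (a * s powr (a - 1)) * V s + of_real (s powr (-a)) * Q s" for s
  define r where "r s = (of_real ((nu\<^sup>2 - 1/4) / s\<^sup>2) :: complex)" for s
  define k where "k = \<i> * z"
  have k: "k \<noteq> 0" "norm k = norm z" "Re k = - Im z" "k\<^sup>2 = - (z\<^sup>2)"
    using z by (auto simp: k_def norm_mult power_mult_distrib)
  have pw: "((\<lambda>s. of_real (s powr c) :: complex) has_vector_derivative of_real (c * s powr (c - 1))) (at s)" if "s > 0" for c s
    by (intro has_vector_derivative_of_real has_real_derivative_powr that)
  have V2: "s powr (2*a) = s powr a * s powr a" "s powr (- (2*a)) = s powr (-a) * s powr (-a)" for s :: real
    by (simp_all flip: powr_add)
  have df: "(f has_vector_derivative f' s) (at s)" if s: "s \<in> {y<..<1}" for s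
  proof -
    have sp: "s > 0" using s y by simp
    have dd: "(f has_vector_derivative of_real (s powr a) * (of_real (s powr (-(2*nu+1))) * Q s) + of_real (a * s powr (a - 1)) * V s) (at s)"
      unfolding f_def[abs_def] by (intro has_vector_derivative_mult pw V s sp)
    have "s powr a * s powr (-(2*nu+1)) = s powr (-a)" unfolding powr_add[symmetric] a2 by simp
    hence e: "of_real (s powr a) * (of_real (s powr (-(2*nu+1))) * Q s) = of_real (s powr (-a)) * Q s"
      by (metis mult.assoc of_real_mult)
    show ?thesis using dd unfolding e f'_def by (simp only: add.commute)
  qed
  have df': "(f' has_vector_derivative (k\<^sup>2 + r s) * f s) (at s)" if s: "s \<in> {y<..<1}" for s
  proof -
    have sp: "s > 0" using s y by simp
    have dd: "((\<lambda>s. of_real a * of_real (s powr (a - 1)) * V s + of_real (s powr (-a)) * Q s) has_vector_derivative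
       (of_real a * of_real (s powr (a-1)) * (of_real (s powr (-(2*nu+1))) * Q s) + of_real a * of_real ((a-1) * s powr (a-1-1)) * V s) +
       (of_real (s powr (-a)) * - (z\<^sup>2 * of_real (s powr (2*nu+1)) * V s) + of_real ((-a) * s powr (-a-1)) * Q s)) (at s)"
      by (intro has_vector_derivative_add has_vector_derivative_mult has_vector_derivative_mult_right pw V Q s sp)
    have e1: "of_real a * of_real (s powr (a-1)) * (of_real (s powr (-(2*nu+1))) * Q s) = - (of_real ((-a) * s powr (-a-1)) * Q s)"
    proof -
      have "s powr (a-1) * s powr (-(2*nu+1)) = s powr (-a-1)" unfolding powr_add[symmetric] a2
        by (rule arg_cong[where f="(powr) s"]) (simp add: algebra_simps)
      hence "of_real (s powr (a-1)) * of_real (s powr (-(2*nu+1))) = (of_real (s powr (-a-1)) :: complex)" by (metis of_real_mult)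
      thus ?thesis by (simp add: mult_ac)
    qed
    have e2: "of_real a * of_real ((a-1) * s powr (a-1-1)) * V s = r s * f s"
    proof -
      have "s powr (a-1-1) = s powr a / s\<^sup>2" using sp by (simp add: powr_diff power2_eq_square)
      thus ?thesis unfolding r_def f_def aa[symmetric] by (simp add: mult_ac)
    qed
    have e3: "of_real (s powr (-a)) * - (z\<^sup>2 * of_real (s powr (2*nu+1)) * V s) = k\<^sup>2 * f s"
    proof -
      have "s powr (-a) * s powr (2*nu+1) = s powr a" unfolding powr_add[symmetric] a2 by simp
      hence "of_real (s powr (-a)) * of_real (s powr (2*nu+1)) = (of_real (s powr a) :: complex)" by (metis of_real_mult)
      thus ?thesis unfolding f_def k(4) by (simp add: mult_ac)
    qed
    have "- W + r s * f s + (k\<^sup>2 * f s + W) = (k\<^sup>2 + r s) * f s" for W by (simp add: algebra_simps)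
    thus ?thesis unfolding f'_def[abs_def] of_real_mult[of a] using dd unfolding e1 e2 e3 by (simp only:)
  qed
  have pc: "continuous_on {y..1} (\<lambda>t. of_real (t powr c) :: complex)" for c
    by (intro continuous_on_of_real powr_cont_pos y)
  have cf: "continuous_on {y..1} f" "continuous_on {y..1} f'"
    unfolding f_def[abs_def] f'_def[abs_def] of_real_mult by (intro continuous_intros cont pc)+
  define D where "D s = - m / (norm z * s)" for s
  have cD: "continuous_on {y..1} D" unfolding D_def using y z by (intro continuous_intros) auto
  have dD: "(D has_real_derivative m / (norm z * s\<^sup>2)) (at s)" if "s \<in> {y<..<1}" for s
    unfolding D_def[abs_def] using that y z by (auto intro!: derivative_eq_intros simp: power2_eq_square field_simps)
  have "ode_energy k (f y) (f' y) \<le> ode_energy k (f 1) (f' 1) * exp (2 * \<bar>Re k\<bar> * (1 - y) + (D 1 - D y))"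
  proof (rule ode_energy_bounds(2)[OF y(2) k(1) df df' dD _ cf cD])
    fix s assume s: "s \<in> {y<..<1}"
    have "norm (r s) = m / s\<^sup>2" unfolding r_def norm_of_real m_def by simp
    also have "m / s\<^sup>2 = norm k * (m / (norm z * s\<^sup>2))" using z k(2) by simp
    finally show "norm (r s) \<le> norm k * (m / (norm z * s\<^sup>2))" by simp
  qed auto
  also have "... \<le> ode_energy k (f 1) (f' 1) * exp (2 * (\<bar>Im z\<bar> * (1 - y) + m / (norm z * y)))"
  proof (intro mult_left_mono)
    have "m / norm z \<ge> 0" "m / (norm z * y) \<ge> 0" using y by (auto simp: m_def)
    thus "exp (2 * \<bar>Re k\<bar> * (1 - y) + (D 1 - D y)) \<le> exp (2 * (\<bar>Im z\<bar> * (1 - y) + m / (norm z * y)))"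
      by (simp add: D_def k(3))
  qed (simp add: ode_energy_def)
  also have "ode_energy k (f 1) (f' 1) = (norm (of_real a * V 1 + Q 1))\<^sup>2 + (norm z * norm (V 1))\<^sup>2"
    by (simp add: ode_energy_def f_def f'_def k(2) power_mult_distrib)
  finally have e: "ode_energy k (f y) (f' y) \<le> ((norm (of_real a * V 1 + Q 1))\<^sup>2 + (norm z * norm (V 1))\<^sup>2) * exp (2 * (\<bar>Im z\<bar> * (1 - y) + m / (norm z * y)))" .
  have "(norm z * norm (f y))\<^sup>2 \<le> ode_energy k (f y) (f' y)" by (simp add: ode_energy_def k(2) power_mult_distrib)
  also note e
  also have "((norm (of_real a * V 1 + Q 1))\<^sup>2 + (norm z * norm (V 1))\<^sup>2) * exp (2 * (\<bar>Im z\<bar> * (1 - y) + m / (norm z * y)))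
      = (sqrt ((norm (of_real a * V 1 + Q 1))\<^sup>2 + (norm z * norm (V 1))\<^sup>2) * exp (\<bar>Im z\<bar> * (1 - y) + m / (norm z * y)))\<^sup>2"
    unfolding power_mult_distrib exp_double by simp
  finally have "norm z * norm (f y) \<le> sqrt ((norm (of_real a * V 1 + Q 1))\<^sup>2 + (norm z * norm (V 1))\<^sup>2) * exp (\<bar>Im z\<bar> * (1 - y) + m / (norm z * y))"
    by (rule power2_le_imp_le) simp
  thus ?thesis by (simp only: f_def a_def m_def)
qed

lemma bV_bQ_deriv:
  assumes "0 < y" "s \<in> {y<..<1}"
  shows "(bV nu z has_vector_derivative of_real (s powr (-(2*nu+1))) * bQ nu z s) (at s)"
    and "(bQ nu z has_vector_derivative - (z\<^sup>2 * of_real (s powr (2*nu+1)) * bV nu z s)) (at s)"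
  using bV_bQ_deriv_within[of y s nu z] assms at_within_Icc_at[of y s 1] by auto

lemma bV_bQ_continuous:
  assumes "0 < y"
  shows "continuous_on {y..1} (bV nu z)" "continuous_on {y..1} (bQ nu z)"
  by (rule continuous_on_vector_derivative, rule bV_bQ_deriv_within[OF assms], assumption)+

text \<open>The data V(1) = 0, Q(1) = 1 have energy 1. The exponent |nu^2 - 1/4| / (|z| y) is what
  demands |z| y >= 1/2. This is affordable because y will be the larger of the two
  variables.\<close>

lemma bV_bound:
  assumes y: "0 < y" "y \<le> 1" and zy: "norm z * y \<ge> 1/2"
  shows "norm (bV nu z y) \<le> exp (2 * \<bar>nu\<^sup>2 - 1/4\<bar>) * y powr (-(nu+1/2)) * exp (\<bar>Im z\<bar> * (1 - y)) / norm z"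
proof -
  have z: "z \<noteq> 0" using zy by auto
  define m where "m = \<bar>nu\<^sup>2 - 1/4\<bar>"
  have "norm z * norm (of_real (y powr (nu+1/2)) * bV nu z y) \<le>
      sqrt ((norm (of_real (nu+1/2) * bV nu z 1 + bQ nu z 1))\<^sup>2 + (norm z * norm (bV nu z 1))\<^sup>2) * exp (\<bar>Im z\<bar> * (1 - y) + m / (norm z * y))"
    unfolding m_def by (rule radial_energy[OF y z bV_bQ_deriv[OF y(1)] bV_bQ_continuous[OF y(1)]])
  also have "... = exp (\<bar>Im z\<bar> * (1 - y) + m / (norm z * y))" by (simp add: bV_at_1)
  also have "... \<le> exp (\<bar>Im z\<bar> * (1 - y) + 2 * m)"
  proof -
    have "m / (norm z * y) \<le> m / (1/2)" using zy by (intro divide_left_mono) (auto simp: m_def)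
    thus ?thesis by simp
  qed
  finally have 1: "norm z * (y powr (nu+1/2) * norm (bV nu z y)) \<le> exp (\<bar>Im z\<bar> * (1 - y) + 2 * m)" by (simp add: norm_mult)
  have yy: "y powr (nu+1/2) * y powr (-(nu+1/2)) = 1" unfolding powr_add[symmetric] using y by simp
  have "N = (Z * (A * N)) * (B / Z)" if "Z \<noteq> 0" "A * B = 1" for A B Z N :: real
    using that by (simp add: mult_ac)
  from this[OF _ yy, of "norm z" "norm (bV nu z y)"]
  have "norm (bV nu z y) = (norm z * (y powr (nu+1/2) * norm (bV nu z y))) * (y powr (-(nu+1/2)) / norm z)"
    using z by simp
  also have "... \<le> exp (\<bar>Im z\<bar> * (1 - y) + 2 * m) * (y powr (-(nu+1/2)) / norm z)"
    by (intro mult_right_mono 1) auto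
  finally show ?thesis by (simp add: exp_add m_def mult_ac)
qed

lemma bphi_succ_nz: "nu > -1 \<Longrightarrow> s \<in> bzeros nu \<Longrightarrow> bphi (nu+1) s \<noteq> 0"
proof
  assume nu: "nu > -1" and s: "s \<in> bzeros nu" and z: "bphi (nu+1) s = 0"
  obtain c where "c > 0" "\<And>s. s \<in> bzeros nu \<Longrightarrow> c \<le> s powr (nu + 1/2) * \<bar>s * bphi (nu+1) s\<bar>"
    using zeros_facts[OF nu] by blast
  from this(2)[OF s] this(1) z show False by simp
qed

text \<open>At a zero s the function \<open>bphi nu (s * y)\<close> of y itself solves the radial
  equation and vanishes at 1, so V is the multiple of it whose flux at 1 equals 1. Uniqueness is
  \<open>radial_energy\<close> for the difference, whose data at 1 vanish.\<close>

lemma bV_at_zero: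
  assumes nu: "nu > -1" and s: "s \<in> bzeros nu" and y: "0 < y" "y \<le> 1"
  shows "bV nu (of_real s) y = of_real (- bphi nu (s * y) / (s\<^sup>2 * bphi (nu+1) s))"
proof -
  have sp: "s > 0" "bphi nu s = 0" using s by (auto simp: bzeros_def)
  have n1: "nu+1 > -1" using nu by simp
  have nz: "bphi (nu+1) s \<noteq> 0" by (rule bphi_succ_nz[OF nu s])
  define z where "z = (of_real s :: complex)"
  have z: "z \<noteq> 0" using sp by (simp add: z_def)
  define U where "U x = bphi nu (z * of_real x)" for x :: real
  define P where "P x = - (z\<^sup>2) * (of_real (x powr (2*nu+2)) * bphi (nu+1) (z * of_real x))" for x :: real
  define c where "c = 1 / P 1"
  have phz: "bphi nu z = 0" "bphi (nu+1) z = of_real (bphi (nu+1) s)"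
    unfolding z_def using sp bphi_of_real[OF nu, of s] bphi_of_real[OF n1, of s] by auto
  have P1: "P 1 = - (z\<^sup>2 * of_real (bphi (nu+1) s))" by (simp add: P_def phz)
  have P1nz: "P 1 \<noteq> 0" unfolding P1 using z nz by simp
  have dU: "(U has_vector_derivative of_real (x powr (-(2*nu+1))) * P x) (at x)" if x: "x > 0" for x
  proof -
    have "x powr (-(2*nu+1)) * x powr (2*nu+2) = x"
      unfolding powr_add[symmetric] using x by simp
    hence "of_real (x powr (-(2*nu+1))) * of_real (x powr (2*nu+2)) = (of_real x :: complex)" by (metis of_real_mult)
    moreover have "A * (- (z\<^sup>2) * (B * W)) = - (z\<^sup>2 * (A * B) * W)" for A B W by (simp add: mult_ac)
    ultimately have "of_real (x powr (-(2*nu+1))) * P x = - (z\<^sup>2 * of_real x * bphi (nu+1) (z * of_real x))"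
      unfolding P_def by (simp only:)
    thus ?thesis unfolding U_def[abs_def] using bphi_ray_deriv(1)[OF nu x, of z] by simp
  qed
  have dP: "(P has_vector_derivative - (z\<^sup>2 * of_real (x powr (2*nu+1)) * U x)) (at x)" if x: "x > 0" for x
    unfolding P_def[abs_def] U_def
    using has_vector_derivative_mult_right[OF bphi_ray_deriv(2)[OF nu x, of z], of "- (z\<^sup>2)"] by (simp add: mult_ac)
  have contU: "continuous_on {y..1} U" "continuous_on {y..1} P"
    by (intro continuous_at_imp_continuous_on ballI has_vector_derivative_continuous[OF dU] has_vector_derivative_continuous[OF dP];
        use y in simp)+
  have "norm z * norm (of_real (y powr (nu+1/2)) * (bV nu z y - c * U y)) \<le>
      sqrt ((norm (of_real (nu+1/2) * (bV nu z 1 - c * U 1) + (bQ nu z 1 - c * P 1)))\<^sup>2 + (norm z * norm (bV nu z 1 - c * U 1))\<^sup>2)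
       * exp (\<bar>Im z\<bar> * (1 - y) + \<bar>nu\<^sup>2 - 1/4\<bar> / (norm z * y))"
  proof (rule radial_energy[OF y z, where V="\<lambda>y. bV nu z y - c * U y" and Q="\<lambda>y. bQ nu z y - c * P y"])
    fix t assume t: "t \<in> {y<..<1}"
    hence tp: "t > 0" using y by simp
    show "((\<lambda>y. bV nu z y - c * U y) has_vector_derivative of_real (t powr (-(2*nu+1))) * (bQ nu z t - c * P t)) (at t)"
      by (rule has_vector_derivative_eq_rhs[OF has_vector_derivative_diff[OF bV_bQ_deriv(1)[OF y(1) t] has_vector_derivative_mult_right[OF dU[OF tp]]]])
        (simp add: algebra_simps)
    show "((\<lambda>y. bQ nu z y - c * P y) has_vector_derivative - (z\<^sup>2 * of_real (t powr (2*nu+1)) * (bV nu z t - c * U t))) (at t)"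
      by (rule has_vector_derivative_eq_rhs[OF has_vector_derivative_diff[OF bV_bQ_deriv(2)[OF y(1) t] has_vector_derivative_mult_right[OF dP[OF tp]]]])
        (simp add: algebra_simps)
  qed (intro continuous_intros bV_bQ_continuous y contU)+
  also have "... = 0" using P1nz by (simp add: bV_at_1 c_def U_def phz)
  finally have "bV nu z y = c * U y" using z y by (simp add: mult_le_0_iff)
  moreover have "U y = of_real (bphi nu (s * y))" unfolding U_def z_def of_real_mult[symmetric] by (rule bphi_of_real[OF nu])
  ultimately show ?thesis unfolding c_def P1 z_def by simp
qed

section \<open>The kernel as a contour integral\<close>

text \<open>Half of the product of the normalised eigenfunctions at x and y, see
  \<open>npsi_mult\<close>. Free of square roots and absolute values, it is what the residues
  produce.\<close>

definition zero_term :: "real \<Rightarrow> real \<Rightarrow> real \<Rightarrow> real \<Rightarrow> real" where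
  "zero_term nu s x y = bphi nu (s * x) * bphi nu (s * y) / (s * bphi (nu+1) s)\<^sup>2"

lemma bphi_zeros_complex:
  fixes z :: complex
  assumes nu: "nu > -1"
  shows "bphi nu z = 0 \<longleftrightarrow> (\<exists>s\<in>bzeros nu. z = of_real s \<or> z = - of_real s)"
proof
  assume z: "bphi nu z = 0"
  hence "Im z = 0" by (rule bphi_zero_real[OF nu])
  then obtain t where t: "z = of_real t" by (metis complex_is_Real_iff Reals_cases)
  hence b: "bphi nu t = 0" using z bphi_of_real[OF nu, of t, where 'a=complex] by simp
  have "t \<noteq> 0" using b bphi_0[OF nu] by auto
  thus "\<exists>s\<in>bzeros nu. z = of_real s \<or> z = - of_real s"
  proof (cases "t > 0")
    case True thus ?thesis using b t by (auto simp: bzeros_def)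
  next
    case False
    hence "- t \<in> bzeros nu" using b \<open>t \<noteq> 0\<close> by (simp add: bzeros_def)
    thus ?thesis using t by (intro bexI[of _ "- t"]) auto
  qed
next
  assume "\<exists>s\<in>bzeros nu. z = of_real s \<or> z = - of_real s"
  then obtain s where "s \<in> bzeros nu" "z = of_real s \<or> z = - of_real s" by blast
  thus "bphi nu z = 0" using bphi_of_real[OF nu, of s, where 'a=complex] by (auto simp: bzeros_def)
qed

lemma residue_quotient:
  assumes S: "open S" "p \<in> S" and h: "h holomorphic_on S" and g: "g holomorphic_on S"
    and gz: "\<And>w. w \<in> S \<Longrightarrow> g w = 0 \<longleftrightarrow> w = p" and d: "(g has_field_derivative g') (at p)" "g' \<noteq> (0::complex)"
  shows "residue (\<lambda>w. h w / g w) p = h p / g'"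
proof (rule residue_simple'[OF S])
  show "(\<lambda>w. h w / g w) holomorphic_on S - {p}"
    using gz by (intro holomorphic_on_divide holomorphic_on_subset[OF h] holomorphic_on_subset[OF g]) auto
  have "g p = 0" using gz[OF S(2)] by simp
  hence "((\<lambda>w. g w / (w - p)) \<longlongrightarrow> g') (at p)"
    using d(1) by (simp add: has_field_derivative_iff)
  moreover have "(h \<longlongrightarrow> h p) (at p)"
    using holomorphic_on_imp_continuous_on[OF h] S by (meson continuous_on_eq_continuous_at isCont_def)
  ultimately have "((\<lambda>w. h w / (g w / (w - p))) \<longlongrightarrow> h p / g') (at p)" using d(2) by (intro tendsto_divide)
  thus "((\<lambda>w. h w / g w * (w - p)) \<longlongrightarrow> h p / g') (at p)" by simp
qed

lemma bphi_holomorphic: "nu > -1 \<Longrightarrow> bphi nu holomorphic_on S"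
  using bphi_deriv by (auto simp: holomorphic_on_def field_differentiable_def intro: has_field_derivative_at_within)

lemma bphi_scaled_holomorphic:
  assumes "nu > -1" shows "(\<lambda>z. bphi nu (z * of_real x)) holomorphic_on S"
proof -
  have "(bphi nu \<circ> (\<lambda>z. z * of_real x)) holomorphic_on S"
    by (rule holomorphic_on_compose[OF _ bphi_holomorphic[OF assms]]) (intro holomorphic_intros)
  thus ?thesis by (simp add: o_def)
qed

text \<open>At a zero s the denominator has derivative - s \<open>bphi (nu+1) s\<close>, and V has
  s^2 \<open>bphi (nu+1) s\<close> in its own denominator; the factor z balances the powers of s so
  that the residue is \<open>zero_term\<close> times m. For even m it also makes the integrand odd,
  so that s and - s have the same residue.\<close>

definition kernel_integrand :: "real \<Rightarrow> (complex \<Rightarrow> complex) \<Rightarrow> real \<Rightarrow> real \<Rightarrow> complex \<Rightarrow> complex" where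
  "kernel_integrand nu m x y z = m z * z * bphi nu (z * of_real x) * bV nu z y / bphi nu z"

lemma kernel_residue:
  fixes m :: "complex \<Rightarrow> complex"
  assumes nu: "nu > -1" and y: "0 < y" "y \<le> 1"
    and m: "m holomorphic_on {z. \<bar>Re z\<bar> < R}" and me: "\<And>z. m (-z) = m z"
    and s: "s \<in> bzeros nu" "s < R" and p: "p = of_real s \<or> p = - of_real s"
  shows "residue (kernel_integrand nu m x y) p = m (of_real s) * of_real (zero_term nu s x y)"
proof -
  have n1: "nu+1 > -1" using nu by simp
  have sp: "s > 0" "bphi nu s = 0" using s by (auto simp: bzeros_def)
  define H where "H z = m z * z * bphi nu (z * of_real x) * bV nu z y" for z
  obtain g where g: "g > 0" "\<And>s t. s \<in> bzeros nu \<Longrightarrow> t \<in> bzeros nu \<Longrightarrow> s < t \<Longrightarrow> t - s \<ge> g"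
    using zeros_facts[OF nu] by blast
  \<comment> \<open>The ball around p stays in the strip where m is holomorphic, contains no other
    zero of the same sign because of the separation g, and none of the opposite sign because r <=
    s.\<close>
  define r where "r = min g (min s (R - s))"
  have r: "r > 0" "r \<le> g" "r \<le> s" "r \<le> R - s" using g sp s by (auto simp: r_def)
  have pr: "\<bar>Re p\<bar> = s" "p = of_real (Re p)" using p sp by auto
  have sub: "ball p r \<subseteq> {z. \<bar>Re z\<bar> < R}"
  proof
    fix w assume "w \<in> ball p r"
    hence "\<bar>Re (w - p)\<bar> < r" using abs_Re_le_cmod[of "w - p"] by (simp add: dist_norm norm_minus_commute)
    thus "w \<in> {z. \<bar>Re z\<bar> < R}" using pr(1) r by auto
  qed
  have holx: "(\<lambda>z. bphi nu (z * of_real x)) holomorphic_on ball p r"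
    by (rule bphi_scaled_holomorphic[OF nu])
  have holH: "H holomorphic_on ball p r" unfolding H_def[abs_def]
    by (intro holomorphic_intros holx bV_holomorphic y holomorphic_on_subset[OF m sub])
  have zero: "bphi nu w = 0 \<longleftrightarrow> w = p" if w: "w \<in> ball p r" for w
  proof
    assume "bphi nu w = 0"
    then obtain t where t: "t \<in> bzeros nu" "w = of_real t \<or> w = - of_real t" using bphi_zeros_complex[OF nu] by blast
    have tp: "t > 0" using t by (simp add: bzeros_def)
    have wd: "norm (p - w) < r" using w by (simp add: dist_norm)
    have same: "\<exists>e. (e = 1 \<or> e = (-1::complex)) \<and> p = e * of_real s \<and> w = e * of_real t"
    proof -
      have False if "p = of_real s" "w = - of_real t"
      proof -
        have "norm (p - w) = s + t" unfolding that using sp tp by (simp flip: of_real_add)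
        thus False using wd r tp by linarith
      qed
      moreover have False if "p = - of_real s" "w = of_real t"
      proof -
        have "p - w = - of_real (s + t)" unfolding that by simp
        hence "norm (p - w) = s + t" using sp tp by (simp only: norm_minus_cancel norm_of_real)
        thus False using wd r tp by linarith
      qed
      ultimately have "p = of_real s \<and> w = of_real t \<or> p = - of_real s \<and> w = - of_real t" using p t(2) by blast
      thus ?thesis
      proof
        assume "p = of_real s \<and> w = of_real t" thus ?thesis by (intro exI[of _ 1]) simp
      next
        assume "p = - of_real s \<and> w = - of_real t" thus ?thesis by (intro exI[of _ "-1"]) simp
      qed
    qed
    then obtain e :: complex where e: "norm e = 1" "p = e * of_real s" "w = e * of_real t" by (metis norm_minus_cancel norm_one)
    have "p - w = e * of_real (s - t)" unfolding e by (simp add: algebra_simps)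
    hence "norm (p - w) = \<bar>s - t\<bar>" using e(1) by (simp only: norm_mult norm_of_real mult_1)
    hence "\<bar>s - t\<bar> < g" using wd r by simp
    hence "s = t" using g(2)[OF s(1) t(1)] g(2)[OF t(1) s(1)] by linarith
    thus "w = p" using e by simp
  next
    assume "w = p" thus "bphi nu w = 0" using p s bphi_zeros_complex[OF nu] by blast
  qed
  have pz: "bphi (nu+1) p = of_real (bphi (nu+1) s)" using p bphi_of_real[OF n1, of s, where 'a=complex] by auto
  have nz: "bphi (nu+1) s \<noteq> 0" by (rule bphi_succ_nz[OF nu s(1)])
  have "residue (\<lambda>w. H w / bphi nu w) p = H p / (- p * bphi (nu+1) p)"
  proof (rule residue_quotient[OF open_ball _ holH bphi_holomorphic[OF nu] zero bphi_deriv[OF nu]])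
    show "- p * bphi (nu+1) p \<noteq> 0" using p sp nz by (auto simp: pz)
  qed (use r in auto)
  also have "H p / (- p * bphi (nu+1) p) = m (of_real s) * of_real (zero_term nu s x y)"
  proof -
    have pnz: "p \<noteq> 0" using p sp by auto
    have mp: "m p = m (of_real s)" using p me[of "of_real s"] by auto
    have "bphi nu (p * of_real x) = bphi nu (of_real s * of_real x)"
      using p bphi_minus[of nu "of_real s * of_real x :: complex"] by auto
    also have "... = of_real (bphi nu (s * x))" unfolding of_real_mult[symmetric] by (rule bphi_of_real[OF nu])
    finally have b: "bphi nu (p * of_real x) = of_real (bphi nu (s * x))" .
    have v: "bV nu p y = of_real (- bphi nu (s * y) / (s\<^sup>2 * bphi (nu+1) s))"
      using p bV_at_zero[OF nu s(1) y] bV_minus[of nu "of_real s" y] by auto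
    have "H p / (- p * bphi (nu+1) p) = m (of_real s) * (of_real (bphi nu (s * x)) * of_real (- bphi nu (s * y) / (s\<^sup>2 * bphi (nu+1) s)) / - of_real (bphi (nu+1) s))"
      unfolding H_def mp b v pz using pnz by simp
    also have "of_real (bphi nu (s * x)) * of_real (- bphi nu (s * y) / (s\<^sup>2 * bphi (nu+1) s)) / - of_real (bphi (nu+1) s)
      = (of_real (bphi nu (s * x) * (- bphi nu (s * y) / (s\<^sup>2 * bphi (nu+1) s)) / - bphi (nu+1) s) :: complex)" by simp
    also have "bphi nu (s * x) * (- bphi nu (s * y) / (s\<^sup>2 * bphi (nu+1) s)) / - bphi (nu+1) s = zero_term nu s x y"
      by (simp add: zero_term_def power2_eq_square)
    finally show ?thesis .
  qed
  finally show ?thesis unfolding kernel_integrand_def[abs_def] H_def .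
qed

text \<open>Twice the usual 2 pi i, because s and - s both lie inside the rectangle and contribute
  equally. Zeros between X and R belong to the region of the residue theorem but have winding number
  0.\<close>

lemma kernel_contour:
  fixes m :: "complex \<Rightarrow> complex"
  assumes nu: "nu > -1" and y: "0 < y" "y \<le> 1"
    and m: "m holomorphic_on {z. \<bar>Re z\<bar> < R}" and me: "\<And>z. m (-z) = m z"
    and X: "0 < X" "X < R" "X \<notin> bzeros nu" and T: "T > 0"
  shows "contour_integral (rectpath (Complex (-X) (-T)) (Complex X T)) (kernel_integrand nu m x y)
     = 4 * of_real pi * \<i> * (\<Sum>s\<in>{s\<in>bzeros nu. s < X}. m (of_real s) * of_real (zero_term nu s x y))"
proof -
  define S where "S = {z. \<bar>Re z\<bar> < R}"
  define Z where "Z = {s\<in>bzeros nu. s < R}"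
  have finZ: "finite Z" unfolding Z_def by (rule finite_bzeros_less[OF nu])
  have Zpos: "s > 0" if "s \<in> Z" for s using that by (simp add: Z_def bzeros_def)
  define P :: "complex set" where "P = of_real ` Z \<union> (\<lambda>s. - of_real s) ` Z"
  define a1 where "a1 = Complex (-X) (-T)"
  define a3 where "a3 = Complex X T"
  let ?F = "kernel_integrand nu m x y"
  have S: "S = {z. Re z < R} \<inter> {z. Re z > - R}" by (auto simp: S_def)
  have oS: "open S" unfolding S by (intro open_Int open_halfspace_Re_lt open_halfspace_Re_gt)
  have cS: "convex S" unfolding S by (intro convex_Int convex_halfspace_Re_lt convex_halfspace_Re_gt)
  have zP: "bphi nu z \<noteq> 0" if "z \<in> S - P" for z
  proof
    assume "bphi nu z = 0"
    then obtain s where s: "s \<in> bzeros nu" "z = of_real s \<or> z = - of_real s" using bphi_zeros_complex[OF nu] by blast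
    hence "s < R" using that by (auto simp: S_def)
    hence "z \<in> P" using s by (auto simp: P_def Z_def)
    thus False using that by blast
  qed
  have holx: "(\<lambda>z. bphi nu (z * of_real x)) holomorphic_on S - P"
    by (rule bphi_scaled_holomorphic[OF nu])
  have holF: "?F holomorphic_on S - P" unfolding kernel_integrand_def[abs_def]
    by (intro holomorphic_intros holx bV_holomorphic y bphi_holomorphic nu zP holomorphic_on_subset[OF m]) (auto simp: S_def)
  have sub: "cbox a1 a3 \<subseteq> S" using X by (auto simp: S_def a1_def a3_def in_cbox_complex_iff)
  have img: "path_image (rectpath a1 a3) \<subseteq> S - P"
  proof
    fix z assume z: "z \<in> path_image (rectpath a1 a3)"
    have "z \<in> cbox a1 a3" using z path_image_rectpath_subset_cbox[of a1 a3] X T by (auto simp: a1_def a3_def)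
    moreover have "z \<notin> P"
    proof
      assume "z \<in> P"
      then obtain s where s: "s \<in> Z" "z = of_real s \<or> z = - of_real s" by (auto simp: P_def)
      have "s \<noteq> X" using s X by (auto simp: Z_def)
      moreover have "z \<in> {z. Re z \<in> {Re a1, Re a3} \<and> Im z \<in> {Im a1..Im a3}} \<union> {z. Im z \<in> {Im a1, Im a3} \<and> Re z \<in> {Re a1..Re a3}}"
        using z X T by (subst (asm) path_image_rectpath) (auto simp: a1_def a3_def)
      ultimately show False using s T Zpos[OF s(1)] X by (auto simp: a1_def a3_def)
    qed
    ultimately show "z \<in> S - P" using sub by blast
  qed
  have wn0: "winding_number (rectpath a1 a3) z = 0" if "z \<notin> cbox a1 a3" for z
    using that X T by (intro winding_number_rectpath_outside) (auto simp: a1_def a3_def)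
  have wn: "winding_number (rectpath a1 a3) p = (if s < X then 1 else 0)" if s: "s \<in> Z" and p: "p = of_real s \<or> p = - of_real s" for s p
  proof (cases "s < X")
    case True
    have "p \<in> box a1 a3" using p True Zpos[OF s] T by (auto simp: a1_def a3_def in_box_complex_iff)
    thus ?thesis using True winding_number_rectpath by simp
  next
    case False
    have "s \<noteq> X" using s X by (auto simp: Z_def)
    hence "p \<notin> cbox a1 a3" using p False Zpos[OF s] X by (auto simp: a1_def a3_def in_cbox_complex_iff)
    thus ?thesis using False wn0 by simp
  qed
  have "contour_integral (rectpath a1 a3) ?F = 2 * pi * \<i> * (\<Sum>p\<in>P. winding_number (rectpath a1 a3) p * residue ?F p)"
  proof (rule Residue_theorem[OF oS convex_connected[OF cS] _ holF _ _ img])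
    show "\<forall>z. z \<notin> S \<longrightarrow> winding_number (rectpath a1 a3) z = 0" using wn0 sub by blast
  qed (use finZ in \<open>auto simp: P_def\<close>)
  also have "(\<Sum>p\<in>P. winding_number (rectpath a1 a3) p * residue ?F p)
      = (\<Sum>p\<in>of_real ` Z. winding_number (rectpath a1 a3) p * residue ?F p) + (\<Sum>p\<in>(\<lambda>s. - of_real s) ` Z. winding_number (rectpath a1 a3) p * residue ?F p)"
    unfolding P_def
  proof (rule sum.union_disjoint)
    show "of_real ` Z \<inter> (\<lambda>s. - of_real s) ` Z = ({} :: complex set)"
    proof -
      have "of_real s \<noteq> (- of_real t :: complex)" if "s \<in> Z" "t \<in> Z" for s t
      proof
        assume "of_real s = (- of_real t :: complex)"
        hence "s = - t" by (simp flip: of_real_minus add: of_real_eq_iff)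
        thus False using Zpos[OF that(1)] Zpos[OF that(2)] by linarith
      qed
      thus ?thesis by auto
    qed
  qed (use finZ in auto)
  also have "(\<Sum>p\<in>of_real ` Z. winding_number (rectpath a1 a3) p * residue ?F p) = (\<Sum>s\<in>Z. if s < X then m (of_real s) * of_real (zero_term nu s x y) else 0)"
  proof (subst sum.reindex)
    show "inj_on of_real Z" by (auto simp: inj_on_def)
    have "winding_number (rectpath a1 a3) (of_real s) * residue ?F (of_real s) = (if s < X then m (of_real s) * of_real (zero_term nu s x y) else 0)"
      if s: "s \<in> Z" for s
      using wn[OF s, of "of_real s"] kernel_residue[OF nu y m me, of s "of_real s" x] s by (auto simp: Z_def)
    thus "sum ((\<lambda>p. winding_number (rectpath a1 a3) p * residue ?F p) \<circ> of_real) Z = (\<Sum>s\<in>Z. if s < X then m (of_real s) * of_real (zero_term nu s x y) else 0)"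
      by (simp add: o_def)
  qed
  also have "(\<Sum>p\<in>(\<lambda>s. - of_real s) ` Z. winding_number (rectpath a1 a3) p * residue ?F p) = (\<Sum>s\<in>Z. if s < X then m (of_real s) * of_real (zero_term nu s x y) else 0)"
  proof (subst sum.reindex)
    show "inj_on (\<lambda>s. - of_real s :: complex) Z" by (auto simp: inj_on_def)
    have "winding_number (rectpath a1 a3) (- of_real s) * residue ?F (- of_real s) = (if s < X then m (of_real s) * of_real (zero_term nu s x y) else 0)"
      if s: "s \<in> Z" for s
      using wn[OF s, of "- of_real s"] kernel_residue[OF nu y m me, of s "- of_real s" x] s by (auto simp: Z_def)
    thus "sum ((\<lambda>p. winding_number (rectpath a1 a3) p * residue ?F p) \<circ> (\<lambda>s. - of_real s)) Z = (\<Sum>s\<in>Z. if s < X then m (of_real s) * of_real (zero_term nu s x y) else 0)"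
      by (simp add: o_def)
  qed
  also have "(\<Sum>s\<in>Z. if s < X then m (of_real s) * of_real (zero_term nu s x y) else 0) = (\<Sum>s\<in>{s\<in>bzeros nu. s < X}. m (of_real s) * of_real (zero_term nu s x y))"
  proof -
    have "{s\<in>bzeros nu. s < X} = {s\<in>Z. s < X}" using X by (auto simp: Z_def)
    thus ?thesis using finZ by (simp add: sum.If_cases Int_def)
  qed
  finally show ?thesis unfolding a1_def a3_def by (simp add: algebra_simps)
qed

section \<open>Estimating the contour integral\<close>

lemma exp_poly_decay:
  fixes k :: real
  shows "\<exists>M>0. \<forall>u\<ge>0. (1 + u) powr k * exp (-u) \<le> M * exp (- u / 2)"
proof -
  define K where "K = max k 1"
  have K: "K \<ge> 1" "k \<le> K" by (auto simp: K_def)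
  have "(1 + u) powr k * exp (-u) \<le> (2 * K) powr K * exp (- u / 2)" if u: "u \<ge> 0" for u
  proof -
    have "1 + u \<le> 2 * K * (1 + u / (2 * K))" using K by (simp add: distrib_left)
    also have "... \<le> 2 * K * exp (u / (2 * K))" using K by (intro mult_left_mono exp_ge_add_one_self) auto
    finally have "(1 + u) powr K \<le> (2 * K * exp (u / (2 * K))) powr K" using u K by (intro powr_mono2) auto
    also have "... = (2 * K) powr K * exp (u / 2)" using K by (simp add: powr_mult powr_def[of "exp _"])
    finally have "(1 + u) powr K \<le> (2 * K) powr K * exp (u / 2)" .
    moreover have "(1 + u) powr k \<le> (1 + u) powr K" using u K by (intro powr_mono) auto
    ultimately have "(1 + u) powr k * exp (-u) \<le> (2 * K) powr K * exp (u / 2) * exp (-u)" by (intro mult_right_mono) auto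
    also have "... = (2 * K) powr K * exp (u / 2 + - u)" unfolding exp_add by simp
    finally show ?thesis by (simp add: field_simps)
  qed
  moreover have "(2 * K) powr K > 0" using K by simp
  ultimately show ?thesis by blast
qed

text \<open>Whatever u >= 0 is, l (1 + u) / (1 + l u) lies between 1/2 and B. Both ends are needed
  because the exponent a may have either sign.\<close>

lemma ratio_powr_bound:
  fixes l u a B :: real
  assumes l: "1/2 \<le> l" "l \<le> B" and B: "B \<ge> 1" and u: "u \<ge> 0"
  shows "(l * ((1 + u) / (1 + l * u))) powr a \<le> 2 powr \<bar>a\<bar> * B powr \<bar>a\<bar>"
proof -
  define q where "q = l * ((1 + u) / (1 + l * u))"
  have p: "1 + l * u > 0" "l > 0" using l u by (auto intro: add_pos_nonneg)
  have q1: "q \<ge> 1/2"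
  proof -
    have "(1 + l * u) * (1/2) \<le> l * (1 + u)"
    proof -
      have "l * u \<ge> 0" using p u by simp
      thus ?thesis using l by (simp add: algebra_simps)
    qed
    thus ?thesis using p unfolding q_def by (simp add: field_simps)
  qed
  have q2: "q \<le> B"
  proof -
    have "l * (1 + u) \<le> B * (1 + l * u)"
    proof -
      have "1 * (l * u) \<le> B * (l * u)" using B p u by (intro mult_right_mono) auto
      moreover have "l * (1 + u) = l + l * u" "B * (1 + l * u) = B + B * (l * u)" by (simp_all add: distrib_left)
      ultimately show ?thesis using l by linarith
    qed
    thus ?thesis using p unfolding q_def by (simp add: field_simps)
  qed
  show ?thesis
  proof (cases "a \<ge> 0")
    case True
    have "q powr a \<le> B powr a" using q1 q2 True by (intro powr_mono2) auto
    also have "... \<le> 2 powr \<bar>a\<bar> * B powr \<bar>a\<bar>" using True by (simp add: ge_one_powr_ge_zero mult_le_cancel_right1)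
    finally show ?thesis unfolding q_def .
  next
    case False
    have "q powr a \<le> (1/2) powr a" using q1 False by (intro powr_mono2') auto
    also have "(1/2) powr a = 2 powr \<bar>a\<bar>" using False by (simp add: powr_divide powr_minus_divide)
    also have "... \<le> 2 powr \<bar>a\<bar> * B powr \<bar>a\<bar>" using B False by (simp add: ge_one_powr_ge_zero mult_le_cancel_left1)
    finally show ?thesis unfolding q_def .
  qed
qed

text \<open>Replaces \<open>\<bar>z\<bar>\<close> by \<open>R\<close> in the weight \<open>r\<^sup>a (1 + r x)\<^sup>-\<^sup>a\<close>, for \<open>R/2 \<le> \<bar>z\<bar> \<le> B R\<close>.\<close>
lemma weight_compare:
  fixes r R a B x :: real
  assumes R: "R > 0" and r: "R / 2 \<le> r" "r \<le> B * R" and B: "B \<ge> 1" and x: "x \<ge> 0"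
  shows "r powr a * (1 + r * x) powr (-a) \<le> (2 powr \<bar>a\<bar> * B powr \<bar>a\<bar>) * (R powr a * (1 + R * x) powr (-a))"
proof -
  define l where "l = r / R"
  have l: "1/2 \<le> l" "l \<le> B" "r = l * R" using R r by (auto simp: l_def field_simps)
  have p: "l > 0" "1 + R * x > 0" "1 + l * (R * x) > 0" using l R x by (auto intro: add_pos_nonneg)
  have "(l * ((1 + R * x) / (1 + l * (R * x)))) powr a \<le> 2 powr \<bar>a\<bar> * B powr \<bar>a\<bar>"
    by (rule ratio_powr_bound) (use l B R x in auto)
  hence "(l * ((1 + R * x) / (1 + l * (R * x)))) powr a * (R powr a * (1 + R * x) powr (-a))
     \<le> (2 powr \<bar>a\<bar> * B powr \<bar>a\<bar>) * (R powr a * (1 + R * x) powr (-a))"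
    by (intro mult_right_mono) auto
  moreover have "(l * ((1 + R * x) / (1 + l * (R * x)))) powr a * (R powr a * (1 + R * x) powr (-a)) = r powr a * (1 + r * x) powr (-a)"
  proof -
    have e1: "(l * ((1 + R * x) / (1 + l * (R * x)))) powr a = l powr a * ((1 + R * x) powr a * (1 + l * (R * x)) powr (-a))"
      using p by (simp add: powr_mult powr_divide powr_minus_divide)
    have e2: "r powr a = l powr a * R powr a" using p R by (simp add: l(3) powr_mult)
    have e3: "(1 + R * x) powr a * (1 + R * x) powr (-a) = 1" unfolding powr_add[symmetric] using p by simp
    have e4: "r * x = l * (R * x)" by (simp add: l(3))
    have sh: "(A * (P * Q)) * (D * P') = A * D * Q * (P * P')" for A P Q D P' :: real by (simp add: mult_ac)
    show ?thesis unfolding e1 e2 e4 sh e3 by simp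
  qed
  ultimately show ?thesis by simp
qed

lemma integral_exp_abs:
  fixes k T :: real
  assumes "k > 0" "T \<ge> 0"
  shows "(\<lambda>t. exp (- k * \<bar>t\<bar>)) integrable_on {-T..T}" "integral {-T..T} (\<lambda>t. exp (- k * \<bar>t\<bar>)) \<le> 2 / k"
proof -
  have c: "continuous_on S (\<lambda>t. exp (- k * \<bar>t\<bar>))" for S :: "real set" by (intro continuous_intros)
  show i: "(\<lambda>t. exp (- k * \<bar>t\<bar>)) integrable_on {-T..T}" by (rule integrable_continuous_real[OF c])
  have "((\<lambda>t. exp (- k * t)) has_integral (- exp (- k * T) / k - - exp (- k * 0) / k)) {0..T}"
    using assms by (intro fundamental_theorem_of_calculus)
      (auto intro!: derivative_eq_intros simp: has_real_derivative_iff_has_vector_derivative[symmetric])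
  hence p: "((\<lambda>t. exp (- k * \<bar>t\<bar>)) has_integral (- exp (- k * T) / k - - exp (- k * 0) / k)) {0..T}"
    by (rule has_integral_eq[rotated]) auto
  have "((\<lambda>t. exp (k * t)) has_integral (exp (k * 0) / k - exp (k * (-T)) / k)) {-T..0}"
    using assms by (intro fundamental_theorem_of_calculus)
      (auto intro!: derivative_eq_intros simp: has_real_derivative_iff_has_vector_derivative[symmetric])
  hence n: "((\<lambda>t. exp (- k * \<bar>t\<bar>)) has_integral (exp (k * 0) / k - exp (k * (-T)) / k)) {-T..0}"
    by (rule has_integral_eq[rotated]) auto
  have "integral {-T..T} (\<lambda>t. exp (- k * \<bar>t\<bar>)) = (exp (k * 0) / k - exp (k * (-T)) / k) + (- exp (- k * T) / k - - exp (- k * 0) / k)"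
    by (rule integral_unique[OF has_integral_combine[OF _ _ n p]]) (use assms in auto)
  also have "... = 2 / k - 2 * (exp (- k * T) / k)" by simp
  also have "... \<le> 2 / k" using assms by simp
  finally show "integral {-T..T} (\<lambda>t. exp (- k * \<bar>t\<bar>)) \<le> 2 / k" .
qed

lemma kernel_integrand_continuous:
  assumes nu: "nu > -1" and y: "0 < y" "y \<le> 1" and m: "m holomorphic_on {z. \<bar>Re z\<bar> < R}"
    and S: "\<And>z. z \<in> S \<Longrightarrow> \<bar>Re z\<bar> < R \<and> bphi nu z \<noteq> 0"
  shows "continuous_on S (kernel_integrand nu m x y)"
  unfolding kernel_integrand_def[abs_def]
  by (intro continuous_intros holomorphic_on_imp_continuous_on bphi_scaled_holomorphic bphi_holomorphic bV_holomorphic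
        holomorphic_on_subset[OF m] nu y) (use S in auto)

text \<open>Each vertical side contributes at most 2 h / k, the horizontal sides vanish as their
  height tends to infinity, and the residue sum carries the factor 4 pi, so h / k is generous. The
  bound \<tau> on the horizontal sides may depend on everything else; only its limit
  matters.\<close>

lemma kernel_contour_bound:
  fixes m :: "complex \<Rightarrow> complex"
  assumes nu: "nu > -1" and y: "0 < y" "y \<le> 1"
    and m: "m holomorphic_on {z. \<bar>Re z\<bar> < R}" and me: "\<And>z. m (-z) = m z"
    and X: "0 < X" "X < R" and k: "k > 0" and h: "h \<ge> 0"
    and nz: "\<And>z. \<bar>Re z\<bar> = X \<Longrightarrow> bphi nu z \<noteq> 0"
    and side: "\<And>z. \<bar>Re z\<bar> = X \<Longrightarrow> norm (kernel_integrand nu m x y z) \<le> h * exp (- k * \<bar>Im z\<bar>)"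
    and top: "\<And>T z. T \<ge> T0 \<Longrightarrow> \<bar>Re z\<bar> \<le> X \<Longrightarrow> \<bar>Im z\<bar> = T \<Longrightarrow> norm (kernel_integrand nu m x y z) \<le> \<tau> T"
    and tau: "(\<tau> \<longlongrightarrow> 0) at_top"
  shows "norm (\<Sum>s\<in>{s\<in>bzeros nu. s < X}. m (of_real s) * of_real (zero_term nu s x y)) \<le> h / k"
proof -
  let ?F = "kernel_integrand nu m x y"
  define S where "S = (\<Sum>s\<in>{s\<in>bzeros nu. s < X}. m (of_real s) * of_real (zero_term nu s x y))"
  have nzr: "bphi nu z \<noteq> 0" if "Im z \<noteq> 0" for z using bphi_zero_real[OF nu] that by blast
  have Xz: "X \<notin> bzeros nu"
    using nz[of "of_real X"] X bphi_of_real[OF nu, of X, where 'a=complex] by (auto simp: bzeros_def)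
  have main: "4 * pi * norm S \<le> 4 * X * \<tau> T + 4 * h / k" if T: "T \<ge> T0" "T > 0" for T
  proof -
    define a1 a2 a3 a4 where "a1 = Complex (-X) (-T)" "a2 = Complex X (-T)" "a3 = Complex X T" "a4 = Complex (-X) T"
    note ad = a1_a2_a3_a4_def
    have tau0: "\<tau> T \<ge> 0"
    proof -
      have "norm (?F (Complex 0 T)) \<le> \<tau> T" using top[OF T(1), of "Complex 0 T"] X T by simp
      thus ?thesis by (rule order_trans[OF norm_ge_zero])
    qed
    have segH: "\<bar>Re z\<bar> \<le> X \<and> \<bar>Im z\<bar> = T" if "z \<in> closed_segment a1 a2 \<or> z \<in> closed_segment a3 a4" for z
    proof -
      have "closed_segment a1 a2 \<subseteq> {z. Re z \<in> {-X..X}} \<inter> {z. Im z = - T}" "closed_segment a3 a4 \<subseteq> {z. Re z \<in> {-X..X}} \<inter> {z. Im z = T}"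
        using X by (auto simp: ad closed_segment_same_Im closed_segment_eq_real_ivl)
      thus ?thesis using that T by (auto simp: subset_iff)
    qed
    have segV: "\<bar>Re z\<bar> = X" if "z \<in> closed_segment a2 a3 \<or> z \<in> closed_segment a4 a1" for z
    proof -
      have "closed_segment a2 a3 \<subseteq> {z. Re z = X}" "closed_segment a4 a1 \<subseteq> {z. Re z = - X}"
        by (auto simp: ad closed_segment_same_Re)
      thus ?thesis using that X by (auto simp: subset_iff)
    qed
    have cont: "continuous_on (closed_segment a1 a2) ?F" "continuous_on (closed_segment a2 a3) ?F"
      "continuous_on (closed_segment a3 a4) ?F" "continuous_on (closed_segment a4 a1) ?F"
      by (intro kernel_integrand_continuous[OF nu y m] conjI; use segH segV nz nzr X T in force)+
    have int: "?F contour_integrable_on linepath a1 a2" "?F contour_integrable_on linepath a2 a3"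
      "?F contour_integrable_on linepath a3 a4" "?F contour_integrable_on linepath a4 a1"
      by (intro contour_integrable_continuous_linepath cont)+
    have vert: "norm (contour_integral (linepath (Complex c (-T)) (Complex c T)) ?F) \<le> 2 * h / k"
      if c: "\<bar>c\<bar> = X" and cc: "continuous_on (closed_segment (Complex c (-T)) (Complex c T)) ?F" for c
    proof -
      have i1: "contour_integral (linepath (Complex c (-T)) (Complex c T)) ?F = \<i> * integral {-T..T} (\<lambda>t. ?F (Complex c t))"
        by (rule contour_integral_linepath_same_Re) (use T in auto)
      have i2: "norm (integral {-T..T} (\<lambda>t. ?F (Complex c t))) \<le> integral {-T..T} (\<lambda>t. h * exp (- k * \<bar>t\<bar>))"
      proof (rule integral_norm_bound_integral)
        have "continuous_on {-T..T} (\<lambda>t. Complex c t)"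
          unfolding Complex_eq by (intro continuous_intros)
        moreover have "Complex c t \<in> closed_segment (Complex c (-T)) (Complex c T)" if "t \<in> {-T..T}" for t
          using that T by (simp add: closed_segment_same_Re closed_segment_eq_real_ivl)
        ultimately show "(\<lambda>t. ?F (Complex c t)) integrable_on {-T..T}"
          by (intro integrable_continuous_real continuous_on_compose2[OF cc]) auto
        show "(\<lambda>t. h * exp (- k * \<bar>t\<bar>)) integrable_on {-T..T}"
          using integral_exp_abs(1)[OF k, of T] T by (intro integrable_on_mult_right) auto
        show "norm (?F (Complex c t)) \<le> h * exp (- k * \<bar>t\<bar>)" for t using side[of "Complex c t"] c by simp
      qed
      have i3: "integral {-T..T} (\<lambda>t. h * exp (- k * \<bar>t\<bar>)) \<le> h * (2 / k)"
        unfolding integral_mult_right using integral_exp_abs(2)[OF k, of T] T h by (intro mult_left_mono) auto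
      have "norm (contour_integral (linepath (Complex c (-T)) (Complex c T)) ?F) = norm (integral {-T..T} (\<lambda>t. ?F (Complex c t)))"
        unfolding i1 norm_mult by simp
      also note i2
      also note i3
      finally show ?thesis by (simp add: mult.commute)
    qed
    have r: "norm (contour_integral (linepath a2 a3) ?F) \<le> 2 * h / k"
      using vert[of X] cont(2) X unfolding ad by simp
    have cl: "continuous_on (closed_segment a1 a4) ?F" using cont(4) by (simp add: closed_segment_commute)
    have l: "norm (contour_integral (linepath a4 a1) ?F) \<le> 2 * h / k"
      using vert[of "-X"] cl X contour_integral_reverse_linepath[OF cont(4)] unfolding ad by simp
    have hb: "norm (contour_integral (linepath a1 a2) ?F) \<le> \<tau> T * norm (a2 - a1)"
      by (rule contour_integral_bound_linepath[OF int(1) tau0]) (use top[OF T(1)] segH in auto)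
    have ht: "norm (contour_integral (linepath a3 a4) ?F) \<le> \<tau> T * norm (a4 - a3)"
      by (rule contour_integral_bound_linepath[OF int(3) tau0]) (use top[OF T(1)] segH in auto)
    have n: "norm (a2 - a1) = 2 * X" "norm (a4 - a3) = 2 * X"
    proof -
      have "a2 - a1 = of_real (2 * X)" "a4 - a3 = - of_real (2 * X)" by (auto simp: ad complex_eq_iff)
      thus "norm (a2 - a1) = 2 * X" "norm (a4 - a3) = 2 * X" using X by (simp_all only: norm_minus_cancel norm_of_real)
    qed
    have "contour_integral (rectpath a1 a3) ?F = contour_integral (linepath a1 a2) ?F + (contour_integral (linepath a2 a3) ?F
        + (contour_integral (linepath a3 a4) ?F + contour_integral (linepath a4 a1) ?F))"
    proof -
      have e: "rectpath a1 a3 = linepath a1 a2 +++ linepath a2 a3 +++ linepath a3 a4 +++ linepath a4 a1"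
        by (simp add: rectpath_def Let_def ad)
      show ?thesis unfolding e
        by (simp add: int contour_integrable_joinI valid_path_join)
    qed
    hence "norm (contour_integral (rectpath a1 a3) ?F) \<le> norm (contour_integral (linepath a1 a2) ?F) + (norm (contour_integral (linepath a2 a3) ?F)
        + (norm (contour_integral (linepath a3 a4) ?F) + norm (contour_integral (linepath a4 a1) ?F)))"
      by (simp only:) (intro order_trans[OF norm_triangle_ineq] add_mono order_refl)
    also have "... \<le> \<tau> T * (2 * X) + (2 * h / k + (\<tau> T * (2 * X) + 2 * h / k))"
      using r l hb ht unfolding n by (intro add_mono) auto
    also have "... = 4 * X * \<tau> T + 4 * h / k" by simp
    finally have "norm (contour_integral (rectpath a1 a3) ?F) \<le> 4 * X * \<tau> T + 4 * h / k" .
    moreover have "contour_integral (rectpath a1 a3) ?F = 4 * of_real pi * \<i> * S"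
      unfolding ad S_def by (rule kernel_contour[OF nu y m me X Xz T(2)])
    ultimately show ?thesis by (simp add: norm_mult)
  qed
  have lim: "((\<lambda>T. 4 * X * \<tau> T + 4 * h / k) \<longlongrightarrow> 4 * X * 0 + 4 * h / k) at_top"
    by (intro tendsto_intros tau)
  have "4 * pi * norm S \<le> 4 * X * 0 + 4 * h / k"
  proof (rule tendsto_lowerbound[OF lim])
    have "eventually (\<lambda>T. T0 \<le> T \<and> 0 < T) at_top"
      by (intro eventually_conj eventually_ge_at_top eventually_gt_at_top)
    thus "eventually (\<lambda>T. 4 * pi * norm S \<le> 4 * X * \<tau> T + 4 * h / k) at_top"
      by (rule eventually_mono) (use main in auto)
  qed simp
  hence "pi * norm S \<le> h / k" by simp
  moreover have "1 * norm S \<le> pi * norm S" using pi_ge_two by (intro mult_right_mono) auto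
  ultimately show ?thesis unfolding S_def by simp
qed

text \<open>The numerators are bounded by \<open>bphi_upper\<close>, the denominator from below by
  the energy at the zero; the square of that lower bound gives s^(2 a).\<close>

lemma zero_term_bound:
  assumes nu: "nu > -1"
  defines "a \<equiv> nu + 1/2"
  shows "\<exists>C>0. \<forall>s\<in>bzeros nu. \<forall>x\<ge>0. \<forall>y\<ge>0. \<bar>zero_term nu s x y\<bar> \<le> C * (s powr (2*a) * (1 + s * x) powr (-a) * (1 + s * y) powr (-a))"
proof -
  obtain K where K: "K > 0" "\<And>z. norm (bphi nu z) \<le> K * (1 + norm z) powr (-a) * exp \<bar>Im z\<bar>"
    using bphi_upper[OF nu] unfolding a_def by blast
  obtain c where c: "c > 0" "\<And>s. s \<in> bzeros nu \<Longrightarrow> c \<le> s powr a * \<bar>s * bphi (nu+1) s\<bar>"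
    using zeros_facts[OF nu] unfolding a_def by blast
  have up: "\<bar>bphi nu t\<bar> \<le> K * (1 + t) powr (-a)" if "t \<ge> 0" for t
    using K(2)[of "of_real t"] bphi_of_real[OF nu, of t, where 'a=complex] that by simp
  have "\<bar>zero_term nu s x y\<bar> \<le> (K\<^sup>2 / c\<^sup>2) * (s powr (2*a) * (1 + s * x) powr (-a) * (1 + s * y) powr (-a))"
    if s: "s \<in> bzeros nu" and x: "x \<ge> 0" and y: "y \<ge> 0" for s x y
  proof -
    have sp: "s > 0" using s by (simp add: bzeros_def)
    define W where "W = \<bar>s * bphi (nu+1) s\<bar>"
    have W: "W > 0" "c \<le> s powr a * W" using c(2)[OF s] bphi_succ_nz[OF nu s] sp by (auto simp: W_def)
    have "c\<^sup>2 \<le> (s powr a * W)\<^sup>2" using W c by (intro power_mono) auto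
    also have "... = s powr (2*a) * W\<^sup>2" by (simp add: power_mult_distrib powr_add[symmetric] power2_eq_square)
    finally have f1: "1 / W\<^sup>2 \<le> s powr (2*a) / c\<^sup>2" using W c by (simp add: field_simps)
    have f2: "\<bar>bphi nu (s * x)\<bar> * \<bar>bphi nu (s * y)\<bar> \<le> (K * (1 + s * x) powr (-a)) * (K * (1 + s * y) powr (-a))"
      using sp x y K by (intro mult_mono up) auto
    have "(\<bar>bphi nu (s * x)\<bar> * \<bar>bphi nu (s * y)\<bar>) * (1 / W\<^sup>2) \<le> ((K * (1 + s * x) powr (-a)) * (K * (1 + s * y) powr (-a))) * (s powr (2*a) / c\<^sup>2)"
      by (rule mult_mono[OF f2 f1]) (use K in auto)
    thus ?thesis by (simp add: zero_term_def W_def abs_mult power2_eq_square mult_ac)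
  qed
  thus ?thesis using K(1) c(1) by (intro exI[of _ "K\<^sup>2 / c\<^sup>2"]) auto
qed

section \<open>The pointwise kernel bound\<close>

definition BR_kernel :: "real \<Rightarrow> real \<Rightarrow> real \<Rightarrow> real \<Rightarrow> real \<Rightarrow> real" where
  "BR_kernel nu dl R x y = (\<Sum>s\<in>{s\<in>bzeros nu. s < R}. (1 - s\<^sup>2 / R\<^sup>2) powr dl * zero_term nu s x y)"

definition BR_bound :: "real \<Rightarrow> real \<Rightarrow> real \<Rightarrow> real \<Rightarrow> real \<Rightarrow> real" where
  "BR_bound a dl R x y = R powr (2*a+1) * (1 + R * x) powr (-a) * (1 + R * y) powr (-a) * (1 + R * \<bar>x - y\<bar>) powr (-(1+dl))"

text \<open>No cancellation is used. This settles the range where R |x - y| is bounded, since there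
  the last factor of \<open>BR_bound\<close> is bounded below.\<close>

lemma BR_kernel_abs_le:
  assumes nu: "nu > -1" and dl: "dl > 0"
  defines "a \<equiv> nu + 1/2"
  shows "\<exists>C>0. \<forall>R>0. \<forall>x\<ge>0. \<forall>y\<ge>0. \<bar>BR_kernel nu dl R x y\<bar> \<le> C * (R powr (2*a+1) * (1 + R * x) powr (-a) * (1 + R * y) powr (-a))"
proof -
  obtain C where C: "C > 0" "\<And>s x y. s \<in> bzeros nu \<Longrightarrow> x \<ge> 0 \<Longrightarrow> y \<ge> 0 \<Longrightarrow>
     \<bar>zero_term nu s x y\<bar> \<le> C * (s powr (2*a) * (1 + s * x) powr (-a) * (1 + s * y) powr (-a))"
    using zero_term_bound[OF nu] unfolding a_def by blast
  obtain K where K: "K > 0" "\<And>R x y. R > 0 \<Longrightarrow> x \<ge> 0 \<Longrightarrow> y \<ge> 0 \<Longrightarrow>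
    (\<Sum>s\<in>{s\<in>bzeros nu. s < R}. s powr (2*a) * (1 + s * x) powr (-a) * (1 + s * y) powr (-a))
       \<le> K * R powr (2*a+1) * (1 + R * x) powr (-a) * (1 + R * y) powr (-a)"
    using zero_sum_bound[OF nu] unfolding a_def by blast
  have "\<bar>BR_kernel nu dl R x y\<bar> \<le> (C * K) * (R powr (2*a+1) * (1 + R * x) powr (-a) * (1 + R * y) powr (-a))"
    if R: "R > 0" and x: "x \<ge> 0" and y: "y \<ge> 0" for R x y
  proof -
    have "\<bar>BR_kernel nu dl R x y\<bar> \<le> (\<Sum>s\<in>{s\<in>bzeros nu. s < R}. C * (s powr (2*a) * (1 + s * x) powr (-a) * (1 + s * y) powr (-a)))"
      unfolding BR_kernel_def
    proof (rule order_trans[OF sum_abs sum_mono])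
      fix s assume s: "s \<in> {s\<in>bzeros nu. s < R}"
      hence sp: "s > 0" "s < R" by (auto simp: bzeros_def)
      have "s\<^sup>2 / R\<^sup>2 \<le> 1" using sp by (simp add: power_mono)
      hence "(1 - s\<^sup>2 / R\<^sup>2) powr dl \<le> 1" using dl by (intro powr_le1) auto
      hence "(1 - s\<^sup>2 / R\<^sup>2) powr dl * \<bar>zero_term nu s x y\<bar> \<le> 1 * (C * (s powr (2*a) * (1 + s * x) powr (-a) * (1 + s * y) powr (-a)))"
        using C(2)[of s x y] s x y by (intro mult_mono) auto
      thus "\<bar>(1 - s\<^sup>2 / R\<^sup>2) powr dl * zero_term nu s x y\<bar> \<le> C * (s powr (2*a) * (1 + s * x) powr (-a) * (1 + s * y) powr (-a))"
        by (simp add: abs_mult)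
    qed
    also have "... = C * (\<Sum>s\<in>{s\<in>bzeros nu. s < R}. s powr (2*a) * (1 + s * x) powr (-a) * (1 + s * y) powr (-a))"
      by (simp add: sum_distrib_left)
    also have "... \<le> C * (K * R powr (2*a+1) * (1 + R * x) powr (-a) * (1 + R * y) powr (-a))"
      using K(2)[OF R x y] C by (intro mult_left_mono) auto
    finally show ?thesis by (simp add: mult_ac)
  qed
  thus ?thesis using C K by (intro exI[of _ "C * K"]) auto
qed

text \<open>If 1 - z^2 / R^2 lies on the cut, then z^2 is real and at least R^2, hence |Re z| >= R.
  So the principal branch is holomorphic in the strip up to any height.\<close>

lemma multiplier_holomorphic:
  assumes R: "R > 0"
  shows "(\<lambda>z. (1 - z\<^sup>2 / of_real (R\<^sup>2)) powr of_real dl) holomorphic_on {z. \<bar>Re z\<bar> < R}"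
proof (intro holomorphic_intros)
  fix z assume z: "z \<in> {z. \<bar>Re z\<bar> < R}"
  show "1 - z\<^sup>2 / of_real (R\<^sup>2) \<notin> \<real>\<^sub>\<le>\<^sub>0"
  proof
    assume "1 - z\<^sup>2 / of_real (R\<^sup>2) \<in> \<real>\<^sub>\<le>\<^sub>0"
    then obtain t where t: "1 - z\<^sup>2 / of_real (R\<^sup>2) = of_real t" "t \<le> 0" by (auto elim!: nonpos_Reals_cases)
    hence "z\<^sup>2 / of_real (R\<^sup>2) = of_real (1 - t)" by (simp add: algebra_simps)
    hence e: "z\<^sup>2 = of_real ((1 - t) * R\<^sup>2)" using R by (simp add: field_simps)
    have "Im (z\<^sup>2) = 0" unfolding e by simp
    hence im: "Re z * Im z = 0" by (simp add: Im_power2)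
    have "(Re z)\<^sup>2 - (Im z)\<^sup>2 = Re (z\<^sup>2)" by (simp add: Re_power2)
    also have "... = (1 - t) * R\<^sup>2" unfolding e by simp
    also have "... \<ge> 1 * R\<^sup>2" using t by (intro mult_right_mono) auto
    finally have g: "R\<^sup>2 \<le> (Re z)\<^sup>2 - (Im z)\<^sup>2" by simp
    hence "R\<^sup>2 \<le> (Re z)\<^sup>2" using zero_le_power2[of "Im z"] by linarith
    hence "R \<le> \<bar>Re z\<bar>" using R by (simp add: abs_le_square_iff[symmetric])
    thus False using z by simp
  qed
qed (use R in auto)

text \<open>\<open>bphi nu\<close> is even and commutes with conjugation, so its modulus depends
  only on |Re z| and |Im z|, and bounds known in the first quadrant hold everywhere.\<close>

lemma bphi_lower_reflect:
  assumes nu: "nu > -1" and h: "norm (bw nu (Complex \<bar>Re z\<bar> \<bar>Im z\<bar>)) \<ge> b" and z: "z \<noteq> 0"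
  shows "norm (bphi nu z) \<ge> norm z powr (-(nu+1/2)) * b"
proof -
  define w where "w = Complex \<bar>Re z\<bar> \<bar>Im z\<bar>"
  have "w = z \<or> w = - z \<or> w = cnj z \<or> w = - cnj z"
    unfolding w_def complex_eq_iff by (cases "Re z \<ge> 0"; cases "Im z \<ge> 0") auto
  hence n: "norm (bphi nu w) = norm (bphi nu z)" "norm w = norm z" using bphi_cnj[OF nu, of z] by auto
  have "norm z powr (-(nu+1/2)) * b \<le> norm z powr (-(nu+1/2)) * (norm z powr (nu+1/2) * norm (bphi nu z))"
    using h unfolding w_def[symmetric] norm_bw n by (rule mult_left_mono) simp
  also have "... = norm (bphi nu z)"
  proof -
    have "norm z powr (-(nu+1/2)) * norm z powr (nu+1/2) = 1" unfolding powr_add[symmetric] using z by simp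
    thus ?thesis by (simp only: mult.assoc[symmetric] mult_1)
  qed
  finally show ?thesis .
qed

text \<open>The quotient \<open>\<phi>(zx) V\<^sub>z(y) / \<phi>(z)\<close> is the Green's function, decaying like \<open>exp (- \<bar>Im z\<bar> (y - x))\<close> wherever \<open>\<phi>(z)\<close> has its full size.\<close>
lemma green_bound:
  assumes nu: "nu > -1" and c: "c > 0"
  defines "a \<equiv> nu + 1/2"
  shows "\<exists>C>0. \<forall>m z x y. 0 \<le> x \<longrightarrow> 0 < y \<longrightarrow> y \<le> 1 \<longrightarrow> norm z * y \<ge> 1/2 \<longrightarrow>
     norm (bphi nu z) \<ge> norm z powr (-a) * (c * exp \<bar>Im z\<bar>) \<longrightarrow>
     norm (kernel_integrand nu m x y z) \<le> C * norm (m z) * (norm z powr a * (1 + norm z * x) powr (-a)) * y powr (-a) * exp (- (y - x) * \<bar>Im z\<bar>)"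
proof -
  obtain K where K: "K > 0" "\<And>z. norm (bphi nu z) \<le> K * (1 + norm z) powr (-a) * exp \<bar>Im z\<bar>"
    using bphi_upper[OF nu] unfolding a_def by blast
  define E where "E = exp (2 * \<bar>nu\<^sup>2 - 1/4\<bar>)"
  have E: "E > 0" by (simp add: E_def)
  have "norm (kernel_integrand nu m x y z) \<le> (K * E / c) * norm (m z) * (norm z powr a * (1 + norm z * x) powr (-a)) * y powr (-a) * exp (- (y - x) * \<bar>Im z\<bar>)"
    if x: "0 \<le> x" and y: "0 < y" "y \<le> 1" and zy: "norm z * y \<ge> 1/2" and lo: "norm (bphi nu z) \<ge> norm z powr (-a) * (c * exp \<bar>Im z\<bar>)" for m z x y
  proof -
    have z: "norm z > 0" using zy by (auto simp: zero_less_norm_iff)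
    define t where "t = \<bar>Im z\<bar>"
    have 1: "norm (bphi nu (z * of_real x)) \<le> K * (1 + norm z * x) powr (-a) * exp (t * x)"
      using K(2)[of "z * of_real x"] x by (simp add: norm_mult t_def abs_mult)
    have 2: "norm (bV nu z y) \<le> E * y powr (-a) * exp (t * (1 - y)) / norm z"
      using bV_bound[OF y zy] by (simp add: E_def t_def a_def)
    have lp: "norm z powr (-a) * (c * exp t) > 0" using z c by simp
    have 3: "inverse (norm (bphi nu z)) \<le> inverse (norm z powr (-a) * (c * exp t))"
      by (rule le_imp_inverse_le) (use lo lp in \<open>auto simp: t_def\<close>)
    have "norm (kernel_integrand nu m x y z) = norm (m z) * norm z * (norm (bphi nu (z * of_real x)) * norm (bV nu z y) * inverse (norm (bphi nu z)))"
      unfolding kernel_integrand_def by (simp add: norm_mult norm_divide norm_inverse divide_inverse)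
    also have "... \<le> norm (m z) * norm z * ((K * (1 + norm z * x) powr (-a) * exp (t * x)) * (E * y powr (-a) * exp (t * (1 - y)) / norm z) * inverse (norm z powr (-a) * (c * exp t)))"
      using K E by (intro mult_left_mono mult_mono 1 2 3) auto
    also have "... = (K * E / c) * norm (m z) * (norm z powr a * (1 + norm z * x) powr (-a)) * y powr (-a) * (exp (t * x) * exp (t * (1 - y)) * exp (- t))"
      using z c by (simp add: powr_minus exp_minus field_simps)
    also have "exp (t * x) * exp (t * (1 - y)) * exp (- t) = exp (- (y - x) * \<bar>Im z\<bar>)"
      unfolding exp_add[symmetric] t_def by (simp add: algebra_simps)
    finally show ?thesis .
  qed
  thus ?thesis using K E c by (intro exI[of _ "K * E / c"]) auto
qed

text \<open>On the side Re z = X, at height t, 1 - z^2 / R^2 is at most a constant times (1 + t) (1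
  + t / R) / R, since R - X <= L + 1. With d = y - x < 1 and R d >= 1, the first factor is at most
  (1 + t d) / d and the second at most 1 + t d. The multiplier thus yields R^(-delta) d^(-delta),
  powers of 1 + t d are absorbed by exp (- t d), and the integral over t yields the remaining 1 /
  d.\<close>

lemma BR_kernel_contour_part:
  assumes nu: "nu > -1" and dl: "dl > 0" and L: "L > 0"
  defines "a \<equiv> nu + 1/2"
  shows "\<exists>C>0. \<exists>X0\<ge>1. \<forall>R X x y. X0 \<le> X \<longrightarrow> R/2 \<le> X \<longrightarrow> X \<le> R - 1 \<longrightarrow> R - 1 - L \<le> X \<longrightarrow>
      (wr nu X)\<^sup>2 \<ge> bE nu (of_real X) / 2 \<longrightarrow> 0 < x \<longrightarrow> x < y \<longrightarrow> y < 1 \<longrightarrow> R * (y - x) \<ge> 1 \<longrightarrow>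
      \<bar>\<Sum>s\<in>{s\<in>bzeros nu. s < X}. (1 - s\<^sup>2 / R\<^sup>2) powr dl * zero_term nu s x y\<bar>
        \<le> C * (R powr (2*a - dl) * (y - x) powr (-(1+dl)) * (1 + R * x) powr (-a) * (1 + R * y) powr (-a))"
proof -
  obtain c1 X0 where c1: "c1 > 0" "X0 \<ge> 1" "\<And>x t. x \<ge> X0 \<Longrightarrow> (norm (bw nu (of_real x)))\<^sup>2 \<ge> bE nu (of_real x) / 2 \<Longrightarrow> t \<ge> 0 \<Longrightarrow>
      norm (bw nu (Complex x t)) \<ge> c1 * exp t"
    using bw_lower_good[OF nu] by blast
  obtain c2 T0 where c2: "c2 > 0" "T0 \<ge> 1" "\<And>z. Re z \<ge> 0 \<Longrightarrow> Im z \<ge> T0 \<Longrightarrow> norm (bw nu z) \<ge> c2 * exp (Im z)"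
    using bw_lower_high[OF nu] by blast
  define c where "c = min c1 c2"
  have c: "c > 0" "c \<le> c1" "c \<le> c2" using c1 c2 by (auto simp: c_def)
  obtain M where M: "M > 0" "\<And>u. u \<ge> 0 \<Longrightarrow> (1 + u) powr (\<bar>a\<bar> + 2 * dl) * exp (-u) \<le> M * exp (- u / 2)"
    using exp_poly_decay by blast
  from green_bound[OF nu c(1), folded a_def] obtain G where G1: "G > 0" and
    G2: "\<forall>m z x y. 0 \<le> x \<longrightarrow> 0 < y \<longrightarrow> y \<le> 1 \<longrightarrow> norm z * y \<ge> 1/2 \<longrightarrow>
     norm (bphi nu z) \<ge> norm z powr (-a) * (c * exp \<bar>Im z\<bar>) \<longrightarrow>
     norm (kernel_integrand nu m x y z) \<le> G * norm (m z) * (norm z powr a * (1 + norm z * x) powr (-a)) * y powr (-a) * exp (- (y - x) * \<bar>Im z\<bar>)"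
    by (elim exE conjE)
  note G = G1 G2[rule_format]
  \<comment> \<open>The leading 2 comes from the decay rate d / 2 that is left on the sides after
    half of the exponential has been spent on the powers.\<close>
  define C where "C = 2 * (G * ((2 * (L+2)) powr dl) * 2 powr \<bar>a\<bar> * 2 powr \<bar>a\<bar> * M)"
  have C: "C > 0" using G M L by (simp add: C_def)
  have main: "\<bar>\<Sum>s\<in>{s\<in>bzeros nu. s < X}. (1 - s\<^sup>2 / R\<^sup>2) powr dl * zero_term nu s x y\<bar>
        \<le> C * (R powr (2*a - dl) * (y - x) powr (-(1+dl)) * (1 + R * x) powr (-a) * (1 + R * y) powr (-a))"
    if X: "X0 \<le> X" "R/2 \<le> X" "X \<le> R - 1" "R - 1 - L \<le> X" and good: "(wr nu X)\<^sup>2 \<ge> bE nu (of_real X) / 2"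
      and xy: "0 < x" "x < y" "y < 1" and Rd: "R * (y - x) \<ge> 1" for R X x y
  proof -
    define d where "d = y - x"
    have d: "0 < d" "d < 1" "R * d \<ge> 1" using xy Rd by (auto simp: d_def)
    have X1: "X \<ge> 1" using X c1 by simp
    have R: "R \<ge> 2" using X X1 by simp
    have Ry: "R * y \<ge> 1" 
    proof -
      have "R * d \<le> R * y" using R xy by (intro mult_left_mono) (auto simp: d_def)
      thus ?thesis using d by simp
    qed
    define m where "m z = (1 - z\<^sup>2 / of_real (R\<^sup>2)) powr of_real dl" for z :: complex
    have nm: "norm (m z) = norm (1 - z\<^sup>2 / of_real (R\<^sup>2)) powr dl" for z
      unfolding m_def by (subst norm_powr_real_powr') auto
    have good': "(norm (bw nu (of_real X)))\<^sup>2 \<ge> bE nu (of_real X) / 2"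
      using good wr_facts(2)[OF nu, of X] X1 by simp
    have lowside: "norm (bphi nu z) \<ge> norm z powr (-a) * (c * exp \<bar>Im z\<bar>)" if z: "\<bar>Re z\<bar> = X" for z
    proof -
      have "z \<noteq> 0" using z X1 by auto
      moreover have "c * exp \<bar>Im z\<bar> \<le> c1 * exp \<bar>Im z\<bar>" using c by simp
      hence "norm (bw nu (Complex \<bar>Re z\<bar> \<bar>Im z\<bar>)) \<ge> c * exp \<bar>Im z\<bar>"
        unfolding z by (rule order_trans[OF _ c1(3)[OF X(1) good' abs_ge_zero]])
      ultimately show ?thesis unfolding a_def by (intro bphi_lower_reflect[OF nu])
    qed
    have lowtop: "norm (bphi nu z) \<ge> norm z powr (-a) * (c * exp \<bar>Im z\<bar>)" if z: "\<bar>Im z\<bar> \<ge> T0" for z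
    proof -
      have "z \<noteq> 0" using z c2(2) by auto
      moreover have "c * exp \<bar>Im z\<bar> \<le> c2 * exp \<bar>Im z\<bar>" using c by simp
      moreover have "c2 * exp \<bar>Im z\<bar> \<le> norm (bw nu (Complex \<bar>Re z\<bar> \<bar>Im z\<bar>))"
        using c2(3)[of "Complex \<bar>Re z\<bar> \<bar>Im z\<bar>"] z by simp
      hence "norm (bw nu (Complex \<bar>Re z\<bar> \<bar>Im z\<bar>)) \<ge> c * exp \<bar>Im z\<bar>"
        using calculation(2) by (rule order_trans[rotated])
      ultimately show ?thesis unfolding a_def by (intro bphi_lower_reflect[OF nu])
    qed
    define W where "W = (R powr a * (1 + R * x) powr (-a)) * (R powr a * (1 + R * y) powr (-a))"
    \<comment> \<open>The Green's function bound has y^(-a); since R y >= 1, this is comparable to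
      the weight R^a (1 + R y)^(-a).\<close>
    have yW: "y powr (-a) \<le> 2 powr \<bar>a\<bar> * (R powr a * (1 + R * y) powr (-a))"
    proof -
      have "(R * y) powr (-a) \<le> 2 powr \<bar>-a\<bar> * (1 + R * y) powr (-a)" by (rule powr_add_one_le[OF Ry])
      hence "R powr a * (R powr (-a) * y powr (-a)) \<le> R powr a * (2 powr \<bar>a\<bar> * (1 + R * y) powr (-a))"
        using R xy by (intro mult_left_mono) (auto simp: powr_mult)
      moreover have "R powr a * (R powr (-a) * y powr (-a)) = y powr (-a)"
        unfolding mult.assoc[symmetric] powr_add[symmetric] using R by simp
      ultimately show ?thesis by (simp add: mult_ac)
    qed
    have nz: "\<bar>Re z\<bar> \<le> norm z" "\<bar>Im z\<bar> \<le> norm z" "norm z \<le> \<bar>Re z\<bar> + \<bar>Im z\<bar>" for z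
      using abs_Re_le_cmod abs_Im_le_cmod cmod_le by auto
    have side: "norm (kernel_integrand nu m x y z) \<le> (G * ((2 * (L+2)) powr dl) * 2 powr \<bar>a\<bar> * 2 powr \<bar>a\<bar> * M * R powr (-dl) * d powr (-dl) * W) * exp (- (d/2) * \<bar>Im z\<bar>)"
      if z: "\<bar>Re z\<bar> = X" for z
    proof -
      define t where "t = \<bar>Im z\<bar>"
      have t: "t \<ge> 0" by (simp add: t_def)
      \<comment> \<open>B measures every loss at height t: 1 + t / R <= B because R d >= 1, and 1 +
        t <= B / d because d < 1.\<close>
      define B where "B = 1 + t * d"
      have B: "B \<ge> 1" using t d by (simp add: B_def)
      have tR: "1 + t / R \<le> B"
      proof -
        have "t * 1 \<le> t * (R * d)" using t d by (intro mult_left_mono) auto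
        hence "t / R \<le> t * d" using R by (simp add: field_simps)
        thus ?thesis by (simp add: B_def)
      qed
      have td: "1 + t \<le> B / d"
      proof -
        have "(1 + t) * d \<le> B" using d t by (simp add: B_def algebra_simps)
        thus ?thesis using d by (simp add: field_simps)
      qed
      have nzl: "R / 2 \<le> norm z" using nz(1)[of z] z X by simp
      have nzu: "norm z \<le> B * R"
      proof -
        have "norm z \<le> R + t" using nz(3)[of z] z X by (simp add: t_def)
        also have "... = (1 + t / R) * R" using R by (simp add: field_simps)
        also have "... \<le> B * R" using tR R by (intro mult_right_mono) auto
        finally show ?thesis .
      qed
      have zy: "norm z * y \<ge> 1/2"
      proof -
        have "(R/2) * y \<le> norm z * y" using nzl xy by (intro mult_right_mono) auto
        thus ?thesis using Ry by simp
      qed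
      have mz: "norm (m z) \<le> (2 * (L+2)) powr dl * R powr (-dl) * d powr (-dl) * B powr (2*dl)"
      proof -
        \<comment> \<open>Reflecting to Re v = X > 0 makes R - v the small factor of R^2 - v^2 on
          either side of the contour.\<close>
        define \<sigma> where "\<sigma> = (if Re z \<ge> 0 then 1 else -1 :: real)"
        have sg: "of_real \<sigma> * of_real \<sigma> = (1::complex)" "norm (of_real \<sigma> :: complex) = 1" "\<sigma> * Re z = X" using z by (auto simp: \<sigma>_def)
        define v where "v = of_real \<sigma> * z"
        have v: "Re v = X" "\<bar>Im v\<bar> = t" "v\<^sup>2 = z\<^sup>2" using sg z by (auto simp: v_def t_def \<sigma>_def power2_eq_square)
        have f: "1 - z\<^sup>2 / of_real (R\<^sup>2) = (1 - v / of_real R) * (1 + v / of_real R)"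
          unfolding v(3)[symmetric] by (simp add: algebra_simps power2_eq_square)
        have "norm (of_real R - v) \<le> \<bar>R - X\<bar> + t" using nz(3)[of "of_real R - v"] v by simp
        also have "... \<le> (L + 2) * (1 + t)"
        proof -
          have "(L + 2) * (1 + t) = L + 2 + 2 * t + L * t" by (simp add: algebra_simps)
          moreover have "L * t \<ge> 0" using L t by simp
          moreover have "\<bar>R - X\<bar> = R - X" using X by simp
          ultimately show ?thesis using X t by linarith
        qed
        finally have f1: "norm (of_real R - v) \<le> (L + 2) * (1 + t)" .
        have "1 - v / of_real R = (of_real R - v) / of_real R" using R by (simp add: field_simps)
        hence "norm (1 - v / of_real R) = norm (of_real R - v) / R" using R by (simp add: norm_divide)
        also have "... \<le> ((L + 2) * (1 + t)) / R" using f1 R by (intro divide_right_mono) auto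
        also have "... \<le> ((L + 2) * (B / d)) / R" using td L R by (intro divide_right_mono mult_left_mono) auto
        finally have g1: "norm (1 - v / of_real R) \<le> (L + 2) * (B / d) / R" .
        have "norm (1 + v / of_real R) \<le> 1 + norm v / R" using norm_triangle_ineq[of 1 "v / of_real R"] R by (simp add: norm_divide)
        also have "norm v \<le> R + t" using nz(3)[of v] v X by simp
        hence "1 + norm v / R \<le> 1 + (R + t) / R" using R by (intro add_left_mono divide_right_mono) auto
        also have "... = 1 + (1 + t / R)" using R by (simp add: field_simps)
        also have "... \<le> 2 * B" using tR B by simp
        finally have g2: "norm (1 + v / of_real R) \<le> 2 * B" .
        have "norm (1 - z\<^sup>2 / of_real (R\<^sup>2)) \<le> ((L + 2) * (B / d) / R) * (2 * B)"
          unfolding f norm_mult using L B d R by (intro mult_mono g1 g2) auto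
        also have "... = (2 * (L+2)) * (1 / R) * (1 / d) * (B * B)"
        proof -
          have "(l * (B / d) / R) * (2 * B) = (2 * l) * (1 / R) * (1 / d) * (B * B)" for l by (simp add: mult_ac)
          thus ?thesis .
        qed
        finally have "norm (m z) \<le> ((2 * (L+2)) * (1 / R) * (1 / d) * (B * B)) powr dl"
          unfolding nm using dl by (intro powr_mono2) auto
        also have "... = (2 * (L+2)) powr dl * (1 / R) powr dl * (1 / d) powr dl * (B powr dl * B powr dl)"
        proof -
          have "(l * r * u * (B * B)) powr dl = l powr dl * r powr dl * u powr dl * (B powr dl * B powr dl)"
            if "l \<ge> 0" "r \<ge> 0" "u \<ge> 0" for l r u using that B by (simp add: powr_mult)
          from this[of "2 * (L+2)" "1 / R" "1 / d"] show ?thesis using L R d by fastforce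
        qed
        also have "B powr dl * B powr dl = B powr (2 * dl)" by (simp flip: powr_add)
        also have "(1 / R) powr dl = R powr (-dl)" using R by (simp add: powr_divide powr_minus_divide)
        also have "(1 / d) powr dl = d powr (-dl)" using d by (simp add: powr_divide powr_minus_divide)
        finally show ?thesis .
      qed
      have w1: "norm z powr a * (1 + norm z * x) powr (-a) \<le> (2 powr \<bar>a\<bar> * B powr \<bar>a\<bar>) * (R powr a * (1 + R * x) powr (-a))"
        by (rule weight_compare[OF _ nzl nzu B]) (use R xy in auto)
      have "norm (kernel_integrand nu m x y z) \<le> G * norm (m z) * (norm z powr a * (1 + norm z * x) powr (-a)) * y powr (-a) * exp (- (y - x) * \<bar>Im z\<bar>)"
        using xy by (intro G(2) zy lowside[OF z]) auto
      also have "... \<le> G * ((2 * (L+2)) powr dl * R powr (-dl) * d powr (-dl) * B powr (2*dl))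
          * ((2 powr \<bar>a\<bar> * B powr \<bar>a\<bar>) * (R powr a * (1 + R * x) powr (-a))) * (2 powr \<bar>a\<bar> * (R powr a * (1 + R * y) powr (-a))) * exp (- (t * d))"
      proof -
        have ee: "exp (- (y - x) * \<bar>Im z\<bar>) = exp (- (t * d))"
          by (rule arg_cong[where f=exp]) (simp add: t_def d_def algebra_simps)
        show ?thesis unfolding ee
          by (intro mult_right_mono mult_mono[OF mult_mono[OF mult_left_mono[OF mz] w1] yW]) (use G(1) in auto)
      qed
      also have "... = (G * (2 * (L+2)) powr dl * 2 powr \<bar>a\<bar> * 2 powr \<bar>a\<bar> * R powr (-dl) * d powr (-dl) * W) * ((B powr \<bar>a\<bar> * B powr (2*dl)) * exp (- (t * d)))"
        by (simp add: W_def mult_ac)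
      also have "B powr \<bar>a\<bar> * B powr (2*dl) = (1 + t * d) powr (\<bar>a\<bar> + 2 * dl)" by (simp add: B_def powr_add)
      also have "(G * (2 * (L+2)) powr dl * 2 powr \<bar>a\<bar> * 2 powr \<bar>a\<bar> * R powr (-dl) * d powr (-dl) * W) * ((1 + t * d) powr (\<bar>a\<bar> + 2 * dl) * exp (- (t * d)))
         \<le> (G * (2 * (L+2)) powr dl * 2 powr \<bar>a\<bar> * 2 powr \<bar>a\<bar> * R powr (-dl) * d powr (-dl) * W) * (M * exp (- (t * d) / 2))"
        using G(1) t d by (intro mult_left_mono M(2)) (auto simp: W_def)
      also have "- (t * d) / 2 = - (d/2) * \<bar>Im z\<bar>" by (simp add: t_def)
      finally show ?thesis by (simp add: mult_ac)
    qed
    \<comment> \<open>A crude bound on the horizontal sides: only its decay in T for fixed R, x, y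
      matters, so the weights are replaced by powers of 2 + R + T.\<close>
    define \<tau> where "\<tau> T = (G * (2 + 2 * R + 2 * T) powr (2 * dl) * ((2 + R + T) powr \<bar>a\<bar> * (2 + R + T) powr \<bar>a\<bar>) * y powr (-a)) * exp (- (d * T))" for T
    have tau: "(\<tau> \<longlongrightarrow> 0) at_top"
    proof -
      have "((\<lambda>T. (2 + R + T) powr (2 * dl + 2 * \<bar>a\<bar>) * exp (- (d * T))) \<longlongrightarrow> 0) at_top"
      proof -
        obtain M' where M': "M' > 0" "\<And>u. u \<ge> 0 \<Longrightarrow> (1 + u) powr (2 * dl + 2 * \<bar>a\<bar>) * exp (-u) \<le> M' * exp (- u / 2)"
          using exp_poly_decay by blast
        define D where "D = (2 + R) / d"
        have D: "D \<ge> 2 + R" "D * d = 2 + R" 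
        proof -
          have "(2 + R) * d \<le> (2 + R) * 1" using d R by (intro mult_left_mono) auto
          thus "D \<ge> 2 + R" using d by (simp add: D_def pos_le_divide_eq)
          show "D * d = 2 + R" using d by (simp add: D_def)
        qed
        have b: "norm ((2 + R + T) powr (2 * dl + 2 * \<bar>a\<bar>) * exp (- (d * T))) \<le> D powr (2 * dl + 2 * \<bar>a\<bar>) * (M' * exp (- (d * T) / 2))" if T: "T \<ge> 0" for T
        proof -
          have "D * 1 + D * (d * T) \<ge> 2 + R + T"
          proof -
            have "1 * T \<le> (D * d) * T" using D R T by (intro mult_right_mono) auto
            moreover have "(D * d) * T = D * (d * T)" by (rule mult.assoc)
            ultimately show ?thesis using D(1) by linarith
          qed
          hence "2 + R + T \<le> D * (1 + d * T)" by (simp add: distrib_left)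
          hence "(2 + R + T) powr (2 * dl + 2 * \<bar>a\<bar>) \<le> (D * (1 + d * T)) powr (2 * dl + 2 * \<bar>a\<bar>)"
            using R T dl by (intro powr_mono2) auto
          also have "... = D powr (2 * dl + 2 * \<bar>a\<bar>) * (1 + d * T) powr (2 * dl + 2 * \<bar>a\<bar>)"
            by (rule powr_mult)
          finally have "(2 + R + T) powr (2 * dl + 2 * \<bar>a\<bar>) * exp (- (d * T)) \<le> D powr (2 * dl + 2 * \<bar>a\<bar>) * (1 + d * T) powr (2 * dl + 2 * \<bar>a\<bar>) * exp (- (d * T))"
            by (rule mult_right_mono) simp
          also have "... \<le> D powr (2 * dl + 2 * \<bar>a\<bar>) * (M' * exp (- (d * T) / 2))"
            unfolding mult.assoc using d T by (intro mult_left_mono M'(2)) auto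
          finally show ?thesis by simp
        qed
        have "((\<lambda>T. exp (- (d * T) / 2)) \<longlongrightarrow> 0) at_top"
        proof -
          have "filterlim (\<lambda>T. (d/2) * T) at_top at_top" by (rule filterlim_tendsto_pos_mult_at_top[OF tendsto_const _ filterlim_ident]) (use d in simp)
          hence "filterlim (\<lambda>T. - ((d/2) * T)) at_bot at_top" by (simp add: filterlim_uminus_at_top)
          hence "((\<lambda>T. exp (- ((d/2) * T))) \<longlongrightarrow> 0) at_top" by (rule filterlim_compose[OF exp_at_bot])
          thus ?thesis by (simp add: mult.commute)
        qed
        hence z: "((\<lambda>T. D powr (2 * dl + 2 * \<bar>a\<bar>) * (M' * exp (- (d * T) / 2))) \<longlongrightarrow> D powr (2 * dl + 2 * \<bar>a\<bar>) * (M' * 0)) at_top"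
          by (intro tendsto_intros)
        have "D powr (2 * dl + 2 * \<bar>a\<bar>) * (M' * 0) = 0" by simp
        note z' = z[unfolded this]
        show ?thesis
          by (rule Lim_null_comparison[OF eventually_mono[OF eventually_ge_at_top[of 0] b] z'])
      qed
      hence "((\<lambda>T. (G * 2 powr (2*dl) * y powr (-a)) * ((2 + R + T) powr (2 * dl + 2 * \<bar>a\<bar>) * exp (- (d * T)))) \<longlongrightarrow> (G * 2 powr (2*dl) * y powr (-a)) * 0) at_top"
        by (intro tendsto_intros)
      hence l0: "((\<lambda>T. (G * 2 powr (2*dl) * y powr (-a)) * ((2 + R + T) powr (2 * dl + 2 * \<bar>a\<bar>) * exp (- (d * T)))) \<longlongrightarrow> 0) at_top" by simp
      show ?thesis
      proof (rule Lim_null_comparison[OF _ l0])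
        have "norm (\<tau> T) \<le> (G * 2 powr (2*dl) * y powr (-a)) * ((2 + R + T) powr (2 * dl + 2 * \<bar>a\<bar>) * exp (- (d * T)))" if T: "T \<ge> 0" for T
        proof -
          have "(2 + 2 * R + 2 * T) powr (2*dl) \<le> (2 * (2 + R + T)) powr (2*dl)" using R T dl by (intro powr_mono2) auto
          also have "... = 2 powr (2*dl) * (2 + R + T) powr (2*dl)" by (rule powr_mult)
          finally have q: "(2 + 2 * R + 2 * T) powr (2*dl) \<le> 2 powr (2*dl) * (2 + R + T) powr (2*dl)" .
          have "norm (\<tau> T) = (G * (2 + 2 * R + 2 * T) powr (2 * dl) * ((2 + R + T) powr \<bar>a\<bar> * (2 + R + T) powr \<bar>a\<bar>) * y powr (-a)) * exp (- (d * T))"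
            unfolding \<tau>_def using G(1) by simp
          also have "... \<le> (G * (2 powr (2*dl) * (2 + R + T) powr (2*dl)) * ((2 + R + T) powr \<bar>a\<bar> * (2 + R + T) powr \<bar>a\<bar>) * y powr (-a)) * exp (- (d * T))"
            using G(1) by (intro mult_right_mono mult_left_mono q) auto
          also have "... = (G * 2 powr (2*dl) * y powr (-a)) * (((2 + R + T) powr (2*dl) * ((2 + R + T) powr \<bar>a\<bar> * (2 + R + T) powr \<bar>a\<bar>)) * exp (- (d * T)))"
            by (simp add: mult_ac)
          also have "(2 + R + T) powr (2*dl) * ((2 + R + T) powr \<bar>a\<bar> * (2 + R + T) powr \<bar>a\<bar>) = (2 + R + T) powr (2 * dl + 2 * \<bar>a\<bar>)"
            by (simp flip: powr_add)
          finally show ?thesis .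
        qed
        thus "\<forall>\<^sub>F T in at_top. norm (\<tau> T) \<le> (G * 2 powr (2*dl) * y powr (-a)) * ((2 + R + T) powr (2 * dl + 2 * \<bar>a\<bar>) * exp (- (d * T)))"
          by (rule eventually_mono[OF eventually_ge_at_top[of 0]])
      qed
    qed
    \<comment> \<open>The height is at least T0, so that \<open>bw_lower_high\<close> applies at
      every real part, and at least 1 / y, so that |z| y >= 1/2.\<close>
    have top: "norm (kernel_integrand nu m x y z) \<le> \<tau> T" if T: "T \<ge> max T0 (1 / y)" and z: "\<bar>Re z\<bar> \<le> X" "\<bar>Im z\<bar> = T" for T z
    proof -
      have T1: "T \<ge> 1" "T \<ge> T0" "T \<ge> 1 / y" using T c2(2) by auto
      have nzl: "T \<le> norm z" using nz(2)[of z] z by simp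
      have nzu: "norm z \<le> R + T" using nz(3)[of z] z X by simp
      have zy: "norm z * y \<ge> 1/2"
      proof -
        have "(1 / y) * y \<le> norm z * y" using T1 nzl xy by (intro mult_right_mono) auto
        thus ?thesis using xy by simp
      qed
      have mz: "norm (m z) \<le> (2 + 2 * R + 2 * T) powr (2 * dl)"
      proof -
        have "norm (1 - z\<^sup>2 / of_real (R\<^sup>2)) \<le> 1 + (norm z)\<^sup>2 / R\<^sup>2"
          using norm_triangle_ineq4[of 1 "z\<^sup>2 / of_real (R\<^sup>2)"] by (simp add: norm_divide norm_power)
        also have "(norm z)\<^sup>2 / R\<^sup>2 \<le> (norm z)\<^sup>2"
        proof -
          have "1 \<le> R\<^sup>2" using R by (simp add: one_le_power)
          thus ?thesis using R by (simp add: divide_le_eq mult_le_cancel_left1)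
        qed
        also have "1 + (norm z)\<^sup>2 \<le> (2 + 2 * R + 2 * T)\<^sup>2"
        proof -
          have "1 + (norm z)\<^sup>2 \<le> (1 + norm z)\<^sup>2" by (simp add: power2_sum)
          also have "... \<le> (2 + 2 * R + 2 * T)\<^sup>2" using nzu R T1 by (intro power_mono) auto
          finally show ?thesis .
        qed
        finally have "norm (m z) \<le> ((2 + 2 * R + 2 * T)\<^sup>2) powr dl" unfolding nm using dl by (intro powr_mono2) auto
        also have "(2 + 2 * R + 2 * T)\<^sup>2 = (2 + 2 * R + 2 * T) powr 2" using R T1 by (subst powr_numeral) auto
        finally show ?thesis by (simp add: powr_powr)
      qed
      have pb: "v powr e \<le> (2 + R + T) powr \<bar>a\<bar>" if v: "1 \<le> v" "v \<le> 2 + R + T" and e: "e = a \<or> e = - a" for v e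
      proof -
        have "v powr e \<le> v powr \<bar>a\<bar>" using v e by (intro powr_mono) auto
        also have "... \<le> (2 + R + T) powr \<bar>a\<bar>" using v by (intro powr_mono2) auto
        finally show ?thesis .
      qed
      have p1: "norm z powr a \<le> (2 + R + T) powr \<bar>a\<bar>" using nzl nzu T1 by (intro pb) auto
      have "norm z * x \<le> norm z * 1" using xy by (intro mult_left_mono) auto
      hence p2: "(1 + norm z * x) powr (-a) \<le> (2 + R + T) powr \<bar>a\<bar>" using nzu xy by (intro pb) auto
      have "norm (kernel_integrand nu m x y z) \<le> G * norm (m z) * (norm z powr a * (1 + norm z * x) powr (-a)) * y powr (-a) * exp (- (y - x) * \<bar>Im z\<bar>)"
        using xy by (intro G(2) zy lowtop) (use z T1 in auto)
      also have "... \<le> \<tau> T"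
      proof -
        have ee: "exp (- (y - x) * \<bar>Im z\<bar>) = exp (- (d * T))"
          by (rule arg_cong[where f=exp]) (simp add: z(2) d_def algebra_simps)
        show ?thesis unfolding ee \<tau>_def
          by (intro mult_right_mono mult_mono[OF mult_left_mono[OF mz] mult_mono[OF p1 p2]]) (use G(1) in auto)
      qed
      finally show ?thesis .
    qed
    define h where "h = G * ((2 * (L+2)) powr dl) * 2 powr \<bar>a\<bar> * 2 powr \<bar>a\<bar> * M * R powr (-dl) * d powr (-dl) * W"
    have h: "h \<ge> 0" using G M by (simp add: h_def W_def)
    have "norm (\<Sum>s\<in>{s\<in>bzeros nu. s < X}. m (of_real s) * of_real (zero_term nu s x y)) \<le> h / (d/2)"
    proof (rule kernel_contour_bound[OF nu _ _ _ _ _ _ _ h, where R = R and \<tau> = \<tau> and ?T0.0 = "max T0 (1/y)"])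
      show "m holomorphic_on {z. \<bar>Re z\<bar> < R}" unfolding m_def[abs_def] by (rule multiplier_holomorphic) (use R in simp)
      show "m (- z) = m z" for z by (simp add: m_def)
      show "bphi nu z \<noteq> 0" if "\<bar>Re z\<bar> = X" for z
      proof -
        have "norm z > 0" using that X1 by auto
        hence "norm z powr (-a) * (c * exp \<bar>Im z\<bar>) > 0" using c by simp
        thus ?thesis using lowside[OF that] by auto
      qed
      show "norm (kernel_integrand nu m x y z) \<le> h * exp (- (d / 2) * \<bar>Im z\<bar>)" if "\<bar>Re z\<bar> = X" for z
        using side[OF that] unfolding h_def .
    qed (use top tau xy X X1 d in auto)
    moreover have "(\<Sum>s\<in>{s\<in>bzeros nu. s < X}. m (of_real s) * of_real (zero_term nu s x y))
      = of_real (\<Sum>s\<in>{s\<in>bzeros nu. s < X}. (1 - s\<^sup>2 / R\<^sup>2) powr dl * zero_term nu s x y)"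
    proof -
      have "m (of_real s) = of_real ((1 - s\<^sup>2 / R\<^sup>2) powr dl)" if s: "s \<in> {s\<in>bzeros nu. s < X}" for s
      proof -
        have "0 < s" "s < R" using s X by (auto simp: bzeros_def)
        hence "s\<^sup>2 / R\<^sup>2 \<le> 1" by (simp add: power_mono)
        hence "(of_real (1 - s\<^sup>2 / R\<^sup>2) :: complex) powr of_real dl = of_real ((1 - s\<^sup>2 / R\<^sup>2) powr dl)" by (intro powr_of_real) simp
        thus ?thesis by (simp add: m_def)
      qed
      thus ?thesis by simp
    qed
    ultimately have "\<bar>\<Sum>s\<in>{s\<in>bzeros nu. s < X}. (1 - s\<^sup>2 / R\<^sup>2) powr dl * zero_term nu s x y\<bar> \<le> h / (d/2)"
      by (simp only: norm_of_real)
    also have "h / (d/2) = C * (R powr (-dl) * (d powr (-dl) * (1 / d)) * W)" by (simp add: h_def C_def mult_ac)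
    also have "d powr (-dl) * (1 / d) = d powr (-(1+dl))"
    proof -
      have "d powr (-dl) * d powr (-1) = d powr (-(1+dl))" unfolding powr_add[symmetric] by (simp add: algebra_simps)
      thus ?thesis using d by (simp add: powr_minus_divide)
    qed
    also have "R powr (-dl) * d powr (-(1+dl)) * W = R powr (2*a - dl) * d powr (-(1+dl)) * (1 + R * x) powr (-a) * (1 + R * y) powr (-a)"
    proof -
      have "R powr (-dl) * (R powr a * R powr a) = R powr (2*a - dl)" unfolding powr_add[symmetric] by (simp add: algebra_simps)
      moreover have "R powr (-dl) * q * W = (R powr (-dl) * (R powr a * R powr a)) * q * (1 + R * x) powr (-a) * (1 + R * y) powr (-a)" for q
        by (simp add: W_def mult_ac)
      ultimately show ?thesis by simp
    qed
    finally show ?thesis unfolding d_def .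
  qed
  show ?thesis using C c1(2) main by (intro exI[of _ C] conjI exI[of _ X0]) blast+
qed

text \<open>By symmetry x < y. If R (y - x) is bounded, the estimate without cancellation suffices.
  Otherwise the sum is cut at a good point X in [R - 1 - L, R - 1]: the contour handles the zeros
  below X, and at the boundedly many zeros in [X, R) the multiplier itself is at most a constant
  times R^(-delta).\<close>

lemma BR_kernel_bound:
  assumes nu: "nu > -1" and dl: "dl > 0"
  defines "a \<equiv> nu + 1/2"
  shows "\<exists>C>0. \<forall>R>0. \<forall>x\<in>{0<..<1}. \<forall>y\<in>{0<..<1}. \<bar>BR_kernel nu dl R x y\<bar> \<le> C * BR_bound a dl R x y"
proof -
  obtain L where L: "L > 0" "\<And>x. x \<ge> 1 \<Longrightarrow> \<exists>y\<in>{x..x+L}. (wr nu y)\<^sup>2 \<ge> bE nu (of_real y) / 2"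
    using good_points[OF nu] by blast
  from BR_kernel_contour_part[OF nu dl L(1), folded a_def] obtain C1 X0 where C1: "C1 > 0" "X0 \<ge> 1" and
    C1': "\<forall>R X x y. X0 \<le> X \<longrightarrow> R/2 \<le> X \<longrightarrow> X \<le> R - 1 \<longrightarrow> R - 1 - L \<le> X \<longrightarrow>
      (wr nu X)\<^sup>2 \<ge> bE nu (of_real X) / 2 \<longrightarrow> 0 < x \<longrightarrow> x < y \<longrightarrow> y < 1 \<longrightarrow> R * (y - x) \<ge> 1 \<longrightarrow>
      \<bar>\<Sum>s\<in>{s\<in>bzeros nu. s < X}. (1 - s\<^sup>2 / R\<^sup>2) powr dl * zero_term nu s x y\<bar>
        \<le> C1 * (R powr (2*a - dl) * (y - x) powr (-(1+dl)) * (1 + R * x) powr (-a) * (1 + R * y) powr (-a))"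
    by (elim exE conjE)
  note C1 = C1 C1'[rule_format]
  from BR_kernel_abs_le[OF nu dl, folded a_def] obtain C0 where C0: "C0 > 0" and
    C0': "\<forall>R>0. \<forall>x\<ge>0. \<forall>y\<ge>0. \<bar>BR_kernel nu dl R x y\<bar> \<le> C0 * (R powr (2*a+1) * (1 + R * x) powr (-a) * (1 + R * y) powr (-a))"
    by (elim exE conjE)
  note C0 = C0 C0'[rule_format]
  from zero_term_bound[OF nu, folded a_def] obtain Z where Z: "Z > 0" and
    Z': "\<forall>s\<in>bzeros nu. \<forall>x\<ge>0. \<forall>y\<ge>0. \<bar>zero_term nu s x y\<bar> \<le> Z * (s powr (2*a) * (1 + s * x) powr (-a) * (1 + s * y) powr (-a))"
    by (elim exE conjE)
  note Z = Z Z'[rule_format]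
  obtain g where g: "g > 0" "\<And>s t. s \<in> bzeros nu \<Longrightarrow> t \<in> bzeros nu \<Longrightarrow> s < t \<Longrightarrow> t - s \<ge> g"
    using zeros_facts[OF nu] by blast
  \<comment> \<open>As y - x < 1, R (y - x) > A forces R > A, which places every point of
    [R - 1 - L, R - 1] above X0 and above R / 2.\<close>
  define A where "A = X0 + 2 * L + 4"
  have A: "A \<ge> 1" using C1 L by (simp add: A_def)
  define N where "N = (L + 1) / g + 1"
  have N: "N > 0" using L g by (simp add: N_def add_pos_pos)
  define C2 where "C2 = N * ((2 * (L+1)) powr dl * (Z * (2 powr \<bar>a\<bar> * 2 powr \<bar>a\<bar>)))"
  have C2: "C2 \<ge> 0" using N Z by (simp add: C2_def)
  define C where "C = C0 * (1 + A) powr (1+dl) + (C1 + C2) * 2 powr (1+dl)"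
  have C: "C > 0" using C0 C1 C2 A by (simp add: C_def add_pos_nonneg)
  have far: "\<bar>BR_kernel nu dl R x y\<bar> \<le> (C1 + C2) * 2 powr (1+dl) * BR_bound a dl R x y"
    if R: "R > 0" and x: "0 < x" and xy: "x < y" and y: "y < 1" and big: "R * (y - x) > A" for R x y
  proof -
    define d where "d = y - x"
    have d: "0 < d" "d < 1" using x xy y by (auto simp: d_def)
    have RA: "R > A"
    proof -
      have "R * d \<le> R * 1" using d R by (intro mult_left_mono) auto
      thus ?thesis using big by (simp add: d_def)
    qed
    have "R - 1 - L \<ge> 1" using RA C1 L by (simp add: A_def)
    then obtain X where X: "X \<in> {R-1-L..R-1-L+L}" "(wr nu X)\<^sup>2 \<ge> bE nu (of_real X) / 2" using L(2) by blast
    have Xb: "X0 \<le> X" "R/2 \<le> X" "X \<le> R - 1" "R - 1 - L \<le> X" using X RA C1 L by (auto simp: A_def)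
    define W where "W = R powr (2*a - dl) * d powr (-(1+dl)) * (1 + R * x) powr (-a) * (1 + R * y) powr (-a)"
    have W: "W \<ge> 0" by (simp add: W_def)
    have p1: "\<bar>\<Sum>s\<in>{s\<in>bzeros nu. s < X}. (1 - s\<^sup>2 / R\<^sup>2) powr dl * zero_term nu s x y\<bar> \<le> C1 * W"
      unfolding W_def d_def by (rule C1(3)) (use Xb X x xy y big A in auto)
    define S where "S = {s\<in>bzeros nu. X \<le> s \<and> s < R}"
    have cS: "real (card S) \<le> N" "finite S"
    proof -
      have sub: "S \<subseteq> {X..R}" and XR: "X \<le> R" using Xb by (auto simp: S_def)
      have sep: "\<And>s t. s \<in> S \<Longrightarrow> t \<in> S \<Longrightarrow> s < t \<Longrightarrow> t - s \<ge> g" using g(2) by (simp add: S_def)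
      have "finite S" "real (card S) \<le> (R - X) / g + 1"
        using card_separated_le[OF g(1) sub XR sep] by blast+
      moreover have "(R - X) / g \<le> (L + 1) / g" using Xb g by (intro divide_right_mono) auto
      ultimately show "real (card S) \<le> N" "finite S" by (auto simp: N_def)
    qed
    have tb: "\<bar>(1 - s\<^sup>2 / R\<^sup>2) powr dl * zero_term nu s x y\<bar> \<le> (2 * (L+1)) powr dl * (Z * (2 powr \<bar>a\<bar> * 2 powr \<bar>a\<bar>)) * W" if s: "s \<in> S" for s
    proof -
      have s1: "X \<le> s" "s < R" "s > 0" "s \<in> bzeros nu" using s by (auto simp: S_def bzeros_def)
      have "1 - s\<^sup>2 / R\<^sup>2 = (R - s) * (R + s) / R\<^sup>2" using R by (simp add: field_simps power2_eq_square)
      also have "... \<le> (L + 1) * (2 * R) / R\<^sup>2" using s1 Xb R by (intro divide_right_mono mult_mono) auto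
      also have "... = 2 * (L + 1) / R" using R by (simp add: power2_eq_square)
      finally have e: "1 - s\<^sup>2 / R\<^sup>2 \<le> 2 * (L + 1) / R" .
      have "s\<^sup>2 / R\<^sup>2 \<le> 1" using s1 by (simp add: power_mono)
      hence "(1 - s\<^sup>2 / R\<^sup>2) powr dl \<le> (2 * (L + 1) / R) powr dl" using e dl by (intro powr_mono2) auto
      also have "... = (2 * (L+1)) powr dl * R powr (-dl)" using L R by (simp add: powr_divide powr_minus_divide)
      \<comment> \<open>These few terms have no decay in d; since d < 1, the missing negative power
        can be inserted at no cost.\<close>
      also have "... \<le> (2 * (L+1)) powr dl * (R powr (-dl) * d powr (-(1+dl)))"
      proof -
        have "1 powr (-(1+dl)) \<le> d powr (-(1+dl))" using d dl by (intro powr_mono2') auto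
        hence "R powr (-dl) * 1 \<le> R powr (-dl) * d powr (-(1+dl))" by (intro mult_left_mono) auto
        thus ?thesis by (intro mult_left_mono) auto
      qed
      finally have f1: "(1 - s\<^sup>2 / R\<^sup>2) powr dl \<le> (2 * (L+1)) powr dl * (R powr (-dl) * d powr (-(1+dl)))" .
      have w: "s powr a * (1 + s * u) powr (-a) \<le> 2 powr \<bar>a\<bar> * (R powr a * (1 + R * u) powr (-a))" if "u \<ge> 0" for u
        using weight_compare[of R s 1 u a] R s1 Xb that by simp
      have "\<bar>zero_term nu s x y\<bar> \<le> Z * (s powr (2*a) * (1 + s * x) powr (-a) * (1 + s * y) powr (-a))"
        using Z(2)[OF s1(4), of x y] x xy by simp
      also have "s powr (2*a) * (1 + s * x) powr (-a) * (1 + s * y) powr (-a) = (s powr a * (1 + s * x) powr (-a)) * (s powr a * (1 + s * y) powr (-a))"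
      proof -
        have "s powr (2*a) = s powr a * s powr a" by (simp flip: powr_add)
        thus ?thesis by simp
      qed
      also have "Z * ... \<le> Z * ((2 powr \<bar>a\<bar> * (R powr a * (1 + R * x) powr (-a))) * (2 powr \<bar>a\<bar> * (R powr a * (1 + R * y) powr (-a))))"
        using x xy Z by (intro mult_left_mono mult_mono w) auto
      finally have f2: "\<bar>zero_term nu s x y\<bar> \<le> Z * ((2 powr \<bar>a\<bar> * (R powr a * (1 + R * x) powr (-a))) * (2 powr \<bar>a\<bar> * (R powr a * (1 + R * y) powr (-a))))" .
      have "\<bar>(1 - s\<^sup>2 / R\<^sup>2) powr dl * zero_term nu s x y\<bar> = (1 - s\<^sup>2 / R\<^sup>2) powr dl * \<bar>zero_term nu s x y\<bar>" by (simp add: abs_mult)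
      also have "... \<le> ((2 * (L+1)) powr dl * (R powr (-dl) * d powr (-(1+dl)))) * (Z * ((2 powr \<bar>a\<bar> * (R powr a * (1 + R * x) powr (-a))) * (2 powr \<bar>a\<bar> * (R powr a * (1 + R * y) powr (-a)))))"
        by (rule mult_mono[OF f1 f2]) auto
      also have "... = (2 * (L+1)) powr dl * (Z * (2 powr \<bar>a\<bar> * 2 powr \<bar>a\<bar>)) * ((R powr (-dl) * (R powr a * R powr a)) * d powr (-(1+dl)) * (1 + R * x) powr (-a) * (1 + R * y) powr (-a))"
        by (simp only: mult_ac)
      also have "R powr (-dl) * (R powr a * R powr a) = R powr (2*a - dl)" unfolding powr_add[symmetric] by (simp add: algebra_simps)
      finally show ?thesis unfolding W_def .
    qed
    have "\<bar>\<Sum>s\<in>S. (1 - s\<^sup>2 / R\<^sup>2) powr dl * zero_term nu s x y\<bar> \<le> (\<Sum>s\<in>S. \<bar>(1 - s\<^sup>2 / R\<^sup>2) powr dl * zero_term nu s x y\<bar>)" by (rule sum_abs)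
    also have "... \<le> real (card S) * ((2 * (L+1)) powr dl * (Z * (2 powr \<bar>a\<bar> * 2 powr \<bar>a\<bar>)) * W)" using tb by (rule sum_bounded_above)
    also have "... \<le> N * ((2 * (L+1)) powr dl * (Z * (2 powr \<bar>a\<bar> * 2 powr \<bar>a\<bar>)) * W)" using cS W Z by (intro mult_right_mono) auto
    finally have p2: "\<bar>\<Sum>s\<in>S. (1 - s\<^sup>2 / R\<^sup>2) powr dl * zero_term nu s x y\<bar> \<le> C2 * W" by (simp add: C2_def mult.assoc)
    have un: "{s\<in>bzeros nu. s < R} = {s\<in>bzeros nu. s < X} \<union> S" using Xb by (auto simp: S_def)
    have dis: "{s\<in>bzeros nu. s < X} \<inter> S = {}" by (auto simp: S_def)
    have "BR_kernel nu dl R x y = (\<Sum>s\<in>{s\<in>bzeros nu. s < X}. (1 - s\<^sup>2 / R\<^sup>2) powr dl * zero_term nu s x y) + (\<Sum>s\<in>S. (1 - s\<^sup>2 / R\<^sup>2) powr dl * zero_term nu s x y)"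
      unfolding BR_kernel_def un by (rule sum.union_disjoint[OF finite_bzeros_less[OF nu] cS(2) dis])
    hence "\<bar>BR_kernel nu dl R x y\<bar> \<le> C1 * W + C2 * W" using p1 p2 by linarith
    also have "... = (C1 + C2) * W" by (simp add: distrib_right)
    also have "W \<le> 2 powr (1+dl) * BR_bound a dl R x y"
    proof -
      have "R powr (2*a - dl) * d powr (-(1+dl)) = R powr (2*a+1) * (R * d) powr (-(1+dl))"
      proof -
        have "(R * d) powr (-(1+dl)) = R powr (-(1+dl)) * d powr (-(1+dl))" using R d by (simp add: powr_mult)
        moreover have "R powr (2*a+1) * R powr (-(1+dl)) = R powr (2*a - dl)" unfolding powr_add[symmetric] by (simp add: algebra_simps)
        ultimately show ?thesis by (simp only: mult.assoc[symmetric])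
      qed
      also have "... \<le> R powr (2*a+1) * (2 powr (1+dl) * (1 + R * d) powr (-(1+dl)))"
      proof (rule mult_left_mono)
        have ab: "\<bar>-(1+dl)\<bar> = 1 + dl" using dl by simp
        have "R * d \<ge> 1" using big A by (simp add: d_def)
        from powr_add_one_le[OF this, of "-(1+dl)", unfolded ab]
        show "(R * d) powr (-(1+dl)) \<le> 2 powr (1+dl) * (1 + R * d) powr (-(1+dl))" .
      qed simp
      finally have q: "R powr (2*a - dl) * d powr (-(1+dl)) \<le> R powr (2*a+1) * (2 powr (1+dl) * (1 + R * d) powr (-(1+dl)))" .
      have "W \<le> (R powr (2*a+1) * (2 powr (1+dl) * (1 + R * d) powr (-(1+dl)))) * (1 + R * x) powr (-a) * (1 + R * y) powr (-a)"
        unfolding W_def by (intro mult_right_mono q) auto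
      also have "\<bar>x - y\<bar> = d" using xy by (simp add: d_def)
      hence "(R powr (2*a+1) * (2 powr (1+dl) * (1 + R * d) powr (-(1+dl)))) * (1 + R * x) powr (-a) * (1 + R * y) powr (-a) = 2 powr (1+dl) * BR_bound a dl R x y"
        by (simp add: BR_bound_def mult_ac)
      finally show ?thesis .
    qed
    hence "(C1 + C2) * W \<le> (C1 + C2) * (2 powr (1+dl) * BR_bound a dl R x y)" using C1 C2 by (intro mult_left_mono) auto
    finally show ?thesis by (simp add: mult.assoc)
  qed
  have B0: "BR_bound a dl R x y \<ge> 0" for R x y by (simp add: BR_bound_def)
  have sym: "BR_kernel nu dl R x y = BR_kernel nu dl R y x" "BR_bound a dl R x y = BR_bound a dl R y x" for R x y
    by (auto simp: BR_kernel_def zero_term_def BR_bound_def abs_minus_commute mult_ac)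
  have near: "\<bar>BR_kernel nu dl R x y\<bar> \<le> C0 * (1 + A) powr (1+dl) * BR_bound a dl R x y"
    if R: "R > 0" and x: "0 < x" and y: "0 < y" and n: "R * \<bar>x - y\<bar> \<le> A" for R x y
  proof -
    have "(1 + A) powr (-(1+dl)) \<le> (1 + R * \<bar>x - y\<bar>) powr (-(1+dl))"
      using n R dl by (intro powr_mono2') (auto intro: add_pos_nonneg)
    hence "(1 + A) powr (1+dl) * (1 + A) powr (-(1+dl)) \<le> (1 + A) powr (1+dl) * (1 + R * \<bar>x - y\<bar>) powr (-(1+dl))"
      by (intro mult_left_mono) auto
    moreover have "(1 + A) powr (1+dl) * (1 + A) powr (-(1+dl)) = 1" unfolding powr_add[symmetric] using A by simp
    ultimately have o: "1 \<le> (1 + A) powr (1+dl) * (1 + R * \<bar>x - y\<bar>) powr (-(1+dl))" by simp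
    have "\<bar>BR_kernel nu dl R x y\<bar> \<le> C0 * (R powr (2*a+1) * (1 + R * x) powr (-a) * (1 + R * y) powr (-a)) * 1"
      using C0(2)[of R x y] R x y by simp
    also have "... \<le> C0 * (R powr (2*a+1) * (1 + R * x) powr (-a) * (1 + R * y) powr (-a)) * ((1 + A) powr (1+dl) * (1 + R * \<bar>x - y\<bar>) powr (-(1+dl)))"
      using o C0 by (intro mult_left_mono) auto
    finally show ?thesis by (simp add: BR_bound_def mult_ac)
  qed
  have "\<bar>BR_kernel nu dl R x y\<bar> \<le> C * BR_bound a dl R x y" if R: "R > 0" and x: "x \<in> {0<..<1}" and y: "y \<in> {0<..<1}" for R x y
  proof -
    have u: "C0 * (1 + A) powr (1+dl) * BR_bound a dl R x y \<le> C * BR_bound a dl R x y"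
      "(C1 + C2) * 2 powr (1+dl) * BR_bound a dl R x y \<le> C * BR_bound a dl R x y"
      by (rule mult_right_mono[OF _ B0], use C0 C1 C2 in \<open>simp add: C_def\<close>)+
    have "R * \<bar>x - y\<bar> \<le> A \<or> (x < y \<and> R * (y - x) > A) \<or> (y < x \<and> R * (x - y) > A)"
    proof (cases "x < y")
      case True
      hence e: "\<bar>x - y\<bar> = y - x" by simp
      show ?thesis unfolding e using True by (cases "R * (y - x) \<le> A") auto
    next
      case False
      hence e: "\<bar>x - y\<bar> = x - y" by simp
      show ?thesis unfolding e using False A by (cases "x = y"; cases "R * (x - y) \<le> A") auto
    qed
    then consider "R * \<bar>x - y\<bar> \<le> A" | "x < y" "R * (y - x) > A" | "y < x" "R * (x - y) > A" by blast
    thus ?thesis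
    proof cases
      case 1 thus ?thesis using near[of R x y] R x y u(1) by auto
    next
      case 2 thus ?thesis using far[of R x y] R x y u(2) by auto
    next
      case 3 thus ?thesis using far[of R y x] R x y u(2) sym(1)[of R x y] sym(2)[of R x y] by auto
    qed
  qed
  thus ?thesis using C by blast
qed

section \<open>The maximal function\<close>

text \<open>The p-th power on [0, infinity] with the value infinity kept; it packages the case
  distinction in the integrand of \<open>Lp_norm\<close>, see \<open>Lp_norm_epow\<close>.\<close>

definition epow :: "real \<Rightarrow> ennreal \<Rightarrow> ennreal" where
  "epow p t = (if t = \<infinity> then \<infinity> else ennreal (enn2real t powr p))"

lemma epow_top [simp]: "epow p \<infinity> = \<infinity>" "epow p top = top"
  by (auto simp: epow_def)

lemma epow_ennreal: "x \<ge> 0 \<Longrightarrow> epow p (ennreal x) = ennreal (x powr p)"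
  by (simp add: epow_def)

lemma epow_0 [simp]: "epow p 0 = 0"
  by (simp add: epow_def)

lemma epow_mono: "p \<ge> 0 \<Longrightarrow> s \<le> t \<Longrightarrow> epow p s \<le> epow p t"
  by (cases s; cases t) (auto simp: epow_ennreal top_unique intro!: ennreal_leI powr_mono2)

lemma epow_mult: "p > 0 \<Longrightarrow> epow p (s * t) = epow p s * epow p t"
proof (cases s; cases t)
  fix a b assume "0 \<le> a" "0 \<le> b" "s = ennreal a" "t = ennreal b"
  thus ?thesis by (simp add: epow_ennreal ennreal_mult[symmetric] powr_mult)
next
  fix a assume "p > 0" "0 \<le> a" "s = ennreal a" "t = top"
  thus ?thesis by (cases "a = 0") (auto simp: epow_ennreal ennreal_mult_top ennreal_mult_eq_top_iff)
next
  fix a assume "p > 0" "0 \<le> a" "t = ennreal a" "s = top"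
  thus ?thesis by (cases "a = 0") (auto simp: epow_ennreal ennreal_top_mult ennreal_mult_eq_top_iff)
qed auto

lemma epow_add: assumes "p > 0" shows "epow p (s + t) \<le> ennreal (2 powr p) * (epow p s + epow p t)"
proof (cases s; cases t)
  fix a b assume ab: "0 \<le> a" "0 \<le> b" "s = ennreal a" "t = ennreal b"
  have "(a + b) powr p \<le> (2 * max a b) powr p" using assms ab by (intro powr_mono2) auto
  also have "... = 2 powr p * (max a b) powr p" by (rule powr_mult)
  also have "(max a b) powr p \<le> a powr p + b powr p" by (simp add: max_def)
  finally have "(a + b) powr p \<le> 2 powr p * (a powr p + b powr p)" by (simp add: mult_left_mono)
  thus ?thesis using ab by (simp add: epow_ennreal ennreal_mult[symmetric] flip: ennreal_plus)
qed (auto simp: ennreal_mult_top)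

lemma epow_measurable [measurable]: "epow p \<in> borel_measurable borel"
  unfolding epow_def[abs_def] by measurable

lemma nn_integral_powr_0:
  assumes "a > -1" "c \<ge> 0"
  shows "(NN l. ennreal (l powr a) * indicator {0..c} l) = ennreal (c powr (a+1) / (a+1))"
proof -
  have "((\<lambda>x. if x \<in> {0..c} then x powr a else 0) has_integral (c powr (a+1) / (a+1))) UNIV"
    unfolding has_integral_restrict_UNIV by (rule has_integral_powr_from_0[OF assms])
  hence "integral\<^sup>N lborel (\<lambda>x. ennreal (if x \<in> {0..c} then x powr a else 0)) = ennreal (c powr (a+1) / (a+1))"
    by (intro nn_integral_has_integral_lborel) auto
  moreover have "(\<lambda>x. ennreal (if x \<in> {0..c} then x powr a else 0)) = (\<lambda>l. ennreal (l powr a) * indicator {0..c} l)"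
    by (auto simp: indicator_def fun_eq_iff)
  ultimately show ?thesis by simp
qed

lemma nn_integral_powr_inf:
  assumes "a < -1" "c > 0"
  shows "(NN l. ennreal (l powr a) * indicator {c..} l) = ennreal (c powr (a+1) / (- (a+1)))"
proof -
  have "((\<lambda>x. if x \<in> {c..} then x powr a else 0) has_integral (- (c powr (a+1)) / (a+1))) UNIV"
    unfolding has_integral_restrict_UNIV by (rule has_integral_powr_to_inf[OF assms])
  hence "integral\<^sup>N lborel (\<lambda>x. ennreal (if x \<in> {c..} then x powr a else 0)) = ennreal (- (c powr (a+1)) / (a+1))"
    by (intro nn_integral_has_integral_lborel) auto
  moreover have "(\<lambda>x. ennreal (if x \<in> {c..} then x powr a else 0)) = (\<lambda>l. ennreal (l powr a) * indicator {c..} l)"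
    by (auto simp: indicator_def fun_eq_iff)
  moreover have "- (c powr (a+1)) / (a+1) = c powr (a+1) / (- (a+1))" by (metis minus_divide_left minus_divide_right)
  ultimately show ?thesis by metis
qed

text \<open>Only this direction is used. For finite c <= t the integral of p l^(p-1) over [0, c] is
  c^p, and t = infinity is exhausted by such c.\<close>

lemma epow_layer_cake:
  assumes p: "p > 0"
  shows "epow p t \<le> (NN l. (if 0 \<le> l \<and> ennreal l < t then ennreal (p * l powr (p - 1)) else 0))"
proof -
  have fin: "ennreal (c powr p) \<le> (NN l. (if 0 \<le> l \<and> ennreal l < t then ennreal (p * l powr (p - 1)) else 0))"
    if c: "c \<ge> 0" "ennreal c \<le> t" for c
  proof -
    have "ennreal (c powr p) = ennreal p * ennreal (c powr (p - 1 + 1) / (p - 1 + 1))"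
      using p by (simp add: ennreal_mult[symmetric])
    also have "... = ennreal p * (NN l. ennreal (l powr (p - 1)) * indicator {0..c} l)"
      using p c by (subst nn_integral_powr_0) auto
    also have "... = (NN l. ennreal p * (ennreal (l powr (p - 1)) * indicator {0..c} l))"
      by (rule nn_integral_cmult[symmetric]) measurable
    also have "... \<le> (NN l. (if 0 \<le> l \<and> ennreal l < t then ennreal (p * l powr (p - 1)) else 0))"
    proof (rule nn_integral_mono_AE)
      show "AE l in lborel. ennreal p * (ennreal (l powr (p - 1)) * indicator {0..c} l) \<le> (if 0 \<le> l \<and> ennreal l < t then ennreal (p * l powr (p - 1)) else 0)"
        using AE_lborel_singleton[of c]
      proof eventually_elim
        case (elim l)
        show ?case
        proof (cases "l \<in> {0..c}")
          case True
          hence "l < c" using elim by simp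
          hence "ennreal l < t" using True c by (metis atLeastAtMost_iff ennreal_lessI le_less_trans less_le_trans)
          thus ?thesis using True p by (simp add: ennreal_mult)
        qed simp
      qed
    qed
    finally show ?thesis .
  qed
  show ?thesis
  proof (cases t)
    case (real c) thus ?thesis using fin[of c] by (simp add: epow_ennreal)
  next
    case top
    show ?thesis
    proof (rule ccontr)
      assume "\<not> ?thesis"
      then obtain r where r: "r \<ge> 0" "(NN l. (if 0 \<le> l \<and> ennreal l < t then ennreal (p * l powr (p - 1)) else 0)) = ennreal r"
        using top by (cases "(NN l. (if 0 \<le> l \<and> ennreal l < t then ennreal (p * l powr (p - 1)) else 0))") auto
      have "ennreal (((r+1) powr (1/p)) powr p) \<le> ennreal r" using fin[of "(r+1) powr (1/p)"] top r(2) by simp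
      thus False using r(1) p by (simp add: powr_powr)
    qed
  qed
qed

text \<open>The centred maximal function over dyadic radii, so that the supremum is countable and
  measurable. The integral is divided by the radius and not by the length, so that the constant 1
  has value up to 2 (\<open>hlM_one\<close>).\<close>

definition hlM :: "(real \<Rightarrow> ennreal) \<Rightarrow> real \<Rightarrow> ennreal" where
  "hlM g x = (SUP k::int. ennreal (2 powr real_of_int k) * (NN y. (if \<bar>x - y\<bar> \<le> 2 powr (- real_of_int k) then g y else 0)))"

lemma hlM_measurable [measurable]:
  assumes [measurable]: "g \<in> borel_measurable borel"
  shows "hlM g \<in> borel_measurable borel"
  unfolding hlM_def[abs_def] by measurable

lemma hlM_upper: "ennreal (2 powr real_of_int k) * (NN y. (if \<bar>x - y\<bar> \<le> 2 powr (- real_of_int k) then g y else 0)) \<le> hlM g x"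
  unfolding hlM_def by (rule SUP_upper) simp

text \<open>Vitali's covering lemma: each point of the level set is the centre of a ball of radius r
  on which g has integral at least l r. Disjoint ones are selected whose fivefold enlargements, of
  length 10 r, cover the level set.\<close>

lemma hlM_weak_type:
  assumes g [measurable]: "g \<in> borel_measurable borel" and l: "l > 0"
  shows "ennreal l * emeasure lborel {x. ennreal l < hlM g x} \<le> 10 * (NN y. g y)"
proof (cases "(NN y. g y) = top")
  case True thus ?thesis by (simp add: ennreal_mult_top)
next
  case False
  then obtain I where I: "I \<ge> 0" "(NN y. g y) = ennreal I" by (cases "(NN y. g y)") auto
  define E where "E = {x. ennreal l < hlM g x}"
  have [measurable]: "E \<in> sets borel" unfolding E_def by measurable
  have "\<forall>x\<in>E. \<exists>k::int. ennreal l < ennreal (2 powr real_of_int k) * (NN y. (if \<bar>x - y\<bar> \<le> 2 powr (- real_of_int k) then g y else 0))"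
    unfolding E_def hlM_def by (auto simp: less_SUP_iff)
  then obtain k :: "real \<Rightarrow> int" where k: "\<And>x. x \<in> E \<Longrightarrow> ennreal l < ennreal (2 powr real_of_int (k x)) * (NN y. (if \<bar>x - y\<bar> \<le> 2 powr (- real_of_int (k x)) then g y else 0))"
    by metis
  define r where "r x = (2::real) powr (- real_of_int (k x))" for x
  have r0: "r x > 0" for x by (simp add: r_def)
  have cb: "(if \<bar>x - y\<bar> \<le> \<rho> then g y else 0) = g y * indicator (cball x \<rho>) y" for x y \<rho>
    by (auto simp: dist_real_def)
  have avg: "ennreal (l * r x) \<le> (NN y. g y * indicator (cball x (r x)) y)" if x: "x \<in> E" for x
  proof -
    have "ennreal (l * r x) = ennreal (r x) * ennreal l" using l r0[of x] by (simp add: ennreal_mult'[symmetric] mult.commute)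
    also have "... \<le> ennreal (r x) * (ennreal (2 powr real_of_int (k x)) * (NN y. g y * indicator (cball x (r x)) y))"
      using k[OF x] unfolding cb r_def[symmetric] by (intro mult_left_mono) (auto intro: less_imp_le)
    also have "... = (ennreal (r x) * ennreal (2 powr real_of_int (k x))) * (NN y. g y * indicator (cball x (r x)) y)"
      by (simp add: mult.assoc)
    also have "ennreal (r x) * ennreal (2 powr real_of_int (k x)) = 1"
      using r0[of x] by (simp add: ennreal_mult[symmetric] r_def powr_add[symmetric])
    finally show ?thesis by simp
  qed
  \<comment> \<open>The covering lemma requires bounded radii; this is where the integral of g has
    to be finite.\<close>
  have rB: "r x \<le> I / l" if x: "x \<in> E" for x
  proof -
    have "(NN y. g y * indicator (cball x (r x)) y) \<le> (NN y. g y)"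
      by (intro nn_integral_mono) (auto simp: indicator_def)
    hence "ennreal (l * r x) \<le> ennreal I" using avg[OF x] unfolding I(2) by (rule order_trans[rotated])
    hence "l * r x \<le> I" using I(1) by (simp add: ennreal_le_iff)
    thus ?thesis using l by (simp add: field_simps)
  qed
  have "E \<subseteq> (\<Union>i\<in>E. cball i (r i))" using r0 by (force intro: less_imp_le)
  moreover have "\<And>i. i \<in> E \<Longrightarrow> 0 < r i \<and> r i \<le> I / l" using r0 rB by blast
  ultimately obtain C where C: "countable C" "C \<subseteq> E"
     "pairwise (\<lambda>i j. disjnt (cball i (r i)) (cball j (r j))) C" "E \<subseteq> (\<Union>i\<in>C. cball i (5 * r i))"
    by (rule Vitali_covering_lemma_cballs[where a="\<lambda>i. i"])
  have "emeasure lborel E = (NN x. indicator E x)" by simp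
  \<comment> \<open>Sums over the countable family are written as integrals for the counting
    measure, so that they can be exchanged with the integral over x.\<close>
  also have "... \<le> (NN x. (\<integral>\<^sup>+i. indicator (cball i (5 * r i)) x \<partial>count_space C))"
  proof (rule nn_integral_mono)
    fix x show "indicator E x \<le> (\<integral>\<^sup>+i. indicator (cball i (5 * r i)) x \<partial>count_space C :: ennreal)"
    proof (cases "x \<in> E")
      case True
      then obtain j where j: "j \<in> C" "x \<in> cball j (5 * r j)" using C(4) by blast
      have "(1::ennreal) = (\<integral>\<^sup>+i. indicator {j} i \<partial>count_space C)" using j by (simp)
      also have "... \<le> (\<integral>\<^sup>+i. indicator (cball i (5 * r i)) x \<partial>count_space C)"
        using j by (intro nn_integral_mono) (auto simp: indicator_def)
      finally show ?thesis using True by simp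
    qed simp
  qed
  also have "... = (\<integral>\<^sup>+i. (NN x. indicator (cball i (5 * r i)) x) \<partial>count_space C)"
    by (rule nn_integral_count_space_nn_integral[OF C(1)]) (intro borel_measurable_indicator, simp)
  also have "... = (\<integral>\<^sup>+i. ennreal (10 * r i) \<partial>count_space C)"
  proof (rule nn_integral_cong)
    fix i
    have "cball i (5 * r i) = {i - 5 * r i..i + 5 * r i}" by (auto simp: dist_real_def)
    thus "(NN x. indicator (cball i (5 * r i)) x) = ennreal (10 * r i)" using r0[of i] by simp
  qed
  finally have 1: "emeasure lborel E \<le> (\<integral>\<^sup>+i. ennreal (10 * r i) \<partial>count_space C)" .
  have "ennreal l * emeasure lborel E \<le> ennreal l * (\<integral>\<^sup>+i. ennreal (10 * r i) \<partial>count_space C)"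
    by (intro mult_left_mono 1) simp
  also have "... = (\<integral>\<^sup>+i. ennreal l * ennreal (10 * r i) \<partial>count_space C)" by (rule nn_integral_cmult[symmetric]) simp
  also have "... = (\<integral>\<^sup>+i. 10 * ennreal (l * r i) \<partial>count_space C)"
  proof (rule nn_integral_cong)
    fix i show "ennreal l * ennreal (10 * r i) = 10 * ennreal (l * r i)"
    proof -
      have "10 * ennreal (l * r i) = ennreal 10 * ennreal (l * r i)" by simp
      also have "... = ennreal l * ennreal (10 * r i)" using l r0[of i] by (simp add: ennreal_mult[symmetric] mult_ac del: ennreal_numeral)
      finally show ?thesis by simp
    qed
  qed
  also have "... \<le> (\<integral>\<^sup>+i. 10 * (NN y. g y * indicator (cball i (r i)) y) \<partial>count_space C)"
    using C(2) by (intro nn_integral_mono mult_left_mono avg) auto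
  also have "... = 10 * (\<integral>\<^sup>+i. (NN y. g y * indicator (cball i (r i)) y) \<partial>count_space C)"
    by (rule nn_integral_cmult) simp
  also have "(\<integral>\<^sup>+i. (NN y. g y * indicator (cball i (r i)) y) \<partial>count_space C)
      = (NN y. (\<integral>\<^sup>+i. g y * indicator (cball i (r i)) y \<partial>count_space C))"
    by (rule nn_integral_count_space_nn_integral[OF C(1), symmetric])
       (intro borel_measurable_times_ennreal borel_measurable_indicator; simp)
  also have "... \<le> (NN y. g y)"
  proof (rule nn_integral_mono)
    fix y show "(\<integral>\<^sup>+i. g y * indicator (cball i (r i)) y \<partial>count_space C) \<le> g y"
    proof (cases "\<exists>j\<in>C. y \<in> cball j (r j)")
      case True
      then obtain j where j: "j \<in> C" "y \<in> cball j (r j)" by blast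
      have "(\<integral>\<^sup>+i. g y * indicator (cball i (r i)) y \<partial>count_space C) = (\<integral>\<^sup>+i. g y * indicator {j} i \<partial>count_space C)"
      proof (rule nn_integral_cong)
        fix i assume "i \<in> space (count_space C)"
        hence i: "i \<in> C" by simp
        have "y \<notin> cball i (r i)" if "i \<noteq> j"
          using C(3) i j that unfolding pairwise_def disjnt_def by blast
        thus "g y * indicator (cball i (r i)) y = g y * indicator {j} i" using j by (cases "i = j") auto
      qed
      also have "... = g y * (\<integral>\<^sup>+i. indicator {j} i \<partial>count_space C)" by (rule nn_integral_cmult) simp
      also have "... = g y" using j by simp
      finally show ?thesis by simp
    next
      case False
      hence "(\<integral>\<^sup>+i. g y * indicator (cball i (r i)) y \<partial>count_space C) = (\<integral>\<^sup>+i. 0 \<partial>count_space C)"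
        by (intro nn_integral_cong) auto
      thus ?thesis by simp
    qed
  qed
  finally show ?thesis unfolding E_def by (simp add: mult_left_mono)
qed

text \<open>Marcinkiewicz interpolation between the weak type and the trivial bound for bounded
  functions. At level l only the part of g above l / 4 counts, since the rest contributes at most l
  / 2 to \<open>hlM\<close>. The layer-cake formula and Fubini then leave the integral of l^(p-2) up
  to 4 h(x), which converges because p > 1.\<close>

lemma hlM_strong_type:
  assumes p: "p > 1"
  shows "\<exists>A>0. \<forall>h\<in>borel_measurable borel. (\<forall>x. h x \<ge> 0) \<longrightarrow>
     (NN x. epow p (hlM (\<lambda>y. ennreal (h y)) x)) \<le> ennreal A * (NN x. ennreal (h x powr p))"
proof -
  \<comment> \<open>20 is twice the 10 of the weak type, which is applied at level l / 2; p comes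
    from the layer cake and 4^(p-1) / (p-1) from integrating l^(p-2) over [0, 4 h].\<close>
  define A where "A = 20 * p * 4 powr (p-1) / (p-1)"
  have A: "A > 0" using p by (simp add: A_def)
  have "(NN x. epow p (hlM (\<lambda>y. ennreal (h y)) x)) \<le> ennreal A * (NN x. ennreal (h x powr p))"
    if h [measurable]: "h \<in> borel_measurable borel" and h0: "\<And>x. h x \<ge> 0" for h
  proof -
    define g where "g y = ennreal (h y)" for y
    have [measurable]: "g \<in> borel_measurable borel" unfolding g_def by measurable
    define gl where "gl l y = (if l < 4 * h y then g y else 0)" for l y
    have glm [measurable]: "gl l \<in> borel_measurable borel" for l unfolding gl_def by measurable
    have lev: "emeasure lborel {x. ennreal l < hlM g x} \<le> ennreal (20 / l) * (NN y. gl l y)" if l: "l > 0" for l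
    proof -
      have "hlM g x \<le> hlM (gl l) x + ennreal (l/2)" for x
        unfolding hlM_def[of g]
      proof (rule SUP_least)
        fix k :: int
        let ?r = "2 powr (- real_of_int k)"
        have "(NN y. (if \<bar>x - y\<bar> \<le> ?r then g y else 0))
          \<le> (NN y. (if \<bar>x - y\<bar> \<le> ?r then gl l y else 0) + ennreal (l/4) * indicator {x - ?r..x + ?r} y)"
          using l by (intro nn_integral_mono) (auto simp: gl_def g_def indicator_def abs_le_iff intro!: ennreal_leI)
        also have "... = (NN y. (if \<bar>x - y\<bar> \<le> ?r then gl l y else 0)) + ennreal (l/4) * ennreal (2 * ?r)"
          by (subst nn_integral_add) (auto simp: nn_integral_cmult)
        finally have "ennreal (2 powr real_of_int k) * (NN y. (if \<bar>x - y\<bar> \<le> ?r then g y else 0))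
          \<le> ennreal (2 powr real_of_int k) * ((NN y. (if \<bar>x - y\<bar> \<le> ?r then gl l y else 0)) + ennreal (l/4) * ennreal (2 * ?r))"
          by (intro mult_left_mono) auto
        also have "... = ennreal (2 powr real_of_int k) * (NN y. (if \<bar>x - y\<bar> \<le> ?r then gl l y else 0))
            + ennreal (2 powr real_of_int k) * (ennreal (l/4) * ennreal (2 * ?r))" by (rule distrib_left)
        also have "ennreal (2 powr real_of_int k) * (ennreal (l/4) * ennreal (2 * ?r)) = ennreal (l/2)"
        proof -
          have "2 powr real_of_int k * (l/4 * (2 * ?r)) = (l/2) * (2 powr real_of_int k * ?r)" by simp
          also have "2 powr real_of_int k * ?r = 1" by (simp flip: powr_add)
          finally show ?thesis using l by (simp add: ennreal_mult[symmetric])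
        qed
        also have "ennreal (2 powr real_of_int k) * (NN y. (if \<bar>x - y\<bar> \<le> ?r then gl l y else 0)) \<le> hlM (gl l) x"
          by (rule hlM_upper)
        finally show "ennreal (2 powr real_of_int k) * (NN y. (if \<bar>x - y\<bar> \<le> ?r then g y else 0)) \<le> hlM (gl l) x + ennreal (l/2)"
          by (simp add: add_right_mono)
      qed
      hence "ennreal (l/2) < hlM (gl l) x" if "ennreal l < hlM g x" for x
      proof -
        have "ennreal (l/2) + ennreal (l/2) < hlM (gl l) x + ennreal (l/2)"
          using that \<open>\<And>x. hlM g x \<le> hlM (gl l) x + ennreal (l/2)\<close>[of x] l by (simp add: less_le_trans flip: ennreal_plus)
        thus ?thesis by (meson add_right_mono leD leI)
      qed
      hence "emeasure lborel {x. ennreal l < hlM g x} \<le> emeasure lborel {x. ennreal (l/2) < hlM (gl l) x}"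
        by (intro emeasure_mono) auto
      also have "... = ennreal (2/l) * (ennreal (l/2) * emeasure lborel {x. ennreal (l/2) < hlM (gl l) x})"
        using l by (simp add: mult.assoc[symmetric] ennreal_mult[symmetric])
      also have "... \<le> ennreal (2/l) * (10 * (NN y. gl l y))"
        using l by (intro mult_left_mono hlM_weak_type) auto
      also have "... = ennreal (20 / l) * (NN y. gl l y)"
      proof -
        have "ennreal (2/l) * 10 = ennreal (2/l) * ennreal 10" by simp
        also have "... = ennreal (20/l)" using l by (simp add: ennreal_mult[symmetric] del: ennreal_numeral)
        finally show ?thesis by (simp add: mult.assoc[symmetric])
      qed
      finally show ?thesis .
    qed
    have "(NN x. epow p (hlM g x)) \<le> (NN x. (NN l. (if 0 \<le> l \<and> ennreal l < hlM g x then ennreal (p * l powr (p - 1)) else 0)))"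
      using p by (intro nn_integral_mono epow_layer_cake) auto
    also have "... = (NN l. (NN x. (if 0 \<le> l \<and> ennreal l < hlM g x then ennreal (p * l powr (p - 1)) else 0)))"
      by (rule lborel_pair.Fubini') measurable
    also have "... \<le> (NN l. (NN x. (if 0 \<le> l \<and> l < 4 * h x then ennreal (20 * p * l powr (p - 2)) * g x else 0)))"
    proof (rule nn_integral_mono)
      fix l :: real
      show "(NN x. (if 0 \<le> l \<and> ennreal l < hlM g x then ennreal (p * l powr (p - 1)) else 0))
        \<le> (NN x. (if 0 \<le> l \<and> l < 4 * h x then ennreal (20 * p * l powr (p - 2)) * g x else 0))"
      proof (cases "l > 0")
        case True
        have "(NN x. (if 0 \<le> l \<and> ennreal l < hlM g x then ennreal (p * l powr (p - 1)) else 0))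
          = (NN x. ennreal (p * l powr (p - 1)) * indicator {x. ennreal l < hlM g x} x)"
          using True by (intro nn_integral_cong) (auto simp: indicator_def)
        also have "... = ennreal (p * l powr (p - 1)) * emeasure lborel {x. ennreal l < hlM g x}"
          by (rule nn_integral_cmult_indicator) measurable
        also have "... \<le> ennreal (p * l powr (p - 1)) * (ennreal (20 / l) * (NN y. gl l y))"
          by (intro mult_left_mono lev True) auto
        also have "... = ennreal (20 * p * l powr (p - 2)) * (NN y. gl l y)"
        proof -
          have e: "l powr (p - 1) / l = l powr (p - 2)" using True by (simp add: powr_diff power2_eq_square)
          have "p * l powr (p - 1) * (20 / l) = 20 * p * (l powr (p - 1) / l)" by simp
          also have "... = 20 * p * l powr (p - 2)" unfolding e ..
          finally have "ennreal (p * l powr (p - 1)) * ennreal (20 / l) = ennreal (20 * p * l powr (p - 2))"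
            using True p by (simp add: ennreal_mult[symmetric])
          thus ?thesis by (simp add: mult.assoc[symmetric])
        qed
        also have "... = (NN y. ennreal (20 * p * l powr (p - 2)) * gl l y)" by (rule nn_integral_cmult[symmetric]) measurable
        also have "... = (NN x. (if 0 \<le> l \<and> l < 4 * h x then ennreal (20 * p * l powr (p - 2)) * g x else 0))"
          using True by (intro nn_integral_cong) (auto simp: gl_def)
        finally show ?thesis .
      next
        case False
        hence "(if 0 \<le> l \<and> ennreal l < hlM g x then ennreal (p * l powr (p - 1)) else 0) = 0" for x
          by (cases "l = 0") auto
        thus ?thesis by simp
      qed
    qed
    also have "... = (NN x. (NN l. (if 0 \<le> l \<and> l < 4 * h x then ennreal (20 * p * l powr (p - 2)) * g x else 0)))"
      by (rule lborel_pair.Fubini') measurable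
    also have "... \<le> (NN x. ennreal A * ennreal (h x powr p))"
    proof (rule nn_integral_mono)
      fix x
      have "(NN l. (if 0 \<le> l \<and> l < 4 * h x then ennreal (20 * p * l powr (p - 2)) * g x else 0))
        \<le> (NN l. ennreal (20 * p * h x) * (ennreal (l powr (p - 2)) * indicator {0..4 * h x} l))"
      proof (rule nn_integral_mono)
        fix l
        have "ennreal (20 * p * l powr (p - 2)) * g x = ennreal (20 * p * h x) * ennreal (l powr (p - 2))"
          unfolding g_def using p h0[of x] by (simp add: ennreal_mult[symmetric] mult_ac)
        thus "(if 0 \<le> l \<and> l < 4 * h x then ennreal (20 * p * l powr (p - 2)) * g x else 0) \<le> ennreal (20 * p * h x) * (ennreal (l powr (p - 2)) * indicator {0..4 * h x} l)"
          by (simp add: indicator_def)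
      qed
      also have "... = ennreal (20 * p * h x) * (NN l. (ennreal (l powr (p - 2)) * indicator {0..4 * h x} l))"
        by (rule nn_integral_cmult) measurable
      also have "... = ennreal (20 * p * h x) * ennreal ((4 * h x) powr (p - 2 + 1) / (p - 2 + 1))"
        using p h0[of x] by (subst nn_integral_powr_0) auto
      also have "... = ennreal (20 * p * h x * ((4 * h x) powr (p - 1) / (p - 1)))"
        using p h0[of x] by (simp add: ennreal_mult[symmetric])
      also have "20 * p * h x * ((4 * h x) powr (p - 1) / (p - 1)) = A * h x powr p"
      proof -
        have "h x powr 1 * h x powr (p - 1) = h x powr p" unfolding powr_add[symmetric] by simp
        hence "h x * h x powr (p - 1) = h x powr p" using h0[of x] by (simp add: abs_of_nonneg)
        moreover have "(4 * h x) powr (p - 1) = 4 powr (p-1) * h x powr (p - 1)" by (rule powr_mult)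
        moreover have "20 * p * H * ((F * G) / (p - 1)) = (20 * p * F / (p - 1)) * (H * G)" for H F G by simp
        ultimately show ?thesis unfolding A_def by simp
      qed
      also have "ennreal (A * h x powr p) = ennreal A * ennreal (h x powr p)" using A by (simp add: ennreal_mult)
      finally show "(NN l. (if 0 \<le> l \<and> l < 4 * h x then ennreal (20 * p * l powr (p - 2)) * g x else 0)) \<le> ennreal A * ennreal (h x powr p)" .
    qed
    also have "... = ennreal A * (NN x. ennreal (h x powr p))" by (rule nn_integral_cmult) measurable
    finally show ?thesis unfolding g_def .
  qed
  thus ?thesis using A by blast
qed

text \<open>Decompose dyadically with balls of radius 2^(j-n), where 2^n <= R <= 2^(n+1). On the
  j-th shell the kernel is O(2^n 2^(-j(1+delta))), and the ball costs 2^(j-n) times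
  \<open>hlM\<close>, which leaves the geometric series of 2^(-j delta).\<close>

lemma kernel_le_hlM:
  assumes dl: "dl > 0"
  shows "\<exists>A>0. \<forall>g\<in>borel_measurable borel. \<forall>R>0. \<forall>x. (NN y. ennreal (R * (1 + R * \<bar>x - y\<bar>) powr (-(1+dl))) * g y) \<le> ennreal A * hlM g x"
proof -
  define q where "q = (2::real) powr (-dl)"
  have q: "0 < q" "q < 1" using dl by (auto simp: q_def powr_minus_divide)
  define D where "D = 2 * 2 powr (1+dl)"
  have D: "D > 0" by (simp add: D_def)
  define A where "A = D * (1 / (1 - q))"
  have A: "A > 0" using D q by (simp add: A_def)
  have "(NN y. ennreal (R * (1 + R * \<bar>x - y\<bar>) powr (-(1+dl))) * g y) \<le> ennreal A * hlM g x"
    if g [measurable]: "g \<in> borel_measurable borel" and R: "R > 0" for g R x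
  proof -
    define n where "n = \<lfloor>log 2 R\<rfloor>"
    define P where "P = (2::real) powr real_of_int n"
    have P: "P > 0" by (simp add: P_def)
    have "real_of_int n \<le> log 2 R" "log 2 R < real_of_int n + 1" by (auto simp: n_def)
    hence "2 powr real_of_int n \<le> 2 powr log 2 R" "2 powr log 2 R \<le> 2 powr (real_of_int n + 1)" by auto
    hence PR: "P \<le> R" "R \<le> 2 * P" using R by (auto simp: P_def powr_add)
    define c where "c j = D * P * (2 powr (-(1+dl))) powr real j" for j :: nat
    have pt: "ennreal (R * (1 + R * d) powr (-(1+dl))) \<le> (\<Sum>j. ennreal (c j) * (if d \<le> 2 powr (- real_of_int (n - int j)) then 1 else 0))" if d: "d \<ge> 0" for d
    proof -
      have ex: "\<exists>j::nat. P * d \<le> 2 ^ j" using real_arch_pow[of 2 "P * d"] by (auto intro: less_imp_le)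
      \<comment> \<open>The least j puts d into the j-th ball but, if j > 0, outside the preceding
        one; this gives the lower bound on P d that the kernel estimate needs.\<close>
      define j where "j = (LEAST j::nat. P * d \<le> 2 ^ j)"
      have j: "P * d \<le> 2 ^ j" unfolding j_def by (rule LeastI_ex[OF ex])
      have jm: "P * d > 2 ^ (j - 1)" if "j > 0"
        using not_less_Least[of "j - 1" "\<lambda>j. P * d \<le> 2 ^ j"] that unfolding j_def[symmetric] by (auto simp: not_le)
      have "(1 + R * d) powr (-(1+dl)) \<le> (1 + P * d) powr (-(1+dl))"
        using PR P d dl by (intro powr_mono2' add_left_mono mult_right_mono) (auto intro: add_pos_nonneg)
      also have "... \<le> 2 powr (1+dl) * (2 powr (-(1+dl))) powr real j"
      proof (cases "j = 0")
        case True
        have "(1 + P * d) powr (-(1+dl)) \<le> 1 powr (-(1+dl))" using P d dl by (intro powr_mono2') auto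
        also have "... \<le> 2 powr (1+dl)" using dl by (simp add: ge_one_powr_ge_zero)
        finally show ?thesis using True by simp
      next
        case False
        have "(2::real) powr (real j - 1) = 2 ^ (j - 1)" using False by (subst powr_realpow[symmetric]) (auto simp: of_nat_diff)
        hence "2 powr (real j - 1) \<le> 1 + P * d" using jm False by simp
        hence "(1 + P * d) powr (-(1+dl)) \<le> (2 powr (real j - 1)) powr (-(1+dl))" using dl by (intro powr_mono2') auto
        also have "... = 2 powr (1+dl) * (2 powr (-(1+dl))) powr real j"
          unfolding powr_powr powr_add[symmetric] by (simp add: algebra_simps)
        finally show ?thesis .
      qed
      finally have "R * (1 + R * d) powr (-(1+dl)) \<le> (2 * P) * (2 powr (1+dl) * (2 powr (-(1+dl))) powr real j)"
        using PR P by (intro mult_mono) auto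
      also have "... = c j" by (simp add: c_def D_def)
      finally have 1: "R * (1 + R * d) powr (-(1+dl)) \<le> c j" .
      have "d \<le> 2 powr (- real_of_int (n - int j))"
      proof -
        have "2 powr (- real_of_int (n - int j)) = 2 powr real j / P"
          unfolding P_def powr_diff[symmetric] by simp
        also have "... = 2 ^ j / P" by (simp add: powr_realpow)
        finally have e: "2 powr (- real_of_int (n - int j)) = 2 ^ j / P" .
        show ?thesis unfolding e using j P by (simp add: pos_le_divide_eq mult.commute)
      qed
      hence "ennreal (c j) = (\<Sum>i. if i = j then ennreal (c i) * (if d \<le> 2 powr (- real_of_int (n - int i)) then 1 else 0) else 0)"
        using sums_unique[OF sums_single[of j "\<lambda>i. ennreal (c i) * (if d \<le> 2 powr (- real_of_int (n - int i)) then 1 else 0)"]] by simp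
      also have "... \<le> (\<Sum>j. ennreal (c j) * (if d \<le> 2 powr (- real_of_int (n - int j)) then 1 else 0))"
        by (intro suminf_le) auto
      finally show ?thesis using 1 by (meson ennreal_leI order_trans)
    qed
    have "(NN y. ennreal (R * (1 + R * \<bar>x - y\<bar>) powr (-(1+dl))) * g y)
      \<le> (NN y. (\<Sum>j. ennreal (c j) * (if \<bar>x - y\<bar> \<le> 2 powr (- real_of_int (n - int j)) then g y else 0)))"
    proof (rule nn_integral_mono)
      fix y
      have "ennreal (R * (1 + R * \<bar>x - y\<bar>) powr (-(1+dl))) * g y \<le> (\<Sum>j. ennreal (c j) * (if \<bar>x - y\<bar> \<le> 2 powr (- real_of_int (n - int j)) then 1 else 0)) * g y"
        by (intro mult_right_mono pt) auto
      also have "... = (\<Sum>j. (ennreal (c j) * (if \<bar>x - y\<bar> \<le> 2 powr (- real_of_int (n - int j)) then 1 else 0)) * g y)" by simp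
      also have "... = (\<Sum>j. ennreal (c j) * (if \<bar>x - y\<bar> \<le> 2 powr (- real_of_int (n - int j)) then g y else 0))"
        by (intro suminf_cong) auto
      finally show "ennreal (R * (1 + R * \<bar>x - y\<bar>) powr (-(1+dl))) * g y \<le> (\<Sum>j. ennreal (c j) * (if \<bar>x - y\<bar> \<le> 2 powr (- real_of_int (n - int j)) then g y else 0))" .
    qed
    also have "... = (\<Sum>j. NN y. ennreal (c j) * (if \<bar>x - y\<bar> \<le> 2 powr (- real_of_int (n - int j)) then g y else 0))"
      by (rule nn_integral_suminf) measurable
    also have "... \<le> (\<Sum>j. ennreal (D * q ^ j) * hlM g x)"
    proof (rule suminf_le)
      fix j
      have "(NN y. ennreal (c j) * (if \<bar>x - y\<bar> \<le> 2 powr (- real_of_int (n - int j)) then g y else 0))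
         = ennreal (c j) * (NN y. (if \<bar>x - y\<bar> \<le> 2 powr (- real_of_int (n - int j)) then g y else 0))"
        by (rule nn_integral_cmult) measurable
      also have "... = ennreal ((D * q ^ j) * 2 powr real_of_int (n - int j)) * (NN y. (if \<bar>x - y\<bar> \<le> 2 powr (- real_of_int (n - int j)) then g y else 0))"
      proof -
        have "q ^ j = q powr real j" using q by (simp add: powr_realpow)
        moreover have "P * (2 powr (-(1+dl))) powr real j = q powr real j * 2 powr real_of_int (n - int j)"
          unfolding P_def q_def powr_powr powr_add[symmetric] by (simp add: algebra_simps)
        ultimately have "c j = (D * q ^ j) * 2 powr real_of_int (n - int j)" by (simp add: c_def mult.assoc)
        thus ?thesis by (simp only:)
      qed
      also have "ennreal ((D * q ^ j) * 2 powr real_of_int (n - int j)) * (NN y. (if \<bar>x - y\<bar> \<le> 2 powr (- real_of_int (n - int j)) then g y else 0))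
        = ennreal (D * q ^ j) * (ennreal (2 powr real_of_int (n - int j)) * (NN y. (if \<bar>x - y\<bar> \<le> 2 powr (- real_of_int (n - int j)) then g y else 0)))"
        using D q by (simp add: ennreal_mult mult.assoc)
      also have "... \<le> ennreal (D * q ^ j) * hlM g x" by (intro mult_left_mono hlM_upper) simp
      finally show "(NN y. ennreal (c j) * (if \<bar>x - y\<bar> \<le> 2 powr (- real_of_int (n - int j)) then g y else 0)) \<le> ennreal (D * q ^ j) * hlM g x" .
    qed auto
    also have "... = (\<Sum>j. ennreal (D * q ^ j)) * hlM g x" by simp
    also have "(\<Sum>j. ennreal (D * q ^ j)) = ennreal A"
    proof -
      have "(\<lambda>j. D * q ^ j) sums (D * (1 / (1 - q)))" using q by (intro sums_mult geometric_sums) auto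
      thus ?thesis unfolding A_def using D q by (intro suminf_ennreal_eq) auto
    qed
    finally show ?thesis .
  qed
  thus ?thesis using A by blast
qed

section \<open>Weighted bounds for the positive kernel\<close>

lemma one_add_powr_small:
  fixes v e :: real
  assumes "0 \<le> v" "v \<le> 1" shows "(1 + v) powr e \<le> 2 powr \<bar>e\<bar>"
proof -
  have "(1 + v) powr e \<le> (1 + v) powr \<bar>e\<bar>" using assms by (intro powr_mono) auto
  also have "... \<le> 2 powr \<bar>e\<bar>" using assms by (intro powr_mono2) auto
  finally show ?thesis .
qed

lemma one_add_powr_large:
  fixes v e :: real
  assumes "1 \<le> v" shows "(1 + v) powr e \<le> 2 powr \<bar>e\<bar> * v powr e"
proof (cases "e \<ge> 0")
  case True
  have "(1 + v) powr e \<le> (2 * v) powr e" using assms True by (intro powr_mono2) auto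
  thus ?thesis using True by (simp add: powr_mult)
next
  case False
  have "1 * (1 + v) powr e \<le> 2 powr \<bar>e\<bar> * v powr e"
    using assms False by (intro mult_mono powr_mono2' ge_one_powr_ge_zero) auto
  thus ?thesis by simp
qed

lemma half_powr_minus: "((v::real) / 2) powr (- e) = 2 powr e * v powr (- e)"
proof -
  have "2 powr (- e) = (1 :: real) / 2 powr e" by (rule powr_minus_divide)
  thus ?thesis by (simp add: powr_divide)
qed

lemma inverse_powr_real: "(1 / (r::real)) powr e = r powr (- e)"
  by (simp add: powr_divide powr_minus_divide)

text \<open>Here X = R u and r = v / u for the larger variable u and the smaller v. The profile is
  bounded for X <= 1, at most of order X^(a - delta) up to X = 1 / r, and of order r^(-a) X^(-delta)
  beyond. The worst cases are X = 1 and X = 1 / r, which give r^0 and r^(delta - a); the bound is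
  uniform in R.\<close>

lemma kernel_profile_bound:
  fixes a dl X r :: real
  assumes a: "2 * a + 1 > 0" and dl: "dl > 0" and X: "X > 0" and r: "0 < r" "r \<le> 1"
  shows "X powr (2*a+1) * (1 + X) powr (-(a+1+dl)) * (1 + r * X) powr (-a) \<le> 2 powr \<bar>a\<bar> * r powr (min 0 (dl - a))"
proof -
  define m where "m = min 0 (dl - a)"
  have m: "m \<le> 0" "m \<le> dl - a" by (auto simp: m_def)
  have r1: "1 \<le> r powr m"
  proof -
    have "1 powr m \<le> r powr m" using r m by (intro powr_mono2') auto
    thus ?thesis by simp
  qed
  have e: "a + 1 + dl > 0" using a dl by simp
  show ?thesis unfolding m_def[symmetric]
  proof (cases "X \<le> 1")
    case True
    have "X powr (2*a+1) \<le> 1" using X True a by (intro powr_le1) auto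
    moreover have "(1 + X) powr (-(a+1+dl)) \<le> 1 powr (-(a+1+dl))" using X e by (intro powr_mono2') auto
    moreover have "(1 + r * X) powr (-a) \<le> 2 powr \<bar>-a\<bar>" using X True r by (intro one_add_powr_small) (auto simp: mult_le_one)
    ultimately have "X powr (2*a+1) * (1 + X) powr (-(a+1+dl)) * (1 + r * X) powr (-a) \<le> 1 * 1 * 2 powr \<bar>a\<bar>"
      by (intro mult_mono) auto
    also have "... \<le> 2 powr \<bar>a\<bar> * r powr m" using r1 by simp
    finally show "X powr (2*a+1) * (1 + X) powr (-(a+1+dl)) * (1 + r * X) powr (-a) \<le> 2 powr \<bar>a\<bar> * r powr m" .
  next
    case False
    have "(1 + X) powr (-(a+1+dl)) \<le> X powr (-(a+1+dl))" using False e by (intro powr_mono2') auto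
    hence "X powr (2*a+1) * (1 + X) powr (-(a+1+dl)) \<le> X powr (2*a+1) * X powr (-(a+1+dl))" by (intro mult_left_mono) auto
    also have "... = X powr (a - dl)" unfolding powr_add[symmetric] by (simp add: algebra_simps)
    finally have A: "X powr (2*a+1) * (1 + X) powr (-(a+1+dl)) \<le> X powr (a - dl)" .
    have "X powr (2*a+1) * (1 + X) powr (-(a+1+dl)) * (1 + r * X) powr (-a) \<le> X powr (a - dl) * (1 + r * X) powr (-a)"
      by (intro mult_right_mono A) auto
    also have "... \<le> 2 powr \<bar>a\<bar> * r powr m"
    proof (cases "r * X \<le> 1")
      case True
      have "(1 + r * X) powr (-a) \<le> 2 powr \<bar>-a\<bar>" using X True r by (intro one_add_powr_small) auto
      moreover have "X powr (a - dl) \<le> r powr m"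
      proof (cases "a \<le> dl")
        case True
        have "X powr (a - dl) \<le> X powr 0" using False True by (intro powr_mono) auto
        thus ?thesis using r1 X by simp
      next
        case F: False
        have "X \<le> 1 / r" using True r by (simp add: field_simps)
        hence "X powr (a - dl) \<le> (1 / r) powr (a - dl)" using F X by (intro powr_mono2) auto
        also have "... = r powr (-(a - dl))" by (rule inverse_powr_real)
        also have "-(a - dl) = m" using F by (simp add: m_def)
        finally show ?thesis .
      qed
      ultimately have "X powr (a - dl) * (1 + r * X) powr (-a) \<le> r powr m * 2 powr \<bar>-a\<bar>" by (intro mult_mono) auto
      thus ?thesis by (simp add: mult.commute)
    next
      case F: False
      have "(1 + r * X) powr (-a) \<le> 2 powr \<bar>-a\<bar> * (r * X) powr (-a)" using F by (intro one_add_powr_large) auto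
      hence "X powr (a - dl) * (1 + r * X) powr (-a) \<le> X powr (a - dl) * (2 powr \<bar>a\<bar> * (r * X) powr (-a))"
        by (intro mult_left_mono) auto
      also have "... = 2 powr \<bar>a\<bar> * ((X powr (a - dl) * X powr (-a)) * r powr (-a))"
        using X r by (simp add: powr_mult mult_ac)
      also have "X powr (a - dl) * X powr (-a) = X powr (-dl)" unfolding powr_add[symmetric] by simp
      also have "X powr (-dl) \<le> (1 / r) powr (-dl)" using F r dl by (intro powr_mono2') (auto simp: field_simps)
      hence "2 powr \<bar>a\<bar> * (X powr (-dl) * r powr (-a)) \<le> 2 powr \<bar>a\<bar> * ((1 / r) powr (-dl) * r powr (-a))"
        by (intro mult_left_mono mult_right_mono) auto
      also have "(1 / r) powr (-dl) = r powr dl" using r by (simp add: powr_divide powr_minus_divide)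
      also have "r powr dl * r powr (-a) = r powr (dl - a)" unfolding powr_add[symmetric] by simp
      also have "r powr (dl - a) \<le> r powr m" using r m by (intro powr_mono') auto
      hence "2 powr \<bar>a\<bar> * r powr (dl - a) \<le> 2 powr \<bar>a\<bar> * r powr m" by (intro mult_left_mono) auto
      finally show ?thesis .
    qed
    finally show "X powr (2*a+1) * (1 + X) powr (-(a+1+dl)) * (1 + r * X) powr (-a) \<le> 2 powr \<bar>a\<bar> * r powr m" .
  qed
qed

text \<open>The kernel majorant of the weighted problem: y^(2 a - B) times y^B |f| is y^(2 nu + 1)
  |f|, since 2 a = 2 nu + 1, so the density of the measure is already included.\<close>

definition wk :: "real \<Rightarrow> real \<Rightarrow> real \<Rightarrow> real \<Rightarrow> real \<Rightarrow> real \<Rightarrow> real \<Rightarrow> real" where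
  "wk a dl b B R x y = x powr b * BR_bound a dl R x y * y powr (2*a - B)"

lemma wk_nonneg [simp]: "wk a dl b B R x y \<ge> 0" by (simp add: wk_def BR_bound_def)

lemma far_decay:
  fixes R u v dl :: real
  assumes "R > 0" "dl > 0" "0 < v" "v \<le> u / 2"
  shows "(1 + R * \<bar>u - v\<bar>) powr (-(1+dl)) \<le> 2 powr (1+dl) * (1 + R * u) powr (-(1+dl))"
proof -
  have "R * (u / 2) \<le> R * \<bar>u - v\<bar>" using assms by (intro mult_left_mono) auto
  hence "(1 + R * u) / 2 \<le> 1 + R * \<bar>u - v\<bar>" by simp
  moreover have p: "1 + R * u > 0" using assms by (intro add_pos_nonneg) auto
  ultimately have "(1 + R * \<bar>u - v\<bar>) powr (-(1+dl)) \<le> ((1 + R * u) / 2) powr (-(1+dl))"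
    using assms by (intro powr_mono2') auto
  also have "... = 2 powr (1+dl) * (1 + R * u) powr (-(1+dl))"
    by (rule half_powr_minus)
  finally show ?thesis .
qed

text \<open>As v <= u / 2, the distance is comparable to u, and the decay in |u - v| becomes
  additional decay in the larger variable.\<close>

lemma BR_bound_far:
  fixes R u v a dl :: real
  assumes "R > 0" "dl > 0" "0 < v" "v \<le> u / 2"
  shows "R powr (2*a+1) * (1 + R * u) powr (-a) * (1 + R * v) powr (-a) * (1 + R * \<bar>u - v\<bar>) powr (-(1+dl))
     \<le> 2 powr (1+dl) * (R powr (2*a+1) * (1 + R * u) powr (-(a+1+dl)) * (1 + R * v) powr (-a))"
proof -
  have "R powr (2*a+1) * (1 + R * u) powr (-a) * (1 + R * v) powr (-a) * (1 + R * \<bar>u - v\<bar>) powr (-(1+dl))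
    \<le> R powr (2*a+1) * (1 + R * u) powr (-a) * (1 + R * v) powr (-a) * (2 powr (1+dl) * (1 + R * u) powr (-(1+dl)))"
    by (intro mult_left_mono far_decay assms) auto
  also have "... = 2 powr (1+dl) * (R powr (2*a+1) * ((1 + R * u) powr (-a) * (1 + R * u) powr (-(1+dl))) * (1 + R * v) powr (-a))"
    by (simp only: mult_ac)
  also have "(1 + R * u) powr (-a) * (1 + R * u) powr (-(1+dl)) = (1 + R * u) powr (-(a+1+dl))"
    unfolding powr_add[symmetric] by (simp add: algebra_simps)
  finally show ?thesis .
qed

lemma BR_bound_far_profile:
  fixes R u v a dl :: real
  assumes a: "2 * a + 1 > 0" and R: "R > 0" "dl > 0" "0 < v" "v \<le> u / 2"
  shows "R powr (2*a+1) * (1 + R * u) powr (-a) * (1 + R * v) powr (-a) * (1 + R * \<bar>u - v\<bar>) powr (-(1+dl))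
     \<le> 2 powr (1+dl+\<bar>a\<bar>) * (u powr (-(2*a+1)) * (v / u) powr (min 0 (dl - a)))"
proof -
  have u: "u > 0" using R by simp
  have "R powr (2*a+1) * (1 + R * u) powr (-(a+1+dl)) * (1 + R * v) powr (-a)
     = u powr (-(2*a+1)) * ((R * u) powr (2*a+1) * (1 + R * u) powr (-(a+1+dl)) * (1 + (v / u) * (R * u)) powr (-a))"
  proof -
    have "u powr (-(2*a+1)) * u powr (2*a+1) = 1" unfolding powr_add[symmetric] using u by simp
    hence "R powr (2*a+1) = u powr (-(2*a+1)) * (R * u) powr (2*a+1)" using R u by (simp add: powr_mult)
    moreover have "(v / u) * (R * u) = R * v" using u by simp
    ultimately show ?thesis by (simp add: mult.assoc)
  qed
  also have "... \<le> u powr (-(2*a+1)) * (2 powr \<bar>a\<bar> * (v / u) powr (min 0 (dl - a)))"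
    using R u by (intro mult_left_mono kernel_profile_bound a) auto
  finally have "2 powr (1+dl) * (R powr (2*a+1) * (1 + R * u) powr (-(a+1+dl)) * (1 + R * v) powr (-a))
    \<le> 2 powr (1+dl) * (u powr (-(2*a+1)) * (2 powr \<bar>a\<bar> * (v / u) powr (min 0 (dl - a))))" by (intro mult_left_mono) auto
  also have "... = 2 powr (1+dl+\<bar>a\<bar>) * (u powr (-(2*a+1)) * (v / u) powr (min 0 (dl - a)))"
    by (simp add: powr_add mult_ac)
  finally show ?thesis using BR_bound_far[OF R, of a] by linarith
qed

text \<open>A Hardy kernel (y / x)^e with respect to dy / y. The exponent e = 2 a + 1 - B + min 0
  (delta - a) is positive exactly when B < 2 a + 1 and B < a + 1 + delta, the normalised forms of
  (2) and of the strict case of (4). The remaining factor x^(b - B) is at most 1 because B <=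
  b.\<close>

lemma wk_left:
  assumes a: "2 * a + 1 > 0" and R: "R > 0" "dl > 0" and y: "0 < y" "y \<le> x / 2" and x: "x \<le> 1" and bB: "B \<le> b"
  shows "wk a dl b B R x y \<le> 2 powr (1+dl+\<bar>a\<bar>) * ((y / x) powr (2*a+1-B + min 0 (dl - a)) / y)"
proof -
  define m where "m = min 0 (dl - a)"
  have xp: "x > 0" using y by simp
  have "wk a dl b B R x y \<le> x powr b * (2 powr (1+dl+\<bar>a\<bar>) * (x powr (-(2*a+1)) * (y / x) powr m)) * y powr (2*a - B)"
    unfolding wk_def BR_bound_def m_def by (intro mult_right_mono mult_left_mono BR_bound_far_profile a R y) auto
  also have "... = 2 powr (1+dl+\<bar>a\<bar>) * (x powr (b - B) * ((y / x) powr (2*a+1-B + m) / y))"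
  proof -
    have 1: "x powr b * x powr (-(2*a+1)) = x powr (b - B) * x powr (-(2*a+1-B))" unfolding powr_add[symmetric] by simp
    have 2: "y powr (2*a - B) = y powr (2*a+1-B) / y"
    proof -
      have "y powr (2*a+1-B) = y powr (2*a - B) * y powr 1" unfolding powr_add[symmetric] by (simp add: algebra_simps)
      thus ?thesis using y by simp
    qed
    have 3: "(y / x) powr (2*a+1-B + m) = x powr (-(2*a+1-B)) * y powr (2*a+1-B) * (y / x) powr m"
    proof -
      have "(y / x) powr (2*a+1-B) = y powr (2*a+1-B) / x powr (2*a+1-B)" using y xp by (intro powr_divide) 
      also have "... = x powr (-(2*a+1-B)) * y powr (2*a+1-B)" unfolding powr_minus by (simp add: divide_inverse mult.commute)
      finally show ?thesis unfolding powr_add by simp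
    qed
    have "A * (C * (P * M)) * (Q / y) = C * (A * P) * M * Q / y" for A C P M Q by simp
    hence "x powr b * (2 powr (1+dl+\<bar>a\<bar>) * (x powr (-(2*a+1)) * (y / x) powr m)) * y powr (2*a - B)
      = 2 powr (1+dl+\<bar>a\<bar>) * (x powr b * x powr (-(2*a+1))) * (y / x) powr m * y powr (2*a+1-B) / y" unfolding 2 .
    thus ?thesis unfolding 1 3 by (simp add: mult_ac)
  qed
  also have "... \<le> 2 powr (1+dl+\<bar>a\<bar>) * (1 * ((y / x) powr (2*a+1-B + m) / y))"
    using xp x bB y by (intro mult_left_mono mult_right_mono powr_le1) auto
  finally show ?thesis by (simp add: m_def)
qed

text \<open>The mirror image for x <= y / 2. The exponent b + min 0 (delta - a) is positive exactly
  when b > 0 and b > a - delta, the normalised strict forms of (1) and (3).\<close>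

lemma wk_right:
  assumes a: "2 * a + 1 > 0" and R: "R > 0" "dl > 0" and x: "0 < x" "x \<le> y / 2" and y: "y \<le> 1" and bB: "B \<le> b"
  shows "wk a dl b B R x y \<le> 2 powr (1+dl+\<bar>a\<bar>) * ((x / y) powr (b + min 0 (dl - a)) / y)"
proof -
  define m where "m = min 0 (dl - a)"
  have yp: "y > 0" using x by simp
  have s: "R powr (2*a+1) * (1 + R * x) powr (-a) * (1 + R * y) powr (-a) * (1 + R * \<bar>x - y\<bar>) powr (-(1+dl))
    = R powr (2*a+1) * (1 + R * y) powr (-a) * (1 + R * x) powr (-a) * (1 + R * \<bar>y - x\<bar>) powr (-(1+dl))"
    by (simp add: abs_minus_commute)
  have "wk a dl b B R x y \<le> x powr b * (2 powr (1+dl+\<bar>a\<bar>) * (y powr (-(2*a+1)) * (x / y) powr m)) * y powr (2*a - B)"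
    unfolding wk_def BR_bound_def m_def s by (intro mult_right_mono mult_left_mono BR_bound_far_profile a R x) auto
  also have "... = 2 powr (1+dl+\<bar>a\<bar>) * (y powr (b - B) * ((x / y) powr (b + m) / y))"
  proof -
    have 1: "y powr (-(2*a+1)) * y powr (2*a - B) = y powr (b - B) * y powr (- b) / y"
    proof -
      have "y powr (-(2*a+1)) * y powr (2*a - B) * y powr 1 = y powr (b - B) * y powr (- b)" unfolding powr_add[symmetric] by (simp add: algebra_simps)
      thus ?thesis using yp by (simp add: field_simps)
    qed
    have 2: "(x / y) powr (b + m) = x powr b * y powr (- b) * (x / y) powr m"
    proof -
      have "(x / y) powr b = x powr b / y powr b" using yp x by (intro powr_divide)
      thus ?thesis unfolding powr_add powr_minus by (simp add: divide_inverse)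
    qed
    have "A * (C * (P * M)) * Q = C * A * M * (P * Q)" for A C P M Q :: real by simp
    hence "x powr b * (2 powr (1+dl+\<bar>a\<bar>) * (y powr (-(2*a+1)) * (x / y) powr m)) * y powr (2*a - B)
      = 2 powr (1+dl+\<bar>a\<bar>) * x powr b * (x / y) powr m * (y powr (-(2*a+1)) * y powr (2*a - B))" .
    thus ?thesis unfolding 1 2 by (simp add: mult_ac)
  qed
  also have "... \<le> 2 powr (1+dl+\<bar>a\<bar>) * (1 * ((x / y) powr (b + m) / y))"
    using yp y bB x by (intro mult_left_mono mult_right_mono powr_le1) auto
  finally show ?thesis by (simp add: m_def)
qed

text \<open>With equality in (4) and B < 2 a + 1 the exponent in \<open>wk_left\<close> is 0, and
  taking the supremum over R inside the kernel would lose integrability. Keeping R leaves a function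
  of R y which, for delta < a, decays at both ends, and the factor x^(b - B) is retained.\<close>

lemma wk_left_eq:
  assumes a: "2 * a + 1 > 0" and R: "R > 0" "dl > 0" and y: "0 < y" "y \<le> x / 2" and B: "B = a + 1 + dl"
  shows "wk a dl b B R x y \<le> 2 powr (1+dl) * (x powr (b - B) * ((R * y) powr (a - dl) * (1 + R * y) powr (-a) / y))"
proof -
  have xp: "x > 0" using y by simp
  have "wk a dl b B R x y \<le> x powr b * (2 powr (1+dl) * (R powr (2*a+1) * (1 + R * x) powr (-(a+1+dl)) * (1 + R * y) powr (-a))) * y powr (2*a - B)"
    unfolding wk_def BR_bound_def by (intro mult_right_mono mult_left_mono BR_bound_far R y) auto
  also have "... \<le> x powr b * (2 powr (1+dl) * (R powr (2*a+1) * (R * x) powr (-(a+1+dl)) * (1 + R * y) powr (-a))) * y powr (2*a - B)"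
    using a R xp by (intro mult_right_mono mult_left_mono powr_mono2') auto
  also have "... = 2 powr (1+dl) * (x powr (b - B) * ((R * y) powr (a - dl) * (1 + R * y) powr (-a) / y))"
  proof -
    have 1: "x powr b * x powr (-(a+1+dl)) = x powr (b - B)" unfolding powr_add[symmetric] B
      by (rule arg_cong[where f="(powr) x"]) simp
    have 2: "R powr (2*a+1) * R powr (-(a+1+dl)) = R powr (a - dl)" unfolding powr_add[symmetric] by (simp add: algebra_simps)
    have 3: "y powr (2*a - B) = y powr (a - dl) / y"
    proof -
      have "y powr (2*a - B) * y powr 1 = y powr (a - dl)" unfolding powr_add[symmetric] B by (simp add: algebra_simps)
      thus ?thesis using y by (simp add: field_simps)
    qed
    have 4: "(R * x) powr (-(a+1+dl)) = R powr (-(a+1+dl)) * x powr (-(a+1+dl))" "(R * y) powr (a - dl) = R powr (a - dl) * y powr (a - dl)"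
      by (rule powr_mult)+
    have "X * (C * (Ra * (Rb * Xb) * W)) * (Y / y) = C * ((X * Xb) * ((Ra * Rb) * Y * W / y))" for X C Ra Rb Xb W Y by simp
    from this[of "x powr b" "2 powr (1+dl)" "R powr (2*a+1)" "R powr (-(a+1+dl))" "x powr (-(a+1+dl))" "(1 + R * y) powr (-a)" "y powr (a - dl)"]
    show ?thesis unfolding 4 3 1 2 .
  qed
  finally show ?thesis .
qed

text \<open>For R x >= 1 the weights cancel and the kernel is an approximate identity at scale 1 /
  R. For R x < 1 the factor (R x)^(2 a + 1) <= 1 leaves a kernel of size 1 / x; as |x - y| <= x
  here, it has the same form with R replaced by 1 / x.\<close>

lemma wk_local:
  assumes a: "2 * a + 1 > 0" and dl: "dl > 0" and bB: "B \<le> b"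
  shows "\<exists>C>0. \<forall>R>0. \<forall>x y. 0 < x \<longrightarrow> x \<le> 1 \<longrightarrow> x / 2 \<le> y \<longrightarrow> y \<le> 2 * x \<longrightarrow>
     wk a dl b B R x y \<le> C * (max R (1 / x) * (1 + max R (1 / x) * \<bar>x - y\<bar>) powr (-(1+dl)))"
proof -
  define C1 where "C1 = (2::real) powr \<bar>a\<bar>"
  define C2 where "C2 = (2::real) powr \<bar>2*a - B\<bar>"
  define C3 where "C3 = (2::real) powr (1+dl) + 2 powr \<bar>2*a\<bar>"
  define C4 where "C4 = (2::real) powr \<bar>2*a\<bar>"
  define C where "C = C1 * C1 * C2 * C3 * C4"
  have c: "C1 > 0" "C2 > 0" "C3 > 0" "C4 > 0" by (auto simp: C1_def C2_def C3_def C4_def add_pos_pos)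
  have C: "C > 0" using c by (simp add: C_def)
  have c1: "C1 \<ge> 1" "C4 \<ge> 1" by (auto simp: C1_def C4_def ge_one_powr_ge_zero)
  have main: "wk a dl b B R x y \<le> C * (max R (1 / x) * (1 + max R (1 / x) * \<bar>x - y\<bar>) powr (-(1+dl)))"
    if R: "R > 0" and x: "0 < x" "x \<le> 1" and y: "x / 2 \<le> y" "y \<le> 2 * x" for R x y
  proof -
    have yp: "y > 0" using x y by linarith
    define X where "X = R * x"
    have X: "X > 0" using R x by (simp add: X_def)
    have ypw: "y powr (2*a - B) \<le> C2 * x powr (2*a - B)"
    proof -
      define q where "q = y / x"
      have q: "1/2 \<le> q" "q \<le> 2" "y = q * x" using x y by (auto simp: q_def field_simps)
      have "q powr e \<le> 2 powr \<bar>e\<bar>" for e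
      proof (cases "e \<ge> 0")
        case True thus ?thesis using q by (auto intro!: powr_mono2)
      next
        case False
        have "q powr e \<le> (1/2) powr e" using q False by (intro powr_mono2') auto
        thus ?thesis using False by (simp add: powr_divide powr_minus_divide)
      qed
      hence "q powr (2*a - B) * x powr (2*a - B) \<le> C2 * x powr (2*a - B)" unfolding C2_def by (intro mult_right_mono) auto
      thus ?thesis unfolding q(3) powr_mult .
    qed
    have yw: "(1 + R * y) powr (-a) \<le> C1 * C1 * (1 + X) powr (-a)"
    proof -
      have p: "1 + X > 0" "1 + R * y > 0" using X R yp by (auto intro: add_pos_pos)
      define q where "q = (1 + R * y) / (1 + X)"
      have "(1 + X) / 2 \<le> 1 + R * y"
      proof -
        have "R * (x / 2) \<le> R * y" using R y by (intro mult_left_mono) auto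
        thus ?thesis by (simp add: X_def)
      qed
      moreover have "1 + R * y \<le> 2 * (1 + X)"
      proof -
        have "R * y \<le> R * (2 * x)" using R y by (intro mult_left_mono) auto
        thus ?thesis by (simp add: X_def)
      qed
      ultimately have q: "1/2 \<le> q" "q \<le> 2" "1 + R * y = q * (1 + X)" using p by (auto simp: q_def field_simps)
      have "q powr (-a) \<le> 2 powr \<bar>a\<bar>"
      proof (cases "-a \<ge> 0")
        case True
        hence "q powr (-a) \<le> 2 powr (-a)" using q by (intro powr_mono2) auto
        thus ?thesis using True by simp
      next
        case False
        have "q powr (-a) \<le> (1/2) powr (-a)" using q False by (intro powr_mono2') auto
        thus ?thesis using False by (simp add: powr_divide powr_minus_divide)
      qed
      hence "q powr (-a) \<le> C1" by (simp add: C1_def)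
      also have "C1 * 1 \<le> C1 * C1" using c1 c by (intro mult_left_mono) auto
      hence "C1 \<le> C1 * C1" by simp
      finally have "q powr (-a) \<le> C1 * C1" .
      hence "q powr (-a) * (1 + X) powr (-a) \<le> (C1 * C1) * (1 + X) powr (-a)" by (intro mult_right_mono) auto
      thus ?thesis unfolding q(3) powr_mult .
    qed
    define E where "E = (1 + R * \<bar>x - y\<bar>) powr (-(1+dl))"
    have "wk a dl b B R x y = x powr b * (R powr (2*a+1) * (1 + X) powr (-a) * (1 + R * y) powr (-a) * E) * y powr (2*a - B)"
      by (simp add: wk_def BR_bound_def X_def E_def)
    also have "... \<le> x powr b * (R powr (2*a+1) * (1 + X) powr (-a) * (C1 * C1 * (1 + X) powr (-a)) * E) * (C2 * x powr (2*a - B))"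
      using c by (intro mult_mono mult_left_mono mult_right_mono yw ypw) (auto simp: E_def)
    also have "... = (C1 * C1 * C2) * (x powr (b - B) * ((X powr (2*a) * (1 + X) powr (- (2*a))) * (R * E)))"
    proof -
      have 1: "x powr b * x powr (2*a - B) = x powr (b - B) * x powr (2*a)" unfolding powr_add[symmetric]
        by (rule arg_cong[where f="(powr) x"]) simp
      have 2: "R powr (2*a+1) = R powr (2*a) * R" using R by (simp add: powr_add)
      have 3: "X powr (2*a) = R powr (2*a) * x powr (2*a)" unfolding X_def by (rule powr_mult)
      have 4: "(1 + X) powr (- (2*a)) = (1 + X) powr (-a) * (1 + X) powr (-a)" unfolding powr_add[symmetric] by simp
      have "P * ((Q * R) * W * (K * W) * E) * (D * S) = (K * D) * (P * S) * (Q * (W * W) * (R * E))" for P Q W K D S by simp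
      from this[of "x powr b" "R powr (2*a)" "(1 + X) powr (-a)" "C1 * C1" C2 "x powr (2*a - B)"]
      show ?thesis unfolding 2 1 3 4 by (simp add: mult_ac)
    qed
    also have "... \<le> (C1 * C1 * C2) * (1 * ((X powr (2*a) * (1 + X) powr (- (2*a))) * (R * E)))"
      using c x bB R by (intro mult_left_mono mult_right_mono powr_le1) (auto simp: E_def)
    also have "... \<le> (C1 * C1 * C2) * (C3 * C4 * (max R (1 / x) * (1 + max R (1 / x) * \<bar>x - y\<bar>) powr (-(1+dl))))"
    proof (intro mult_left_mono)
      show "1 * ((X powr (2*a) * (1 + X) powr (- (2*a))) * (R * E)) \<le> C3 * C4 * (max R (1 / x) * (1 + max R (1 / x) * \<bar>x - y\<bar>) powr (-(1+dl)))"
      proof (cases "X \<ge> 1")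
        case True
        hence mx: "max R (1 / x) = R" using x by (simp add: X_def field_simps max_def)
        have "(1 + X) powr (- (2*a)) \<le> 2 powr \<bar>- (2*a)\<bar> * X powr (- (2*a))" by (rule one_add_powr_large[OF True])
        hence "X powr (2*a) * (1 + X) powr (- (2*a)) \<le> X powr (2*a) * (2 powr \<bar>2*a\<bar> * X powr (- (2*a)))"
          by (intro mult_left_mono) auto
        also have "... = 2 powr \<bar>2*a\<bar> * (X powr (2*a) * X powr (- (2*a)))" by simp
        also have "X powr (2*a) * X powr (- (2*a)) = 1" unfolding powr_add[symmetric] using X by simp
        finally have k: "X powr (2*a) * (1 + X) powr (- (2*a)) \<le> C3" by (simp add: C3_def add_increasing)
        have "(X powr (2*a) * (1 + X) powr (- (2*a))) * (R * E) \<le> (C3 * C4) * (R * E)"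
        proof (rule mult_right_mono)
          have "C3 * 1 \<le> C3 * C4" using c c1 by (intro mult_left_mono) auto
          with k show "X powr (2*a) * (1 + X) powr (- (2*a)) \<le> C3 * C4" by linarith
        qed (use R in \<open>auto simp: E_def\<close>)
        thus ?thesis unfolding mx E_def by simp
      next
        case False
        hence mx: "max R (1 / x) = 1 / x" using x by (simp add: X_def field_simps max_def)
        have E1: "E \<le> 1"
        proof -
          have "E \<le> 1 powr (-(1+dl))" unfolding E_def using R dl by (intro powr_mono2') auto
          thus ?thesis by simp
        qed
        have k2: "(1 + X) powr (- (2*a)) \<le> C4" using one_add_powr_small[of X "- (2*a)"] X False by (simp add: C4_def)
        have "X powr (2*a) * R = X powr (2*a+1) * (1 / x)"
          using X x R by (simp add: powr_add X_def)
        moreover have "X powr (2*a+1) \<le> 1" using X False a by (intro powr_le1) auto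
        ultimately have k1: "X powr (2*a) * R \<le> 1 / x" using x by (simp add: mult_right_mono divide_right_mono)
        have k3: "1 \<le> C3 * (1 + (1 / x) * \<bar>x - y\<bar>) powr (-(1+dl))"
        proof -
          have "(1 / x) * \<bar>x - y\<bar> \<le> 1" using x y by (simp add: field_simps abs_le_iff)
          hence "2 powr (-(1+dl)) \<le> (1 + (1 / x) * \<bar>x - y\<bar>) powr (-(1+dl))" using x dl by (intro powr_mono2') (auto intro: add_pos_nonneg)
          hence "2 powr (1+dl) * 2 powr (-(1+dl)) \<le> C3 * (1 + (1 / x) * \<bar>x - y\<bar>) powr (-(1+dl))"
            using c by (intro mult_mono) (auto simp: C3_def)
          moreover have "2 powr (1+dl) * 2 powr (-(1+dl)) = (1::real)" unfolding powr_add[symmetric] by simp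
          ultimately show ?thesis by simp
        qed
        have "(X powr (2*a) * (1 + X) powr (- (2*a))) * (R * E) = (X powr (2*a) * R) * (1 + X) powr (- (2*a)) * E" by simp
        also have "... \<le> (1 / x) * C4 * 1" using k1 k2 E1 x c by (intro mult_mono) (auto simp: E_def)
        also have "... \<le> (1 / x) * C4 * (C3 * (1 + (1 / x) * \<bar>x - y\<bar>) powr (-(1+dl)))" using k3 x c by (intro mult_left_mono) auto
        finally show ?thesis unfolding mx by (simp add: mult_ac)
      qed
    qed (use c in auto)
    finally show ?thesis by (simp add: C_def mult_ac)
  qed
  show ?thesis using C main by blast
qed

section \<open>Schur's test and Hardy kernels for dy / y\<close>

lemma epow_inverse:
  assumes "p > 0" shows "epow (1/p) (epow p t) = t" "epow p (epow (1/p) t) = t"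
  by (cases t; use assms in \<open>auto simp: epow_ennreal powr_powr\<close>)+

text \<open>Jensen's inequality, from the tangent line of \<open>t \<mapsto> t\<^sup>p\<close> at the optimal point.\<close>
lemma jensen_kernel:
  fixes k :: "'a \<Rightarrow> ennreal" and G :: "'a \<Rightarrow> real"
  assumes k [measurable]: "k \<in> borel_measurable M" and G [measurable]: "G \<in> borel_measurable M" and G0: "\<And>y. G y \<ge> 0"
    and p: "p > 1" and A: "A > 0" and kA: "(\<integral>\<^sup>+y. k y \<partial>M) \<le> ennreal A"
  shows "epow p (\<integral>\<^sup>+y. k y * ennreal (G y) \<partial>M) \<le> ennreal (A powr (p-1)) * (\<integral>\<^sup>+y. k y * ennreal (G y powr p) \<partial>M)"
proof (cases "(\<integral>\<^sup>+y. k y * ennreal (G y powr p) \<partial>M)")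
  case top
  thus ?thesis using A by (simp add: ennreal_mult_top)
next
  case (real j)
  define S where "S = (\<integral>\<^sup>+y. k y * ennreal (G y) \<partial>M)"
  have young: "g \<le> t powr (1-p) / p * g powr p + (1 - 1/p) * t" if g: "g \<ge> 0" and t: "t > 0" for g t
  proof -
    define q where "q = 1 / (1 - 1/p)"
    have q: "q > 1" "1/p + 1/q = 1" using p by (auto simp: q_def field_simps)
    have "(g / t) * 1 \<le> (g / t) powr p / p + 1 powr q / q"
      using p q g t by (intro Youngs_inequality) auto
    hence "t * (g / t) \<le> t * ((g / t) powr p / p + (1 - 1/p))" using t by (intro mult_left_mono) (auto simp: q_def)
    moreover have "t * (g / t) powr p = t powr (1-p) * g powr p"
      using t by (simp add: powr_divide powr_diff)
    ultimately show ?thesis using t by (simp add: distrib_left mult.commute[of t])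
  qed
  have key: "epow p S \<le> ennreal (A powr (p-1) * (j + e))" if e: "e > 0" for e
  proof -
    \<comment> \<open>The tangent point at which t^p is the mean (j + e) / A, so that both terms
      balance; e > 0 keeps t positive when j = 0 and is removed at the end.\<close>
    define t where "t = ((j + e) / A) powr (1/p)"
    have je0: "j + e > 0" using real e by (simp add: add_nonneg_pos)
    have je: "(j + e) / A > 0" using je0 A by simp
    have t: "t > 0" using je0 A by (simp add: t_def)
    have tp: "t powr p = (j + e) / A" using je je0 A p by (simp add: t_def powr_powr)
    have "S \<le> (\<integral>\<^sup>+y. ennreal (t powr (1-p) / p) * (k y * ennreal (G y powr p)) + ennreal ((1 - 1/p) * t) * k y \<partial>M)"
      unfolding S_def
    proof (rule nn_integral_mono)
      fix y
      have "ennreal (G y) \<le> ennreal (t powr (1-p) / p * G y powr p + (1 - 1/p) * t)"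
        by (intro ennreal_leI young G0 t)
      also have "... = ennreal (t powr (1-p) / p) * ennreal (G y powr p) + ennreal ((1 - 1/p) * t)"
        using p t by (simp add: ennreal_mult[symmetric] flip: ennreal_plus)
      finally have "k y * ennreal (G y) \<le> k y * (ennreal (t powr (1-p) / p) * ennreal (G y powr p) + ennreal ((1 - 1/p) * t))"
        by (rule mult_left_mono) simp
      thus "k y * ennreal (G y) \<le> ennreal (t powr (1-p) / p) * (k y * ennreal (G y powr p)) + ennreal ((1 - 1/p) * t) * k y"
        by (simp add: distrib_left mult_ac)
    qed
    also have "... = ennreal (t powr (1-p) / p) * ennreal j + ennreal ((1 - 1/p) * t) * (\<integral>\<^sup>+y. k y \<partial>M)"
      by (subst nn_integral_add) (auto simp: nn_integral_cmult real)
    also have "... \<le> ennreal (t powr (1-p) / p) * ennreal (j + e) + ennreal ((1 - 1/p) * t) * ennreal A"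
      using e by (intro add_mono mult_left_mono kA ennreal_leI) auto
    also have "... = ennreal (t powr (1-p) / p * (j + e) + (1 - 1/p) * t * A)"
      using p t A e real by (simp add: ennreal_mult[symmetric] flip: ennreal_plus)
    also have "t powr (1-p) / p * (j + e) + (1 - 1/p) * t * A = A * t"
    proof -
      have "j + e = A * t powr p" using tp A by simp
      hence "t powr (1-p) / p * (j + e) = A / p * (t powr (1-p) * t powr p)" by simp
      also have "t powr (1-p) * t powr p = t" unfolding powr_add[symmetric] using t by simp
      finally show ?thesis using p by (simp add: field_simps)
    qed
    finally have "epow p S \<le> epow p (ennreal (A * t))" using p by (intro epow_mono) auto
    also have "... = ennreal ((A * t) powr p)" using A t by (intro epow_ennreal) auto
    also have "(A * t) powr p = A powr p * ((j + e) / A)" using tp by (simp add: powr_mult)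
    also have "... = A powr (p-1) * (j + e)" using A by (simp add: powr_diff)
    finally show ?thesis .
  qed
  have "epow p S \<le> ennreal (A powr (p-1) * j)"
  proof (rule ennreal_le_epsilon)
    fix e :: real assume e: "e > 0"
    have Ap: "A powr (p-1) > 0" using A by simp
    have "epow p S \<le> ennreal (A powr (p-1) * (j + e / A powr (p-1)))" using Ap e by (intro key) simp
    also have "A powr (p-1) * (j + e / A powr (p-1)) = A powr (p-1) * j + e" using A by (simp add: distrib_left)
    also have "ennreal (A powr (p-1) * j + e) = ennreal (A powr (p-1) * j) + ennreal e" using e real by (intro ennreal_plus) auto
    finally show "epow p S \<le> ennreal (A powr (p-1) * j) + ennreal e" .
  qed
  thus ?thesis using real by (simp add: S_def ennreal_mult)
qed

text \<open>The invariant measure dy / y of the multiplicative group, restricted to (0, 1). Relative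
  to it, kernels homogeneous of degree 0 have row and column integrals bounded independently of the
  point.\<close>

definition wt :: "real \<Rightarrow> ennreal" where "wt x = ennreal (1 / x) * indicator {0<..<1} x"

lemma wt_measurable [measurable]: "wt \<in> borel_measurable borel"
  unfolding wt_def[abs_def] by measurable

text \<open>Both marginals are bounded, so constant test functions do: Jensen in each row spends
  A^(p-1), Fubini and the column bound spend the last factor A.\<close>

lemma schur_test:
  fixes k :: "real \<Rightarrow> real \<Rightarrow> ennreal" and G :: "real \<Rightarrow> real"
  assumes k [measurable]: "(\<lambda>(x,y). k x y) \<in> borel_measurable (borel \<Otimes>\<^sub>M borel)"
    and G [measurable]: "G \<in> borel_measurable borel" and G0: "\<And>y. G y \<ge> 0" and p: "p > 1" and A: "A > 0"
    and row: "\<And>x. x \<in> {0<..<1} \<Longrightarrow> (NN y. k x y * wt y) \<le> ennreal A"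
    and col: "\<And>y. y \<in> {0<..<1} \<Longrightarrow> (NN x. k x y * wt x) \<le> ennreal A"
  shows "(NN x. epow p (NN y. k x y * wt y * ennreal (G y)) * wt x)
     \<le> ennreal (A powr p) * (NN y. ennreal (G y powr p) * wt y)"
proof -
  have "(NN x. epow p (NN y. k x y * wt y * ennreal (G y)) * wt x)
    \<le> (NN x. ennreal (A powr (p-1)) * (NN y. k x y * wt y * ennreal (G y powr p)) * wt x)"
  proof (rule nn_integral_mono)
    fix x show "epow p (NN y. k x y * wt y * ennreal (G y)) * wt x
      \<le> ennreal (A powr (p-1)) * (NN y. k x y * wt y * ennreal (G y powr p)) * wt x"
    proof (cases "x \<in> {0<..<1}")
      case True
      show ?thesis
      proof (rule mult_right_mono)
        have [measurable]: "(\<lambda>y. k x y) \<in> borel_measurable borel" using k by measurable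
        show "epow p (NN y. k x y * wt y * ennreal (G y)) \<le> ennreal (A powr (p-1)) * (NN y. k x y * wt y * ennreal (G y powr p))"
          by (rule jensen_kernel[OF _ _ G0 p A row[OF True]]) measurable
      qed simp
    qed (auto simp: wt_def)
  qed
  also have "... = (NN x. (NN y. ennreal (A powr (p-1)) * (k x y * wt y * ennreal (G y powr p)) * wt x))"
    by (intro nn_integral_cong) (simp add: nn_integral_cmult nn_integral_multc)
  also have "... = (NN y. (NN x. ennreal (A powr (p-1)) * (k x y * wt y * ennreal (G y powr p)) * wt x))"
    by (rule lborel_pair.Fubini'[symmetric]) measurable
  also have "... \<le> (NN y. ennreal (A powr p) * (ennreal (G y powr p) * wt y))"
  proof (rule nn_integral_mono)
    fix y
    have "(NN x. ennreal (A powr (p-1)) * (k x y * wt y * ennreal (G y powr p)) * wt x)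
      = (NN x. (ennreal (A powr (p-1)) * ennreal (G y powr p) * wt y) * (k x y * wt x))"
      by (intro nn_integral_cong) (simp add: mult_ac)
    also have "... = (ennreal (A powr (p-1)) * ennreal (G y powr p) * wt y) * (NN x. k x y * wt x)"
      by (rule nn_integral_cmult) measurable
    also have "... \<le> (ennreal (A powr (p-1)) * ennreal (G y powr p) * wt y) * ennreal A"
    proof (cases "y \<in> {0<..<1}")
      case True
      show ?thesis by (rule mult_left_mono[OF col[OF True]]) simp
    qed (simp add: wt_def)
    also have "... = (ennreal (A powr (p-1)) * ennreal A) * (ennreal (G y powr p) * wt y)" by (simp add: mult_ac)
    also have "ennreal (A powr (p-1)) * ennreal A = ennreal (A powr p)"
      using A by (simp add: ennreal_mult[symmetric] powr_diff)
    finally show "(NN x. ennreal (A powr (p-1)) * (k x y * wt y * ennreal (G y powr p)) * wt x) \<le> ennreal (A powr p) * (ennreal (G y powr p) * wt y)" .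
  qed
  also have "... = ennreal (A powr p) * (NN y. ennreal (G y powr p) * wt y)" by (rule nn_integral_cmult) measurable
  finally show ?thesis .
qed

text \<open>The mirrored kernel for y >= x is \<open>hk e y x\<close>; for it the row and column
  bounds exchange their roles.\<close>

definition hk :: "real \<Rightarrow> real \<Rightarrow> real \<Rightarrow> ennreal" where
  "hk e x y = (if 0 < y \<and> y \<le> x then ennreal ((y / x) powr e) else 0)"

lemma hk_measurable [measurable]: "(\<lambda>(x,y). hk e x y) \<in> borel_measurable (borel \<Otimes>\<^sub>M borel)"
  "(\<lambda>(x,y). hk e y x) \<in> borel_measurable (borel \<Otimes>\<^sub>M borel)"
  unfolding hk_def[abs_def] by measurable

lemma hk_row: assumes e: "e > 0" and x: "x > 0" shows "(NN y. hk e x y * wt y) \<le> ennreal (1 / e)"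
proof -
  have "(NN y. hk e x y * wt y) \<le> (NN y. ennreal (x powr (-e)) * (ennreal (y powr (e - 1)) * indicator {0..x} y))"
  proof (rule nn_integral_mono)
    fix y show "hk e x y * wt y \<le> ennreal (x powr (-e)) * (ennreal (y powr (e - 1)) * indicator {0..x} y)"
    proof (cases "0 < y \<and> y \<le> x \<and> y < 1")
      case True
      have "(y / x) powr e * (1 / y) = x powr (-e) * y powr (e - 1)"
        using True x by (simp add: powr_divide powr_diff powr_minus_divide)
      thus ?thesis using True by (simp add: hk_def wt_def ennreal_mult'[symmetric])
    qed (auto simp: hk_def wt_def)
  qed
  also have "... = ennreal (x powr (-e)) * (NN y. ennreal (y powr (e - 1)) * indicator {0..x} y)"
    by (rule nn_integral_cmult) measurable
  also have "... = ennreal (x powr (-e)) * ennreal (x powr (e - 1 + 1) / (e - 1 + 1))" using e x by (subst nn_integral_powr_0) auto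
  also have "... = ennreal (1 / e)" using e x by (simp add: ennreal_mult[symmetric] powr_minus_divide)
  finally show ?thesis .
qed

lemma hk_col: assumes e: "e > 0" and y: "y > 0" shows "(NN x. hk e x y * wt x) \<le> ennreal (1 / e)"
proof -
  have "(NN x. hk e x y * wt x) \<le> (NN x. ennreal (y powr e) * (ennreal (x powr (- e - 1)) * indicator {y..} x))"
  proof (rule nn_integral_mono)
    fix x show "hk e x y * wt x \<le> ennreal (y powr e) * (ennreal (x powr (- e - 1)) * indicator {y..} x)"
    proof (cases "0 < y \<and> y \<le> x \<and> x < 1")
      case True
      have "(y / x) powr e * (1 / x) = y powr e * x powr (- e - 1)"
        using True by (simp add: powr_divide powr_diff powr_minus_divide)
      thus ?thesis using True by (simp add: hk_def wt_def ennreal_mult'[symmetric])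
    qed (auto simp: hk_def wt_def)
  qed
  also have "... = ennreal (y powr e) * (NN x. ennreal (x powr (- e - 1)) * indicator {y..} x)"
    by (rule nn_integral_cmult) measurable
  also have "... = ennreal (y powr e) * ennreal (y powr (- e - 1 + 1) / (- (- e - 1 + 1)))" using e y by (subst nn_integral_powr_inf) auto
  also have "... = ennreal (1 / e)" using e y by (simp add: ennreal_mult[symmetric] powr_minus_divide)
  finally show ?thesis .
qed

text \<open>With r = 1 / R the kernel is at most (y / r)^(a - delta) for y <= r and (r / y)^delta
  beyond: a row and a column of Hardy kernels, whose dy / y integrals are bounded independently of r
  and therefore of R.\<close>

lemma eq_kernel_facts:
  fixes a dl R :: real
  assumes dl: "0 < dl" "dl < a" and R: "R > 0"
  shows "0 < y \<Longrightarrow> (R * y) powr (a - dl) * (1 + R * y) powr (-a) \<le> 1"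
    and "(NN y. ennreal ((R * y) powr (a - dl) * (1 + R * y) powr (-a)) * wt y) \<le> ennreal (1 / (a - dl) + 1 / dl)"
proof -
  have l1: "(R * y) powr (a - dl) * (1 + R * y) powr (-a) \<le> (R * y) powr (a - dl)" if "y > 0" for y
  proof -
    have "(1 + R * y) powr (-a) \<le> 1 powr (-a)" using that R dl by (intro powr_mono2') auto
    hence "(R * y) powr (a - dl) * (1 + R * y) powr (-a) \<le> (R * y) powr (a - dl) * 1" by (intro mult_left_mono) auto
    thus ?thesis by simp
  qed
  have l2: "(R * y) powr (a - dl) * (1 + R * y) powr (-a) \<le> (R * y) powr (-dl)" if "y > 0" for y
  proof -
    have "(1 + R * y) powr (-a) \<le> (R * y) powr (-a)" using that R dl by (intro powr_mono2') auto
    hence "(R * y) powr (a - dl) * (1 + R * y) powr (-a) \<le> (R * y) powr (a - dl) * (R * y) powr (-a)" by (intro mult_left_mono) auto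
    also have "... = (R * y) powr (-dl)" unfolding powr_add[symmetric] by simp
    finally show ?thesis .
  qed
  show "(R * y) powr (a - dl) * (1 + R * y) powr (-a) \<le> 1" if "0 < y"
  proof (cases "R * y \<le> 1")
    case True
    have "(R * y) powr (a - dl) \<le> 1" using True that R dl by (intro powr_le1) auto
    thus ?thesis using l1[OF that] by linarith
  next
    case False
    have "(R * y) powr (-dl) \<le> 1 powr (-dl)" using False dl by (intro powr_mono2') auto
    thus ?thesis using l2[OF that] by simp
  qed
  define r where "r = 1 / R"
  have r: "r > 0" using R by (simp add: r_def)
  have "(NN y. ennreal ((R * y) powr (a - dl) * (1 + R * y) powr (-a)) * wt y)
     \<le> (NN y. hk (a - dl) r y * wt y + hk dl y r * wt y)"
  proof (rule nn_integral_mono)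
    fix y show "ennreal ((R * y) powr (a - dl) * (1 + R * y) powr (-a)) * wt y \<le> hk (a - dl) r y * wt y + hk dl y r * wt y"
    proof (cases "0 < y")
      case True
      have "ennreal ((R * y) powr (a - dl) * (1 + R * y) powr (-a)) \<le> hk (a - dl) r y + hk dl y r"
      proof (cases "y \<le> r")
        case le: True
        have "y / r = R * y" by (simp add: r_def mult.commute)
        hence "ennreal ((R * y) powr (a - dl) * (1 + R * y) powr (-a)) \<le> hk (a - dl) r y"
          using True le l1[OF True] by (simp add: hk_def ennreal_leI)
        thus ?thesis by (simp add: add_increasing2)
      next
        case False
        have "(r / y) powr dl = (R * y) powr (-dl)"
        proof -
          have "r / y = 1 / (R * y)" by (simp add: r_def)
          thus ?thesis by (simp only: inverse_powr_real)
        qed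
        hence "ennreal ((R * y) powr (a - dl) * (1 + R * y) powr (-a)) \<le> hk dl y r"
          using True False r l2[OF True] by (simp add: hk_def ennreal_leI)
        thus ?thesis by (simp add: add_increasing)
      qed
      thus ?thesis by (simp add: mult_right_mono flip: distrib_right)
    qed (simp add: wt_def)
  qed
  also have "... = (NN y. hk (a - dl) r y * wt y) + (NN y. hk dl y r * wt y)"
    by (rule nn_integral_add) measurable
  also have "... \<le> ennreal (1 / (a - dl)) + ennreal (1 / dl)"
    using dl r by (intro add_mono hk_row hk_col) auto
  also have "... = ennreal (1 / (a - dl) + 1 / dl)" using dl by (simp flip: ennreal_plus)
  finally show "(NN y. ennreal ((R * y) powr (a - dl) * (1 + R * y) powr (-a)) * wt y) \<le> ennreal (1 / (a - dl) + 1 / dl)" .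
qed

lemma wk_measurable [measurable]:
  "(\<lambda>y. wk a dl b B R x y) \<in> borel_measurable borel"
  unfolding wk_def BR_bound_def by measurable

lemma hlM_mono: "(\<And>y. g y \<le> h y) \<Longrightarrow> hlM g x \<le> hlM h x"
  unfolding hlM_def by (intro SUP_mono') (auto intro!: mult_left_mono nn_integral_mono)

lemma hlM_one: "hlM (\<lambda>_. 1) x \<le> 2"
  unfolding hlM_def
proof (rule SUP_least)
  fix k :: int
  have "(NN y. (if \<bar>x - y\<bar> \<le> 2 powr (- real_of_int k) then 1 else 0)) = (NN y. indicator {x - 2 powr (- real_of_int k)..x + 2 powr (- real_of_int k)} y)"
    by (intro nn_integral_cong) (auto simp: indicator_def abs_le_iff)
  also have "... = ennreal (2 * 2 powr (- real_of_int k))" by simp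
  finally have "ennreal (2 powr real_of_int k) * (NN y. (if \<bar>x - y\<bar> \<le> 2 powr (- real_of_int k) then 1 else 0))
     = ennreal (2 powr real_of_int k * (2 * 2 powr (- real_of_int k)))" by (simp add: ennreal_mult)
  also have "2 powr real_of_int k * (2 * 2 powr (- real_of_int k)) = 2 * (2 powr real_of_int k * 2 powr (- real_of_int k))" by simp
  also have "2 powr real_of_int k * 2 powr (- real_of_int k) = (1::real)" unfolding powr_add[symmetric] by simp
  finally show "ennreal (2 powr real_of_int k) * (NN y. (if \<bar>x - y\<bar> \<le> 2 powr (- real_of_int k) then 1 else 0)) \<le> 2" by simp
qed

section \<open>Splitting the operator at y = x/2 and y = 2x\<close>

definition left_part :: "real \<Rightarrow> real \<Rightarrow> real \<Rightarrow> real \<Rightarrow> real \<Rightarrow> (real \<Rightarrow> ennreal) \<Rightarrow> real \<Rightarrow> ennreal" where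
  "left_part a dl b B R g x = (NN y. (if 0 < y \<and> y \<le> x / 2 then ennreal (wk a dl b B R x y) * g y else 0))"

definition right_part :: "real \<Rightarrow> real \<Rightarrow> real \<Rightarrow> real \<Rightarrow> real \<Rightarrow> (real \<Rightarrow> ennreal) \<Rightarrow> real \<Rightarrow> ennreal" where
  "right_part a dl b B R g x = (NN y. (if 2 * x \<le> y \<and> y < 1 then ennreal (wk a dl b B R x y) * g y else 0))"

definition local_part :: "real \<Rightarrow> real \<Rightarrow> real \<Rightarrow> real \<Rightarrow> real \<Rightarrow> (real \<Rightarrow> ennreal) \<Rightarrow> real \<Rightarrow> ennreal" where
  "local_part a dl b B R g x = (NN y. (if x / 2 \<le> y \<and> y \<le> 2 * x \<and> y < 1 then ennreal (wk a dl b B R x y) * g y else 0))"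

lemma parts_sum:
  assumes [measurable]: "g \<in> borel_measurable borel" and x: "x \<in> {0<..<1}"
  shows "(NN y. ennreal (wk a dl b B R x y) * g y * indicator {0<..<1} y)
     \<le> left_part a dl b B R g x + (local_part a dl b B R g x + right_part a dl b B R g x)"
proof -
  let ?l = "\<lambda>y. if 0 < y \<and> y \<le> x / 2 then ennreal (wk a dl b B R x y) * g y else 0"
  let ?m = "\<lambda>y. if x / 2 \<le> y \<and> y \<le> 2 * x \<and> y < 1 then ennreal (wk a dl b B R x y) * g y else 0"
  let ?r = "\<lambda>y. if 2 * x \<le> y \<and> y < 1 then ennreal (wk a dl b B R x y) * g y else 0"
  have "(NN y. ennreal (wk a dl b B R x y) * g y * indicator {0<..<1} y) \<le> (NN y. ?l y + (?m y + ?r y))"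
  proof (rule nn_integral_mono)
    fix y
    consider "y \<notin> {0<..<1}" | "0 < y" "y < 1" "y \<le> x/2" | "0 < y" "y < 1" "x/2 < y" "y < 2 * x" | "0 < y" "y < 1" "2 * x \<le> y" by fastforce
    thus "ennreal (wk a dl b B R x y) * g y * indicator {0<..<1} y \<le> ?l y + (?m y + ?r y)"
      by cases (auto simp: add_increasing add_increasing2)
  qed
  also have "... = (NN y. ?l y) + (NN y. ?m y + ?r y)"
    by (rule nn_integral_add) measurable
  also have "(NN y. ?m y + ?r y) = (NN y. ?m y) + (NN y. ?r y)"
    by (rule nn_integral_add) measurable
  finally show ?thesis by (simp add: left_part_def local_part_def right_part_def)
qed

lemma left_part_strict:
  assumes a: "2 * a + 1 > 0" and R: "R > 0" "dl > 0" and bB: "B \<le> b" and x: "x \<in> {0<..<1}"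
    and [measurable]: "g \<in> borel_measurable borel"
  shows "left_part a dl b B R g x \<le> ennreal (2 powr (1+dl+\<bar>a\<bar>)) * (NN y. hk (2*a+1-B + min 0 (dl - a)) x y * wt y * g y)"
proof -
  have [measurable]: "(\<lambda>y. hk e x y) \<in> borel_measurable borel" for e unfolding hk_def by measurable
  have "left_part a dl b B R g x \<le> (NN y. ennreal (2 powr (1+dl+\<bar>a\<bar>)) * (hk (2*a+1-B + min 0 (dl - a)) x y * wt y * g y))"
    unfolding left_part_def
  proof (rule nn_integral_mono)
    fix y show "(if 0 < y \<and> y \<le> x / 2 then ennreal (wk a dl b B R x y) * g y else 0) \<le> ennreal (2 powr (1+dl+\<bar>a\<bar>)) * (hk (2*a+1-B + min 0 (dl - a)) x y * wt y * g y)"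
    proof (cases "0 < y \<and> y \<le> x / 2")
      case True
      have "ennreal (wk a dl b B R x y) \<le> ennreal (2 powr (1+dl+\<bar>a\<bar>) * ((y / x) powr (2*a+1-B + min 0 (dl - a)) * (1 / y)))"
        using wk_left[OF a R, of y x B b] True x bB by (intro ennreal_leI) auto
      also have "... = ennreal (2 powr (1+dl+\<bar>a\<bar>)) * (hk (2*a+1-B + min 0 (dl - a)) x y * wt y)"
        using True x by (simp add: hk_def wt_def ennreal_mult'[symmetric])
      finally have "ennreal (wk a dl b B R x y) * g y \<le> ennreal (2 powr (1+dl+\<bar>a\<bar>)) * (hk (2*a+1-B + min 0 (dl - a)) x y * wt y) * g y"
        by (rule mult_right_mono) simp
      thus ?thesis using True by (simp add: mult.assoc)
    qed auto
  qed
  also have "... = ennreal (2 powr (1+dl+\<bar>a\<bar>)) * (NN y. hk (2*a+1-B + min 0 (dl - a)) x y * wt y * g y)"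
    by (rule nn_integral_cmult) measurable
  finally show ?thesis .
qed

lemma right_part_strict:
  assumes a: "2 * a + 1 > 0" and R: "R > 0" "dl > 0" and bB: "B \<le> b" and x: "x \<in> {0<..<1}"
    and [measurable]: "g \<in> borel_measurable borel"
  shows "right_part a dl b B R g x \<le> ennreal (2 powr (1+dl+\<bar>a\<bar>)) * (NN y. hk (b + min 0 (dl - a)) y x * wt y * g y)"
proof -
  have [measurable]: "(\<lambda>y. hk e y x) \<in> borel_measurable borel" for e unfolding hk_def by measurable
  have "right_part a dl b B R g x \<le> (NN y. ennreal (2 powr (1+dl+\<bar>a\<bar>)) * (hk (b + min 0 (dl - a)) y x * wt y * g y))"
    unfolding right_part_def
  proof (rule nn_integral_mono)
    fix y show "(if 2 * x \<le> y \<and> y < 1 then ennreal (wk a dl b B R x y) * g y else 0) \<le> ennreal (2 powr (1+dl+\<bar>a\<bar>)) * (hk (b + min 0 (dl - a)) y x * wt y * g y)"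
    proof (cases "2 * x \<le> y \<and> y < 1")
      case True
      have "ennreal (wk a dl b B R x y) \<le> ennreal (2 powr (1+dl+\<bar>a\<bar>) * ((x / y) powr (b + min 0 (dl - a)) * (1 / y)))"
        using wk_right[OF a R, of x y B b] True x bB by (intro ennreal_leI) auto
      also have "... = ennreal (2 powr (1+dl+\<bar>a\<bar>)) * (hk (b + min 0 (dl - a)) y x * wt y)"
        using True x by (simp add: hk_def wt_def ennreal_mult'[symmetric])
      finally have "ennreal (wk a dl b B R x y) * g y \<le> ennreal (2 powr (1+dl+\<bar>a\<bar>)) * (hk (b + min 0 (dl - a)) y x * wt y) * g y"
        by (rule mult_right_mono) simp
      thus ?thesis using True by (simp add: mult.assoc)
    qed auto
  qed
  also have "... = ennreal (2 powr (1+dl+\<bar>a\<bar>)) * (NN y. hk (b + min 0 (dl - a)) y x * wt y * g y)"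
    by (rule nn_integral_cmult) measurable
  finally show ?thesis .
qed

lemma left_part_eq:
  assumes a: "2 * a + 1 > 0" and R: "R > 0" "dl > 0" and B: "B = a + 1 + dl" and x: "x \<in> {0<..<1}"
    and [measurable]: "g \<in> borel_measurable borel"
  shows "left_part a dl b B R g x \<le> ennreal (2 powr (1+dl) * x powr (b - B)) *
     (NN y. ennreal ((R * y) powr (a - dl) * (1 + R * y) powr (-a)) * wt y * g y)"
proof -
  have "left_part a dl b B R g x \<le> (NN y. ennreal (2 powr (1+dl) * x powr (b - B)) * (ennreal ((R * y) powr (a - dl) * (1 + R * y) powr (-a)) * wt y * g y))"
    unfolding left_part_def
  proof (rule nn_integral_mono)
    fix y show "(if 0 < y \<and> y \<le> x / 2 then ennreal (wk a dl b B R x y) * g y else 0)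
       \<le> ennreal (2 powr (1+dl) * x powr (b - B)) * (ennreal ((R * y) powr (a - dl) * (1 + R * y) powr (-a)) * wt y * g y)"
    proof (cases "0 < y \<and> y \<le> x / 2")
      case True
      have "ennreal (wk a dl b B R x y) \<le> ennreal ((2 powr (1+dl) * x powr (b - B)) * (((R * y) powr (a - dl) * (1 + R * y) powr (-a)) * (1 / y)))"
        using wk_left_eq[OF a R, of y x B b] True x B by (intro ennreal_leI) (auto simp: mult.assoc)
      also have "... = ennreal (2 powr (1+dl) * x powr (b - B)) * (ennreal ((R * y) powr (a - dl) * (1 + R * y) powr (-a)) * ennreal (1 / y))"
        using True by (subst ennreal_mult, simp, simp, subst (2) ennreal_mult) auto
      also have "ennreal (1 / y) = wt y" using True x by (simp add: wt_def)
      finally have "ennreal (wk a dl b B R x y) * g y \<le> ennreal (2 powr (1+dl) * x powr (b - B)) * (ennreal ((R * y) powr (a - dl) * (1 + R * y) powr (-a)) * wt y) * g y"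
        by (rule mult_right_mono) simp
      thus ?thesis using True by (simp add: mult.assoc)
    qed auto
  qed
  also have "... = ennreal (2 powr (1+dl) * x powr (b - B)) *
     (NN y. ennreal ((R * y) powr (a - dl) * (1 + R * y) powr (-a)) * wt y * g y)"
    by (rule nn_integral_cmult) measurable
  finally show ?thesis .
qed

text \<open>The argument of \<open>hlM\<close> is cut off to [x/2, 2 x], so that powers of y can
  later be exchanged for powers of x inside it. The scale max R (1 / x) varies with x, which is
  harmless because \<open>hlM\<close> takes the supremum over all dyadic scales.\<close>

lemma local_part_hlM:
  assumes a: "2 * a + 1 > 0" and dl: "dl > 0" and bB: "B \<le> b"
  shows "\<exists>C>0. \<forall>R>0. \<forall>x\<in>{0<..<1}. \<forall>g\<in>borel_measurable borel. local_part a dl b B R g x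
      \<le> ennreal C * hlM (\<lambda>y. if x / 2 \<le> y \<and> y \<le> 2 * x \<and> y < 1 then g y else 0) x"
proof -
  obtain C1 where C1: "C1 > 0" "\<And>R x y. R > 0 \<Longrightarrow> 0 < x \<Longrightarrow> x \<le> 1 \<Longrightarrow> x / 2 \<le> y \<Longrightarrow> y \<le> 2 * x \<Longrightarrow>
     wk a dl b B R x y \<le> C1 * (max R (1 / x) * (1 + max R (1 / x) * \<bar>x - y\<bar>) powr (-(1+dl)))"
    using wk_local[OF a dl bB] by blast
  obtain C2 where C2: "C2 > 0" "\<And>g R x. g \<in> borel_measurable borel \<Longrightarrow> R > 0 \<Longrightarrow>
     (NN y. ennreal (R * (1 + R * \<bar>x - y\<bar>) powr (-(1+dl))) * g y) \<le> ennreal C2 * hlM g x"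
    using kernel_le_hlM[OF dl] by blast
  have "local_part a dl b B R g x \<le> ennreal (C1 * C2) * hlM (\<lambda>y. if x / 2 \<le> y \<and> y \<le> 2 * x \<and> y < 1 then g y else 0) x"
    if R: "R > 0" and x: "x \<in> {0<..<1}" and g [measurable]: "g \<in> borel_measurable borel" for R x g
  proof -
    define g' where "g' y = (if x / 2 \<le> y \<and> y \<le> 2 * x \<and> y < 1 then g y else 0)" for y
    have g' [measurable]: "g' \<in> borel_measurable borel" unfolding g'_def by measurable
    define R' where "R' = max R (1 / x)"
    have R': "R' > 0" using R by (simp add: R'_def)
    have "local_part a dl b B R g x \<le> (NN y. ennreal C1 * (ennreal (R' * (1 + R' * \<bar>x - y\<bar>) powr (-(1+dl))) * g' y))"
      unfolding local_part_def
    proof (rule nn_integral_mono)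
      fix y show "(if x / 2 \<le> y \<and> y \<le> 2 * x \<and> y < 1 then ennreal (wk a dl b B R x y) * g y else 0)
         \<le> ennreal C1 * (ennreal (R' * (1 + R' * \<bar>x - y\<bar>) powr (-(1+dl))) * g' y)"
      proof (cases "x / 2 \<le> y \<and> y \<le> 2 * x \<and> y < 1")
        case True
        have "ennreal (wk a dl b B R x y) \<le> ennreal (C1 * (R' * (1 + R' * \<bar>x - y\<bar>) powr (-(1+dl))))"
          using C1(2)[OF R, of x y] True x by (intro ennreal_leI) (auto simp: R'_def)
        also have "... = ennreal C1 * ennreal (R' * (1 + R' * \<bar>x - y\<bar>) powr (-(1+dl)))"
          using C1 R' by (intro ennreal_mult) auto
        finally have "ennreal (wk a dl b B R x y) * g y \<le> ennreal C1 * ennreal (R' * (1 + R' * \<bar>x - y\<bar>) powr (-(1+dl))) * g y"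
          by (rule mult_right_mono) simp
        moreover have "g' y = g y" using True by (simp add: g'_def)
        ultimately show ?thesis using True by (simp add: mult.assoc)
      qed auto
    qed
    also have "... = ennreal C1 * (NN y. ennreal (R' * (1 + R' * \<bar>x - y\<bar>) powr (-(1+dl))) * g' y)"
      by (rule nn_integral_cmult) measurable
    also have "... \<le> ennreal C1 * (ennreal C2 * hlM g' x)" by (intro mult_left_mono C2(2) g' R') simp
    also have "... = ennreal (C1 * C2) * hlM g' x" using C1 C2 by (simp add: ennreal_mult mult.assoc)
    finally show ?thesis unfolding g'_def .
  qed
  thus ?thesis using C1(1) C2(1) by (intro exI[of _ "C1 * C2"]) auto
qed

lemma nn_integral_wt_cmult: "f \<in> borel_measurable borel \<Longrightarrow> (NN x. c * f x * wt x) = c * (NN x. f x * wt x)"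
  by (simp add: mult.assoc nn_integral_cmult)

text \<open>On \<open>(0,1)\<close> with \<open>dy / y\<close>, all exponents being normalised to that measure.\<close>
lemma positive_operator_bound:
  assumes a: "2 * a + 1 > 0" and dl: "dl > 0" and p: "p > 1"
    and c: "b > 0" "b > a - dl" "B < 2 * a + 1" "B \<le> a + 1 + dl" "B \<le> b" and st: "B < a + 1 + dl \<or> B < b"
  shows "\<exists>C>0. \<forall>G\<in>borel_measurable borel. (\<forall>y. G y \<ge> 0) \<longrightarrow>
    (NN x. epow p (SUP R\<in>{0<..}. NN y. ennreal (wk a dl b B R x y) * ennreal (G y) * indicator {0<..<1} y) * wt x)
     \<le> ennreal C * (NN y. ennreal (G y powr p) * wt y)"
proof -
  have p0: "p > 0" using p by simp
  define D where "D = (2::real) powr (1+dl+\<bar>a\<bar>)"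
  have D: "D > 0" by (simp add: D_def)
  \<comment> \<open>One majorant F independent of R is needed for each G, because the supremum over
    R is taken before the norm. The Hardy kernel provides it if (4) is strict; the critical case
    needs another F.\<close>
  have left: "\<exists>CL\<ge>0. \<forall>G\<in>borel_measurable borel. (\<forall>y. G y \<ge> 0) \<longrightarrow> (\<exists>F\<in>borel_measurable borel.
      (\<forall>R>0. \<forall>x\<in>{0<..<1}. left_part a dl b B R (\<lambda>y. ennreal (G y)) x \<le> F x) \<and>
      (NN x. epow p (F x) * wt x) \<le> ennreal CL * (NN y. ennreal (G y powr p) * wt y))"
  proof (cases "B < a + 1 + dl")
    case True
    define e where "e = 2*a+1-B + min 0 (dl - a)"
    have e: "e > 0" using True c by (auto simp: e_def min_def)
    show ?thesis
    proof (intro exI[of _ "D powr p * (1/e) powr p"] conjI ballI impI)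
      fix G :: "real \<Rightarrow> real" assume G [measurable]: "G \<in> borel_measurable borel" and G0: "\<forall>y. G y \<ge> 0"
      define H where "H x = (NN y. hk e x y * wt y * ennreal (G y))" for x
      have [measurable]: "H \<in> borel_measurable borel" unfolding H_def by measurable
      show "\<exists>F\<in>borel_measurable borel. (\<forall>R>0. \<forall>x\<in>{0<..<1}. left_part a dl b B R (\<lambda>y. ennreal (G y)) x \<le> F x) \<and>
        (NN x. epow p (F x) * wt x) \<le> ennreal (D powr p * (1/e) powr p) * (NN y. ennreal (G y powr p) * wt y)"
      proof (intro bexI[of _ "\<lambda>x. ennreal D * H x"] conjI allI impI ballI)
        fix R x :: real assume "R > 0" "x \<in> {0<..<1}"
        thus "left_part a dl b B R (\<lambda>y. ennreal (G y)) x \<le> ennreal D * H x"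
          unfolding H_def D_def e_def by (intro left_part_strict a dl c(5)) auto
      next
        have "(NN x. epow p (ennreal D * H x) * wt x) = ennreal (D powr p) * (NN x. epow p (H x) * wt x)"
          unfolding epow_mult[OF p0] using D by (simp add: epow_ennreal nn_integral_wt_cmult)
        also have "... \<le> ennreal (D powr p) * (ennreal ((1/e) powr p) * (NN y. ennreal (G y powr p) * wt y))"
          unfolding H_def using e G0 by (intro mult_left_mono schur_test p hk_row hk_col) auto
        also have "... = ennreal (D powr p * (1/e) powr p) * (NN y. ennreal (G y powr p) * wt y)"
          by (simp add: ennreal_mult mult.assoc)
        finally show "(NN x. epow p (ennreal D * H x) * wt x) \<le> ennreal (D powr p * (1/e) powr p) * (NN y. ennreal (G y powr p) * wt y)" .
      qed measurable
    qed auto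
  next
    case False
    hence B: "B = a + 1 + dl" and Bb: "B < b" using c st by auto
    have da: "dl < a" using B c by simp
    define A0 where "A0 = 1 / (a - dl) + 1 / dl"
    have A0: "A0 > 0" using da dl by (simp add: A0_def add_pos_pos)
    define D' where "D' = (2::real) powr (1+dl)"
    define q where "q = p * (b - B)"
    have q: "q > 0" using p Bb by (simp add: q_def)
    show ?thesis
    proof (intro exI[of _ "D' powr p * A0 powr (p-1) * (1 / q)"] conjI ballI impI)
      fix G :: "real \<Rightarrow> real" assume G [measurable]: "G \<in> borel_measurable borel" and G0: "\<forall>y. G y \<ge> 0"
      define N where "N = (NN y. ennreal (G y powr p) * wt y)"
      \<comment> \<open>A constant: Jensen with mass at most A0 and kernel at most 1 bounds the
        integral, for every R, by the norm of G alone. All dependence on x then sits in x^(b - B),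
        whose p-th power is integrable for dx / x because B < b.\<close>
      define Q where "Q = epow (1/p) (ennreal (A0 powr (p-1)) * N)"
      have key: "(NN y. ennreal ((R * y) powr (a - dl) * (1 + R * y) powr (-a)) * wt y * ennreal (G y)) \<le> Q" (is "?S \<le> Q") if R: "R > 0" for R
      proof -
        have "epow p ?S \<le> ennreal (A0 powr (p-1)) * (NN y. ennreal ((R * y) powr (a - dl) * (1 + R * y) powr (-a)) * wt y * ennreal (G y powr p))"
          using G0 unfolding A0_def by (intro jensen_kernel p eq_kernel_facts(2) dl da R) (use A0 in \<open>auto simp: A0_def\<close>)
        also have "... \<le> ennreal (A0 powr (p-1)) * N" unfolding N_def
        proof (intro mult_left_mono nn_integral_mono)
          fix y show "ennreal ((R * y) powr (a - dl) * (1 + R * y) powr (-a)) * wt y * ennreal (G y powr p) \<le> ennreal (G y powr p) * wt y"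
          proof (cases "0 < y")
            case True
            have "ennreal ((R * y) powr (a - dl) * (1 + R * y) powr (-a)) \<le> 1"
              using eq_kernel_facts(1)[OF dl da R True] by simp
            hence "ennreal ((R * y) powr (a - dl) * (1 + R * y) powr (-a)) * (wt y * ennreal (G y powr p)) \<le> 1 * (wt y * ennreal (G y powr p))"
              by (rule mult_right_mono) simp
            thus ?thesis by (simp add: mult_ac)
          qed (simp add: wt_def)
        qed auto
        finally have "epow (1/p) (epow p ?S) \<le> Q" unfolding Q_def using p by (intro epow_mono) auto
        thus ?thesis by (simp only: epow_inverse(1)[OF p0])
      qed
      show "\<exists>F\<in>borel_measurable borel. (\<forall>R>0. \<forall>x\<in>{0<..<1}. left_part a dl b B R (\<lambda>y. ennreal (G y)) x \<le> F x) \<and>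
        (NN x. epow p (F x) * wt x) \<le> ennreal (D' powr p * A0 powr (p-1) * (1 / q)) * (NN y. ennreal (G y powr p) * wt y)"
      proof (intro bexI[of _ "\<lambda>x. ennreal (D' * x powr (b - B)) * Q"] conjI allI impI ballI)
        fix R x :: real assume R: "R > 0" and x: "x \<in> {0<..<1}"
        have "left_part a dl b B R (\<lambda>y. ennreal (G y)) x \<le> ennreal (D' * x powr (b - B)) *
           (NN y. ennreal ((R * y) powr (a - dl) * (1 + R * y) powr (-a)) * wt y * ennreal (G y))"
          unfolding D'_def by (rule left_part_eq[OF a R dl B x]) measurable
        also have "... \<le> ennreal (D' * x powr (b - B)) * Q" by (intro mult_left_mono key R) simp
        finally show "left_part a dl b B R (\<lambda>y. ennreal (G y)) x \<le> ennreal (D' * x powr (b - B)) * Q" .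
      next
        have "(NN x. epow p (ennreal (D' * x powr (b - B)) * Q) * wt x)
          \<le> (NN x. (ennreal (D' powr p) * epow p Q) * (ennreal (x powr (q - 1)) * indicator {0..1} x))"
        proof (rule nn_integral_mono)
          fix x show "epow p (ennreal (D' * x powr (b - B)) * Q) * wt x \<le> (ennreal (D' powr p) * epow p Q) * (ennreal (x powr (q - 1)) * indicator {0..1} x)"
          proof (cases "x \<in> {0<..<1}")
            case True
            have "epow p (ennreal (D' * x powr (b - B)) * Q) * wt x = ennreal ((D' * x powr (b - B)) powr p) * epow p Q * ennreal (1 / x)"
              unfolding epow_mult[OF p0] using True by (simp add: epow_ennreal D'_def wt_def)
            also have "... = ennreal ((D' * x powr (b - B)) powr p * (1 / x)) * epow p Q"
              using True by (subst ennreal_mult) (auto simp: mult_ac)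
            also have "(D' * x powr (b - B)) powr p * (1 / x) = D' powr p * x powr (q - 1)"
              using True unfolding powr_mult powr_powr by (simp add: q_def powr_diff mult.commute)
            also have "ennreal (D' powr p * x powr (q - 1)) * epow p Q = (ennreal (D' powr p) * epow p Q) * (ennreal (x powr (q - 1)) * indicator {0..1} x)"
              using True by (simp add: ennreal_mult mult_ac)
            finally show ?thesis by simp
          qed (simp add: wt_def)
        qed
        also have "... = (ennreal (D' powr p) * epow p Q) * (NN x. ennreal (x powr (q - 1)) * indicator {0..1} x)"
          by (rule nn_integral_cmult) measurable
        also have "(NN x. ennreal (x powr (q - 1)) * indicator {0..1} x) = ennreal (1 / q)"
          using q by (subst nn_integral_powr_0) auto
        also have "epow p Q = ennreal (A0 powr (p-1)) * N" unfolding Q_def by (rule epow_inverse(2)[OF p0])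
        also have "ennreal (D' powr p) * (ennreal (A0 powr (p-1)) * N) * ennreal (1 / q) = ennreal (D' powr p * A0 powr (p-1) * (1 / q)) * N"
          using q by (subst ennreal_mult[of "D' powr p * A0 powr (p-1)"]) (auto simp: ennreal_mult mult_ac)
        finally show "(NN x. epow p (ennreal (D' * x powr (b - B)) * Q) * wt x) \<le> ennreal (D' powr p * A0 powr (p-1) * (1 / q)) * (NN y. ennreal (G y powr p) * wt y)"
          unfolding N_def .
      qed measurable
    qed (use q in auto)
  qed
  then obtain CL where CL: "CL \<ge> 0" "\<And>G. G \<in> borel_measurable borel \<Longrightarrow> (\<And>y. G y \<ge> 0) \<Longrightarrow> (\<exists>F\<in>borel_measurable borel.
      (\<forall>R>0. \<forall>x\<in>{0<..<1}. left_part a dl b B R (\<lambda>y. ennreal (G y)) x \<le> F x) \<and>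
      (NN x. epow p (F x) * wt x) \<le> ennreal CL * (NN y. ennreal (G y powr p) * wt y))"
    by blast
  obtain C1 where C1: "C1 > 0" "\<And>R x g. R > 0 \<Longrightarrow> x \<in> {0<..<1} \<Longrightarrow> g \<in> borel_measurable borel \<Longrightarrow> local_part a dl b B R g x
      \<le> ennreal C1 * hlM (\<lambda>y. if x / 2 \<le> y \<and> y \<le> 2 * x \<and> y < 1 then g y else 0) x"
    using local_part_hlM[OF a dl c(5)] by blast
  obtain C2 where C2: "C2 > 0" "\<And>h. h \<in> borel_measurable borel \<Longrightarrow> (\<And>x. h x \<ge> 0) \<Longrightarrow>
     (NN x. epow p (hlM (\<lambda>y. ennreal (h y)) x)) \<le> ennreal C2 * (NN x. ennreal (h x powr p))"
    using hlM_strong_type[OF p] by blast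
  define eR where "eR = b + min 0 (dl - a)"
  have eR: "eR > 0" using c by (auto simp: eR_def min_def)
  define CR where "CR = D powr p * (1/eR) powr p"
  \<comment> \<open>The power 2^(1/p) comes from y <= 2 x, when y^(1/p) is replaced by a power of
    x.\<close>
  define K1 where "K1 = C1 * 2 powr (1/p)"
  have K1: "K1 > 0" using C1 by (simp add: K1_def)
  define CM where "CM = K1 powr p * C2"
  \<comment> \<open>The price of the p-th power of a sum of two terms, paid once for F and twice for
    the other two parts.\<close>
  define P where "P = (2::real) powr p"
  have P: "P > 0" by (simp add: P_def)
  define C where "C = P * CL + P * (P * CM + P * CR)"
  have C0: "C > 0"
  proof -
    have "CM > 0" "CR \<ge> 0" using C2 K1 by (auto simp: CM_def CR_def)
    hence "P * CL \<ge> 0" "P * (P * CM) > 0" "P * (P * CR) \<ge> 0" using P CL by auto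
    thus ?thesis by (simp add: C_def distrib_left)
  qed
  have "(NN x. epow p (SUP R\<in>{0<..}. NN y. ennreal (wk a dl b B R x y) * ennreal (G y) * indicator {0<..<1} y) * wt x)
     \<le> ennreal C * (NN y. ennreal (G y powr p) * wt y)"
    if G [measurable]: "G \<in> borel_measurable borel" and G0: "\<And>y. G y \<ge> 0" for G
  proof -
    define N where "N = (NN y. ennreal (G y powr p) * wt y)"
    obtain F where F [measurable]: "F \<in> borel_measurable borel" and F1: "\<And>R x. R > 0 \<Longrightarrow> x \<in> {0<..<1} \<Longrightarrow> left_part a dl b B R (\<lambda>y. ennreal (G y)) x \<le> F x"
      and F2: "(NN x. epow p (F x) * wt x) \<le> ennreal CL * N"
      using CL(2)[OF G G0] unfolding N_def by blast
    define H where "H x = ennreal D * (NN y. hk eR y x * wt y * ennreal (G y))" for x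
    have H [measurable]: "H \<in> borel_measurable borel" unfolding H_def by measurable
    have H1: "right_part a dl b B R (\<lambda>y. ennreal (G y)) x \<le> H x" if "R > 0" "x \<in> {0<..<1}" for R x
      using that unfolding H_def D_def eR_def by (intro right_part_strict a dl c(5)) auto
    have H2: "(NN x. epow p (H x) * wt x) \<le> ennreal CR * N"
    proof -
      have "(NN x. epow p (H x) * wt x) = ennreal (D powr p) * (NN x. epow p (NN y. hk eR y x * wt y * ennreal (G y)) * wt x)"
        unfolding H_def epow_mult[OF p0] using D by (simp add: epow_ennreal nn_integral_wt_cmult)
      also have "... \<le> ennreal (D powr p) * (ennreal ((1/eR) powr p) * N)"
        unfolding N_def using eR G0 by (intro mult_left_mono schur_test[where k="\<lambda>x y. hk eR y x"] p hk_row hk_col) auto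
      also have "... = ennreal CR * N" by (simp add: CR_def ennreal_mult mult.assoc)
      finally show ?thesis .
    qed
    \<comment> \<open>Passing from G to y^(-1/p) G turns the p-norm for dy / y into the one for dy,
      for which \<open>hlM\<close> is bounded.\<close>
    define h where "h y = (if 0 < y \<and> y < 1 then y powr (-(1/p)) * G y else 0)" for y
    have h [measurable]: "h \<in> borel_measurable borel" unfolding h_def by measurable
    have h0: "h y \<ge> 0" for y using G0 by (simp add: h_def)
    define L where "L x = ennreal (K1 * x powr (1/p)) * hlM (\<lambda>y. ennreal (h y)) x" for x
    have L [measurable]: "L \<in> borel_measurable borel" unfolding L_def by measurable
    have L1: "local_part a dl b B R (\<lambda>y. ennreal (G y)) x \<le> L x" if R: "R > 0" and x: "x \<in> {0<..<1}" for R x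
    proof -
      define t where "t = (2 * x) powr (1/p)"
      have t: "t \<ge> 0" by (simp add: t_def)
      have dom: "(if x / 2 \<le> y \<and> y \<le> 2 * x \<and> y < 1 then ennreal (G y) else 0) \<le> ennreal t * ennreal (h y)" for y
      proof (cases "x / 2 \<le> y \<and> y \<le> 2 * x \<and> y < 1")
        case True
        hence y: "0 < y" using x by auto
        have "y powr (1/p) * y powr (-(1/p)) = 1" unfolding powr_add[symmetric] using y by simp
        hence "G y = y powr (1/p) * (y powr (-(1/p)) * G y)" by (simp only: mult.assoc[symmetric] mult_1_left)
        also have "... \<le> t * (y powr (-(1/p)) * G y)" unfolding t_def using True y p G0 by (intro mult_right_mono powr_mono2) auto
        also have "... = t * h y" using True y by (simp add: h_def)
        finally show ?thesis using True t h0 by (simp add: ennreal_mult[symmetric] ennreal_leI)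
      qed (auto simp: h0)
      have "local_part a dl b B R (\<lambda>y. ennreal (G y)) x \<le> ennreal C1 * hlM (\<lambda>y. if x / 2 \<le> y \<and> y \<le> 2 * x \<and> y < 1 then ennreal (G y) else 0) x"
        by (rule C1(2)[OF R x]) measurable
      also have "... \<le> ennreal C1 * hlM (\<lambda>y. ennreal t * ennreal (h y)) x" by (intro mult_left_mono hlM_mono dom) auto
      also have "hlM (\<lambda>y. ennreal t * ennreal (h y)) x \<le> ennreal t * hlM (\<lambda>y. ennreal (h y)) x"
        unfolding hlM_def
      proof (rule SUP_least)
        fix k :: int
        have "(NN y. (if \<bar>x - y\<bar> \<le> 2 powr (- real_of_int k) then ennreal t * ennreal (h y) else 0))
          = (NN y. ennreal t * (if \<bar>x - y\<bar> \<le> 2 powr (- real_of_int k) then ennreal (h y) else 0))"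
          by (intro nn_integral_cong) auto
        also have "... = ennreal t * (NN y. (if \<bar>x - y\<bar> \<le> 2 powr (- real_of_int k) then ennreal (h y) else 0))"
          by (rule nn_integral_cmult) measurable
        finally have "ennreal (2 powr real_of_int k) * (NN y. (if \<bar>x - y\<bar> \<le> 2 powr (- real_of_int k) then ennreal t * ennreal (h y) else 0))
          = ennreal t * (ennreal (2 powr real_of_int k) * (NN y. (if \<bar>x - y\<bar> \<le> 2 powr (- real_of_int k) then ennreal (h y) else 0)))"
          by (simp add: mult.left_commute)
        thus "ennreal (2 powr real_of_int k) * (NN y. (if \<bar>x - y\<bar> \<le> 2 powr (- real_of_int k) then ennreal t * ennreal (h y) else 0))
          \<le> ennreal t * (SUP k::int. ennreal (2 powr real_of_int k) * (NN y. (if \<bar>x - y\<bar> \<le> 2 powr (- real_of_int k) then ennreal (h y) else 0)))"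
          by (simp only:) (intro mult_left_mono SUP_upper, auto)
      qed
      hence "ennreal C1 * hlM (\<lambda>y. ennreal t * ennreal (h y)) x \<le> ennreal C1 * (ennreal t * hlM (\<lambda>y. ennreal (h y)) x)" by (intro mult_left_mono) auto
      also have "... = ennreal (C1 * t) * hlM (\<lambda>y. ennreal (h y)) x" using C1 t by (simp add: ennreal_mult mult.assoc)
      also have "C1 * t = K1 * x powr (1/p)" by (simp add: K1_def t_def powr_mult)
      finally show ?thesis unfolding L_def .
    qed
    have L2: "(NN x. epow p (L x) * wt x) \<le> ennreal CM * N"
    proof -
      have "(NN x. epow p (L x) * wt x) \<le> (NN x. ennreal (K1 powr p) * epow p (hlM (\<lambda>y. ennreal (h y)) x))"
      proof (rule nn_integral_mono)
        fix x show "epow p (L x) * wt x \<le> ennreal (K1 powr p) * epow p (hlM (\<lambda>y. ennreal (h y)) x)"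
        proof (cases "x \<in> {0<..<1}")
          case True
          have "epow p (L x) * wt x = ennreal ((K1 * x powr (1/p)) powr p) * epow p (hlM (\<lambda>y. ennreal (h y)) x) * ennreal (1 / x)"
            unfolding L_def epow_mult[OF p0] using True K1 by (simp add: epow_ennreal wt_def)
          also have "(K1 * x powr (1/p)) powr p = K1 powr p * x" using True p by (simp add: powr_mult powr_powr)
          also have "ennreal (K1 powr p * x) * epow p (hlM (\<lambda>y. ennreal (h y)) x) * ennreal (1 / x)
             = ennreal (K1 powr p) * epow p (hlM (\<lambda>y. ennreal (h y)) x) * (ennreal x * ennreal (1 / x))"
            using True by (simp add: ennreal_mult mult_ac)
          also have "ennreal x * ennreal (1 / x) = 1" using True by (simp add: ennreal_mult[symmetric])
          finally show ?thesis by simp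
        qed (simp add: wt_def)
      qed
      also have "... = ennreal (K1 powr p) * (NN x. epow p (hlM (\<lambda>y. ennreal (h y)) x))"
        by (rule nn_integral_cmult) measurable
      also have "... \<le> ennreal (K1 powr p) * (ennreal C2 * (NN x. ennreal (h x powr p)))"
        by (intro mult_left_mono C2(2) h h0) simp
      also have "(NN x. ennreal (h x powr p)) = N" unfolding N_def
      proof (rule nn_integral_cong)
        fix x show "ennreal (h x powr p) = ennreal (G x powr p) * wt x"
        proof (cases "x \<in> {0<..<1}")
          case True
          have "(x powr (-(1/p)) * G x) powr p = x powr (-1) * G x powr p" using p by (simp add: powr_mult powr_powr)
          also have "... = G x powr p * (1 / x)" using True by (simp add: powr_minus_divide)
          finally show ?thesis using True by (simp add: h_def wt_def ennreal_mult'[symmetric])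
        qed (auto simp: h_def wt_def)
      qed
      also have "ennreal (K1 powr p) * (ennreal C2 * N) = ennreal CM * N" using C2 by (simp add: CM_def ennreal_mult mult.assoc)
      finally show ?thesis .
    qed
    have "(NN x. epow p (SUP R\<in>{0<..}. NN y. ennreal (wk a dl b B R x y) * ennreal (G y) * indicator {0<..<1} y) * wt x)
      \<le> (NN x. ennreal P * (epow p (F x) * wt x) + ennreal P * (ennreal P * (epow p (L x) * wt x) + ennreal P * (epow p (H x) * wt x)))"
    proof (rule nn_integral_mono)
      fix x
      let ?T = "SUP R\<in>{0<..}. \<integral>\<^sup>+y. ennreal (wk a dl b B R x y) * ennreal (G y) * indicator {0<..<1} y \<partial>lborel"
      show "epow p ?T * wt x \<le> ennreal P * (epow p (F x) * wt x) + ennreal P * (ennreal P * (epow p (L x) * wt x) + ennreal P * (epow p (H x) * wt x))"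
      proof (cases "x \<in> {0<..<1}")
        case True
        have "?T \<le> F x + (L x + H x)"
        proof (rule SUP_least)
          fix R :: real assume R: "R \<in> {0<..}"
          have "(NN y. ennreal (wk a dl b B R x y) * ennreal (G y) * indicator {0<..<1} y)
            \<le> left_part a dl b B R (\<lambda>y. ennreal (G y)) x + (local_part a dl b B R (\<lambda>y. ennreal (G y)) x + right_part a dl b B R (\<lambda>y. ennreal (G y)) x)"
            by (rule parts_sum[OF _ True]) measurable
          also have "... \<le> F x + (L x + H x)" using R True by (intro add_mono F1 L1 H1) auto
          finally show "(NN y. ennreal (wk a dl b B R x y) * ennreal (G y) * indicator {0<..<1} y) \<le> F x + (L x + H x)" .
        qed
        hence "epow p ?T \<le> epow p (F x + (L x + H x))" using p by (intro epow_mono) auto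
        also have "... \<le> ennreal P * (epow p (F x) + epow p (L x + H x))" unfolding P_def by (rule epow_add[OF p0])
        also have "... \<le> ennreal P * (epow p (F x) + ennreal P * (epow p (L x) + epow p (H x)))"
          unfolding P_def by (intro mult_left_mono add_left_mono epow_add[OF p0]) auto
        finally have "epow p ?T * wt x \<le> ennreal P * (epow p (F x) + ennreal P * (epow p (L x) + epow p (H x))) * wt x"
          by (rule mult_right_mono) simp
        thus ?thesis by (simp add: distrib_left distrib_right mult_ac)
      qed (simp add: wt_def)
    qed
    also have "... = ennreal P * (NN x. epow p (F x) * wt x) + ennreal P * (ennreal P * (NN x. epow p (L x) * wt x) + ennreal P * (NN x. epow p (H x) * wt x))"
      by (simp add: nn_integral_add nn_integral_cmult)
    also have "... \<le> ennreal P * (ennreal CL * N) + ennreal P * (ennreal P * (ennreal CM * N) + ennreal P * (ennreal CR * N))"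
      by (intro add_mono mult_left_mono F2 L2 H2) auto
    also have "... = ennreal C * N"
    proof -
      have nn: "CM \<ge> 0" "CR \<ge> 0" "P \<ge> 0" "CL \<ge> 0" using C2 CL P by (auto simp: CM_def CR_def)
      have "ennreal C = ennreal P * ennreal CL + ennreal P * (ennreal P * ennreal CM + ennreal P * ennreal CR)"
        unfolding C_def using nn by (simp add: ennreal_plus ennreal_mult)
      thus ?thesis by (simp add: distrib_right distrib_left mult.assoc)
    qed
    finally show ?thesis unfolding N_def .
  qed
  thus ?thesis using C0 by blast
qed

section \<open>The endpoint p = infinity\<close>

text \<open>The range R y >= 1 for p = infinity, with equality allowed in (3). If b > a - delta,
  then B may be raised to b because y < 1, the integral converges at infinity, and all powers of R
  cancel. If b = a - delta, the prefactor is at most 1 and B < b makes the integral converge at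
  0.\<close>

lemma right_tail_bound:
  assumes dl: "dl > 0" and b: "b \<ge> 0" "b \<ge> a - dl" "B \<le> b" "b > a - dl \<or> B < b"
  shows "\<exists>E>0. \<forall>R>0. \<forall>x\<in>{0<..<1}. ennreal (x powr b * R powr (a - dl) * (1 + R * x) powr (-a)) *
    (NN y. (if 1 / R \<le> y \<and> x \<le> y \<and> y < 1 then ennreal (y powr (a - 1 - dl - B)) else 0)) \<le> ennreal E"
proof (cases "b > a - dl")
  case True
  define E where "E = 2 powr \<bar>a\<bar> / (b + dl - a)"
  have "ennreal (x powr b * R powr (a - dl) * (1 + R * x) powr (-a)) *
    (NN y. (if 1 / R \<le> y \<and> x \<le> y \<and> y < 1 then ennreal (y powr (a - 1 - dl - B)) else 0)) \<le> ennreal E"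
    if R: "R > 0" and x: "x \<in> {0<..<1}" for R x
  proof -
    define X where "X = R * x"
    \<comment> \<open>The lower end max (1 / R) x of the range of y, written so that its power of R
      can be split off.\<close>
    define m where "m = max 1 X / R"
    have X: "X > 0" using R x by (simp add: X_def)
    have m: "m > 0" using R by (simp add: m_def)
    have "(NN y. (if 1 / R \<le> y \<and> x \<le> y \<and> y < 1 then ennreal (y powr (a - 1 - dl - B)) else 0))
       \<le> (NN y. ennreal (y powr (a - 1 - dl - b)) * indicator {m..} y)"
    proof (rule nn_integral_mono)
      fix y show "(if 1 / R \<le> y \<and> x \<le> y \<and> y < 1 then ennreal (y powr (a - 1 - dl - B)) else 0) \<le> ennreal (y powr (a - 1 - dl - b)) * indicator {m..} y"
      proof (cases "1 / R \<le> y \<and> x \<le> y \<and> y < 1")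
        case t: True
        have y: "0 < y" using t x by auto
        have "X \<le> R * y" using R t by (simp add: X_def)
        moreover have "1 \<le> R * y" using R t by (simp add: field_simps)
        ultimately have "m \<le> y" using R by (simp add: m_def pos_divide_le_eq mult.commute)
        moreover have "y powr (a - 1 - dl - B) \<le> y powr (a - 1 - dl - b)" using y t b by (intro powr_mono') auto
        ultimately show ?thesis using t by (simp add: ennreal_leI)
      next
        case False
        show ?thesis unfolding if_not_P[OF False] by simp
      qed
    qed
    also have "... = ennreal (m powr (a - 1 - dl - b + 1) / (- (a - 1 - dl - b + 1)))"
      using True m by (intro nn_integral_powr_inf) auto
    also have "m powr (a - 1 - dl - b + 1) / (- (a - 1 - dl - b + 1)) = m powr (a - dl - b) / (b + dl - a)"
      by (intro arg_cong2[where f="(/)"] arg_cong2[where f="(powr)"]) auto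
    finally have "ennreal (x powr b * R powr (a - dl) * (1 + R * x) powr (-a)) *
    (NN y. (if 1 / R \<le> y \<and> x \<le> y \<and> y < 1 then ennreal (y powr (a - 1 - dl - B)) else 0))
      \<le> ennreal (x powr b * R powr (a - dl) * (1 + R * x) powr (-a)) * ennreal (m powr (a - dl - b) / (b + dl - a))"
      by (rule mult_left_mono) simp
    also have "... = ennreal ((x powr b * R powr (a - dl) * (1 + R * x) powr (-a)) * (m powr (a - dl - b) / (b + dl - a)))"
      using True by (subst ennreal_mult) auto
    also have "... \<le> ennreal E"
    proof (rule ennreal_leI)
      have xX: "x powr b = X powr b * R powr (-b)" using R x by (simp add: X_def powr_mult powr_minus field_simps)
      have mX: "m powr (a - dl - b) = max 1 X powr (a - dl - b) * R powr (-(a - dl - b))"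
        using R unfolding m_def powr_divide by (simp only: powr_minus_divide) simp
      have "x powr b * R powr (a - dl) * (1 + R * x) powr (-a) * m powr (a - dl - b)
        = (X powr b * (1 + X) powr (-a) * max 1 X powr (a - dl - b)) * (R powr (-b) * R powr (a - dl) * R powr (-(a - dl - b)))"
        unfolding xX mX X_def[symmetric] by (simp only: mult_ac)
      also have "R powr (-b) * R powr (a - dl) * R powr (-(a - dl - b)) = 1"
        unfolding powr_add[symmetric] using R by simp
      also have "X powr b * (1 + X) powr (-a) * max 1 X powr (a - dl - b) \<le> 2 powr \<bar>a\<bar>"
      proof (cases "X \<le> 1")
        case le: True
        have "X powr b * (1 + X) powr (-a) \<le> 1 * 2 powr \<bar>-a\<bar>"
          using X le b by (intro mult_mono one_add_powr_small powr_le1) auto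
        moreover have "max 1 X = 1" using le by simp
        ultimately show ?thesis by simp
      next
        case False
        have "X powr b * (1 + X) powr (-a) * X powr (a - dl - b) \<le> X powr b * (2 powr \<bar>-a\<bar> * X powr (-a)) * X powr (a - dl - b)"
          using False by (intro mult_right_mono mult_left_mono one_add_powr_large) auto
        also have "... = 2 powr \<bar>a\<bar> * (X powr b * X powr (-a) * X powr (a - dl - b))" by simp
        also have "X powr b * X powr (-a) * X powr (a - dl - b) = X powr (-dl)" unfolding powr_add[symmetric] by simp
        also have "2 powr \<bar>a\<bar> * X powr (-dl) \<le> 2 powr \<bar>a\<bar> * 1 powr (-dl)"
          using False dl by (intro mult_left_mono powr_mono2') auto
        finally show ?thesis using False by (simp add: max_absorb2)
      qed
      finally have "x powr b * R powr (a - dl) * (1 + R * x) powr (-a) * m powr (a - dl - b) \<le> 2 powr \<bar>a\<bar>" by simp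
      hence "x powr b * R powr (a - dl) * (1 + R * x) powr (-a) * m powr (a - dl - b) / (b + dl - a) \<le> E"
        unfolding E_def using True by (intro divide_right_mono) auto
      thus "(x powr b * R powr (a - dl) * (1 + R * x) powr (-a)) * (m powr (a - dl - b) / (b + dl - a)) \<le> E" by simp
    qed
    finally show ?thesis .
  qed
  moreover have "E > 0" using True by (simp add: E_def)
  ultimately show ?thesis by blast
next
  case False
  hence ba: "b = a - dl" and Bb: "B < b" using b by auto
  have "ennreal (x powr b * R powr (a - dl) * (1 + R * x) powr (-a)) *
    (NN y. (if 1 / R \<le> y \<and> x \<le> y \<and> y < 1 then ennreal (y powr (a - 1 - dl - B)) else 0)) \<le> ennreal (1 / (b - B))"
    if R: "R > 0" and x: "x \<in> {0<..<1}" for R x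
  proof -
    define X where "X = R * x"
    have X: "X > 0" using R x by (simp add: X_def)
    have "(NN y. (if 1 / R \<le> y \<and> x \<le> y \<and> y < 1 then ennreal (y powr (a - 1 - dl - B)) else 0))
       \<le> (NN y. ennreal (y powr (a - 1 - dl - B)) * indicator {0..1} y)"
      using x by (intro nn_integral_mono) auto
    also have "... = ennreal (1 powr (a - 1 - dl - B + 1) / (a - 1 - dl - B + 1))"
      using Bb ba by (intro nn_integral_powr_0) auto
    also have "1 powr (a - 1 - dl - B + 1) / (a - 1 - dl - B + 1) = 1 / (b - B)" using ba by simp
    finally have I: "(NN y. (if 1 / R \<le> y \<and> x \<le> y \<and> y < 1 then ennreal (y powr (a - 1 - dl - B)) else 0)) \<le> ennreal (1 / (b - B))" .
    have "x powr b * R powr (a - dl) = X powr (a - dl)" by (simp add: ba X_def powr_mult)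
    moreover have "X powr (a - dl) * (1 + X) powr (-a) \<le> (1 + X) powr (a - dl) * (1 + X) powr (-a)"
      using X b ba by (intro mult_right_mono powr_mono2) auto
    moreover have "(1 + X) powr (a - dl) * (1 + X) powr (-a) = (1 + X) powr (-dl)" unfolding powr_add[symmetric] by simp
    moreover have "(1 + X) powr (-dl) \<le> 1 powr (-dl)" using X dl by (intro powr_mono2') auto
    ultimately have "x powr b * R powr (a - dl) * (1 + R * x) powr (-a) \<le> 1" by (simp add: X_def)
    hence "ennreal (x powr b * R powr (a - dl) * (1 + R * x) powr (-a)) *
       (NN y. (if 1 / R \<le> y \<and> x \<le> y \<and> y < 1 then ennreal (y powr (a - 1 - dl - B)) else 0)) \<le> 1 * ennreal (1 / (b - B))"
      by (intro mult_mono I) (auto simp: ennreal_le_1)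
    thus ?thesis by simp
  qed
  thus ?thesis using Bb by (intro exI[of _ "1 / (b - B)"]) auto
qed

text \<open>For p = infinity the exponent in \<open>wk_right\<close> may be 0, and the row integral
  of the Hardy kernel is then unbounded as x tends to 0. So R is kept, and the range is split at R y
  = 1. The inner range leaves R^(B - b), bounded only for R >= c0; this suffices, since the means
  vanish for R below the first zero.\<close>

lemma right_part_one:
  assumes a: "2 * a + 1 > 0" and dl: "dl > 0" and c0: "c0 > 0"
    and b: "b \<ge> 0" "b \<ge> a - dl" "B < 2 * a + 1" "B \<le> b" "b > a - dl \<or> B < b"
  shows "\<exists>C>0. \<forall>R\<ge>c0. \<forall>x\<in>{0<..<1}. right_part a dl b B R (\<lambda>_. 1) x \<le> ennreal C"
proof -
  obtain E where E: "E > 0" "\<And>R x. R > 0 \<Longrightarrow> x \<in> {0<..<1} \<Longrightarrow> ennreal (x powr b * R powr (a - dl) * (1 + R * x) powr (-a)) *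
    (NN y. (if 1 / R \<le> y \<and> x \<le> y \<and> y < 1 then ennreal (y powr (a - 1 - dl - B)) else 0)) \<le> ennreal E"
    using right_tail_bound[OF dl b(1,2,4,5)] by blast
  define D where "D = (2::real) powr (1+dl)"
  have D: "D > 0" by (simp add: D_def)
  define C where "C = D * 2 powr \<bar>a\<bar> * c0 powr (B - b) / (2*a+1-B) + D * E"
  have C: "C > 0" using D E b c0 by (simp add: C_def add_pos_pos)
  have "right_part a dl b B R (\<lambda>_. 1) x \<le> ennreal C" if R0: "R \<ge> c0" and x: "x \<in> {0<..<1}" for R x
  proof -
    have R: "R > 0" using R0 c0 by simp
    define K1 where "K1 = D * 2 powr \<bar>a\<bar> * R powr (2*a+1-b)"
    define K2 where "K2 = x powr b * R powr (a - dl) * (1 + R * x) powr (-a)"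
    have K: "K1 \<ge> 0" "K2 \<ge> 0" using D by (auto simp: K1_def K2_def)
    let ?h = "\<lambda>y. (if 1 / R \<le> y \<and> x \<le> y \<and> y < 1 then ennreal (y powr (a - 1 - dl - B)) else 0)"
    have "right_part a dl b B R (\<lambda>_. 1) x
      \<le> (NN y. ennreal K1 * (ennreal (y powr (2*a - B)) * indicator {0..1/R} y) + ennreal D * (ennreal K2 * ?h y))"
      unfolding right_part_def
    proof (rule nn_integral_mono)
      fix y
      show "(if 2 * x \<le> y \<and> y < 1 then ennreal (wk a dl b B R x y) * 1 else 0)
        \<le> ennreal K1 * (ennreal (y powr (2*a - B)) * indicator {0..1/R} y) + ennreal D * (ennreal K2 * ?h y)"
      proof (cases "2 * x \<le> y \<and> y < 1")
        case True
        hence y: "0 < y" "x \<le> y" "x \<le> y / 2" "y < 1" using x by auto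
        have s: "BR_bound a dl R x y = R powr (2*a+1) * (1 + R * y) powr (-a) * (1 + R * x) powr (-a) * (1 + R * \<bar>y - x\<bar>) powr (-(1+dl))"
          by (simp add: BR_bound_def abs_minus_commute)
        have far: "BR_bound a dl R x y \<le> D * (R powr (2*a+1) * (1 + R * y) powr (-(a+1+dl)) * (1 + R * x) powr (-a))"
          unfolding s D_def using x y by (intro BR_bound_far R dl) auto
        show ?thesis
        proof (cases "R * y \<le> 1")
          case le: True
          have xR1: "R * x \<le> 1" using mult_left_mono[OF y(2), of R] le R by linarith
          have xR: "x \<le> 1 / R" using xR1 R by (simp add: pos_le_divide_eq mult.commute)
          have yR: "y \<le> 1 / R" using le R by (simp add: pos_le_divide_eq mult.commute)
          have "1 \<le> 1 + R * y" using R y by simp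
          hence q: "(1 + R * y) powr (-(a+1+dl)) \<le> 1 powr (-(a+1+dl))" using a dl by (intro powr_mono2') auto
          have q2: "(1 + R * x) powr (-a) \<le> 2 powr \<bar>-a\<bar>"
            using R x xR1 by (intro one_add_powr_small) auto
          have q3: "x powr b \<le> R powr (-b)"
          proof -
            have "x powr b \<le> (1 / R) powr b" using xR x b by (intro powr_mono2) auto
            thus ?thesis by (simp add: inverse_powr_real)
          qed
          have "BR_bound a dl R x y \<le> D * (R powr (2*a+1) * 1 * 2 powr \<bar>a\<bar>)"
            by (rule order_trans[OF far], intro mult_left_mono mult_mono) (use q q2 D in auto)
          hence "wk a dl b B R x y \<le> R powr (-b) * (D * (R powr (2*a+1) * 1 * 2 powr \<bar>a\<bar>)) * y powr (2*a - B)"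
            unfolding wk_def using q3 by (intro mult_right_mono mult_mono) (auto simp: BR_bound_def)
          also have "... = (D * 2 powr \<bar>a\<bar> * (R powr (2*a+1) * R powr (-b))) * y powr (2*a - B)" by simp
          also have "R powr (2*a+1) * R powr (-b) = R powr (2*a+1-b)" unfolding powr_add[symmetric] by simp
          finally have "wk a dl b B R x y \<le> K1 * y powr (2*a - B)" by (simp add: K1_def)
          hence "ennreal (wk a dl b B R x y) \<le> ennreal K1 * ennreal (y powr (2*a - B))"
            using K by (simp add: ennreal_mult[symmetric] ennreal_leI)
          thus ?thesis using True y yR by (simp add: add_increasing2)
        next
          case False
          have yR: "1 / R \<le> y" using False R by (simp add: field_simps)
          have "(1 + R * y) powr (-(a+1+dl)) \<le> (R * y) powr (-(a+1+dl))" using a dl R y by (intro powr_mono2') auto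
          hence "D * (R powr (2*a+1) * (1 + R * y) powr (-(a+1+dl)) * (1 + R * x) powr (-a))
             \<le> D * (R powr (2*a+1) * (R * y) powr (-(a+1+dl)) * (1 + R * x) powr (-a))"
            using D by (intro mult_left_mono mult_right_mono) auto
          hence "wk a dl b B R x y \<le> x powr b * (D * (R powr (2*a+1) * (R * y) powr (-(a+1+dl)) * (1 + R * x) powr (-a))) * y powr (2*a - B)"
            unfolding wk_def using far by (intro mult_right_mono mult_left_mono) auto
          also have "... = D * (x powr b * (R powr (2*a+1) * R powr (-(a+1+dl))) * (1 + R * x) powr (-a)) * (y powr (-(a+1+dl)) * y powr (2*a - B))"
            unfolding powr_mult by (simp only: mult_ac)
          also have "R powr (2*a+1) * R powr (-(a+1+dl)) = R powr (a - dl)"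
          proof -
            have "2*a+1 + -(a+1+dl) = a - dl" by simp
            thus ?thesis by (simp only: powr_add[symmetric])
          qed
          also have "y powr (-(a+1+dl)) * y powr (2*a - B) = y powr (a - 1 - dl - B)"
          proof -
            have "-(a+1+dl) + (2*a - B) = a - 1 - dl - B" by simp
            thus ?thesis by (simp only: powr_add[symmetric])
          qed
          finally have "wk a dl b B R x y \<le> D * (K2 * y powr (a - 1 - dl - B))" by (simp add: K2_def mult.assoc)
          hence "ennreal (wk a dl b B R x y) \<le> ennreal D * (ennreal K2 * ennreal (y powr (a - 1 - dl - B)))"
            using K D by (simp add: ennreal_mult[symmetric] ennreal_leI)
          thus ?thesis using True y yR by (simp add: add_increasing)
        qed
      qed auto
    qed
    also have "... = ennreal K1 * (NN y. ennreal (y powr (2*a - B)) * indicator {0..1/R} y) + ennreal D * (ennreal K2 * (NN y. ?h y))"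
    proof -
      have "(NN y. ennreal K1 * (ennreal (y powr (2*a - B)) * indicator {0..1/R} y) + ennreal D * (ennreal K2 * ?h y))
        = (NN y. ennreal K1 * (ennreal (y powr (2*a - B)) * indicator {0..1/R} y)) + (NN y. ennreal D * (ennreal K2 * ?h y))"
        by (rule nn_integral_add) measurable
      also have "(NN y. ennreal K1 * (ennreal (y powr (2*a - B)) * indicator {0..1/R} y)) = ennreal K1 * (NN y. ennreal (y powr (2*a - B)) * indicator {0..1/R} y)"
        by (rule nn_integral_cmult) measurable
      also have "(NN y. ennreal D * (ennreal K2 * ?h y)) = ennreal D * (NN y. ennreal K2 * ?h y)"
        by (rule nn_integral_cmult) measurable
      also have "(NN y. ennreal K2 * ?h y) = ennreal K2 * (NN y. ?h y)"
        by (rule nn_integral_cmult) measurable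
      finally show ?thesis .
    qed
    also have "(NN y. ennreal (y powr (2*a - B)) * indicator {0..1/R} y) = ennreal ((1/R) powr (2*a - B + 1) / (2*a - B + 1))"
      using b R by (intro nn_integral_powr_0) auto
    also have "ennreal K1 * ennreal ((1/R) powr (2*a - B + 1) / (2*a - B + 1)) = ennreal (K1 * ((1/R) powr (2*a - B + 1) / (2*a - B + 1)))"
      using K b by (subst ennreal_mult) auto
    also have "K1 * ((1/R) powr (2*a - B + 1) / (2*a - B + 1)) = D * 2 powr \<bar>a\<bar> * (R powr (2*a+1-b) * R powr (-(2*a - B + 1))) / (2*a+1-B)"
      by (simp add: K1_def inverse_powr_real algebra_simps)
    also have "R powr (2*a+1-b) * R powr (-(2*a - B + 1)) = R powr (B - b)" unfolding powr_add[symmetric] by simp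
    also have "ennreal (D * 2 powr \<bar>a\<bar> * R powr (B - b) / (2*a+1-B)) + ennreal D * (ennreal K2 * (NN y. ?h y))
      \<le> ennreal (D * 2 powr \<bar>a\<bar> * c0 powr (B - b) / (2*a+1-B)) + ennreal D * ennreal E"
    proof (intro add_mono ennreal_leI mult_left_mono divide_right_mono)
      show "ennreal K2 * (NN y. ?h y) \<le> ennreal E" unfolding K2_def by (rule E(2)[OF R x])
      show "R powr (B - b) \<le> c0 powr (B - b)" using R0 c0 b by (intro powr_mono2') auto
    qed (use D b in auto)
    also have "... = ennreal C" unfolding C_def using D E b by (subst ennreal_plus) (auto simp: ennreal_mult)
    finally show ?thesis .
  qed
  thus ?thesis using C by blast
qed

text \<open>For p = infinity the operator norm is controlled by row integrals, so the three parts
  are only tested on the constant 1. Equality in (4) needs no strict B < b here, because x^(b - B)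
  <= 1 is enough when no integration in x follows.\<close>

lemma uniform_operator_bound:
  assumes a: "2 * a + 1 > 0" and dl: "dl > 0" and c0: "c0 > 0"
    and b: "b \<ge> 0" "b \<ge> a - dl" "B < 2 * a + 1" "B \<le> a + 1 + dl" "B \<le> b" "b > a - dl \<or> B < b"
  shows "\<exists>C>0. \<forall>R\<ge>c0. \<forall>x\<in>{0<..<1}. (NN y. ennreal (wk a dl b B R x y) * indicator {0<..<1} y) \<le> ennreal C"
proof -
  obtain CR where CR: "CR > 0" "\<And>R x. R \<ge> c0 \<Longrightarrow> x \<in> {0<..<1} \<Longrightarrow> right_part a dl b B R (\<lambda>_. 1) x \<le> ennreal CR"
    using right_part_one[OF a dl c0 b(1,2,3,5,6)] by blast
  obtain C1 where C1: "C1 > 0" "\<And>R x g. R > 0 \<Longrightarrow> x \<in> {0<..<1} \<Longrightarrow> g \<in> borel_measurable borel \<Longrightarrow> local_part a dl b B R g x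
      \<le> ennreal C1 * hlM (\<lambda>y. if x / 2 \<le> y \<and> y \<le> 2 * x \<and> y < 1 then g y else 0) x"
    using local_part_hlM[OF a dl b(5)] by blast
  have loc: "local_part a dl b B R (\<lambda>_. 1) x \<le> ennreal (C1 * 2)" if "R > 0" "x \<in> {0<..<1}" for R x
  proof -
    have "local_part a dl b B R (\<lambda>_. 1) x \<le> ennreal C1 * hlM (\<lambda>y. if x / 2 \<le> y \<and> y \<le> 2 * x \<and> y < 1 then 1 else 0) x"
      by (rule C1(2)[OF that]) simp
    also have "... \<le> ennreal C1 * hlM (\<lambda>_. 1) x" by (intro mult_left_mono hlM_mono) auto
    also have "... \<le> ennreal C1 * 2" by (intro mult_left_mono hlM_one) auto
    finally show ?thesis using C1 by (simp add: ennreal_mult)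
  qed
  have "\<exists>CL>0. \<forall>R>0. \<forall>x\<in>{0<..<1}. left_part a dl b B R (\<lambda>_. 1) x \<le> ennreal CL"
  proof (cases "B < a + 1 + dl")
    case True
    define e where "e = 2*a+1-B + min 0 (dl - a)"
    have e: "e > 0" using True b by (auto simp: e_def min_def)
    have "left_part a dl b B R (\<lambda>_. 1) x \<le> ennreal (2 powr (1+dl+\<bar>a\<bar>) * (1 / e))" if R: "R > 0" and x: "x \<in> {0<..<1}" for R x
    proof -
      have "left_part a dl b B R (\<lambda>_. 1) x \<le> ennreal (2 powr (1+dl+\<bar>a\<bar>)) * (NN y. hk e x y * wt y * 1)"
        unfolding e_def by (rule left_part_strict[OF a R dl b(5) x]) simp
      also have "... \<le> ennreal (2 powr (1+dl+\<bar>a\<bar>)) * ennreal (1 / e)"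
        using hk_row[OF e, of x] x by (intro mult_left_mono) auto
      finally show ?thesis using e by (subst ennreal_mult) auto
    qed
    moreover have "2 powr (1+dl+\<bar>a\<bar>) * (1 / e) > 0" using e by simp
    ultimately show ?thesis by blast
  next
    case False
    hence B: "B = a + 1 + dl" and dla: "dl < a" using b by auto
    define D where "D = 2 powr (1+dl) * (1 / (a - dl) + 1 / dl)"
    have "left_part a dl b B R (\<lambda>_. 1) x \<le> ennreal D" if R: "R > 0" and x: "x \<in> {0<..<1}" for R x
    proof -
      have "left_part a dl b B R (\<lambda>_. 1) x \<le> ennreal (2 powr (1+dl) * x powr (b - B)) *
         (NN y. ennreal ((R * y) powr (a - dl) * (1 + R * y) powr (-a)) * wt y * 1)"
        by (rule left_part_eq[OF a R dl B x]) simp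
      also have "... \<le> ennreal (2 powr (1+dl) * 1) * ennreal (1 / (a - dl) + 1 / dl)"
        using eq_kernel_facts(2)[OF dl dla R] x b by (intro mult_mono ennreal_leI mult_left_mono powr_le1) auto
      also have "... = ennreal D" unfolding D_def using dl dla by (subst ennreal_mult) auto
      finally show ?thesis .
    qed
    moreover have "D > 0" using dl dla by (simp add: D_def add_pos_pos)
    ultimately show ?thesis by blast
  qed
  then obtain CL where CL: "CL > 0" "\<And>R x. R > 0 \<Longrightarrow> x \<in> {0<..<1} \<Longrightarrow> left_part a dl b B R (\<lambda>_. 1) x \<le> ennreal CL" by blast
  have "(NN y. ennreal (wk a dl b B R x y) * indicator {0<..<1} y) \<le> ennreal (CL + (C1 * 2 + CR))"
    if R: "R \<ge> c0" and x: "x \<in> {0<..<1}" for R x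
  proof -
    have R0: "R > 0" using R c0 by simp
    have "(NN y. ennreal (wk a dl b B R x y) * 1 * indicator {0<..<1} y)
      \<le> left_part a dl b B R (\<lambda>_. 1) x + (local_part a dl b B R (\<lambda>_. 1) x + right_part a dl b B R (\<lambda>_. 1) x)"
      by (rule parts_sum[OF _ x]) simp
    also have "... \<le> ennreal CL + (ennreal (C1 * 2) + ennreal CR)" by (intro add_mono CL(2) loc CR(2) R R0 x)
    also have "... = ennreal (CL + (C1 * 2 + CR))" using CL C1 CR by simp
    finally show ?thesis by simp
  qed
  moreover have "CL + (C1 * 2 + CR) > 0" using CL C1 CR by simp
  ultimately show ?thesis by blast
qed

section \<open>Fourier-Bessel means\<close>

text \<open>The same function as \<open>psi\<close> for x > 0, with the powers of s and x cancelled.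
  In this form it is continuous on the whole line, in particular at 0.\<close>

definition npsi :: "real \<Rightarrow> real \<Rightarrow> real \<Rightarrow> real" where
  "npsi nu s x = sqrt 2 * bphi nu (s * x) / (s * \<bar>bphi (nu+1) s\<bar>)"

lemma npsi_mult: "npsi nu s x * npsi nu s y = 2 * zero_term nu s x y"
proof -
  have "npsi nu s x * npsi nu s y = (sqrt 2 * sqrt 2) * (bphi nu (s * x) * bphi nu (s * y)) / (s * \<bar>bphi (nu+1) s\<bar>)\<^sup>2"
    unfolding npsi_def by (simp add: power2_eq_square)
  also have "(s * \<bar>bphi (nu+1) s\<bar>)\<^sup>2 = (s * bphi (nu+1) s)\<^sup>2" by (simp add: power_mult_distrib)
  finally show ?thesis by (simp add: zero_term_def)
qed

lemma npsi_continuous: "nu > -1 \<Longrightarrow> continuous_on S (npsi nu s)"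
  unfolding npsi_def[abs_def] divide_inverse
  by (intro continuous_intros continuous_on_compose2[OF bphi_continuous_on[of nu UNIV]]) auto

lemma besselzero_in_bzeros: "nu > -1 \<Longrightarrow> besselzero nu (Suc j) \<in> bzeros nu"
  using bij_betw_apply[OF besselzero_bij] by blast

lemma psi_npsi:
  assumes nu: "nu > -1" and x: "x > 0"
  shows "psi nu (Suc j) x = npsi nu (besselzero nu (Suc j)) x"
proof -
  define s where "s = besselzero nu (Suc j)"
  have s: "s > 0" "s \<in> bzeros nu" using besselzero_in_bzeros[OF nu, of j] by (auto simp: s_def bzeros_def)
  have J1: "besselJ (nu+1) s = s powr nu * s * bphi (nu+1) s"
    using besselJ_bphi[of "nu+1" s] nu s by (simp add: powr_add)
  have J2: "besselJ nu (s * x) = s powr nu * x powr nu * bphi nu (s * x)"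
    using besselJ_bphi[of nu "s * x"] nu s x by (simp add: powr_mult)
  have x1: "x powr nu * x powr (-nu) = 1" unfolding powr_add[symmetric] using x by simp
  have "psi nu (Suc j) x = sqrt 2 / \<bar>s powr nu * s * bphi (nu+1) s\<bar> * (s powr nu * bphi nu (s * x)) * (x powr nu * x powr (-nu))"
    unfolding psi_def s_def[symmetric] J1 J2 by (simp only: mult_ac)
  hence "psi nu (Suc j) x = sqrt 2 / \<bar>s powr nu * s * bphi (nu+1) s\<bar> * (s powr nu * bphi nu (s * x))"
    unfolding x1 by simp
  also have "... = npsi nu s x" using s unfolding npsi_def by (simp add: abs_mult)
  finally show ?thesis by (simp add: s_def)
qed

lemma space_mu_nu [simp]: "space (mu_nu nu) = {0<..<1}"
  by (simp add: mu_nu_def space_restrict_space)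

lemma sets_mu_nuI: "S \<in> sets borel \<Longrightarrow> S \<subseteq> {0<..<1} \<Longrightarrow> S \<in> sets (mu_nu nu)"
  by (simp add: mu_nu_def sets_restrict_space_iff)

lemma borel_mu_nu: "f \<in> measurable borel M \<Longrightarrow> f \<in> measurable (mu_nu nu) M"
  unfolding mu_nu_def by (simp add: measurable_restrict_space1)

lemma nn_integral_mu_nu:
  assumes "h \<in> borel_measurable (mu_nu nu)"
  shows "(\<integral>\<^sup>+y. h y \<partial>mu_nu nu) = (NN y. ennreal (y powr (2*nu+1)) * h y * indicator {0<..<1} y)"
proof -
  have "h \<in> borel_measurable (restrict_space lborel {0<..<1})" using assms by (simp add: mu_nu_def)
  thus ?thesis unfolding mu_nu_def
    by (subst nn_integral_density) (auto simp: nn_integral_restrict_space intro!: measurable_restrict_space1)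
qed

text \<open>Only an inequality, because the lower integral of a non-measurable maximal function is not additive.\<close>
lemma nn_integral_mu_nu_le:
  "(\<integral>\<^sup>+y. h y \<partial>mu_nu nu) \<le> (NN y. ennreal (y powr (2*nu+1)) * h y * indicator {0<..<1} y)"
  unfolding nn_integral_def[of "mu_nu nu"]
proof (rule SUP_least)
  fix g assume g: "g \<in> {g. simple_function (mu_nu nu) g \<and> g \<le> h}"
  have "integral\<^sup>S (mu_nu nu) g = (\<integral>\<^sup>+y. g y \<partial>mu_nu nu)" using g by (simp add: nn_integral_eq_simple_integral)
  also have "... = (NN y. ennreal (y powr (2*nu+1)) * g y * indicator {0<..<1} y)"
    using g by (intro nn_integral_mu_nu) (auto intro: borel_measurable_simple_function)
  also have "... \<le> (NN y. ennreal (y powr (2*nu+1)) * h y * indicator {0<..<1} y)"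
    using g by (intro nn_integral_mono mult_right_mono mult_left_mono) (auto simp: le_fun_def)
  finally show "integral\<^sup>S (mu_nu nu) g \<le> (NN y. ennreal (y powr (2*nu+1)) * h y * indicator {0<..<1} y)" .
qed

text \<open>For s >= R the truncated multiplier has base 0, and \<open>0 powr dl\<close> is 0, so
  the series is a finite sum over the zeros below R and convergence is not an issue.\<close>

lemma BR_mean_finite_sum:
  assumes nu: "nu > -1" and R: "R > 0" and x: "x > 0"
  shows "BR_mean nu dl R f x = (\<Sum>s\<in>{s\<in>bzeros nu. s < R}. (1 - s\<^sup>2 / R\<^sup>2) powr dl * (\<integral>y. f y * npsi nu s y \<partial>mu_nu nu) * npsi nu s x)"
proof -
  let ?z = "\<lambda>j. besselzero nu (Suc j)"
  define g where "g s = (max (1 - s\<^sup>2 / R\<^sup>2) 0) powr dl * (\<integral>y. f y * npsi nu s y \<partial>mu_nu nu) * npsi nu s x" for s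
  define N where "N = {j. ?z j < R}"
  have bij: "bij_betw ?z N {s\<in>bzeros nu. s < R}"
  proof (rule bij_betw_imageI)
    show "inj_on ?z N" using bij_betw_imp_inj_on[OF besselzero_bij[OF nu]] by (rule inj_on_subset) simp
    show "?z ` N = {s\<in>bzeros nu. s < R}"
    proof (intro set_eqI iffI)
      fix s assume "s \<in> ?z ` N"
      thus "s \<in> {s\<in>bzeros nu. s < R}" using besselzero_in_bzeros[OF nu] by (auto simp: N_def)
    next
      fix s assume s: "s \<in> {s\<in>bzeros nu. s < R}"
      hence "s \<in> range ?z" by (simp add: bij_betw_imp_surj_on[OF besselzero_bij[OF nu]])
      then obtain j where "s = ?z j" by (rule rangeE)
      thus "s \<in> ?z ` N" using s by (simp add: N_def)
    qed
  qed
  have finN: "finite N" using bij_betw_finite[OF bij] finite_bzeros_less[OF nu] by simp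
  have coef: "coeff_a nu (Suc j) f = (\<integral>y. f y * npsi nu (?z j) y \<partial>mu_nu nu)" for j
    unfolding coeff_a_def by (rule Bochner_Integration.integral_cong) (auto simp: psi_npsi[OF nu])
  have "BR_mean nu dl R f x = (\<Sum>j. g (?z j))"
    unfolding BR_mean_def g_def coef psi_npsi[OF nu x] ..
  also have "... = (\<Sum>j\<in>N. g (?z j))"
  proof (rule suminf_finite[OF finN])
    fix j assume "j \<notin> N"
    hence "R \<le> ?z j" by (simp add: N_def)
    hence "R\<^sup>2 \<le> (?z j)\<^sup>2" using R by (intro power_mono) auto
    hence "max (1 - (?z j)\<^sup>2 / R\<^sup>2) 0 = 0" using R by simp
    thus "g (?z j) = 0" unfolding g_def by simp
  qed
  also have "... = (\<Sum>s\<in>{s\<in>bzeros nu. s < R}. g s)" by (rule sum.reindex_bij_betw[OF bij])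
  also have "... = (\<Sum>s\<in>{s\<in>bzeros nu. s < R}. (1 - s\<^sup>2 / R\<^sup>2) powr dl * (\<integral>y. f y * npsi nu s y \<partial>mu_nu nu) * npsi nu s x)"
  proof (rule sum.cong[OF refl])
    fix s assume s: "s \<in> {s\<in>bzeros nu. s < R}"
    hence "s\<^sup>2 \<le> R\<^sup>2" by (intro power_mono) (auto simp: bzeros_def)
    hence "max (1 - s\<^sup>2 / R\<^sup>2) 0 = 1 - s\<^sup>2 / R\<^sup>2" using R by simp
    thus "g s = (1 - s\<^sup>2 / R\<^sup>2) powr dl * (\<integral>y. f y * npsi nu s y \<partial>mu_nu nu) * npsi nu s x" unfolding g_def by simp
  qed
  finally show ?thesis .
qed

text \<open>The eigenfunctions are bounded on [0, 1], so integrability of f alone allows the finite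
  sum to be moved under the integral; the factor 2 is that of \<open>npsi_mult\<close>.\<close>

lemma BR_mean_kernel:
  assumes nu: "nu > -1" and R: "R > 0" and x: "x > 0" and f: "integrable (mu_nu nu) f"
  shows "BR_mean nu dl R f x = (\<integral>y. 2 * BR_kernel nu dl R x y * f y \<partial>mu_nu nu)" "integrable (mu_nu nu) (\<lambda>y. 2 * BR_kernel nu dl R x y * f y)"
proof -
  have [measurable]: "f \<in> borel_measurable (mu_nu nu)" using f by auto
  have I: "integrable (mu_nu nu) (\<lambda>y. f y * npsi nu s y)" for s
  proof -
    have "bounded (npsi nu s ` {0..1})" by (intro compact_imp_bounded compact_continuous_image npsi_continuous nu) simp
    then obtain K where "\<forall>v\<in>npsi nu s ` {0..1}. norm v \<le> K" by (auto simp only: bounded_iff)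
    hence K: "\<bar>npsi nu s y\<bar> \<le> K" if "y \<in> {0..1}" for y using that by simp
    have [measurable]: "npsi nu s \<in> borel_measurable (mu_nu nu)"
      by (intro borel_mu_nu borel_measurable_continuous_onI npsi_continuous nu)
    have K0: "K \<ge> 0" using K[of 0] by simp
    show ?thesis
    proof (rule Bochner_Integration.integrable_bound[where f="\<lambda>y. K * f y"])
      show "AE y in mu_nu nu. norm (f y * npsi nu s y) \<le> norm (K * f y)"
      proof (rule AE_I2)
        fix y assume "y \<in> space (mu_nu nu)"
        hence "\<bar>npsi nu s y\<bar> \<le> K" by (intro K) auto
        hence "\<bar>f y\<bar> * \<bar>npsi nu s y\<bar> \<le> \<bar>f y\<bar> * K" by (intro mult_left_mono) auto
        thus "norm (f y * npsi nu s y) \<le> norm (K * f y)" using K0 by (simp add: abs_mult mult.commute)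
      qed
    qed (use f in auto)
  qed
  have e: "2 * BR_kernel nu dl R x y * f y = (\<Sum>s\<in>{s\<in>bzeros nu. s < R}. (1 - s\<^sup>2 / R\<^sup>2) powr dl * npsi nu s x * (f y * npsi nu s y))" for y
  proof -
    have "2 * BR_kernel nu dl R x y * f y = (\<Sum>s\<in>{s\<in>bzeros nu. s < R}. (1 - s\<^sup>2 / R\<^sup>2) powr dl * (2 * zero_term nu s x y) * f y)"
      by (simp add: BR_kernel_def sum_distrib_left sum_distrib_right mult_ac)
    thus ?thesis unfolding npsi_mult[symmetric] by (simp add: mult_ac)
  qed
  show "integrable (mu_nu nu) (\<lambda>y. 2 * BR_kernel nu dl R x y * f y)"
    unfolding e by (intro Bochner_Integration.integrable_sum integrable_mult_right I)
  show "BR_mean nu dl R f x = (\<integral>y. 2 * BR_kernel nu dl R x y * f y \<partial>mu_nu nu)"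
  proof -
    have "(\<integral>y. 2 * BR_kernel nu dl R x y * f y \<partial>mu_nu nu) = (\<Sum>s\<in>{s\<in>bzeros nu. s < R}. \<integral>y. (1 - s\<^sup>2 / R\<^sup>2) powr dl * npsi nu s x * (f y * npsi nu s y) \<partial>mu_nu nu)"
      unfolding e by (intro Bochner_Integration.integral_sum integrable_mult_right I)
    also have "... = (\<Sum>s\<in>{s\<in>bzeros nu. s < R}. (1 - s\<^sup>2 / R\<^sup>2) powr dl * (\<integral>y. f y * npsi nu s y \<partial>mu_nu nu) * npsi nu s x)"
      by (intro sum.cong refl) (simp only: integral_mult_right_zero, simp only: mult_ac)
    finally show ?thesis by (simp only: BR_mean_finite_sum[OF nu R x])
  qed
qed

text \<open>The shift \<theta> is left free: adding it to both b and B costs the factor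
  x^(-\<theta>) and changes the reference measure. The value 2 (nu + 1) / p turns the p-norm for
  x^(2 nu + 1) dx into the one for dx / x; for p = infinity the shift is 0.\<close>

lemma BR_mean_wk_bound:
  assumes nu: "nu > -1" and dl: "dl > 0"
  defines "a \<equiv> nu + 1/2"
  shows "\<exists>C>0. \<forall>f\<in>borel_measurable borel. integrable (mu_nu nu) f \<longrightarrow> (\<forall>R>0. \<forall>x\<in>{0<..<1}. \<forall>b B \<theta>.
     ennreal (x powr b) * ennreal \<bar>BR_mean nu dl R f x\<bar> \<le> ennreal (C * x powr (-\<theta>)) *
      (NN y. ennreal (wk a dl (b + \<theta>) (B + \<theta>) R x y) * ennreal (y powr (B + \<theta>) * \<bar>f y\<bar>) * indicator {0<..<1} y))"
proof -
  obtain C where C: "C > 0" "\<And>R x y. R > 0 \<Longrightarrow> x \<in> {0<..<1} \<Longrightarrow> y \<in> {0<..<1} \<Longrightarrow> \<bar>BR_kernel nu dl R x y\<bar> \<le> C * BR_bound a dl R x y"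
    using BR_kernel_bound[OF nu dl] unfolding a_def by blast
  have "ennreal (x powr b) * ennreal \<bar>BR_mean nu dl R f x\<bar> \<le> ennreal (2 * C * x powr (-\<theta>)) *
      (NN y. ennreal (wk a dl (b + \<theta>) (B + \<theta>) R x y) * ennreal (y powr (B + \<theta>) * \<bar>f y\<bar>) * indicator {0<..<1} y)"
    if f [measurable]: "f \<in> borel_measurable borel" and fi: "integrable (mu_nu nu) f" and R: "R > 0" and x: "x \<in> {0<..<1}" for f R x b B \<theta>
  proof -
    have x0: "x > 0" using x by simp
    have "ennreal \<bar>BR_mean nu dl R f x\<bar> \<le> (\<integral>\<^sup>+y. ennreal (norm (2 * BR_kernel nu dl R x y * f y)) \<partial>mu_nu nu)"
      unfolding BR_mean_kernel(1)[OF nu R x0 fi] real_norm_def[symmetric]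
      by (intro integral_norm_bound_ennreal BR_mean_kernel(2)[OF nu R x0 fi])
    also have "... = (NN y. ennreal (y powr (2*nu+1)) * ennreal (norm (2 * BR_kernel nu dl R x y * f y)) * indicator {0<..<1} y)"
      using BR_mean_kernel(2)[OF nu R x0 fi] by (intro nn_integral_mu_nu) auto
    finally have "ennreal (x powr b) * ennreal \<bar>BR_mean nu dl R f x\<bar> \<le> ennreal (x powr b) *
        (NN y. ennreal (y powr (2*nu+1)) * ennreal (norm (2 * BR_kernel nu dl R x y * f y)) * indicator {0<..<1} y)"
      by (rule mult_left_mono) simp
    also have "... \<le> ennreal (x powr b) * (NN y. ennreal (2 * C * x powr (-(b+\<theta>))) * (ennreal (wk a dl (b + \<theta>) (B + \<theta>) R x y) * ennreal (y powr (B + \<theta>) * \<bar>f y\<bar>) * indicator {0<..<1} y))"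
    proof (intro mult_left_mono nn_integral_mono)
      fix y
      show "ennreal (y powr (2*nu+1)) * ennreal (norm (2 * BR_kernel nu dl R x y * f y)) * indicator {0<..<1} y
        \<le> ennreal (2 * C * x powr (-(b+\<theta>))) * (ennreal (wk a dl (b + \<theta>) (B + \<theta>) R x y) * ennreal (y powr (B + \<theta>) * \<bar>f y\<bar>) * indicator {0<..<1} y)"
      proof (cases "y \<in> {0<..<1}")
        case True
        have x1: "x powr (-(b+\<theta>)) * x powr (b+\<theta>) = 1" unfolding powr_add[symmetric] using x by simp
        have y1: "y powr (2*a - (B+\<theta>)) * y powr (B+\<theta>) = y powr (2*nu+1)"
          unfolding powr_add[symmetric] by (simp add: a_def)
        have "y powr (2*nu+1) * norm (2 * BR_kernel nu dl R x y * f y) \<le> y powr (2*nu+1) * (2 * (C * BR_bound a dl R x y) * \<bar>f y\<bar>)"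
          unfolding real_norm_def abs_mult using C(2)[OF R x True] by (intro mult_left_mono mult_right_mono) auto
        also have "... = 2 * C * (x powr (-(b+\<theta>)) * x powr (b+\<theta>)) * BR_bound a dl R x y * (y powr (2*a - (B+\<theta>)) * y powr (B+\<theta>)) * \<bar>f y\<bar>"
          unfolding x1 y1 by simp
        also have "... = (2 * C * x powr (-(b+\<theta>))) * (wk a dl (b + \<theta>) (B + \<theta>) R x y * (y powr (B + \<theta>) * \<bar>f y\<bar>))"
          unfolding wk_def by (simp only: mult_ac)
        finally have "ennreal (y powr (2*nu+1) * norm (2 * BR_kernel nu dl R x y * f y))
           \<le> ennreal ((2 * C * x powr (-(b+\<theta>))) * (wk a dl (b + \<theta>) (B + \<theta>) R x y * (y powr (B + \<theta>) * \<bar>f y\<bar>)))"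
          by (rule ennreal_leI)
        also have "... = ennreal (2 * C * x powr (-(b+\<theta>))) * (ennreal (wk a dl (b + \<theta>) (B + \<theta>) R x y) * ennreal (y powr (B + \<theta>) * \<bar>f y\<bar>))"
          by (subst ennreal_mult, use C in simp, simp, subst (2) ennreal_mult) auto
        finally show ?thesis using True by (simp add: ennreal_mult'[symmetric])
      qed simp
    qed simp
    also have "... = ennreal (x powr b) * (ennreal (2 * C * x powr (-(b+\<theta>))) * (NN y. ennreal (wk a dl (b + \<theta>) (B + \<theta>) R x y) * ennreal (y powr (B + \<theta>) * \<bar>f y\<bar>) * indicator {0<..<1} y))"
      by (subst nn_integral_cmult) auto
    also have "... = ennreal (x powr b * (2 * C * x powr (-(b+\<theta>)))) * (NN y. ennreal (wk a dl (b + \<theta>) (B + \<theta>) R x y) * ennreal (y powr (B + \<theta>) * \<bar>f y\<bar>) * indicator {0<..<1} y)"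
      by (subst ennreal_mult'[of "x powr b"]) (simp_all only: mult.assoc powr_ge_zero)
    also have "x powr b * (2 * C * x powr (-(b+\<theta>))) = 2 * C * (x powr b * x powr (-(b+\<theta>)))" by (simp only: mult_ac)
    also have "x powr b * x powr (-(b+\<theta>)) = x powr (-\<theta>)" unfolding powr_add[symmetric] by simp
    finally show ?thesis .
  qed
  thus ?thesis using C by (intro exI[of _ "2 * C"]) auto
qed

lemma AE_mu_nu:
  assumes "AE y in mu_nu nu. P y" shows "AE y in lborel. y \<in> {0<..<1} \<longrightarrow> P y"
proof -
  have m: "(\<lambda>x. ennreal (x powr (2 * nu + 1))) \<in> borel_measurable (restrict_space lborel {0<..<1})"
    by (intro measurable_restrict_space1) simp
  have "AE y in restrict_space lborel {0<..<1}. 0 < ennreal (y powr (2 * nu + 1)) \<longrightarrow> P y"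
    using assms unfolding mu_nu_def AE_density[OF m] .
  hence "AE y in lborel. y \<in> {0<..<1} \<longrightarrow> (0 < ennreal (y powr (2 * nu + 1)) \<longrightarrow> P y)"
    by (subst (asm) AE_restrict_space_iff) auto
  thus ?thesis by eventually_elim auto
qed

text \<open>The supremum over R is uncountable, but every mean is a finite sum and continuous in x,
  so the set where its modulus exceeds t is open, and so is the union over R. The estimate of the
  essential supremum requires this measurability.\<close>

lemma BR_max_measurable:
  assumes nu: "nu > -1" shows "BR_max nu dl f \<in> borel_measurable (mu_nu nu)"
proof (rule borel_measurableI_greater)
  fix t :: ennreal
  define F where "F R x = (\<Sum>s\<in>{s\<in>bzeros nu. s < R}. (1 - s\<^sup>2 / R\<^sup>2) powr dl * (\<integral>y. f y * npsi nu s y \<partial>mu_nu nu) * npsi nu s x)" for R x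
  have c: "continuous_on UNIV (\<lambda>x. ennreal \<bar>F R x\<bar>)" for R
    unfolding F_def by (intro continuous_on_ennreal continuous_on_rabs continuous_on_sum continuous_on_mult_left npsi_continuous nu)
  have op: "open {x. t < ennreal \<bar>F R x\<bar>}" for R by (intro open_Collect_less c continuous_on_const)
  have "{x \<in> space (mu_nu nu). t < BR_max nu dl f x} = {0<..<1} \<inter> (\<Union>R\<in>{0<..}. {x. t < ennreal \<bar>F R x\<bar>})"
    by (auto simp: BR_max_def less_SUP_iff BR_mean_finite_sum[OF nu] F_def)
  also have "... \<in> sets (mu_nu nu)" using op by (intro sets_mu_nuI borel_open open_Int open_UN) auto
  finally show "{x \<in> space (mu_nu nu). t < BR_max nu dl f x} \<in> sets (mu_nu nu)" .
qed

section \<open>Norm inequalities and the final estimates\<close>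

lemma Lp_norm_epow:
  assumes "p \<noteq> \<infinity>"
  shows "Lp_norm M p g = (let I = (\<integral>\<^sup>+x. epow (enn2real p) (g x) \<partial>M) in if I = \<infinity> then \<infinity> else ennreal (enn2real I powr (1 / enn2real p)))"
proof -
  have "ennreal (enn2real (g x) powr enn2real p) * indicator {x. g x < \<infinity>} x + \<infinity> * indicator {x. g x = \<infinity>} x = epow (enn2real p) (g x)" for x
    by (cases "g x") (auto simp: epow_def)
  thus ?thesis unfolding Lp_norm_def using assms by simp
qed

text \<open>If the norm on the right is infinite there is nothing to show, so the integral
  inequality may assume it finite; that assumption later makes f integrable.\<close>

lemma Lp_norm_le:
  fixes C :: real
  assumes p: "p \<noteq> \<infinity>" "enn2real p > 0" and C: "C > 0"
    and le: "(\<integral>\<^sup>+x. epow (enn2real p) (f x) \<partial>M) < \<infinity> \<Longrightarrow>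
      (\<integral>\<^sup>+x. epow (enn2real p) (g x) \<partial>M) \<le> ennreal C * (\<integral>\<^sup>+x. epow (enn2real p) (f x) \<partial>M)"
  shows "Lp_norm M p g \<le> ennreal (C powr (1 / enn2real p)) * Lp_norm M p f"
proof (cases "(\<integral>\<^sup>+x. epow (enn2real p) (f x) \<partial>M)")
  case top
  hence "Lp_norm M p f = \<infinity>" by (simp add: Lp_norm_epow[OF p(1)])
  thus ?thesis using C by (simp add: ennreal_mult_top)
next
  case (real i)
  have "(\<integral>\<^sup>+x. epow (enn2real p) (g x) \<partial>M) \<le> ennreal C * ennreal i" using le real by simp
  also have "... = ennreal (C * i)" using C real by (simp add: ennreal_mult)
  finally obtain j where j: "(\<integral>\<^sup>+x. epow (enn2real p) (g x) \<partial>M) = ennreal j" "j \<ge> 0" "j \<le> C * i"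
    using C real by (cases "\<integral>\<^sup>+x. epow (enn2real p) (g x) \<partial>M") (auto simp: top_unique)
  have "Lp_norm M p g = ennreal (j powr (1 / enn2real p))" using j by (simp add: Lp_norm_epow[OF p(1)])
  also have "... \<le> ennreal ((C * i) powr (1 / enn2real p))" using j p by (intro ennreal_leI powr_mono2) auto
  also have "... = ennreal (C powr (1 / enn2real p)) * ennreal (i powr (1 / enn2real p))" by (simp add: powr_mult ennreal_mult)
  also have "ennreal (i powr (1 / enn2real p)) = Lp_norm M p f" using real by (simp add: Lp_norm_epow[OF p(1)])
  finally show ?thesis .
qed

text \<open>Hoelder's inequality is replaced by the pointwise bound g <= 1 + g^p: the constant is
  integrable against y^(e - 1) because e > 0, and for the other term y^(e - 1) <= y^(-1) on (0, 1).
  Thus the integrals that define the coefficients exist.\<close>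

lemma integrable_of_weighted:
  assumes [measurable]: "f \<in> borel_measurable borel" and p: "p \<ge> 1" and B: "B < 2 * nu + 2"
    and fin: "(NN y. ennreal ((y powr B * \<bar>f y\<bar>) powr p) * wt y) < \<infinity>"
  shows "integrable (mu_nu nu) f"
proof (rule integrableI_bounded)
  show m: "f \<in> borel_measurable (mu_nu nu)" by (rule borel_mu_nu) simp
  define e where "e = 2 * nu + 2 - B"
  have e: "e > 0" using B by (simp add: e_def)
  have "(\<integral>\<^sup>+y. ennreal (norm (f y)) \<partial>mu_nu nu) = (NN y. ennreal (y powr (2*nu+1)) * ennreal (norm (f y)) * indicator {0<..<1} y)"
    using m by (intro nn_integral_mu_nu) simp
  also have "... \<le> (NN y. ennreal (y powr (e - 1)) * indicator {0..1} y + ennreal ((y powr B * \<bar>f y\<bar>) powr p) * wt y)"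
  proof (rule nn_integral_mono)
    fix y
    show "ennreal (y powr (2*nu+1)) * ennreal (norm (f y)) * indicator {0<..<1} y
      \<le> ennreal (y powr (e - 1)) * indicator {0..1} y + ennreal ((y powr B * \<bar>f y\<bar>) powr p) * wt y"
    proof (cases "y \<in> {0<..<1}")
      case True
      define g where "g = y powr B * \<bar>f y\<bar>"
      have g: "g \<ge> 0" by (simp add: g_def)
      have "g \<le> 1 + g powr p"
      proof (cases "g \<le> 1")
        case False
        hence "g powr 1 \<le> g powr p" using p by (intro powr_mono) auto
        thus ?thesis using False by simp
      qed (simp add: add_increasing2)
      hence "y powr (e - 1) * g \<le> y powr (e - 1) * (1 + g powr p)" by (intro mult_left_mono) auto
      also have "... = y powr (e - 1) + y powr (e - 1) * g powr p" by (simp add: distrib_left)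
      also have "y powr (e - 1) * g powr p \<le> y powr (-1) * g powr p"
        using True e by (intro mult_right_mono powr_mono') auto
      also have "y powr (-1) * g powr p = g powr p * (1 / y)" using True by (simp add: powr_minus_divide)
      finally have "y powr (e - 1) * g \<le> y powr (e - 1) + g powr p * (1 / y)" by simp
      moreover have "y powr (2*nu+1) * norm (f y) = y powr (e - 1) * g"
      proof -
        have "e - 1 + B = 2*nu+1" by (simp add: e_def)
        hence "y powr (2*nu+1) = y powr (e - 1) * y powr B" by (simp only: powr_add[symmetric])
        thus ?thesis by (simp add: g_def)
      qed
      ultimately have "ennreal (y powr (2*nu+1) * norm (f y)) \<le> ennreal (y powr (e - 1) + g powr p * (1 / y))" by (intro ennreal_leI) simp
      also have "... = ennreal (y powr (e - 1)) + ennreal (g powr p * (1 / y))" using True by (intro ennreal_plus) auto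
      finally show ?thesis using True by (simp add: g_def wt_def ennreal_mult'[symmetric])
    qed simp
  qed
  also have "... = (NN y. ennreal (y powr (e - 1)) * indicator {0..1} y) + (NN y. ennreal ((y powr B * \<bar>f y\<bar>) powr p) * wt y)"
    by (rule nn_integral_add) measurable
  also have "... < \<infinity>" using fin e by (subst nn_integral_powr_0) auto
  finally show "(\<integral>\<^sup>+y. ennreal (norm (f y)) \<partial>mu_nu nu) < \<infinity>" .
qed

text \<open>After the shift of the exponents, \<open>positive_operator_bound\<close> applies to b +
  \<theta>, B + \<theta> and a multiple of y^(B + \<theta>) |f(y)|. The hypothesis B + \<theta> < 2
  a + 1 also makes f integrable.\<close>

lemma maximal_bound_finite:
  fixes nu dl b B :: real and p :: ennreal
  defines "a \<equiv> nu + 1/2" and "\<theta> \<equiv> 2 * (nu + 1) / enn2real p"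
  assumes nu: "nu > -1" and dl: "dl > 0" and p: "p \<noteq> \<infinity>" "enn2real p > 1"
    and c: "b + \<theta> > 0" "b + \<theta> > a - dl" "B + \<theta> < 2 * a + 1" "B + \<theta> \<le> a + 1 + dl" "B \<le> b" "B + \<theta> < a + 1 + dl \<or> B < b"
  shows "\<exists>C::real. \<forall>f \<in> borel_measurable borel.
    Lp_norm (mu_nu nu) p (\<lambda>x. ennreal (x powr b) * BR_max nu dl f x) \<le> ennreal C * Lp_norm (mu_nu nu) p (\<lambda>x. ennreal \<bar>x powr B * f x\<bar>)"
proof -
  define P where "P = enn2real p"
  have P: "P > 1" "P > 0" using p by (auto simp: P_def)
  \<comment> \<open>This identity is the reason for the choice of \<theta>: the p-th power of
    y^\<theta>, divided by y, is the density y^(2 nu + 1).\<close>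
  have \<theta>P: "\<theta> * P = 2 * nu + 2" using P by (simp add: \<theta>_def P_def)
  have a: "2 * a + 1 > 0" using nu by (simp add: a_def)
  from BR_mean_wk_bound[OF nu dl, folded a_def] obtain C1 where C10: "C1 > 0" and C1': "\<forall>f\<in>borel_measurable borel. integrable (mu_nu nu) f \<longrightarrow> (\<forall>R>0. \<forall>x\<in>{0<..<1}. \<forall>b B \<theta>.
     ennreal (x powr b) * ennreal \<bar>BR_mean nu dl R f x\<bar> \<le> ennreal (C1 * x powr (-\<theta>)) *
      (NN y. ennreal (wk a dl (b + \<theta>) (B + \<theta>) R x y) * ennreal (y powr (B + \<theta>) * \<bar>f y\<bar>) * indicator {0<..<1} y))"
    by (elim exE conjE)
  note C1 = C10 C1'[rule_format]
  have c': "B + \<theta> \<le> b + \<theta>" "B + \<theta> < a + 1 + dl \<or> B + \<theta> < b + \<theta>" using c by auto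
  from positive_operator_bound[OF a dl P(1) c(1-4) c'] obtain C2 where C20: "C2 > 0" and C2': "\<forall>G\<in>borel_measurable borel. (\<forall>y. G y \<ge> 0) \<longrightarrow>
    (NN x. epow P (SUP R\<in>{0<..}. NN y. ennreal (wk a dl (b + \<theta>) (B + \<theta>) R x y) * ennreal (G y) * indicator {0<..<1} y) * wt x)
     \<le> ennreal C2 * (NN y. ennreal (G y powr P) * wt y)"
    by (elim exE conjE)
  note C2 = C20 C2'[rule_format]
  have "Lp_norm (mu_nu nu) p (\<lambda>x. ennreal (x powr b) * BR_max nu dl f x)
     \<le> ennreal ((C2 * C1 powr P) powr (1 / enn2real p)) * Lp_norm (mu_nu nu) p (\<lambda>x. ennreal \<bar>x powr B * f x\<bar>)"
    if f [measurable]: "f \<in> borel_measurable borel" for f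
  proof (rule Lp_norm_le)
    show "C2 * C1 powr P > 0" using C1 C2 by simp
    define g where "g y = y powr (B + \<theta>) * \<bar>f y\<bar>" for y
    have g [measurable]: "g \<in> borel_measurable borel" unfolding g_def by measurable
    have g0: "g y \<ge> 0" for y by (simp add: g_def)
    have If: "(\<integral>\<^sup>+x. epow P (ennreal \<bar>x powr B * f x\<bar>) \<partial>mu_nu nu) = (NN y. ennreal (g y powr P) * wt y)"
    proof -
      have "(\<integral>\<^sup>+x. epow P (ennreal \<bar>x powr B * f x\<bar>) \<partial>mu_nu nu) = (\<integral>\<^sup>+x. ennreal (\<bar>x powr B * f x\<bar> powr P) \<partial>mu_nu nu)"
        by (simp add: epow_ennreal)
      also have "... = (NN y. ennreal (y powr (2*nu+1)) * ennreal (\<bar>y powr B * f y\<bar> powr P) * indicator {0<..<1} y)"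
        by (intro nn_integral_mu_nu borel_mu_nu) measurable
      also have "... = (NN y. ennreal (g y powr P) * wt y)"
      proof (rule nn_integral_cong)
        fix y show "ennreal (y powr (2*nu+1)) * ennreal (\<bar>y powr B * f y\<bar> powr P) * indicator {0<..<1} y = ennreal (g y powr P) * wt y"
        proof (cases "y \<in> {0<..<1}")
          case True
          have "g y powr P * (1 / y) = y powr ((B + \<theta>) * P) * y powr (-1) * \<bar>f y\<bar> powr P"
            using True unfolding g_def powr_mult powr_powr by (simp add: powr_minus_divide)
          also have "y powr ((B + \<theta>) * P) * y powr (-1) = y powr (2*nu+1) * y powr (B * P)"
          proof -
            have "(B + \<theta>) * P + -1 = 2*nu+1 + B * P" using \<theta>P by (simp add: distrib_right)
            thus ?thesis by (simp only: powr_add[symmetric])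
          qed
          also have "y powr (2*nu+1) * y powr (B * P) * \<bar>f y\<bar> powr P = y powr (2*nu+1) * \<bar>y powr B * f y\<bar> powr P"
            by (simp add: abs_mult powr_mult powr_powr)
          finally have "ennreal (g y powr P * (1 / y)) = ennreal (y powr (2*nu+1) * \<bar>y powr B * f y\<bar> powr P)" by simp
          thus ?thesis using True by (simp add: wt_def ennreal_mult'[symmetric])
        qed (simp add: wt_def)
      qed
      finally show ?thesis .
    qed
    assume fin: "(\<integral>\<^sup>+x. epow (enn2real p) (ennreal \<bar>x powr B * f x\<bar>) \<partial>mu_nu nu) < \<infinity>"
    have fi: "integrable (mu_nu nu) f"
    proof (rule integrable_of_weighted[OF f])
      show "1 \<le> P" using P by simp
      show "B + \<theta> < 2 * nu + 2" using c(3) by (simp add: a_def)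
      show "(NN y. ennreal ((y powr (B + \<theta>) * \<bar>f y\<bar>) powr P) * wt y) < \<infinity>"
        using fin unfolding P_def[symmetric] If g_def .
    qed
    \<comment> \<open>C1 is put inside the supremum, as a factor of the argument, so that the
      operator bound applies to S as it stands.\<close>
    define S where "S x = (SUP R\<in>{0<..}. NN y. ennreal (wk a dl (b + \<theta>) (B + \<theta>) R x y) * ennreal (C1 * g y) * indicator {0<..<1} y)" for x
    have pt: "ennreal (x powr b) * BR_max nu dl f x \<le> ennreal (x powr (-\<theta>)) * S x" if x: "x \<in> {0<..<1}" for x
      unfolding BR_max_def SUP_mult_left_ennreal
    proof (rule SUP_least)
      fix R :: real assume R: "R \<in> {0<..}"
      let ?I = "\<integral>\<^sup>+y. ennreal (wk a dl (b + \<theta>) (B + \<theta>) R x y) * ennreal (g y) * indicator {0<..<1} y \<partial>lborel"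
      have "ennreal (x powr b) * ennreal \<bar>BR_mean nu dl R f x\<bar> \<le> ennreal (C1 * x powr (-\<theta>)) * ?I"
        unfolding g_def using R by (intro C1(2) f fi x) simp
      also have "... = ennreal (x powr (-\<theta>)) * (ennreal C1 * ?I)" using C1 by (simp add: ennreal_mult mult_ac)
      also have "ennreal C1 * ?I = (NN y. ennreal C1 * (ennreal (wk a dl (b + \<theta>) (B + \<theta>) R x y) * ennreal (g y) * indicator {0<..<1} y))"
        by (rule nn_integral_cmult[symmetric]) measurable
      also have "... = (NN y. ennreal (wk a dl (b + \<theta>) (B + \<theta>) R x y) * ennreal (C1 * g y) * indicator {0<..<1} y)"
        using C1 g0 by (intro nn_integral_cong) (simp add: ennreal_mult mult_ac)
      also have "... \<le> S x" unfolding S_def using R by (rule SUP_upper)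
      finally show "ennreal (x powr b) * ennreal \<bar>BR_mean nu dl R f x\<bar> \<le> ennreal (x powr (-\<theta>)) * S x"
        by (simp add: mult_left_mono)
    qed
    have "(\<integral>\<^sup>+x. epow P (ennreal (x powr b) * BR_max nu dl f x) \<partial>mu_nu nu)
      \<le> (NN x. ennreal (x powr (2*nu+1)) * epow P (ennreal (x powr b) * BR_max nu dl f x) * indicator {0<..<1} x)"
      by (rule nn_integral_mu_nu_le)
    also have "... \<le> (NN x. epow P (S x) * wt x)"
    proof (rule nn_integral_mono)
      fix x show "ennreal (x powr (2*nu+1)) * epow P (ennreal (x powr b) * BR_max nu dl f x) * indicator {0<..<1} x \<le> epow P (S x) * wt x"
      proof (cases "x \<in> {0<..<1}")
        case True
        have "epow P (ennreal (x powr b) * BR_max nu dl f x) \<le> epow P (ennreal (x powr (-\<theta>)) * S x)"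
          using P by (intro epow_mono pt True) auto
        also have "... = ennreal (x powr (-\<theta> * P)) * epow P (S x)"
          unfolding epow_mult[OF P(2)] by (simp add: epow_ennreal powr_powr)
        finally have "ennreal (x powr (2*nu+1)) * epow P (ennreal (x powr b) * BR_max nu dl f x)
          \<le> ennreal (x powr (2*nu+1)) * (ennreal (x powr (-\<theta> * P)) * epow P (S x))" by (rule mult_left_mono) simp
        also have "... = ennreal (x powr (2*nu+1) * x powr (-\<theta> * P)) * epow P (S x)" by (simp only: ennreal_mult'[OF powr_ge_zero] mult.assoc)
        also have "x powr (2*nu+1) * x powr (-\<theta> * P) = x powr (-1)"
        proof -
          have "2*nu+1 + -\<theta> * P = -1" using \<theta>P by simp
          thus ?thesis by (simp only: powr_add[symmetric])
        qed
        also have "x powr (-1) = 1 / x" using True by (simp add: powr_minus_divide)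
        finally show ?thesis using True by (simp add: wt_def mult.commute)
      qed (simp add: wt_def)
    qed
    also have "... \<le> ennreal C2 * (NN y. ennreal ((C1 * g y) powr P) * wt y)"
      unfolding S_def using C1 g0 by (intro C2(2)) auto
    also have "(NN y. ennreal ((C1 * g y) powr P) * wt y) = (NN y. ennreal (C1 powr P) * (ennreal (g y powr P) * wt y))"
      by (intro nn_integral_cong) (simp add: powr_mult ennreal_mult mult.assoc)
    also have "... = ennreal (C1 powr P) * (NN y. ennreal (g y powr P) * wt y)" by (rule nn_integral_cmult) measurable
    also have "ennreal C2 * (ennreal (C1 powr P) * (NN y. ennreal (g y powr P) * wt y)) = ennreal (C2 * C1 powr P) * (NN y. ennreal (g y powr P) * wt y)"
      using C2 by (simp add: ennreal_mult mult.assoc)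
    finally show "(\<integral>\<^sup>+x. epow (enn2real p) (ennreal (x powr b) * BR_max nu dl f x) \<partial>mu_nu nu)
      \<le> ennreal (C2 * C1 powr P) * (\<integral>\<^sup>+x. epow (enn2real p) (ennreal \<bar>x powr B * f x\<bar>) \<partial>mu_nu nu)"
      unfolding P_def[symmetric] If .
  qed (use p in auto)
  thus ?thesis by blast
qed

text \<open>For p = infinity the measure enters the norm only through its null sets, so no shift of
  exponents is made. The bound on the maximal function is obtained at every x in (0, 1).\<close>

lemma maximal_bound_sup:
  fixes nu dl b B :: real
  defines "a \<equiv> nu + 1/2"
  assumes nu: "nu > -1" and dl: "dl > 0"
    and c: "b \<ge> 0" "b \<ge> a - dl" "B < 2 * a + 1" "B \<le> a + 1 + dl" "B \<le> b" "b > a - dl \<or> B < b"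
  shows "\<exists>C::real. \<forall>f \<in> borel_measurable borel.
    Lp_norm (mu_nu nu) \<infinity> (\<lambda>x. ennreal (x powr b) * BR_max nu dl f x) \<le> ennreal C * Lp_norm (mu_nu nu) \<infinity> (\<lambda>x. ennreal \<bar>x powr B * f x\<bar>)"
proof -
  have a: "2 * a + 1 > 0" using nu by (simp add: a_def)
  \<comment> \<open>For R < a0 the mean is an empty sum; for R >= a0 the uniform row bound is
    available with c0 = a0.\<close>
  obtain a0 where a0: "a0 > 0" "\<And>s. s \<in> bzeros nu \<Longrightarrow> a0 \<le> s" using zeros_facts[OF nu] by blast
  from BR_mean_wk_bound[OF nu dl, folded a_def] obtain C1 where C10: "C1 > 0" and C1': "\<forall>f\<in>borel_measurable borel. integrable (mu_nu nu) f \<longrightarrow> (\<forall>R>0. \<forall>x\<in>{0<..<1}. \<forall>b B \<theta>.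
     ennreal (x powr b) * ennreal \<bar>BR_mean nu dl R f x\<bar> \<le> ennreal (C1 * x powr (-\<theta>)) *
      (NN y. ennreal (wk a dl (b + \<theta>) (B + \<theta>) R x y) * ennreal (y powr (B + \<theta>) * \<bar>f y\<bar>) * indicator {0<..<1} y))"
    by (elim exE conjE)
  note C1 = C10 C1'[rule_format]
  from uniform_operator_bound[OF a dl a0(1) c] obtain C2 where C20: "C2 > 0" and C2': "\<forall>R\<ge>a0. \<forall>x\<in>{0<..<1}.
     (NN y. ennreal (wk a dl b B R x y) * indicator {0<..<1} y) \<le> ennreal C2"
    by (elim exE conjE)
  note C2 = C20 C2'[rule_format]
  have "esssup (mu_nu nu) (\<lambda>x. ennreal (x powr b) * BR_max nu dl f x) \<le> ennreal (C1 * C2) * esssup (mu_nu nu) (\<lambda>x. ennreal \<bar>x powr B * f x\<bar>)"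
    if f [measurable]: "f \<in> borel_measurable borel" for f
  proof (cases "esssup (mu_nu nu) (\<lambda>x. ennreal \<bar>x powr B * f x\<bar>)")
    case top
    thus ?thesis using C1 C2 by (simp add: ennreal_mult_top)
  next
    case (real m)
    have "AE y in mu_nu nu. ennreal \<bar>y powr B * f y\<bar> \<le> ennreal m"
      unfolding real(2)[symmetric] by (rule esssup_AE)
    hence "AE y in mu_nu nu. y powr B * \<bar>f y\<bar> \<le> m"
      by eventually_elim (simp add: ennreal_le_iff[OF real(1)] abs_mult)
    hence ae: "AE y in lborel. y \<in> {0<..<1} \<longrightarrow> y powr B * \<bar>f y\<bar> \<le> m" by (rule AE_mu_nu)
    define e where "e = 2*nu+1-B"
    have e: "e > -1" using c(3) by (simp add: e_def a_def)
    have fi: "integrable (mu_nu nu) f"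
    proof (rule integrableI_bounded)
      show mf: "f \<in> borel_measurable (mu_nu nu)" by (rule borel_mu_nu) simp
      have "(\<integral>\<^sup>+y. ennreal (norm (f y)) \<partial>mu_nu nu) = (NN y. ennreal (y powr (2*nu+1)) * ennreal (norm (f y)) * indicator {0<..<1} y)"
        using mf by (intro nn_integral_mu_nu) simp
      also have "... \<le> (NN y. ennreal m * (ennreal (y powr e) * indicator {0..1} y))"
      proof (rule nn_integral_mono_AE, use ae in eventually_elim)
        case (elim y)
        show ?case
        proof (cases "y \<in> {0<..<1}")
          case True
          have "e + B = 2*nu+1" by (simp add: e_def)
          hence "y powr (2*nu+1) * norm (f y) = y powr e * (y powr B * \<bar>f y\<bar>)" by (simp add: powr_add[symmetric])
          also have "... \<le> y powr e * m" using elim True by (intro mult_left_mono) auto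
          finally have "ennreal (y powr (2*nu+1) * norm (f y)) \<le> ennreal (m * y powr e)" by (intro ennreal_leI) (simp add: mult.commute)
          thus ?thesis using True real(1) by (simp add: ennreal_mult)
        qed simp
      qed
      also have "... = ennreal m * (NN y. ennreal (y powr e) * indicator {0..1} y)" by (rule nn_integral_cmult) measurable
      also have "... < \<infinity>" using e by (subst nn_integral_powr_0) (auto simp: ennreal_mult_less_top)
      finally show "(\<integral>\<^sup>+y. ennreal (norm (f y)) \<partial>mu_nu nu) < \<infinity>" .
    qed
    have pt: "ennreal (x powr b) * BR_max nu dl f x \<le> ennreal (C1 * C2) * ennreal m" if x: "x \<in> {0<..<1}" for x
      unfolding BR_max_def SUP_mult_left_ennreal
    proof (rule SUP_least)
      fix R :: real assume "R \<in> {0<..}"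
      hence R: "R > 0" by simp
      have x0: "x > 0" using x by simp
      show "ennreal (x powr b) * ennreal \<bar>BR_mean nu dl R f x\<bar> \<le> ennreal (C1 * C2) * ennreal m"
      proof (cases "R \<ge> a0")
        case True
        have "ennreal (x powr b) * ennreal \<bar>BR_mean nu dl R f x\<bar> \<le> ennreal C1 *
           (NN y. ennreal (wk a dl b B R x y) * ennreal (y powr B * \<bar>f y\<bar>) * indicator {0<..<1} y)"
          using C1(2)[OF f fi R x, of b 0 B] x0 by simp
        also have "... \<le> ennreal C1 * (NN y. ennreal m * (ennreal (wk a dl b B R x y) * indicator {0<..<1} y))"
        proof (rule mult_left_mono, rule nn_integral_mono_AE, use ae in eventually_elim)
          case (elim y)
          show ?case
          proof (cases "y \<in> {0<..<1}")
            case True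
            hence "ennreal (y powr B * \<bar>f y\<bar>) \<le> ennreal m" using elim by (intro ennreal_leI) auto
            hence "ennreal (wk a dl b B R x y) * ennreal (y powr B * \<bar>f y\<bar>) \<le> ennreal (wk a dl b B R x y) * ennreal m" by (rule mult_left_mono) simp
            thus ?thesis using True by (simp add: mult.commute)
          qed simp
        qed simp
        also have "(NN y. ennreal m * (ennreal (wk a dl b B R x y) * indicator {0<..<1} y))
          = ennreal m * (NN y. ennreal (wk a dl b B R x y) * indicator {0<..<1} y)" by (rule nn_integral_cmult) measurable
        also have "ennreal C1 * (ennreal m * (NN y. ennreal (wk a dl b B R x y) * indicator {0<..<1} y)) \<le> ennreal C1 * (ennreal m * ennreal C2)"
          by (intro mult_left_mono C2(2) True x) auto
        also have "... = ennreal (C1 * C2) * ennreal m" using C1 C2 by (simp add: ennreal_mult mult_ac)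
        finally show ?thesis .
      next
        case False
        hence none: "{s\<in>bzeros nu. s < R} = {}" using a0(2) by force
        have "BR_mean nu dl R f x = 0" unfolding BR_mean_finite_sum[OF nu R x0] none by simp
        thus ?thesis by simp
      qed
    qed
    show ?thesis unfolding real(2)
    proof (rule esssup_I)
      show "(\<lambda>x. ennreal (x powr b) * BR_max nu dl f x) \<in> borel_measurable (mu_nu nu)"
        by (intro borel_measurable_times_ennreal BR_max_measurable nu borel_mu_nu) measurable
      show "AE x in mu_nu nu. ennreal (x powr b) * BR_max nu dl f x \<le> ennreal (C1 * C2) * ennreal m"
        by (rule AE_I2) (use pt in simp)
    qed
  qed
  thus ?thesis unfolding Lp_norm_def by (intro exI[of _ "C1 * C2"]) simp
qed

theorem theorem5:
  fixes nu delta b B :: real and p :: ennreal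
  assumes nu: "nu > -1" and delta: "delta > 0" and p: "1 < p"
    and c1: "if p = \<infinity> then b \<ge> - 2 * (nu + 1) * recip p else b > - 2 * (nu + 1) * recip p"
    and c2: "B < 2 * (nu + 1) * (1 - recip p)"
    and c3: "if p = \<infinity> then b \<ge> 2 * (nu + 1) * (1/2 - recip p) - delta - 1/2
             else b > 2 * (nu + 1) * (1/2 - recip p) - delta - 1/2"
    and c4: "B \<le> 2 * (nu + 1) * (1/2 - recip p) + delta + 1/2"
    and c5: "B \<le> b"
    and s25: "B < 2 * (nu + 1) * (1 - recip p) \<or> B < b"
    and s35: "b > 2 * (nu + 1) * (1/2 - recip p) - delta - 1/2 \<or> B < b"
    and s45: "p \<noteq> \<infinity> \<longrightarrow> (B < 2 * (nu + 1) * (1/2 - recip p) + delta + 1/2 \<or> B < b)"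
  shows "\<exists>C::real. \<forall>f \<in> borel_measurable borel.
           Lp_norm (mu_nu nu) p (\<lambda>x. ennreal (x powr b) * BR_max nu delta f x)
             \<le> ennreal C * Lp_norm (mu_nu nu) p (\<lambda>x. ennreal \<bar>x powr B * f x\<bar>)"
proof (cases "p = \<infinity>")
  case True
  \<comment> \<open>In \<open>ennreal\<close> the reciprocal of infinity is 0, so all terms with 1 /
    p disappear from the conditions.\<close>
  have r: "recip p = 0" by (simp add: recip_def True)
  have e: "2 * (nu + 1) * (1 - recip p) = 2 * nu + 2" "2 * (nu + 1) * (1/2 - recip p) = nu + 1" "- 2 * (nu + 1) * recip p = 0"
    by (simp_all add: r)
  show ?thesis unfolding True
  proof (rule maximal_bound_sup[OF nu delta])
    show "0 \<le> b" using c1[unfolded if_P[OF True] e] by simp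
    show "nu + 1/2 - delta \<le> b" using c3[unfolded if_P[OF True] e] by linarith
    show "B < 2 * (nu + 1/2) + 1" using c2[unfolded e] by (simp add: algebra_simps)
    show "B \<le> nu + 1/2 + 1 + delta" using c4[unfolded e] by linarith
    show "B \<le> b" by (rule c5)
    show "nu + 1/2 - delta < b \<or> B < b" using s35[unfolded e] by linarith
  qed
next
  case False
  then obtain q where q: "p = ennreal q" "q \<ge> 0" by (cases p) auto
  have q1: "q > 1" using p q by (simp add: ennreal_less_iff flip: ennreal_1)
  have "1 / p = ennreal (1 / q)" using q q1 divide_ennreal[of 1 q] by simp
  hence r: "recip p = 1 / q" using q1 by (simp add: recip_def)
  have pq: "enn2real p = q" using q by simp
  \<comment> \<open>Adding t to b and B turns (1) to (4) into b > 0, B < 2 a + 1, b > a - delta and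
    B <= a + 1 + delta, where a = nu + 1/2.\<close>
  define t where "t = 2 * (nu + 1) / q"
  have t: "2 * (nu + 1) * recip p = t" by (simp add: r t_def)
  have e: "2 * (nu + 1) * (1 - recip p) = 2 * nu + 2 - t" "2 * (nu + 1) * (1/2 - recip p) = nu + 1 - t" "- 2 * (nu + 1) * recip p = - t"
    unfolding t[symmetric] by (simp_all add: algebra_simps)
  show ?thesis
  proof (rule maximal_bound_finite[OF nu delta False])
    show "enn2real p > 1" using pq q1 by simp
    note c' = c1[unfolded if_not_P[OF False] e] c2[unfolded e] c3[unfolded if_not_P[OF False] e] c4[unfolded e] c5 mp[OF s45 False, unfolded e]
    show "0 < b + 2 * (nu + 1) / enn2real p" using c' unfolding pq t_def[symmetric] by linarith
    show "nu + 1/2 - delta < b + 2 * (nu + 1) / enn2real p" using c' unfolding pq t_def[symmetric] by linarith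
    show "B + 2 * (nu + 1) / enn2real p < 2 * (nu + 1/2) + 1" using c'(2) unfolding pq t_def[symmetric] by (simp add: algebra_simps)
    show "B + 2 * (nu + 1) / enn2real p \<le> nu + 1/2 + 1 + delta" using c' unfolding pq t_def[symmetric] by linarith
    show "B \<le> b" by (rule c5)
    show "B + 2 * (nu + 1) / enn2real p < nu + 1/2 + 1 + delta \<or> B < b" using c' unfolding pq t_def[symmetric] by linarith
  qed
qed

end
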